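(* Let $d\ge 3$, $\nu=d/2-1$, $R>0$, $\alpha>0$, $k>0$, and let $B_R(0)\subset\mathbb{R}^d$ be the open ball of radius $R$ centred at the origin. For $\ell=0,1,2,\dots$ put $$\mathcal{B}\!\left[\frac{J_{\ell+\nu}(kr)}{(kr)^{\nu}}\right] = (kR)^{-\nu}\left[\left(\alpha+\frac{\ell}{R}\right)J_{\ell+\nu}(kR)-kJ_{\ell+\nu+1}(kR)\right],$$ $$\mathcal{B}\!\left[\frac{H^{(1)}_{\ell+\nu}(kr)}{(kr)^{\nu}}\right] = (kR)^{-\nu}\left[\left(\alpha+\frac{\ell}{R}\right)H^{(1)}_{\ell+\nu}(kR)-kH^{(1)}_{\ell+\nu+1}(kR)\right],$$ and assume that $k$ is not a resonant wavenumber, i.e. $\mathcal{B}[J_{\ell+\nu}(kr)/(kr)^\nu]\ne0$ for all $\ell\ge0$. Let $x_0\in B_R(0)$. Then the Robin Green's function $G(\cdot,x_0)$ for the Helmholtz equation on $B_R(0)$, i.e. the solution of $$\begin{cases}\Delta G(x,x_0)+k^2G(x,x_0)=-\delta(x-x_0), & x\in B_R(0),\\[4pt] \dfrac{\partial G(x,x_0)}{\partial n}+\alpha G(x,x_0)=0, & x\in\partial B_R(0),\end{cases}$$ is given, with $r=|x|$, $r_0=|x_0|$, $\omega=x/|x|$, $\omega_0=x_0/|x_0|$, by $$G(x,x_{0}) = \frac{i}{4}\left(\frac{k}{2\pi|x-x_{0}|}\right)^{\nu} H_{\nu}^{(1)}(k|x-x_{0}|) -\frac{i\pi k^{d-2}}{2}\sum_{\ell=0}^{\infty}\sum_{m=1}^{N(d,\ell)}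 \frac{\mathcal{B}[H_{\ell+\nu}^{(1)}(kr)/(kr)^{\nu}]}{\mathcal{B}[J_{\ell+\nu}(kr)/(kr)^{\nu}]}\,\frac{J_{\ell+\nu}(kr_{0})}{(kr_{0})^{\nu}}\,\frac{J_{\ell+\nu}(kr)}{(kr)^{\nu}}\,Y_{\ell,m}(\omega)\,\overline{Y_{\ell,m}(\omega_{0})}.$$
   Context: $J_\mu$ and $H_\mu^{(1)}$ denote the Bessel function of the first kind and the Hankel function of the first kind of order $\mu$. $\{Y_{\ell,m}\}_{m=1}^{N(d,\ell)}$ is an orthonormal basis, in $L^2(\mathbb{S}^{d-1})$, of the space of spherical harmonics of degree $\ell$ in $\mathbb{R}^d$, whose dimension is $N(d,\ell)=\frac{(2\ell+d-2)\Gamma(\ell+d-2)}{\Gamma(\ell+1)\Gamma(d-1)}$. $\delta$ is the Dirac delta; the first equation is in the sense of distributions in $x$. $\partial/\partial n$ is the outer normal derivative with respect to $x$. The operator $\mathcal{B}=\partial_r+\alpha$ evaluated at $r=R$ is the Robin boundary trace, so the displayed quantities $\mathcal{B}[\cdot]$ are constants, the Robin traces at $r=R$ of the corresponding radial functions. The functions $z^{-\nu}J_{\ell+\nu}(z)$ are extended continuously to $z=0$ (they vanish there for $\ell\ge1$, so the choice of $\omega$ or $\omega_0$ at the origin is immaterial). *)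

theory Defs
  imports "HOL-Analysis.Analysis"
begin

section \<open>Bessel and Hankel functions of real order and positive real argument\<close>

definition bessel_J :: "real \<Rightarrow> real \<Rightarrow> real" where
  "bessel_J \<mu> x = (x / 2) powr \<mu> *
     (\<Sum>n. (- 1) ^ n * rGamma (\<mu> + real n + 1) / fact n * (x / 2) ^ (2 * n))"

text \<open>At integer orders the quotient defining the Bessel function of the second kind has the
  form 0/0, and the function is defined by its limit in the order.\<close>

definition bessel_Y :: "real \<Rightarrow> real \<Rightarrow> real" where
  "bessel_Y \<mu> x =
     (let q = (\<lambda>t. (bessel_J t x * cos (t * pi) - bessel_J (- t) x) / sin (t * pi))
      in if \<mu> \<in> \<int> then Lim (at \<mu>) q else q \<mu>)"

definition hankel_H1 :: "real \<Rightarrow> real \<Rightarrow> complex" where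
  "hankel_H1 \<mu> x = complex_of_real (bessel_J \<mu> x) + \<i> * complex_of_real (bessel_Y \<mu> x)"

text \<open>The function \<open>z powr (-\<nu>) * J(\<ell> + \<nu>, z)\<close> on \<open>z \<ge> 0\<close>, extended continuously to \<open>z = 0\<close>.\<close>

definition bessel_quot :: "real \<Rightarrow> nat \<Rightarrow> real \<Rightarrow> real" where
  "bessel_quot \<nu> l z =
     (let q = (\<lambda>t. bessel_J (real l + \<nu>) t / t powr \<nu>)
      in if z = 0 then Lim (at_right 0) q else q z)"

text \<open>The values at \<open>r = R\<close> of \<open>(d/dr + \<alpha>) f\<close> for \<open>f r = J(\<ell> + \<nu>, k r) / (k r) powr \<nu>\<close>, respectively with
  the Hankel function in place of \<open>J\<close>, in closed form by the recurrence
  \<open>J'(\<mu>, z) = (\<mu> / z) J(\<mu>, z) - J(\<mu> + 1, z)\<close>.\<close>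

definition robin_trace_J :: "real \<Rightarrow> real \<Rightarrow> real \<Rightarrow> real \<Rightarrow> nat \<Rightarrow> real" where
  "robin_trace_J R \<alpha> k \<nu> l = (k * R) powr (- \<nu>) *
     ((\<alpha> + real l / R) * bessel_J (real l + \<nu>) (k * R) - k * bessel_J (real l + \<nu> + 1) (k * R))"

definition robin_trace_H :: "real \<Rightarrow> real \<Rightarrow> real \<Rightarrow> real \<Rightarrow> nat \<Rightarrow> complex" where
  "robin_trace_H R \<alpha> k \<nu> l = complex_of_real ((k * R) powr (- \<nu>)) *
     (complex_of_real (\<alpha> + real l / R) * hankel_H1 (real l + \<nu>) (k * R)
      - complex_of_real k * hankel_H1 (real l + \<nu> + 1) (k * R))"


section \<open>Smooth functions and the Laplacian\<close>

fun C_k :: "nat \<Rightarrow> ('a::euclidean_space \<Rightarrow> complex) \<Rightarrow> bool" where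
  "C_k 0 f \<longleftrightarrow> continuous_on UNIV f"
| "C_k (Suc n) f \<longleftrightarrow> (\<forall>x. f differentiable (at x)) \<and>
     (\<forall>b\<in>Basis. C_k n (\<lambda>x. frechet_derivative f (at x) b))"

definition test_function :: "'a::euclidean_space set \<Rightarrow> ('a \<Rightarrow> complex) \<Rightarrow> bool" where
  "test_function S \<phi> \<longleftrightarrow> (\<forall>n. C_k n \<phi>) \<and>
     compact (closure {x. \<phi> x \<noteq> 0}) \<and> closure {x. \<phi> x \<noteq> 0} \<subseteq> S"

definition laplacian :: "('a::euclidean_space \<Rightarrow> complex) \<Rightarrow> 'a \<Rightarrow> complex" where
  "laplacian f x =
     (\<Sum>b\<in>Basis. frechet_derivative (\<lambda>y. frechet_derivative f (at y) b) (at x) b)"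


section \<open>Spherical harmonics\<close>

text \<open>Surface measure on the unit sphere: the measure of \<open>A\<close> is \<open>d\<close> times the Lebesgue measure of
  the part of the unit ball lying on rays through \<open>A\<close>.\<close>

definition sphere_measure :: "'a::euclidean_space measure" where
  "sphere_measure = scale_measure (of_nat DIM('a))
     (distr (restrict_space lborel (ball 0 1 - {0})) (restrict_space borel (sphere 0 1))
        (\<lambda>x. x /\<^sub>R norm x))"

definition solid_harmonic :: "nat \<Rightarrow> ('a::euclidean_space \<Rightarrow> complex) \<Rightarrow> bool" where
  "solid_harmonic l p \<longleftrightarrow> polynomial_function p \<and>
     (\<forall>t x. p (t *\<^sub>R x) = complex_of_real (t ^ l) * p x) \<and> (\<forall>x. laplacian p x = 0)"

text \<open>A function on the sphere is represented by a function on the whole space of which only the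
  values on the unit sphere matter.\<close>

definition spherical_harmonic :: "nat \<Rightarrow> ('a::euclidean_space \<Rightarrow> complex) \<Rightarrow> bool" where
  "spherical_harmonic l f \<longleftrightarrow> (\<exists>p. solid_harmonic l p \<and> (\<forall>\<omega>\<in>sphere 0 1. f \<omega> = p \<omega>))"

text \<open>The floor only converts to a natural number; see \<open>real_harmonic_dim\<close>.\<close>

definition harmonic_dim :: "nat \<Rightarrow> nat \<Rightarrow> nat" where
  "harmonic_dim d l =
     nat \<lfloor>(2 * real l + real d - 2) * Gamma (real l + real d - 2)
           / (Gamma (real l + 1) * Gamma (real d - 1))\<rfloor>"

lemma real_harmonic_dim:
  assumes "d \<ge> 3"
  shows "real (harmonic_dim d l) =
           (2 * real l + real d - 2) * Gamma (real l + real d - 2)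
             / (Gamma (real l + 1) * Gamma (real d - 1))" (is "_ = ?q")
proof -
  obtain e where d: "d = e + 3"
    using assms by (metis add.commute le_Suc_ex)
  have g1: "Gamma (real l + real d - 2) = fact (l + e)"
    using Gamma_fact[of "l + e", where 'a = real] by (simp add: d algebra_simps)
  have g2: "Gamma (real l + 1) = fact l"
    using Gamma_fact[of l, where 'a = real] by (simp add: algebra_simps)
  have g3: "Gamma (real d - 1) = fact (e + 1)"
    using Gamma_fact[of "e + 1", where 'a = real] by (simp add: d algebra_simps)
  have b1: "real ((l + e + 1) choose l) = fact (l + e + 1) / (fact l * fact (e + 1))"
    by (subst binomial_fact) (simp_all add: algebra_simps)
  have b2: "real ((l + e) choose (e + 1)) = real l * fact (l + e) / (fact l * fact (e + 1))"
  proof (cases l)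
    case (Suc l')
    then show ?thesis
      by (subst binomial_fact) (simp_all add: divide_simps)
  qed simp
  have "?q = (real (l + e + 1) + real l) * fact (l + e) / (fact l * fact (e + 1))"
    unfolding g1 g2 g3 by (simp add: d algebra_simps)
  also have "\<dots> = real ((l + e + 1) choose l) + real ((l + e) choose (e + 1))"
    unfolding b1 b2 by (simp add: add_divide_distrib ring_distribs)
  also have "\<dots> = real (((l + e + 1) choose l) + ((l + e) choose (e + 1)))"
    by simp
  finally have q: "?q = real (((l + e + 1) choose l) + ((l + e) choose (e + 1)))" .
  show ?thesis
    unfolding harmonic_dim_def q by simp
qed

definition orthonormal_harmonic_basis ::
    "nat \<Rightarrow> nat \<Rightarrow> (nat \<Rightarrow> 'a::euclidean_space \<Rightarrow> complex) \<Rightarrow> bool" where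
  "orthonormal_harmonic_basis l N Y \<longleftrightarrow>
     (\<forall>m\<in>{1..N}. spherical_harmonic l (Y m)) \<and>
     (\<forall>m\<in>{1..N}. \<forall>m'\<in>{1..N}.
        (LINT \<omega>|sphere_measure. Y m \<omega> * cnj (Y m' \<omega>)) = (if m = m' then 1 else 0)) \<and>
     (\<forall>f. spherical_harmonic l f \<longrightarrow>
        (\<exists>c. \<forall>\<omega>\<in>sphere 0 1. f \<omega> = (\<Sum>m = 1..N. c m * Y m \<omega>)))"


section \<open>The Robin Green's function of the ball\<close>

text \<open>The equation in the ball is imposed on \<open>G\<close> as a distribution. The boundary condition needs a
  normal derivative, so \<open>G\<close> is required to be continuously differentiable up to the boundary away
  from the source \<open>x0\<close>. The value of \<open>G\<close> at \<open>x0\<close> is irrelevant.\<close>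

definition robin_green_function ::
    "real \<Rightarrow> real \<Rightarrow> real \<Rightarrow> 'a::euclidean_space \<Rightarrow> ('a \<Rightarrow> complex) \<Rightarrow> bool" where
  "robin_green_function R \<alpha> k x0 G \<longleftrightarrow>
     set_integrable lborel (ball 0 R) G \<and>
     (\<forall>\<phi>. test_function (ball 0 R) \<phi> \<longrightarrow>
        (LINT x:ball 0 R|lborel. G x * (laplacian \<phi> x + complex_of_real (k\<^sup>2) * \<phi> x)) = - \<phi> x0) \<and>
     (\<exists>D. continuous_on (cball 0 R - {x0}) D \<and>
        (\<forall>x\<in>cball 0 R - {x0}. (G has_derivative blinfun_apply (D x)) (at x within cball 0 R)) \<and>
        (\<forall>x\<in>sphere 0 R. blinfun_apply (D x) (x /\<^sub>R R) + complex_of_real \<alpha> * G x = 0))"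

end

theory Submission
 imports Defs
begin

text \<open>The variable throughout is s = |x|^2 (or z^2). In it z^(-t) J_t is entire and d/ds
  merely raises the order by one, up to a constant; so every radial profile comes with its whole
  chain of derivatives, composition with |x|^2 is smooth at the origin, and the l-th Taylor
  coefficient of a profile of order \<nu> is already a profile of order \<nu> + l, which is how the
  higher orders enter the addition theorem. At integer orders (even d) Y is a limit in the order, so
  the derivative of J in the order is carried along. Green functions satisfy their equation only
  weakly; averages over thin shells convert it into pointwise statements on sphere integrals.
  Convergence up to and beyond the boundary is the other obstacle: the quotient of the Robin traces
  grows like Y / J of order \<nu> + l. All sizes are measured against
  \<open>redJ (\<nu> + real l) 0\<close>; each subexponential loss is absorbed by an arbitrary q >
  1, and what remains is the geometric ratio |x0| / R < 1, which leaves room for a ball slightly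
  larger than R.\<close>

notation scaleR (infixr "*R" 75)
notation divideR (infixl "'/R" 70)

lemmas lint_add = Bochner_Integration.integral_add
 and lint_cong = Bochner_Integration.integral_cong
 and lint_diff = Bochner_Integration.integral_diff
 and lint_minus = Bochner_Integration.integral_minus
 and lint_norm_bound_integral = Bochner_Integration.integral_norm_bound_integral
 and lint_sum = Bochner_Integration.integral_sum
 and lint_zero = Bochner_Integration.integral_zero

text \<open>Strength of the point source carried by \<open>famY k \<nu> 0 (sq x)\<close>: the
  Helmholtz operator maps it to this multiple of the Dirac delta. The value is the leading
  singularity of Y times the area of the sphere.\<close>

abbreviation source_const :: "real => nat => real => real" where
 "source_const k d \<nu> \<equiv> k powr (2 - real d) * 2 powr (\<nu> + 2) * pi powr \<nu>"

text \<open>For a solid harmonic \<open>p\<close> of degree \<open>l\<close>, the product of \<open>p(x)\<close> with \<open>z powr (-\<nu> - l) * J(\<nu> + l, z)\<close>,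
 \<open>z = k |x|\<close>, is an entire Helmholtz solution. Testing a weak Helmholtz solution with radial cutoffs of such
 products and of their \<open>Y\<close> counterparts shows that its projection on \<open>p\<close> over a sphere of radius \<open>r\<close>
 is a multiple of \<open>r powr (-\<nu>) * J(\<nu> + l, k r)\<close>. For a shifted radial solution the multiple is found by
 Taylor expansion at the centre, which gives the addition theorem. With it the projections of the boundary
 expression of the fundamental solution minus the series vanish, so the Robin condition follows from the
 completeness of spherical harmonics. The difference of two Green functions has projections which are multiples
 of the regular radial solutions, and nonresonance forces them to vanish.\<close>

abbreviation cx :: "real => complex" where
 "cx \<equiv> complex_of_real"

abbreviation sq :: "'a::real_inner => real" where
 "sq x \<equiv> x \<bullet> x"

abbreviation helmholtz :: "real => ('a::euclidean_space => complex) => 'a => complex" where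
 "helmholtz k f x \<equiv> laplacian f x + cx (k\<^sup>2) * f x"

abbreviation sphere_integral ::
  "('a::euclidean_space => 'b::{banach, second_countable_topology}) => 'b" (binder "SPH " 10) where
 "sphere_integral f \<equiv> integral\<^sup>L sphere_measure f"

section \<open>Reduced Bessel functions\<close>

lemma deriv_rGamma: "(rGamma has_field_derivative deriv rGamma x) (at x)" for x :: real
 using field_differentiable_derivI field_differentiable_def has_field_derivative_rGamma by blast

lemma deriv_rGamma_plus1: "deriv rGamma x = rGamma (x + 1) + x * deriv rGamma (x + 1)" for x :: real
proof -
 have "((\<lambda>x::real. x * rGamma (x + 1)) has_field_derivative
   1 * rGamma (x + 1) + x * (deriv rGamma (x + 1) * 1)) (at x)"
  by (rule derivative_eq_intros DERIV_chain2[OF deriv_rGamma] refl)+ simp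
 then have "(rGamma has_field_derivative rGamma (x + 1) + x * deriv rGamma (x + 1)) (at x)"
  by (simp add: rGamma_plus1)
 then show ?thesis by (rule DERIV_imp_deriv)
qed

text \<open>Compactness covers [1, 3]; beyond it the recurrence divides by x - 1 \<ge> 2. The length
  two of the interval makes this divisor large enough: the step for the derivative yields (C + C /
  2) / 2 \<le> C, so the bound does not grow along the induction.\<close>

lemma rGamma_bounded_ge_1:
 "\<exists>C. \<forall>x::real. x \<ge> 1 \<longrightarrow> \<bar>rGamma x\<bar> \<le> C \<and> \<bar>deriv rGamma x\<bar> \<le> C"
proof -
 have cont: "continuous_on {1..3} (deriv rGamma :: real => real)"
 proof -
  have eq: "deriv rGamma x = - rGamma x * Digamma x" if "x \<in> {1..3}" for x :: real
   using that by (intro DERIV_imp_deriv has_field_derivative_rGamma_no_nonpos_int)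
     (auto elim!: nonpos_Ints_cases)
  have "continuous_on {1..3} (\<lambda>x::real. - rGamma x * Digamma x)"
   by (intro continuous_intros continuous_on_Polygamma) (auto elim!: nonpos_Ints_cases)
  then show ?thesis by (rule continuous_on_eq) (simp add: eq)
 qed
 obtain C1 where C1: "\<And>x. x \<in> {1..3} ==> \<bar>deriv rGamma x :: real\<bar> \<le> C1"
  using compact_continuous_image[OF cont] compact_imp_bounded[of "deriv rGamma ` {1..3::real}"]
  by (metis bounded_iff compact_Icc imageI real_norm_def)
 have "continuous_on {1..3} (rGamma :: real => real)" by (intro continuous_intros)
 then obtain C2 where C2: "\<And>x::real. x \<in> {1..3} ==> \<bar>rGamma x\<bar> \<le> C2"
  using compact_continuous_image compact_imp_bounded[of "rGamma ` {1..3::real}"]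
  by (metis bounded_iff compact_Icc imageI real_norm_def)
 define C where "C = max C1 C2"
 have "x \<le> 3 + real n ==> \<bar>rGamma x\<bar> \<le> C \<and> \<bar>deriv rGamma x\<bar> \<le> C" if "x \<ge> 1" for x n using that
 proof (induction n arbitrary: x)
  case 0
  then show ?case using C1[of x] C2[of x] by (auto simp: C_def)
 next
  case (Suc n)
  show ?case
  proof (cases "x \<le> 3")
   case True
   then show ?thesis using C1[of x] C2[of x] Suc.prems by (auto simp: C_def)
  next
   case False
   define y where "y = x - 1"
   have y: "y \<ge> 2" "y \<ge> 1" "y \<le> 3 + real n" "x = y + 1" using False Suc.prems by (auto simp: y_def)
   have IH: "\<bar>rGamma y\<bar> \<le> C" "\<bar>deriv rGamma y\<bar> \<le> C" using Suc.IH[of y] y by auto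
   have "\<bar>rGamma x\<bar> * y = \<bar>rGamma y\<bar>"
    using y by (simp add: abs_mult mult.commute flip: rGamma_plus1[of y])
   then have "\<bar>rGamma x\<bar> * 2 \<le> C" using IH y mult_left_mono[of 2 y "\<bar>rGamma x\<bar>"] by linarith
   then have r: "\<bar>rGamma x\<bar> \<le> C / 2" by simp
   have "y * deriv rGamma x = deriv rGamma y - rGamma x" using deriv_rGamma_plus1[of y] y by simp
   then have "y * \<bar>deriv rGamma x\<bar> \<le> C + C / 2"
    using IH r y abs_mult[of y "deriv rGamma x"] by linarith
   moreover have "2 * \<bar>deriv rGamma x\<bar> \<le> y * \<bar>deriv rGamma x\<bar>"
    using y by (intro mult_right_mono) auto
   ultimately show ?thesis using r by linarith
  qed
 qed
 then have "\<bar>rGamma x\<bar> \<le> C \<and> \<bar>deriv rGamma x\<bar> \<le> C" if "x \<ge> 1" for x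
  using that by (meson add_increasing2 dual_order.trans le_add_same_cancel2 linear nle_le of_nat_0_le_iff real_arch_simple zero_le_numeral)
 then show ?thesis by blast
qed

text \<open>The recurrence transports the bound to the left one unit at a time; each unit costs a
  factor comparable to the distance from the origin, which is harmless because T is fixed.\<close>

lemma rGamma_bounded:
 "\<exists>C. \<forall>x::real. x \<ge> - T \<longrightarrow> \<bar>rGamma x\<bar> \<le> C \<and> \<bar>deriv rGamma x\<bar> \<le> C"
proof -
 have "\<exists>C. \<forall>x::real. x \<ge> 1 - real n \<longrightarrow> \<bar>rGamma x\<bar> \<le> C \<and> \<bar>deriv rGamma x\<bar> \<le> C" for n
 proof (induction n)
  case 0
  then show ?case using rGamma_bounded_ge_1 by simp
 next
  case (Suc n)
  then obtain C where C: "\<And>x::real. x \<ge> 1 - real n ==> \<bar>rGamma x\<bar> \<le> C \<and> \<bar>deriv rGamma x\<bar> \<le> C"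
   by blast
  have C0: "C \<ge> 0" using C[of 1] by (smt (verit) of_nat_0_le_iff)
  have "\<bar>rGamma x\<bar> \<le> (real n + 2) * C \<and> \<bar>deriv rGamma x\<bar> \<le> (real n + 2) * C"
   if x: "x \<ge> 1 - real (Suc n)" for x
  proof (cases "x \<ge> 1 - real n")
   case True
   then show ?thesis
    using C[of x] C0 by (smt (verit) mult_left_mono mult_cancel_right1 of_nat_0_le_iff mult_right_mono)
  next
   case False
   have ax: "\<bar>x\<bar> \<le> real n + 1" using False x by auto
   have C': "\<bar>rGamma (x + 1)\<bar> \<le> C" "\<bar>deriv rGamma (x + 1)\<bar> \<le> C" using C[of "x + 1"] x by auto
   have "\<bar>rGamma x\<bar> \<le> (real n + 1) * C"
    using mult_mono[OF ax C'(1)] by (simp add: rGamma_plus1[of x, symmetric] abs_mult)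
   moreover have "\<bar>x * deriv rGamma (x + 1)\<bar> \<le> (real n + 1) * C"
    using mult_mono[OF ax C'(2)] by (simp add: abs_mult)
   ultimately show ?thesis using C' C0 deriv_rGamma_plus1[of x] by (simp add: algebra_simps)
  qed
  then show ?case by blast
 qed
 then obtain C where "\<forall>x::real. x \<ge> 1 - real (nat \<lceil>T + 1\<rceil>) \<longrightarrow> \<bar>rGamma x\<bar> \<le> C \<and> \<bar>deriv rGamma x\<bar> \<le> C"
  by blast
 moreover have "1 - real (nat \<lceil>T + 1\<rceil>) \<le> - T" by linarith
 ultimately show ?thesis by (meson dual_order.trans)
qed

section \<open>Power series of the reduced function J and its derivative in the order\<close>

definition redJ_coeff :: "real => nat => real" where
 "redJ_coeff t n = (- 1) ^ n * 2 powr (- t) * rGamma (t + real n + 1) / (fact n * 4 ^ n)"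

text \<open>Derivative of the coefficient in the order t. It serves to describe Y at integer orders,
  where Y is a derivative of J with respect to the order.\<close>

definition redJ_coeff_deriv :: "real => nat => real" where
 "redJ_coeff_deriv t n = (- 1) ^ n * 2 powr (- t) *
   (deriv rGamma (t + real n + 1) - ln 2 * rGamma (t + real n + 1)) / (fact n * 4 ^ n)"

definition redJ :: "real => real => real" where
 "redJ t s = (\<Sum>n. redJ_coeff t n * s ^ n)"

definition redJ_deriv :: "real => real => real" where
 "redJ_deriv t s = (\<Sum>n. redJ_coeff_deriv t n * s ^ n)"

text \<open>A majorant uniform for orders in a compact interval: it gives convergence of both series
  and lets the first be differentiated in the order. Bounds for \<open>rGamma\<close> to the right
  of - T suffice, since n is added to t.\<close>

lemma redJ_coeff_bounded:
 "\<exists>C. \<forall>n. \<forall>t\<in>{- T..T}. \<forall>s. \<bar>redJ_coeff t n * s ^ n\<bar> \<le> C * ((\<bar>s\<bar> / 4) ^ n /R fact n) \<and>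
   \<bar>redJ_coeff_deriv t n * s ^ n\<bar> \<le> C * ((\<bar>s\<bar> / 4) ^ n /R fact n)"
proof -
 obtain C where C: "\<And>x::real. x \<ge> - T ==> \<bar>rGamma x\<bar> \<le> C \<and> \<bar>deriv rGamma x\<bar> \<le> C"
  using rGamma_bounded by blast
 have C0: "C \<ge> 0" using C[of "\<bar>T\<bar>"] by linarith
 have "\<bar>redJ_coeff t n * s ^ n\<bar> \<le> (2 * (2 powr T * C)) * ((\<bar>s\<bar> / 4) ^ n /R fact n) \<and>
   \<bar>redJ_coeff_deriv t n * s ^ n\<bar> \<le> (2 * (2 powr T * C)) * ((\<bar>s\<bar> / 4) ^ n /R fact n)"
  if t: "t \<in> {- T..T}" for n t s
 proof -
  have p: "2 powr (- t) \<le> 2 powr T" using t by simp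
  have r: "\<bar>rGamma (t + real n + 1)\<bar> \<le> C" "\<bar>deriv rGamma (t + real n + 1)\<bar> \<le> C"
   using C[of "t + real n + 1"] t by auto
  have ln2: "0 \<le> ln (2::real)" "ln (2::real) \<le> 1" using ln_le_minus_one[of "2::real"] by auto
  have "ln 2 * \<bar>rGamma (t + real n + 1)\<bar> \<le> 1 * C" using r ln2 C0 by (intro mult_mono) auto
  then have r2: "\<bar>deriv rGamma (t + real n + 1) - ln 2 * rGamma (t + real n + 1)\<bar> \<le> 2 * C"
   using r ln2(1) abs_triangle_ineq4[of "deriv rGamma (t + real n + 1)" "ln 2 * rGamma (t + real n + 1)"]
   by (simp add: abs_mult)
  have b1: "2 powr (- t) * \<bar>rGamma (t + real n + 1)\<bar> \<le> 2 powr T * (2 * C)"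
   using p r C0 by (intro mult_mono) auto
  have b2: "2 powr (- t) * \<bar>deriv rGamma (t + real n + 1) - ln 2 * rGamma (t + real n + 1)\<bar>
    \<le> 2 powr T * (2 * C)" using p r2 C0 by (intro mult_mono) auto
  have q: "(\<bar>s\<bar> / 4) ^ n /R fact n = \<bar>s\<bar> ^ n / (fact n * 4 ^ n)"
   by (simp add: power_divide divide_simps)
  show ?thesis using mult_right_mono[OF b1, of "\<bar>s\<bar> ^ n / (fact n * 4 ^ n)"]
    mult_right_mono[OF b2, of "\<bar>s\<bar> ^ n / (fact n * 4 ^ n)"]
   unfolding q by (simp add: redJ_coeff_def redJ_coeff_deriv_def abs_mult power_abs mult_ac)
 qed
 then show ?thesis by blast
qed

lemma summable_exp_bound: "summable (\<lambda>n. C * ((\<bar>s\<bar> / 4) ^ n /R fact n))" for C s :: real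
 by (intro summable_mult summable_exp_generic)

lemma summable_redJ: "summable (\<lambda>n. redJ_coeff t n * s ^ n)"
 and summable_redJ_deriv: "summable (\<lambda>n. redJ_coeff_deriv t n * s ^ n)"
proof -
 obtain C where C: "\<And>n s. \<bar>redJ_coeff t n * s ^ n\<bar> \<le> C * ((\<bar>s\<bar> / 4) ^ n /R fact n)"
  "\<And>n s. \<bar>redJ_coeff_deriv t n * s ^ n\<bar> \<le> C * ((\<bar>s\<bar> / 4) ^ n /R fact n)"
 proof -
  obtain C where "\<forall>n. \<forall>t\<in>{- \<bar>t\<bar>..\<bar>t\<bar>}. \<forall>s. \<bar>redJ_coeff t n * s ^ n\<bar> \<le> C * ((\<bar>s\<bar> / 4) ^ n /R fact n) \<and>
    \<bar>redJ_coeff_deriv t n * s ^ n\<bar> \<le> C * ((\<bar>s\<bar> / 4) ^ n /R fact n)"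
   using redJ_coeff_bounded[of "\<bar>t\<bar>"] by blast
  moreover have "t \<in> {- \<bar>t\<bar>..\<bar>t\<bar>}" by auto
  ultimately show ?thesis using that[of C] by blast
 qed
 show "summable (\<lambda>n. redJ_coeff t n * s ^ n)" "summable (\<lambda>n. redJ_coeff_deriv t n * s ^ n)"
  using C by (auto intro!: summable_comparison_test'[OF summable_exp_bound[of C s], of 0])
qed

lemma redJ_coeff_order_deriv: "((\<lambda>t. redJ_coeff t n) has_real_derivative redJ_coeff_deriv t n) (at t)"
proof -
 have eq: "redJ_coeff t n = ((- 1) ^ n / (fact n * 4 ^ n)) * (exp (- t * ln 2) * rGamma (t + real n + 1))" for t
  by (simp add: redJ_coeff_def powr_def)
 have "((\<lambda>t. rGamma (t + real n + 1)) has_real_derivative deriv rGamma (t + real n + 1) * 1) (at t)"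
  by (rule DERIV_chain2[OF deriv_rGamma]) (auto intro!: derivative_eq_intros)
 then have "((\<lambda>t. exp (- t * ln 2) * rGamma (t + real n + 1)) has_real_derivative
   exp (- t * ln 2) * (- ln 2) * rGamma (t + real n + 1) +
   deriv rGamma (t + real n + 1) * 1 * exp (- t * ln 2)) (at t)"
  by (intro DERIV_mult) (auto intro!: derivative_eq_intros)
 from DERIV_cmult[OF this, of "(- 1) ^ n / (fact n * 4 ^ n)"] show ?thesis
  unfolding eq redJ_coeff_deriv_def
  by (rule DERIV_cong) (simp add: powr_def algebra_simps diff_divide_distrib)
qed

lemma redJ_order_deriv: "((\<lambda>t. redJ t s) has_real_derivative redJ_deriv t s) (at t)"
proof -
 define T where "T = \<bar>t\<bar> + 1"
 obtain C where C: "\<And>n t s. t \<in> {-T..T} ==>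
   \<bar>redJ_coeff_deriv t n * s ^ n\<bar> \<le> C * ((\<bar>s\<bar> / 4) ^ n /R fact n)"
  using redJ_coeff_bounded[of T] by blast
 show ?thesis unfolding redJ_def redJ_deriv_def
 proof (rule has_field_derivative_series'(2)[where S = "{-T..T}" and ?x0.0 = t
     and f = "\<lambda>n t. redJ_coeff t n * s ^ n" and f' = "\<lambda>n t. redJ_coeff_deriv t n * s ^ n"])
  show "((\<lambda>t. redJ_coeff t n * s ^ n) has_real_derivative redJ_coeff_deriv t n * s ^ n)
    (at t within {-T..T})" for n t
   by (rule has_field_derivative_at_within[OF DERIV_cmult_right[OF redJ_coeff_order_deriv]])
  show "uniformly_convergent_on {-T..T} (\<lambda>n x. \<Sum>i<n. redJ_coeff_deriv x i * s ^ i)"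
   using C by (intro Weierstrass_m_test'[OF _ summable_exp_bound]) auto
  show "summable (\<lambda>n. redJ_coeff t n * s ^ n)" by (rule summable_redJ)
  show "t \<in> interior {-T..T}" "t \<in> {-T..T}" by (auto simp: T_def)
 qed auto
qed

lemma redJ_coeff_Suc: "real (Suc n) * redJ_coeff t (Suc n) = - 1 / 2 * redJ_coeff (t + 1) n"
proof -
 define m where "m = real (Suc n)"
 have m: "m \<noteq> 0" "t + m + 1 = t + 1 + real n + 1" "fact (Suc n) = m * fact n" by (auto simp: m_def)
 show ?thesis unfolding redJ_coeff_def m_def[symmetric] m(2,3) using m(1)
  by (simp add: powr_diff powr_minus field_simps)
qed

text \<open>Coefficient form of J_t + J_(t+2) = (2 (t + 1) / z) J_(t+1). The conditional with n - 1
  is the coefficient of s^n after multiplication by s.\<close>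

lemma redJ_coeff_rec:
 "redJ_coeff t n + (if n = 0 then 0 else redJ_coeff (t + 2) (n - 1)) = 2 * (t + 1) * redJ_coeff (t + 1) n"
proof -
 have r: "rGamma (t + real n + 1) = (t + real n + 1) * rGamma (t + real n + 2)"
  using rGamma_plus1[of "t + real n + 1"] by (simp add: add_ac)
 define c where "c = (- 1) ^ n * 2 powr (- t) * rGamma (t + real n + 2) / (fact n * 4 ^ n)"
 have 1: "redJ_coeff t n = (t + real n + 1) * c" by (simp add: redJ_coeff_def r c_def)
 have 2: "redJ_coeff (t + 1) n = c / 2"
  by (simp add: redJ_coeff_def c_def powr_diff powr_minus add_ac divide_simps)
 have 3: "(if n = 0 then 0 else redJ_coeff (t + 2) (n - 1)) = - real n * c"
 proof (cases n)
  case (Suc k)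
  define m where "m = real n"
  have m: "m \<noteq> 0" "t + 2 + real k + 1 = t + m + 2" "fact n = m * fact k" "n - 1 = k"
   by (auto simp: Suc m_def)
  have "redJ_coeff (t + 2) k = - m * c"
   unfolding redJ_coeff_def c_def m_def[symmetric] m(2,3) using m(1)
   by (simp add: Suc powr_diff powr_minus field_simps)
  then show ?thesis by (simp add: Suc m_def)
 qed simp
 show ?thesis unfolding 1 2 3 by (simp add: algebra_simps)
qed

text \<open>Both sides of the identity for \<open>redJ_coeff\<close> are differentiated in the
  order, and uniqueness of derivatives gives the result.\<close>

lemma redJ_coeff_deriv_Suc:
 "real (Suc n) * redJ_coeff_deriv t (Suc n) = - 1 / 2 * redJ_coeff_deriv (t + 1) n"
proof -
 have "((\<lambda>t. real (Suc n) * redJ_coeff t (Suc n)) has_real_derivative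
   real (Suc n) * redJ_coeff_deriv t (Suc n)) (at t)" by (intro DERIV_cmult redJ_coeff_order_deriv)
 moreover have "((\<lambda>t. - 1 / 2 * redJ_coeff (t + 1) n) has_real_derivative
   - 1 / 2 * (redJ_coeff_deriv (t + 1) n * 1)) (at t)"
  by (intro DERIV_cmult DERIV_chain2[OF redJ_coeff_order_deriv]) (auto intro!: derivative_eq_intros)
 ultimately show ?thesis unfolding redJ_coeff_Suc by (metis DERIV_unique mult.right_neutral)
qed

text \<open>The extra \<open>2 * redJ_coeff (t + 1) n\<close> is the product rule acting on the
  factor 2 (t + 1). In the integer-order identities for Y these inhomogeneous terms have to
  cancel.\<close>

lemma redJ_coeff_deriv_rec:
 "redJ_coeff_deriv t n + (if n = 0 then 0 else redJ_coeff_deriv (t + 2) (n - 1)) =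
   2 * (t + 1) * redJ_coeff_deriv (t + 1) n + 2 * redJ_coeff (t + 1) n"
proof -
 have shift: "((\<lambda>t. redJ_coeff (t + c) n) has_real_derivative redJ_coeff_deriv (t + c) n) (at t)" for c n
  using DERIV_shift[of "\<lambda>t. redJ_coeff t n" _ t c] redJ_coeff_order_deriv by blast
 have "((\<lambda>t. redJ_coeff t n + (if n = 0 then 0 else redJ_coeff (t + 2) (n - 1))) has_real_derivative
   redJ_coeff_deriv t n + (if n = 0 then 0 else redJ_coeff_deriv (t + 2) (n - 1))) (at t)"
  by (cases "n = 0") (auto intro!: derivative_eq_intros redJ_coeff_order_deriv shift)
 moreover have "((\<lambda>t. 2 * (t + 1) * redJ_coeff (t + 1) n) has_real_derivative
   2 * (t + 1) * redJ_coeff_deriv (t + 1) n + 2 * redJ_coeff (t + 1) n) (at t)"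
  by (rule derivative_eq_intros shift refl)+ simp
 ultimately show ?thesis unfolding redJ_coeff_rec by (rule DERIV_unique)
qed

text \<open>With s = z^2 one has d/ds = (1 / (2 z)) d/dz, so the classical rule (z^(-t) J_t)' = -
  z^(-t) J_(t+1) becomes a plain shift of the order with factor -1/2.\<close>

lemma redJ_has_derivative [derivative_intros]:
 assumes "(f has_real_derivative f') (at x within S)"
 shows "((\<lambda>x. redJ t (f x)) has_real_derivative (- 1 / 2 * redJ (t + 1) (f x)) * f') (at x within S)"
proof -
 have "(redJ t has_real_derivative (\<Sum>n. diffs (redJ_coeff t) n * s ^ n)) (at s)" for s
  unfolding redJ_def by (rule termdiffs_strong_converges_everywhere) (rule summable_redJ)
 moreover have "diffs (redJ_coeff t) n * s ^ n = - 1 / 2 * (redJ_coeff (t + 1) n * s ^ n)" for n s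
  using redJ_coeff_Suc[of n t] by (simp add: diffs_def)
 then have "(\<Sum>n. diffs (redJ_coeff t) n * s ^ n) = - 1 / 2 * redJ (t + 1) s" for s
  unfolding redJ_def by (simp only: suminf_mult[OF summable_redJ])
 ultimately show ?thesis using assms DERIV_chain2 by metis
qed

lemma redJ_deriv_has_derivative [derivative_intros]:
 assumes "(f has_real_derivative f') (at x within S)"
 shows "((\<lambda>x. redJ_deriv t (f x)) has_real_derivative (- 1 / 2 * redJ_deriv (t + 1) (f x)) * f') (at x within S)"
proof -
 have "(redJ_deriv t has_real_derivative (\<Sum>n. diffs (redJ_coeff_deriv t) n * s ^ n)) (at s)" for s
  unfolding redJ_deriv_def by (rule termdiffs_strong_converges_everywhere) (rule summable_redJ_deriv)
 moreover have "diffs (redJ_coeff_deriv t) n * s ^ n = - 1 / 2 * (redJ_coeff_deriv (t + 1) n * s ^ n)" for n s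
  using redJ_coeff_deriv_Suc[of n t] by (simp add: diffs_def)
 then have "(\<Sum>n. diffs (redJ_coeff_deriv t) n * s ^ n) = - 1 / 2 * redJ_deriv (t + 1) s" for s
  unfolding redJ_deriv_def by (simp only: suminf_mult[OF summable_redJ_deriv])
 ultimately show ?thesis using assms DERIV_chain2 by metis
qed

lemma shifted_power_series:
 fixes c :: "nat => real"
 assumes "summable (\<lambda>n. c n * s ^ n)"
 shows "summable (\<lambda>n. (if n = 0 then 0 else c (n - 1)) * s ^ n)"
  and "(\<Sum>n. (if n = 0 then 0 else c (n - 1)) * s ^ n) = s * (\<Sum>n. c n * s ^ n)"
proof -
 have "(\<lambda>n. s * (c n * s ^ n)) sums (s * (\<Sum>n. c n * s ^ n))"
  using assms by (intro sums_mult) (simp add: summable_sums)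
 then have "(\<lambda>n. (if n = 0 then 0 else c (n - 1)) * s ^ n) sums (s * (\<Sum>n. c n * s ^ n))"
  using sums_Suc[of "\<lambda>n. (if n = 0 then 0 else c (n - 1)) * s ^ n" "s * (\<Sum>n. c n * s ^ n)"]
  by (simp add: mult.left_commute)
 then show "summable (\<lambda>n. (if n = 0 then 0 else c (n - 1)) * s ^ n)"
  and "(\<Sum>n. (if n = 0 then 0 else c (n - 1)) * s ^ n) = s * (\<Sum>n. c n * s ^ n)"
  by (auto simp: sums_iff)
qed

lemma redJ_rec: "s * redJ (t + 2) s = 2 * (t + 1) * redJ (t + 1) s - redJ t s"
proof -
 note sh = shifted_power_series[OF summable_redJ[of "t + 2" s]]
 have "redJ t s + s * redJ (t + 2) s =
   (\<Sum>n. redJ_coeff t n * s ^ n + (if n = 0 then 0 else redJ_coeff (t + 2) (n - 1)) * s ^ n)"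
  using suminf_add[OF summable_redJ sh(1), of t] sh(2) unfolding redJ_def by simp
 also have "... = (\<Sum>n. 2 * (t + 1) * (redJ_coeff (t + 1) n * s ^ n))"
  by (simp only: redJ_coeff_rec flip: distrib_right mult.assoc)
 also have "... = 2 * (t + 1) * redJ (t + 1) s"
  unfolding redJ_def by (rule suminf_mult[OF summable_redJ])
 finally show ?thesis by simp
qed

lemma redJ_deriv_rec:
 "s * redJ_deriv (t + 2) s = 2 * (t + 1) * redJ_deriv (t + 1) s + 2 * redJ (t + 1) s - redJ_deriv t s"
proof -
 note sh = shifted_power_series[OF summable_redJ_deriv[of "t + 2" s]]
 have "redJ_deriv t s + s * redJ_deriv (t + 2) s =
   (\<Sum>n. redJ_coeff_deriv t n * s ^ n + (if n = 0 then 0 else redJ_coeff_deriv (t + 2) (n - 1)) * s ^ n)"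
  using suminf_add[OF summable_redJ_deriv sh(1), of t] sh(2) unfolding redJ_deriv_def by simp
 also have "... = (\<Sum>n. 2 * (t + 1) * (redJ_coeff_deriv (t + 1) n * s ^ n) + 2 * (redJ_coeff (t + 1) n * s ^ n))"
  by (simp only: redJ_coeff_deriv_rec flip: distrib_right mult.assoc)
 also have "... = 2 * (t + 1) * redJ_deriv (t + 1) s + 2 * redJ (t + 1) s"
  unfolding redJ_def redJ_deriv_def
  by (subst suminf_add[symmetric]) (auto intro!: summable_mult summable_redJ summable_redJ_deriv
    simp: suminf_mult[OF summable_redJ] suminf_mult[OF summable_redJ_deriv])
 finally show ?thesis by simp
qed

section \<open>Comparison with the Bessel function J and negative integer orders\<close>

lemma bessel_J_redJ:
 assumes "z > 0"
 shows "bessel_J \<mu> z = z powr \<mu> * redJ \<mu> (z^2)"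
proof -
 have eq: "(- 1) ^ n * rGamma (\<mu> + real n + 1) / fact n * (z / 2) ^ (2 * n) =
   2 powr \<mu> * (redJ_coeff \<mu> n * (z^2) ^ n)" for n
 proof -
  have "(z / 2) ^ (2 * n) = (z^2) ^ n / 4 ^ n" by (simp add: power_mult power_divide)
  then show ?thesis by (simp add: redJ_coeff_def powr_minus)
 qed
 show ?thesis unfolding bessel_J_def redJ_def eq suminf_mult[OF summable_redJ]
  using assms by (simp add: powr_divide)
qed

lemma redJ_0: "redJ t 0 = 2 powr (- t) * rGamma (t + 1)"
 unfolding redJ_def powser_zero by (simp add: redJ_coeff_def)

lemma redJ_deriv_0: "redJ_deriv t 0 = 2 powr (- t) * (deriv rGamma (t + 1) - ln 2 * rGamma (t + 1))"
 unfolding redJ_deriv_def powser_zero by (simp add: redJ_coeff_deriv_def)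

text \<open>The recurrence ties the orders - n, - n + 1 and - n + 2 together, whence the two-step
  induction; at n = 1 the middle coefficient 2 (t + 1) vanishes and the claim is the recurrence
  itself.\<close>

lemma redJ_minus_nat: "redJ (- real n) s = (- 1) ^ n * s ^ n * redJ (real n) s"
proof (induction n rule: less_induct)
 case (less n)
 consider "n = 0" | "n = 1" | m where "n = Suc (Suc m)" by (metis One_nat_def not0_implies_Suc)
 then show ?case
 proof cases
  case 2
  then show ?thesis using redJ_rec[of s "-1"] by simp
 next
  case (3 m)
  have "redJ (- real n) s = - 2 * (real m + 1) * redJ (- real (Suc m)) s - s * redJ (- real m) s"
   using redJ_rec[of s "- real n"] 3 by (simp add: algebra_simps)
  also have "... = (- 1) ^ m * s ^ Suc m * (2 * (real m + 1) * redJ (real m + 1) s - redJ (real m) s)"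
   using less.IH[of m] less.IH[of "Suc m"] 3 by (simp add: algebra_simps)
  also have "... = (- 1) ^ m * s ^ Suc m * (s * redJ (real m + 2) s)"
   using redJ_rec[of s "real m"] by simp
  finally show ?thesis using 3 by (simp add: add_ac)
 qed simp
qed

lemma redJ_isCont [continuous_intros]: "isCont (redJ t) s"
 using redJ_has_derivative[OF DERIV_ident] DERIV_isCont by blast

lemma redJ_deriv_isCont [continuous_intros]: "isCont (redJ_deriv t) s"
 using redJ_deriv_has_derivative[OF DERIV_ident] DERIV_isCont by blast

section \<open>Reduced Bessel functions of the second kind\<close>

definition redY :: "real => real => real" where
 "redY \<mu> s = bessel_Y \<mu> (sqrt s) / sqrt s powr \<mu>"

lemma bessel_Y_redY: "z > 0 ==> bessel_Y \<mu> z = z powr \<mu> * redY \<mu> (z^2)" by (simp add: redY_def)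

lemma powr_real_sqrt: "s > 0 ==> sqrt s powr a * sqrt s powr a = s powr a"
 using powr_mult[of "sqrt s" "sqrt s" a] by simp

text \<open>The factor \<open>s powr (- \<mu>)\<close> appears because z^(-\<mu>) J_(-\<mu>) is
  z^(-2 \<mu>) times its reduced function; it carries the singularity at 0.\<close>

lemma redY_nonint:
 assumes "\<mu> \<notin> \<int>" "s > 0"
 shows "redY \<mu> s = (cos (\<mu> * pi) * redJ \<mu> s - s powr (- \<mu>) * redJ (- \<mu>) s) / sin (\<mu> * pi)"
proof -
 have "sqrt s powr (- \<mu>) / sqrt s powr \<mu> = s powr (- \<mu>)"
  using assms powr_real_sqrt[of s "- \<mu>"] by (simp add: powr_minus divide_inverse)
 then have "sqrt s powr (- \<mu>) * redJ (- \<mu>) s / sqrt s powr \<mu> = s powr (- \<mu>) * redJ (- \<mu>) s"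
  by (metis times_divide_eq_left)
 moreover have "((p * A * c - p' * B) / S) / p = (c * A - p' / p * B) / S" if "p \<noteq> 0" for p A c p' B S :: real
  using that by (cases "S = 0") (simp_all add: field_simps)
 ultimately show ?thesis using assms by (simp add: redY_def bessel_Y_def bessel_J_redJ)
qed

text \<open>L'Hospital's rule in the order: numerator and sin (t pi) both vanish at t = n, and their
  derivatives in t are at hand. The logarithms ln z coming from z^t and z^(-t) have equal factors by
  \<open>redJ_minus_nat\<close> and add up to ln s.\<close>

lemma bessel_order_limit:
 assumes "s > 0"
 shows "((\<lambda>t. (bessel_J t (sqrt s) * cos (t * pi) - bessel_J (- t) (sqrt s)) / sin (t * pi)) \<longlongrightarrow>
   sqrt s powr real n *
    (ln s * redJ (real n) s + redJ_deriv (real n) s + (- 1) ^ n * s powr (- real n) * redJ_deriv (- real n) s) / pi)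
   (at (real n))"
proof -
 define z where "z = sqrt s"
 have z: "z > 0" "z^2 = s" using assms by (auto simp: z_def)
 define F where "F = (\<lambda>t. z powr t * redJ t s * cos (t * pi) - z powr (- t) * redJ (- t) s)"
 define F' where "F' = (ln z * z powr n * redJ n s + z powr n * redJ_deriv n s) * (- 1) ^ n
  + ln z * z powr (- real n) * redJ (- real n) s + z powr (- real n) * redJ_deriv (- real n) s"
 have J: "(bessel_J t (sqrt s) * cos (t * pi) - bessel_J (- t) (sqrt s)) / sin (t * pi) = F t / sin (t * pi)" for t
  using z by (simp add: F_def bessel_J_redJ flip: z_def)
 have pw: "((\<lambda>t. z powr t) has_real_derivative ln z * z powr t) (at t)" for t
  using z by (auto simp: powr_def intro!: derivative_eq_intros)
 have m: "((\<lambda>t. f (- t)) has_real_derivative - f' (- t)) (at t)"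
  if "\<And>t. (f has_real_derivative f' t) (at t)" for f f' and t :: real
  using that DERIV_mirror by metis
 note m1 = m[of "\<lambda>t. redJ t s", OF redJ_order_deriv] and m2 = m[OF pw]
 have "(F has_real_derivative F') (at (real n))" unfolding F_def
  by (rule derivative_eq_intros redJ_order_deriv pw m1 m2 refl)+ (simp add: F'_def algebra_simps)
 moreover have e1: "(- 1) ^ n * (- 1) ^ n = (1::real)" by (simp flip: power_mult_distrib)
 moreover have c: "(- 1) ^ n * z powr (- real n) * redJ (- real n) s = z powr n * redJ n s"
 proof -
  have "z powr (- real n) * s ^ n = z powr real n"
   using z by (simp add: powr_minus powr_realpow power2_eq_square power_mult_distrib field_simps flip: z(2))
  then show ?thesis
  proof -
   have "(- 1) ^ n * z powr (- real n) * ((- 1) ^ n * s ^ n * J) =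
     ((- 1) ^ n * (- 1) ^ n) * (z powr (- real n) * s ^ n) * J" for J by (simp only: mult_ac)
   then show ?thesis
    using \<open>z powr (- real n) * s ^ n = z powr real n\<close> unfolding redJ_minus_nat e1 by simp
  qed
 qed
 have F0: "F (real n) = 0"
 proof -
  have "(- 1) ^ n * F (real n) = ((- 1) ^ n * (- 1) ^ n) * (z powr n * redJ n s)
    - (- 1) ^ n * z powr (- real n) * redJ (- real n) s" by (simp add: F_def algebra_simps)
  then show ?thesis unfolding e1 c by simp
 qed
 moreover have "((\<lambda>t. sin (t * pi)) has_real_derivative pi * (- 1) ^ n) (at (real n))"
  by (auto intro!: derivative_eq_intros)
 ultimately have "((\<lambda>t. (F t - F (real n)) / (t - real n)) \<longlongrightarrow> F') (at (real n))"
  "((\<lambda>t. (sin (t * pi) - sin (real n * pi)) / (t - real n)) \<longlongrightarrow> pi * (- 1) ^ n) (at (real n))"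
  by (simp_all only: has_field_derivative_iff)
 \<comment> \<open>Since \<open>F\<close> and the sine vanish at n, the quotient of the two
   difference quotients is \<open>F t / sin (t * pi)\<close> itself.\<close>
 from tendsto_divide[OF this]
 have "((\<lambda>t. ((F t - F (real n)) / (t - real n)) / ((sin (t * pi) - sin (real n * pi)) / (t - real n)))
   \<longlongrightarrow> F' / (pi * (- 1) ^ n)) (at (real n))" by simp
 then have "((\<lambda>t. F t / sin (t * pi)) \<longlongrightarrow> F' / (pi * (- 1) ^ n)) (at (real n))"
  by (rule Lim_transform_eventually) (auto simp: F0 eventually_at_filter)
 moreover have "F' / (pi * (- 1) ^ n) = z powr real n *
    (ln s * redJ (real n) s + redJ_deriv (real n) s + (- 1) ^ n * s powr (- real n) * redJ_deriv (- real n) s) / pi"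
 proof -
  have ls: "ln s = 2 * ln z" using z by (simp add: ln_realpow flip: z(2))
  have zs: "z powr (- real n) = z powr real n * s powr (- real n)"
   using z by (simp add: powr_minus powr_realpow power2_eq_square power_mult_distrib field_simps flip: z(2))
  have "F' / (pi * (- 1) ^ n) = (- 1) ^ n * F' / pi" by (simp add: field_simps minus_one_power_iff)
  also have "(- 1) ^ n * F' = ((- 1) ^ n * (- 1) ^ n) * (ln z * z powr n * redJ n s + z powr n * redJ_deriv n s)
    + ln z * ((- 1) ^ n * z powr (- real n) * redJ (- real n) s) + (- 1) ^ n * z powr (- real n) * redJ_deriv (- real n) s"
   by (simp add: F'_def algebra_simps)
  finally show ?thesis unfolding e1 c unfolding ls zs by (simp add: algebra_simps)
 qed
 ultimately show ?thesis unfolding J by (simp add: z_def)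
qed

lemma redY_nat:
 assumes "s > 0"
 shows "redY (real n) s =
  (ln s * redJ (real n) s + redJ_deriv (real n) s + (- 1) ^ n * s powr (- real n) * redJ_deriv (- real n) s) / pi"
 using tendsto_Lim[OF _ bessel_order_limit[OF assms, of n]] assms
 by (simp add: redY_def bessel_Y_def)

text \<open>Identities for Y are proved twice, from the quotient definition at non-integer orders
  and from the limit form at positive integers; this is the case split.\<close>

lemma order_cases:
 fixes \<mu> :: real
 assumes "\<mu> > 0"
 obtains (nonint) "\<mu> \<notin> \<int>" | (nat) n where "\<mu> = real n" "n > 0"
 using assms by (metis Ints_cases of_int_0_less_iff of_int_of_nat_eq of_nat_0_less_iff zero_less_imp_eq_int)

lemma Ints_shift: "(\<mu> + 1 \<in> \<int>) = (\<mu> \<in> \<int>)" "(\<mu> + 2 \<in> \<int>) = (\<mu> \<in> \<int>)" for \<mu> :: real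
 using Ints_add[of \<mu> 1] Ints_diff[of "\<mu> + 1" 1] Ints_add[of \<mu> 2] Ints_diff[of "\<mu> + 2" 2] by auto

lemma redY_rec:
 assumes "\<mu> > 0" "s > 0"
 shows "s * redY (\<mu> + 2) s = 2 * (\<mu> + 1) * redY (\<mu> + 1) s - redY \<mu> s" using \<open>\<mu> > 0\<close>
proof (cases \<mu> rule: order_cases)
 case nonint
 define c where "c = cos (\<mu> * pi)"
 define S where "S = sin (\<mu> * pi)"
 have S: "S \<noteq> 0"
  using nonint by (simp add: S_def sin_zero_iff_int2 mult.commute) (metis Ints_of_int mult_cancel_left mult.commute pi_neq_zero)
 have tr: "cos ((\<mu> + 1) * pi) = - c" "sin ((\<mu> + 1) * pi) = - S"
  "cos ((\<mu> + 2) * pi) = c" "sin ((\<mu> + 2) * pi) = S"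
  using cos_periodic[of "\<mu> * pi"] sin_periodic[of "\<mu> * pi"]
  by (simp_all add: c_def S_def distrib_right)
 have p: "s powr (- \<mu>) = s * s * s powr (- \<mu> - 2)" "s powr (- \<mu> - 1) = s * s powr (- \<mu> - 2)"
  using assms by (simp_all add: powr_diff powr_minus field_simps power2_eq_square)
 have J: "s * redJ (\<mu> + 2) s = 2 * (\<mu> + 1) * redJ (\<mu> + 1) s - redJ \<mu> s" by (rule redJ_rec)
 have J': "redJ (- \<mu> - 2) s = - 2 * (\<mu> + 1) * redJ (- \<mu> - 1) s - s * redJ (- \<mu>) s"
 proof -
  have "- \<mu> - 2 + 1 = - \<mu> - 1" "- \<mu> - 2 + 2 = - \<mu>" by simp_all
  from redJ_rec[of s "- \<mu> - 2", unfolded this] show ?thesis by (simp add: algebra_simps)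
 qed
 have Y: "redY \<mu> s = (c * redJ \<mu> s - s powr (- \<mu>) * redJ (- \<mu>) s) / S"
  "redY (\<mu> + 1) s = (- c * redJ (\<mu> + 1) s - s powr (- \<mu> - 1) * redJ (- \<mu> - 1) s) / (- S)"
  "redY (\<mu> + 2) s = (c * redJ (\<mu> + 2) s - s powr (- \<mu> - 2) * redJ (- \<mu> - 2) s) / S"
  using redY_nonint[of \<mu> s] redY_nonint[of "\<mu> + 1" s] redY_nonint[of "\<mu> + 2" s] nonint assms
  unfolding tr c_def[symmetric] S_def[symmetric] by (simp_all add: Ints_shift)
 have "S * (s * redY (\<mu> + 2) s) = c * (s * redJ (\<mu> + 2) s) - s * s powr (- \<mu> - 2) * redJ (- \<mu> - 2) s"
  unfolding Y using S by (simp add: field_simps)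
 also have "... = S * (2 * (\<mu> + 1) * redY (\<mu> + 1) s - redY \<mu> s)"
  unfolding J J' Y p using S by (simp add: field_simps)
 finally show ?thesis using S by simp
next
 case (nat n)
 define e where "e = (- 1 :: real) ^ n"
 have ee: "e * e = 1" by (simp add: e_def flip: power_mult_distrib)
 define q where "q = s powr (- real n - 2)"
 have p: "s powr (- real n) = s * s * q" "s powr (- real n - 1) = s * q"
  using assms by (simp_all add: q_def powr_diff powr_minus field_simps power2_eq_square)
 have J: "s * redJ (real n + 2) s = 2 * (real n + 1) * redJ (real n + 1) s - redJ n s"
  by (rule redJ_rec)
 have D: "s * redJ_deriv (real n + 2) s = 2 * (real n + 1) * redJ_deriv (real n + 1) s + 2 * redJ (real n + 1) s - redJ_deriv n s"
  by (rule redJ_deriv_rec)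
 have D': "redJ_deriv (- real n - 2) s = - 2 * (real n + 1) * redJ_deriv (- real n - 1) s
   + 2 * redJ (- real (Suc n)) s - s * redJ_deriv (- real n) s"
 proof -
  have "- real n - 2 + 1 = - real n - 1" "- real n - 2 + 2 = - real n" "- real (Suc n) = - real n - 1" by simp_all
  then show ?thesis using redJ_deriv_rec[of s "- real n - 2"] by (simp only:) (simp add: algebra_simps)
 qed
 have q1: "q * s ^ n * s * s = 1"
  using assms by (simp add: q_def powr_diff powr_minus powr_realpow field_simps power2_eq_square)
 have Y: "pi * redY (real n) s = ln s * redJ n s + redJ_deriv n s + e * (s * s * q) * redJ_deriv (- real n) s"
  "pi * redY (real n + 1) s = ln s * redJ (real n + 1) s + redJ_deriv (real n + 1) s - e * (s * q) * redJ_deriv (- real n - 1) s"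
  "pi * redY (real n + 2) s = ln s * redJ (real n + 2) s + redJ_deriv (real n + 2) s + e * q * redJ_deriv (- real n - 2) s"
 proof -
  have sh: "real (Suc n) = real n + 1" "- (real n + 1) = - real n - 1"
   "real (Suc (Suc n)) = real n + 2" "- (real n + 2) = - real n - 2" by simp_all
  note q = redY_nat[OF assms(2), of n] redY_nat[OF assms(2), of "Suc n", unfolded sh]
   redY_nat[OF assms(2), of "Suc (Suc n)", unfolded sh]
  show "pi * redY (real n) s = ln s * redJ n s + redJ_deriv n s + e * (s * s * q) * redJ_deriv (- real n) s"
   "pi * redY (real n + 1) s = ln s * redJ (real n + 1) s + redJ_deriv (real n + 1) s - e * (s * q) * redJ_deriv (- real n - 1) s"
   "pi * redY (real n + 2) s = ln s * redJ (real n + 2) s + redJ_deriv (real n + 2) s + e * q * redJ_deriv (- real n - 2) s"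
   unfolding q by (simp_all only: p) (simp_all add: e_def q_def)
 qed
 have "pi * (s * redY (real n + 2) s) = ln s * (s * redJ (real n + 2) s) + s * redJ_deriv (real n + 2) s
   + e * s * q * redJ_deriv (- real n - 2) s"
  unfolding mult.left_commute[of pi s] Y(3) by (simp add: algebra_simps)
 \<comment> \<open>The inhomogeneous terms of the two order-derivative recurrences leave this
   remainder; it vanishes because J of order - (n + 1) is J of order n + 1 up to a sign and a power
   of s.\<close>
 also have "... = pi * (2 * (real n + 1) * redY (real n + 1) s - redY (real n) s)
   + 2 * redJ (real n + 1) s * (1 - (e * e) * (q * s ^ n * s * s))"
  unfolding J D D' redJ_minus_nat right_diff_distrib[of pi] mult.left_commute[of pi "2 * _"] Y(1,2)
  by (simp add: algebra_simps e_def)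
 finally show ?thesis unfolding ee q1 by (simp add: nat)
qed

lemma redY_has_derivative:
 assumes "\<mu> > 0" "s > 0"
 shows "(redY \<mu> has_real_derivative - 1 / 2 * redY (\<mu> + 1) s) (at s)" using \<open>\<mu> > 0\<close>
proof (cases \<mu> rule: order_cases)
 case nonint
 define c where "c = cos (\<mu> * pi)"
 define S where "S = sin (\<mu> * pi)"
 have S: "S \<noteq> 0"
  using nonint by (simp add: S_def sin_zero_iff_int2 mult.commute) (metis Ints_of_int mult_cancel_left mult.commute pi_neq_zero)
 have tr: "cos ((\<mu> + 1) * pi) = - c" "sin ((\<mu> + 1) * pi) = - S"
  by (simp_all add: c_def S_def algebra_simps)
 have p: "s powr (- \<mu>) = s * s powr (- \<mu> - 1)"
  using assms by (simp add: powr_diff powr_minus field_simps)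
 have J': "redJ (- \<mu> - 1) s = - 2 * \<mu> * redJ (- \<mu>) s - s * redJ (- \<mu> + 1) s"
  using redJ_rec[of s "- \<mu> - 1"] by (simp add: algebra_simps)
 have "((\<lambda>s. (c * redJ \<mu> s - s powr (- \<mu>) * redJ (- \<mu>) s) / S) has_real_derivative
   (c * (- 1 / 2 * redJ (\<mu> + 1) s) + s powr (- \<mu> - 1) * (\<mu> * redJ (- \<mu>) s + s / 2 * redJ (- \<mu> + 1) s)) / S) (at s)"
  using assms S
  by (auto intro!: derivative_eq_intros has_real_derivative_powr simp: p) (simp add: field_simps)
 also have "(c * (- 1 / 2 * redJ (\<mu> + 1) s) + s powr (- \<mu> - 1) * (\<mu> * redJ (- \<mu>) s + s / 2 * redJ (- \<mu> + 1) s)) / S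
   = - 1 / 2 * redY (\<mu> + 1) s"
 proof -
  have "redY (\<mu> + 1) s = (c * redJ (\<mu> + 1) s + s powr (- \<mu> - 1) * redJ (- \<mu> - 1) s) / S"
   using nonint assms S by (simp add: redY_nonint Ints_shift tr) (simp add: divide_simps)
  then show ?thesis unfolding J' using S by (simp add: field_simps)
 qed
 \<comment> \<open>The closed form of \<open>redY\<close> is available for s > 0 only, so the
   derivative is transferred on the open half line.\<close>
 finally show ?thesis by (rule has_field_derivative_transform_within_open[where S = "{0<..}"])
   (use assms nonint in \<open>auto simp: redY_nonint c_def S_def\<close>)
next
 case (nat n)
 define e where "e = (- 1 :: real) ^ n"
 have ee: "e * e = 1" by (simp add: e_def flip: power_mult_distrib)
 define q where "q = s powr (- real n - 1)"
 have p: "s powr (- real n) = s * q"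
  using assms by (simp add: q_def powr_diff powr_minus field_simps)
 have q1: "q * s ^ n = 1 / s"
  using assms by (simp add: q_def powr_diff powr_minus powr_realpow field_simps power2_eq_square)
 have D': "redJ_deriv (- real n - 1) s = - 2 * real n * redJ_deriv (- real n) s
   + 2 * redJ (- real n) s - s * redJ_deriv (- real n + 1) s"
  using redJ_deriv_rec[of s "- real n - 1"] by (simp add: algebra_simps)
 have Y: "- 1 / 2 * redY (real n + 1) s =
   (- 1 / 2 * ln s * redJ (real n + 1) s - 1 / 2 * redJ_deriv (real n + 1) s + 1 / 2 * e * q * redJ_deriv (- real n - 1) s) / pi"
 proof -
  have sh: "real (Suc n) = real n + 1" "- (real n + 1) = - real n - 1" by simp_all
  have "redY (real n + 1) s =
    (ln s * redJ (real n + 1) s + redJ_deriv (real n + 1) s - e * q * redJ_deriv (- real n - 1) s) / pi"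
   using redY_nat[OF assms(2), of "Suc n"] unfolding sh by (simp add: e_def q_def)
  then show ?thesis by (simp add: field_simps)
 qed
 have "((\<lambda>s. (ln s * redJ n s + redJ_deriv n s + e * s powr (- real n) * redJ_deriv (- real n) s) / pi) has_real_derivative
   (redJ n s / s - 1 / 2 * ln s * redJ (real n + 1) s - 1 / 2 * redJ_deriv (real n + 1) s
    - e * q * (n * redJ_deriv (- real n) s + s / 2 * redJ_deriv (- real n + 1) s)) / pi) (at s)"
  using assms
  by (auto intro!: derivative_eq_intros has_real_derivative_powr simp: p) (simp add: q_def field_simps)
 \<comment> \<open>Differentiating ln s leaves \<open>redJ n s / s\<close>; the recurrence for
   \<open>redJ_deriv\<close> at negative order leaves a multiple of J of order - n, and the two
   cancel.\<close>
 also have "(redJ n s / s - 1 / 2 * ln s * redJ (real n + 1) s - 1 / 2 * redJ_deriv (real n + 1) s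
    - e * q * (n * redJ_deriv (- real n) s + s / 2 * redJ_deriv (- real n + 1) s)) / pi
   = - 1 / 2 * redY (real n + 1) s + (redJ n s * (1 / s - (e * e) * (q * s ^ n))) / pi"
  unfolding Y D' redJ_minus_nat by (simp add: algebra_simps e_def add_divide_distrib diff_divide_distrib)
 also have "... = - 1 / 2 * redY (real n + 1) s" unfolding ee q1 by simp
 finally show ?thesis unfolding nat
  by (rule has_field_derivative_transform_within_open[where S = "{0<..}"])
   (use assms in \<open>auto simp: redY_nat e_def\<close>)
qed

section \<open>Behaviour of Y at zero and the Wronskian\<close>

lemma rGamma_reflection_real: "rGamma x * rGamma (1 - x) = sin (pi * x) / pi" for x :: real
proof -
 have "rGamma (of_real x) * rGamma (of_real (1 - x)) = (sin (of_real (pi * x)) / of_real pi :: complex)"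
  using rGamma_reflection_complex[of "of_real x"] by simp
 then show ?thesis
  unfolding rGamma_complex_of_real sin_of_real by (metis of_real_divide of_real_eq_iff of_real_mult)
qed

text \<open>Leading singularity of Y. For non-integer order the reflection formula turns rGamma(1 -
  \<mu>) / sin into Gamma(\<mu>) / pi; at an integer n the derivative of \<open>rGamma\<close> at
  the pole 1 - n of Gamma is a signed factorial and plays the same role.\<close>

lemma redY_at_0:
 assumes "\<mu> > 0"
 shows "((\<lambda>s. s powr \<mu> * redY \<mu> s) \<longlongrightarrow> - (2 powr \<mu> * Gamma \<mu> / pi)) (at_right 0)"
proof -
 have p0: "((\<lambda>s::real. s powr \<mu>) \<longlongrightarrow> 0) (at_right 0)"
  using assms by (intro tendsto_zero_powrI[OF tendsto_ident_at tendsto_const])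
   (auto simp: eventually_at_filter)
 have J: "((\<lambda>s. redJ t s) \<longlongrightarrow> redJ t 0) (at_right 0)" "((\<lambda>s. redJ_deriv t s) \<longlongrightarrow> redJ_deriv t 0) (at_right 0)" for t
  using redJ_isCont[of 0 t] redJ_deriv_isCont[of 0 t]
  by (auto simp: isCont_def intro: tendsto_within_subset)
 show ?thesis using \<open>\<mu> > 0\<close>
 proof (cases \<mu> rule: order_cases)
  case nonint
  define S where "S = sin (\<mu> * pi)"
  have S: "S \<noteq> 0"
   using nonint by (simp add: S_def sin_zero_iff_int2 mult.commute) (metis Ints_of_int mult_cancel_left mult.commute pi_neq_zero)
  have "((\<lambda>s. (cos (\<mu> * pi) * (s powr \<mu> * redJ \<mu> s) - redJ (- \<mu>) s) / S) \<longlongrightarrow>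
    (cos (\<mu> * pi) * (0 * redJ \<mu> 0) - redJ (- \<mu>) 0) / S) (at_right 0)"
   by (intro tendsto_intros p0 J S)
  moreover have "\<forall>\<^sub>F s in at_right 0. (cos (\<mu> * pi) * (s powr \<mu> * redJ \<mu> s) - redJ (- \<mu>) s) / S = s powr \<mu> * redY \<mu> s"
   using nonint S unfolding eventually_at_filter
   by (intro always_eventually) (auto simp: redY_nonint S_def powr_minus field_simps)
  moreover have "(cos (\<mu> * pi) * (0 * redJ \<mu> 0) - redJ (- \<mu>) 0) / S = - (2 powr \<mu> * Gamma \<mu> / pi)"
  proof -
   have "rGamma \<mu> \<noteq> 0" using assms by (auto simp: rGamma_eq_zero_iff elim!: nonpos_Ints_cases)
   moreover have "rGamma \<mu> * rGamma (1 - \<mu>) = S / pi"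
    using rGamma_reflection_real[of \<mu>] by (simp add: S_def mult.commute)
   ultimately show ?thesis using S by (simp add: redJ_0 Gamma_def field_simps)
  qed
  ultimately show ?thesis by (simp only: tendsto_cong)
 next
  case (nat n)
  \<comment> \<open>Here n \<ge> 1 gives s^n \<le> s below 1, and |ln s| is at most 2 / sqrt s, so
    the product is O(sqrt s).\<close>
  have ln0: "((\<lambda>s::real. s powr n * ln s) \<longlongrightarrow> 0) (at_right 0)"
  proof (rule Lim_null_comparison)
   have "\<bar>s powr n * ln s\<bar> \<le> 2 * sqrt s" if "0 < s" "s < 1" for s :: real
   proof -
    have "- ln s \<le> 2 * (1 / s) powr (1 / 2)"
     using ln_powr_bound[of "1 / s" "1 / 2"] that by (simp add: ln_div)
    moreover have "(1 / s) powr (1 / 2) = 1 / sqrt s"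
     using that by (simp add: powr_half_sqrt real_sqrt_divide)
    ultimately have "\<bar>ln s\<bar> \<le> 2 / sqrt s" using that by (simp add: abs_if)
    moreover have "s powr n \<le> s" using powr_mono'[of 1 n s] that nat by simp
    ultimately have "s powr n * \<bar>ln s\<bar> \<le> s * (2 / sqrt s)" using that by (intro mult_mono) auto
    also have "... = 2 * (s / sqrt s)" by simp
    also have "... = 2 * sqrt s" using that by (simp only: real_div_sqrt less_imp_le)
    finally show ?thesis by (simp add: abs_mult)
   qed
   then show "\<forall>\<^sub>F s in at_right 0. norm (s powr real n * ln s) \<le> 2 * sqrt s"
    unfolding eventually_at_right_field by (intro exI[of _ 1]) auto
   have "((\<lambda>s::real. 2 * sqrt s) \<longlongrightarrow> 2 * sqrt 0) (at_right 0)" by (intro tendsto_intros)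
   then show "((\<lambda>s::real. 2 * sqrt s) \<longlongrightarrow> 0) (at_right 0)" by simp
  qed
  have "((\<lambda>s. ((s powr n * ln s) * redJ n s + s powr n * redJ_deriv n s + (- 1) ^ n * redJ_deriv (- real n) s) / pi) \<longlongrightarrow>
    (0 * redJ n 0 + 0 * redJ_deriv n 0 + (- 1) ^ n * redJ_deriv (- real n) 0) / pi) (at_right 0)"
   using p0 nat by (intro tendsto_intros ln0 J) auto
  moreover have "\<forall>\<^sub>F s in at_right 0. ((s powr n * ln s) * redJ n s + s powr n * redJ_deriv n s + (- 1) ^ n * redJ_deriv (- real n) s) / pi
    = s powr \<mu> * redY \<mu> s" unfolding eventually_at_filter nat
   by (intro always_eventually) (auto simp: redY_nat powr_minus field_simps)
  moreover have "(0 * redJ n 0 + 0 * redJ_deriv n 0 + (- 1) ^ n * redJ_deriv (- real n) 0) / pi = - (2 powr \<mu> * Gamma \<mu> / pi)"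
  proof -
   obtain m where m: "n = Suc m" using nat by (cases n) auto
   have "rGamma (- real m) = 0" by (simp add: rGamma_eq_zero_iff)
   moreover have "deriv rGamma (- real m) = (- 1) ^ m * fact m"
    by (rule DERIV_imp_deriv has_field_derivative_rGamma_nonpos_int)+
   moreover have "Gamma (real n) = fact m"
    using Gamma_fact[of m, where 'a = real] by (simp add: m add_ac)
   ultimately show ?thesis by (simp add: redJ_deriv_0 nat m minus_one_power_iff add.commute)
  qed
  ultimately show ?thesis by (simp only: tendsto_cong)
 qed
qed

text \<open>Both kinds obey the same derivative rule and the same recurrence, so \<open>W\<close>,
  the Wronskian multiplied by s^(\<mu> + 1), has derivative zero; its value is read off as the limit
  at s = 0.\<close>

lemma redJ_redY_wronskian:
 assumes "\<mu> > 0" "s > 0"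
 shows "redJ \<mu> s * redY (\<mu> + 1) s - redJ (\<mu> + 1) s * redY \<mu> s = - (2 / pi) * s powr (- \<mu> - 1)"
proof -
 let ?m = "(\<mu> + 1)"
 define Q where "Q = (\<lambda>s. redJ \<mu> s * redY ?m s - redJ ?m s * redY \<mu> s)"
 define W where "W = (\<lambda>s. s powr ?m * Q s)"
 have W': "(W has_real_derivative 0) (at s)" if "s > 0" for s
 proof -
  have Q': "(Q has_real_derivative - 1 / 2 * (redJ \<mu> s * redY (\<mu> + 2) s - redJ (\<mu> + 2) s * redY \<mu> s)) (at s)"
   unfolding Q_def using assms that
   by (auto intro!: derivative_eq_intros redY_has_derivative simp: algebra_simps)
  have "s * (redJ \<mu> s * redY (\<mu> + 2) s - redJ (\<mu> + 2) s * redY \<mu> s) =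
    redJ \<mu> s * (s * redY (\<mu> + 2) s) - (s * redJ (\<mu> + 2) s) * redY \<mu> s" by (simp add: algebra_simps)
  also have "... = 2 * ?m * Q s"
   unfolding redY_rec[OF assms(1) that] redJ_rec by (simp add: Q_def algebra_simps)
  finally have R: "redJ \<mu> s * redY (\<mu> + 2) s - redJ (\<mu> + 2) s * redY \<mu> s = 2 * ?m * Q s / s"
   using that by (simp add: field_simps)
  have "(W has_real_derivative ?m * s powr \<mu> * Q s
    + (- 1 / 2 * (redJ \<mu> s * redY (\<mu> + 2) s - redJ (\<mu> + 2) s * redY \<mu> s)) * s powr ?m) (at s)"
   unfolding W_def using that by (intro DERIV_mult Q') (auto intro!: derivative_eq_intros has_real_derivative_powr)
  then show ?thesis unfolding R by (rule DERIV_cong) (use that in \<open>simp add: powr_add field_simps\<close>)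
 qed
 have const: "W t = W s" if "t > 0" for t
 proof -
  have "\<exists>c. \<forall>x\<in>{0<..}. W x = c"
   by (rule has_field_derivative_zero_constant) (auto intro: has_field_derivative_at_within[OF W'])
  then show ?thesis using that assms by (metis greaterThan_iff)
 qed
 have J: "((\<lambda>s. redJ t s) \<longlongrightarrow> redJ t 0) (at_right 0)" for t
  using redJ_isCont[of 0 t] by (auto simp: isCont_def intro: tendsto_within_subset)
 \<comment> \<open>Distributing s^(\<mu> + 1) over the second product leaves a spare factor s beside
   the convergent s^\<mu> Y, so only the first product survives in the limit.\<close>
 have "((\<lambda>s. redJ \<mu> s * (s powr ?m * redY ?m s) - redJ ?m s * (s * (s powr \<mu> * redY \<mu> s))) \<longlongrightarrow>
   redJ \<mu> 0 * (- (2 powr ?m * Gamma ?m / pi)) - redJ ?m 0 * (0 * (- (2 powr \<mu> * Gamma \<mu> / pi)))) (at_right 0)"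
  using assms by (intro tendsto_intros J redY_at_0) auto
 moreover have "\<forall>\<^sub>F t in at_right 0. redJ \<mu> t * (t powr ?m * redY ?m t) - redJ ?m t * (t * (t powr \<mu> * redY \<mu> t)) = W s"
 proof -
  have "redJ \<mu> t * (t powr ?m * redY ?m t) - redJ ?m t * (t * (t powr \<mu> * redY \<mu> t)) = W s"
   if "t > 0" for t
   unfolding const[OF that, symmetric] using that by (simp add: W_def Q_def powr_add algebra_simps)
  then show ?thesis by (auto simp: eventually_at_filter)
 qed
 ultimately have "((\<lambda>_. W s) \<longlongrightarrow>
   redJ \<mu> 0 * (- (2 powr ?m * Gamma ?m / pi)) - redJ ?m 0 * (0 * (- (2 powr \<mu> * Gamma \<mu> / pi)))) (at_right (0::real))"
  by (rule Lim_transform_eventually)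
 moreover have "redJ \<mu> 0 * (- (2 powr ?m * Gamma ?m / pi)) - redJ ?m 0 * (0 * (- (2 powr \<mu> * Gamma \<mu> / pi))) = - 2 / pi"
 proof -
  have "rGamma ?m * Gamma ?m = 1"
  proof -
   have "Gamma ?m \<noteq> 0" using assms Gamma_real_pos[of "\<mu> + 1"] by linarith
   then show ?thesis unfolding rGamma_inverse_Gamma by (rule left_inverse)
  qed
  then show ?thesis by (simp add: redJ_0 powr_minus powr_add field_simps)
 qed
 ultimately have "W s = - 2 / pi"
  using tendsto_const_iff[of "at_right (0::real)" "W s" "- 2 / pi"] by simp
 then show ?thesis using assms by (simp add: W_def Q_def powr_diff powr_minus powr_add field_simps)
qed

section \<open>Polar coordinates\<close>

lemma measurable_sphere_proj:
 "(\<lambda>x::'a::euclidean_space. x /R norm x) \<in>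
   restrict_space lborel (ball 0 1 - {0}) \<rightarrow>\<^sub>M restrict_space borel (sphere 0 1)"
proof (rule measurable_restrict_space2)
 have "(\<lambda>x::'a. x /R norm x) \<in> lborel \<rightarrow>\<^sub>M borel" by measurable
 then show "(\<lambda>x::'a. x /R norm x) \<in> restrict_space lborel (ball 0 1 - {0}) \<rightarrow>\<^sub>M borel"
  by (rule measurable_restrict_space1)
qed (auto simp: space_restrict_space)

lemma space_sphere_measure [simp]: "space (sphere_measure :: 'a::euclidean_space measure) = sphere 0 1"
 by (simp add: sphere_measure_def space_scale_measure space_restrict_space)

lemma sets_sphere_measure [measurable_cong]:
 "sets (sphere_measure :: 'a::euclidean_space measure) = sets (restrict_space borel (sphere 0 1))"
 by (simp add: sphere_measure_def)

lemma measurable_sphere_measure: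
 "f \<in> borel \<rightarrow>\<^sub>M N ==> f \<in> (sphere_measure :: 'a::euclidean_space measure) \<rightarrow>\<^sub>M N"
 unfolding measurable_cong_sets[OF sets_sphere_measure refl] by (rule measurable_restrict_space1)

lemma nn_integral_sphere_measure:
 fixes f :: "'a::euclidean_space => ennreal"
 assumes [measurable]: "f \<in> borel_measurable borel"
 shows "(\<integral>\<^sup>+w. f w \<partial>sphere_measure) =
  of_nat DIM('a) * (\<integral>\<^sup>+x. f (x /R norm x) * indicator (ball 0 1 - {0}) x \<partial>lborel)"
proof -
 let ?M = "distr (restrict_space lborel (ball 0 1 - {0 :: 'a})) (restrict_space borel (sphere 0 1)) (\<lambda>x. x /R norm x)"
 have m': "f \<in> borel_measurable ?M" using measurable_restrict_space1[OF assms] by simp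
 then have "(\<integral>\<^sup>+w. f w \<partial>sphere_measure) = of_nat DIM('a) * (\<integral>\<^sup>+w. f w \<partial>?M)"
  unfolding sphere_measure_def by (rule nn_integral_scale_measure)
 also have "(\<integral>\<^sup>+w. f w \<partial>?M) = (\<integral>\<^sup>+x. f (x /R norm x) \<partial>restrict_space lborel (ball 0 1 - {0}))"
  by (rule nn_integral_distr[OF measurable_sphere_proj m'])
 also have "... = (\<integral>\<^sup>+x. f (x /R norm x) * indicator (ball 0 1 - {0}) x \<partial>lborel)"
  by (rule nn_integral_restrict_space) auto
 finally show ?thesis .
qed

lemma emeasure_sphere_measure_space:
 "emeasure (sphere_measure :: 'a::euclidean_space measure) (sphere 0 1) =
   ennreal (real DIM('a) * unit_ball_vol (real DIM('a)))"
proof -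
 have "emeasure (sphere_measure :: 'a measure) (sphere 0 1) = (\<integral>\<^sup>+w. 1 \<partial>(sphere_measure :: 'a measure))"
  by simp
 also have "... = of_nat DIM('a) * emeasure lborel (ball 0 1 - {0 :: 'a})"
  by (subst nn_integral_sphere_measure) auto
 also have "emeasure lborel (ball 0 1 - {0 :: 'a}) = emeasure lborel (ball 0 1 :: 'a set)"
  by (rule emeasure_Diff_null_set) auto
 also have "... = ennreal (unit_ball_vol (real DIM('a)))" using emeasure_ball[of 1 "0::'a"] by simp
 finally show ?thesis by (simp add: ennreal_mult ennreal_of_nat_eq_real_of_nat)
qed

lemma finite_sphere_measure: "finite_measure (sphere_measure :: 'a::euclidean_space measure)"
 by (rule finite_measureI) (simp add: emeasure_sphere_measure_space)

interpretation sphere: finite_measure "sphere_measure :: 'a::euclidean_space measure"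
 by (rule finite_sphere_measure)

text \<open>Integrates out the auxiliary scale t in the polar formula, with a = norm y.\<close>

lemma nn_integral_power_tail:
 fixes a :: real
 assumes "a > 0" "d > 0"
 shows "(\<integral>\<^sup>+t. ennreal (1 / t ^ Suc d) * indicator {a<..} t \<partial>lborel) = ennreal (1 / (real d * a ^ d))"
proof -
 have "(\<integral>\<^sup>+t. ennreal (1 / t ^ Suc d) * indicator {a<..} t \<partial>lborel) =
   (\<integral>\<^sup>+t. ennreal (1 / t ^ Suc d) * indicator {a..} t \<partial>lborel)" using AE_lborel_singleton[of a]
  by (intro nn_integral_cong_AE) (auto elim!: eventually_mono split: split_indicator)
 also have "... = ennreal (0 - (- (1 / real d) * inverse a ^ d))"
 proof (rule nn_integral_FTC_atLeast)
  show "((\<lambda>t. - (1 / real d) * inverse t ^ d) has_real_derivative 1 / t ^ Suc d) (at t)" if "a \<le> t" for t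
  proof -
   obtain e where d: "d = Suc e" using assms by (cases d) auto
   have "((\<lambda>t. - (1 / real d) * inverse t ^ d) has_real_derivative
     - (1 / real d) * (real d * (- (inverse t ^ Suc (Suc 0)) * inverse t ^ (d - Suc 0)))) (at t)"
    using that assms by (intro DERIV_cmult DERIV_power DERIV_inverse) auto
   then show ?thesis
    by (rule DERIV_cong) (use that assms in \<open>simp add: d divide_inverse power_inverse mult_ac del: of_nat_Suc\<close>)
  qed
  have "((\<lambda>t::real. - (1 / real d) * inverse t ^ d) \<longlongrightarrow> - (1 / real d) * 0 ^ d) at_top"
   by (intro tendsto_intros tendsto_inverse_0_at_top filterlim_ident)
  moreover have "- (1 / real d) * 0 ^ d = (0::real)" using assms by simp
  ultimately show "((\<lambda>t. - (1 / real d) * inverse t ^ d) \<longlongrightarrow> 0) at_top" by (simp only:)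
 qed (use assms in auto)
 finally show ?thesis by (simp add: divide_inverse power_inverse)
qed

lemma nn_integral_dilation:
 fixes f :: "'a::euclidean_space => ennreal"
 assumes [measurable]: "f \<in> borel_measurable borel" and "t > 0"
 shows "(\<integral>\<^sup>+x. f x \<partial>lborel) = ennreal (t ^ DIM('a)) * (\<integral>\<^sup>+x. f (t *R x) \<partial>lborel)"
proof -
 have "lborel = density (distr lborel borel (\<lambda>x::'a. 0 + t *R x)) (\<lambda>_. ennreal (\<bar>t\<bar> ^ DIM('a)))"
  (is "_ = ?D") using assms by (intro lborel_affine) auto
 then have "(\<integral>\<^sup>+x. f x \<partial>lborel) = (\<integral>\<^sup>+x. f x \<partial>?D)" by (rule arg_cong)
 also have "... = ennreal (t ^ DIM('a)) * (\<integral>\<^sup>+x. f (t *R x) \<partial>lborel)"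
  using assms by (simp add: nn_integral_density nn_integral_distr nn_integral_cmult)
 finally show ?thesis .
qed

text \<open>The sphere measure is itself a solid integral over the unit ball, so the right-hand side
  is a double integral in r and x. Putting r = |x| t, exchanging the integrals and then setting y =
  t x turns the integrand into f(y) |y|^d t^(-d-1) on |y| < t; the t-integral is f(y) / d and
  cancels the factor d of the sphere measure.\<close>

theorem nn_integral_polar:
 fixes f :: "'a::euclidean_space => ennreal"
 assumes f [measurable]: "f \<in> borel_measurable borel"
 shows "(\<integral>\<^sup>+x. f x \<partial>lborel) =
  (\<integral>\<^sup>+r. ennreal (r ^ (DIM('a) - 1)) * indicator {0<..} r * (\<integral>\<^sup>+w. f (r *R w) \<partial>sphere_measure) \<partial>lborel)"
proof -
 define d where "d = DIM('a)"
 have d: "d > 0" by (simp add: d_def)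
 define B where "B = ball 0 1 - {0 :: 'a}"
 have B [measurable]: "B \<in> sets borel" by (simp add: B_def)
 let ?f = "\<lambda>r x. f (r *R (x /R norm x)) * indicator B x"
 let ?k = "\<lambda>x t. ennreal (norm x ^ d * t ^ (d - 1)) * indicator {0<..} t * (f (t *R x) * indicator B x)"
 let ?h = "\<lambda>r. ennreal (r ^ (d - 1)) * indicator {0<..} r"
 let ?g = "\<lambda>(y::'a). f y * (if 0 < norm y then 1 else 0)"
 let ?e = "\<lambda>(t::real) (y::'a). ennreal (norm y ^ d * (1 / t ^ Suc d)) * (if norm y < t then 1 else 0)"
 have "(\<integral>\<^sup>+r. ?h r * (\<integral>\<^sup>+w. f (r *R w) \<partial>sphere_measure) \<partial>lborel) = (\<integral>\<^sup>+r. of_nat d * (\<integral>\<^sup>+x. ?h r *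
     (?f r x) \<partial>lborel) \<partial>lborel)"
 proof (rule nn_integral_cong)
  fix r :: real
  have "(\<integral>\<^sup>+x. ?h r * ?f r x \<partial>lborel) = (?h r) * (\<integral>\<^sup>+x. ?f r x \<partial>lborel)"
   by (rule nn_integral_cmult) measurable
  moreover have "(\<integral>\<^sup>+w. f (r *R w) \<partial>sphere_measure) = of_nat d * (\<integral>\<^sup>+x. ?f r x \<partial>lborel)"
   unfolding d_def B_def by (rule nn_integral_sphere_measure) measurable
  ultimately show "?h r * (\<integral>\<^sup>+w. f (r *R w) \<partial>sphere_measure) = of_nat d * (\<integral>\<^sup>+x. ?h r *
     (?f r x) \<partial>lborel)" by (simp only: mult_ac)
 qed
 also have "... = of_nat d * (\<integral>\<^sup>+r. (\<integral>\<^sup>+x. ?h r * (?f r x) \<partial>lborel) \<partial>lborel)"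
  by (rule nn_integral_cmult) measurable
 also have "(\<integral>\<^sup>+r. (\<integral>\<^sup>+x. ?h r * (?f r x) \<partial>lborel) \<partial>lborel) = (\<integral>\<^sup>+x. (\<integral>\<^sup>+r. ?h r *
     (?f r x) \<partial>lborel) \<partial>lborel)" by (rule lborel_pair.Fubini') measurable
 \<comment> \<open>Substitution r = norm x * t for fixed x: the point at distance r in direction x
   becomes t x.\<close>
 also have "... = (\<integral>\<^sup>+x. (\<integral>\<^sup>+t. ?k x t \<partial>lborel) \<partial>lborel)"
 proof (rule nn_integral_cong)
  fix x :: 'a
  show "(\<integral>\<^sup>+r. ?h r * (?f r x) \<partial>lborel) = (\<integral>\<^sup>+t. ?k x t \<partial>lborel)"
  proof (cases "x \<in> B")
   case True
   then have x: "norm x > 0" by (auto simp: B_def)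
   have "(\<integral>\<^sup>+r. ?h r * (?f r x) \<partial>lborel) = ennreal (norm x) * (\<integral>\<^sup>+t. ?h (norm x * t) *
     (?f (norm x * t) x) \<partial>lborel)"
    by (subst nn_integral_real_affine[of _ "norm x" 0]) (use x in auto)
   also have "... = (\<integral>\<^sup>+t. ennreal (norm x) * (?h (norm x * t) * (?f (norm x * t) x)) \<partial>lborel)"
    by (rule nn_integral_cmult[symmetric]) measurable
   also have "... = (\<integral>\<^sup>+t. ?k x t \<partial>lborel)"
   proof (rule nn_integral_cong)
    fix t :: real
    have "ennreal (norm x) * ennreal ((norm x * t) ^ (d - 1)) = ennreal (norm x ^ d * t ^ (d - 1))" if "t > 0"
    proof -
     have "norm x * (norm x * t) ^ (d - 1) = norm x ^ d * t ^ (d - 1)"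
      using d by (cases d) (auto simp: power_mult_distrib)
     then show ?thesis using that x by (simp flip: ennreal_mult)
    qed
    moreover have "norm x * t * inverse (norm x) = t" using x by (simp add: field_simps)
    then have fx: "f ((norm x * t) *R (x /R norm x)) = f (t *R x)" by (simp only: scaleR_scaleR)
    moreover have ind: "indicator {0<..} (norm x * t) = (indicator {0<..} t :: ennreal)"
     using x by (simp add: indicator_def zero_less_mult_iff)
    ultimately show "ennreal (norm x) * (?h (norm x * t) * (?f (norm x * t) x)) = (?k x t)"
     unfolding fx ind by (cases "t > 0") (simp_all add: mult.assoc[symmetric])
   qed
   finally show ?thesis .
  qed simp
 qed
 also have "... = (\<integral>\<^sup>+t. (\<integral>\<^sup>+x. ?k x t \<partial>lborel) \<partial>lborel)"
  by (rule lborel_pair.Fubini'[symmetric]) measurable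
 \<comment> \<open>Dilation y = t x for fixed t: the unit ball becomes |y| < t and the powers of t
   combine to t^(-d-1).\<close>
 also have "... = (\<integral>\<^sup>+t. (\<integral>\<^sup>+y. ?e t y * (?g y) \<partial>lborel) \<partial>lborel)"
 proof (rule nn_integral_cong)
  fix t :: real
  show "(\<integral>\<^sup>+x. ?k x t \<partial>lborel) = (\<integral>\<^sup>+y. ?e t y * (?g y) \<partial>lborel)"
  proof (cases "t > 0")
   case True
   have "(\<integral>\<^sup>+y. ?e t y * (?g y) \<partial>lborel) = ennreal (t ^ d) * (\<integral>\<^sup>+x. ?e t (t *R x) *
     (?g (t *R x)) \<partial>lborel)" unfolding d_def by (rule nn_integral_dilation[OF _ True]) measurable
   also have "... = (\<integral>\<^sup>+x. ennreal (t ^ d) * (?e t (t *R x) * (?g (t *R x))) \<partial>lborel)"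
    by (rule nn_integral_cmult[symmetric]) measurable
   also have "... = (\<integral>\<^sup>+x. ?k x t \<partial>lborel)"
   proof (rule nn_integral_cong)
    fix x :: 'a
    have "ennreal (t ^ d) * ennreal (norm (t *R x) ^ d * (1 / t ^ Suc d)) = ennreal (norm x ^ d * t ^ (d - 1))"
    proof -
     have "t ^ d * (norm (t *R x) ^ d * (1 / t ^ Suc d)) = norm x ^ d * t ^ (d - 1)"
      using d True by (cases d) (auto simp: power_mult_distrib field_simps)
     then show ?thesis using True by (simp flip: ennreal_mult)
    qed
    then show "ennreal (t ^ d) * (?e t (t *R x) * (?g (t *R x))) = (?k x t)"
     using True by (simp add: mult.assoc[symmetric] indicator_def B_def)
   qed
   finally show ?thesis by simp
  next
   case False
   then have "norm y \<ge> t" for y :: 'a by (meson norm_ge_zero linorder_not_less order_trans)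
   then show ?thesis using False by (simp add: indicator_def leD)
  qed
 qed
 also have "... = (\<integral>\<^sup>+y. (\<integral>\<^sup>+t. ?e t y * (?g y) \<partial>lborel) \<partial>lborel)"
  by (rule lborel_pair.Fubini') measurable
 also have "... = (\<integral>\<^sup>+y. ennreal (1 / real d) * ?g y \<partial>lborel)"
 proof (rule nn_integral_cong)
  fix y :: 'a
  show "(\<integral>\<^sup>+t. ?e t y * (?g y) \<partial>lborel) = ennreal (1 / real d) * ?g y"
  proof (cases "y = 0")
   case False
   have "(\<integral>\<^sup>+t. ?e t y * (?g y) \<partial>lborel) = (\<integral>\<^sup>+t. (ennreal (norm y ^ d) * ?g y) *
      (ennreal (1 / t ^ Suc d) * indicator {norm y<..} t) \<partial>lborel)"
   proof -
    have "ennreal (norm y ^ d * (1 / t ^ Suc d)) = ennreal (norm y ^ d) * ennreal (1 / t ^ Suc d)" for t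
     by (rule ennreal_mult') simp
    moreover have "indicator {norm y<..} t = (if norm y < t then 1 else 0 :: ennreal)" for t
     by (simp add: indicator_def)
    ultimately show ?thesis by (intro nn_integral_cong) (simp only: mult_ac)
   qed
   also have "... = (ennreal (norm y ^ d) * ?g y) * ennreal (1 / (real d * norm y ^ d))"
    by (subst nn_integral_cmult) (use False d nn_integral_power_tail[of "norm y" d] in auto)
   also have "... = (ennreal (norm y ^ d) * ennreal (1 / (real d * norm y ^ d))) * ?g y"
    by (simp add: mult_ac)
   also have "ennreal (norm y ^ d) * ennreal (1 / (real d * norm y ^ d)) = ennreal (1 / real d)"
    using False by (simp flip: ennreal_mult)
   finally show ?thesis .
  qed simp
 qed
 also have "... = ennreal (1 / real d) * (\<integral>\<^sup>+y. ?g y \<partial>lborel)"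
  by (rule nn_integral_cmult) measurable
 \<comment> \<open>The restriction to nonzero vectors has dropped the origin, a null set.\<close>
 also have "(\<integral>\<^sup>+y. ?g y \<partial>lborel) = (\<integral>\<^sup>+y. f y \<partial>lborel)"
 proof (rule nn_integral_cong_AE)
  show "AE y in lborel. ?g y = f y"
   using AE_lborel_singleton[of "0 :: 'a"] by (rule eventually_mono) simp
 qed
 also have "of_nat d * (ennreal (1 / real d) * (\<integral>\<^sup>+y. f y \<partial>lborel)) = (\<integral>\<^sup>+y. f y \<partial>lborel)"
  using d by (simp add: mult.assoc[symmetric] ennreal_of_nat_eq_real_of_nat flip: ennreal_mult)
 finally show ?thesis by (simp add: d_def)
qed

text \<open>Packaging r^(d-1) dr as a measure lets the theory of product measures carry out the
  iterated integration.\<close>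

definition radial_measure :: "'a::euclidean_space itself => real measure" where
 "radial_measure _ = density lborel (\<lambda>r. ennreal (r ^ (DIM('a) - 1) * indicator {0<..} r))"

lemma sets_radial_measure [measurable_cong]: "sets (radial_measure TYPE('a::euclidean_space)) = sets borel"
 by (simp add: radial_measure_def)

lemma sigma_finite_radial_measure: "sigma_finite_measure (radial_measure TYPE('a::euclidean_space))"
 unfolding radial_measure_def
 by (subst sigma_finite_measure.sigma_finite_iff_density_finite[OF sigma_finite_lborel]) auto

lemma nn_integral_radial_measure:
 assumes [measurable]: "g \<in> borel_measurable borel"
 shows "(\<integral>\<^sup>+r. g r \<partial>radial_measure TYPE('a::euclidean_space)) =
  (\<integral>\<^sup>+r. ennreal (r ^ (DIM('a) - 1)) * indicator {0<..} r * g r \<partial>lborel)"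
 unfolding radial_measure_def
 by (subst nn_integral_density) (auto intro!: nn_integral_cong split: split_indicator)

lemma measurable_id_sphere_measure [measurable]: "(\<lambda>x. x) \<in> (sphere_measure :: 'a::euclidean_space measure) \<rightarrow>\<^sub>M borel"
 by (rule measurable_sphere_measure) simp

interpretation radial_sphere: pair_sigma_finite "radial_measure TYPE('a::euclidean_space)" "sphere_measure :: 'a measure"
 by (intro pair_sigma_finite.intro sigma_finite_radial_measure) (rule sphere.sigma_finite_measure_axioms)

lemma measurable_polar_map:
 "(\<lambda>p. fst p *R snd p) \<in> radial_measure TYPE('a) \<Otimes>\<^sub>M sphere_measure \<rightarrow>\<^sub>M (borel :: 'a::euclidean_space measure)"
proof (rule borel_measurable_scaleR)
 show "fst \<in> borel_measurable (radial_measure TYPE('a) \<Otimes>\<^sub>M (sphere_measure :: 'a measure))"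
  using measurable_fst by (simp add: measurable_cong_sets[OF refl sets_radial_measure])
 show "snd \<in> borel_measurable (radial_measure TYPE('a) \<Otimes>\<^sub>M (sphere_measure :: 'a measure))"
  using measurable_compose[OF measurable_snd measurable_id_sphere_measure] by simp
qed

lemma nn_integral_polar_pair:
 fixes f :: "'a::euclidean_space => ennreal"
 assumes f: "f \<in> borel_measurable borel"
 shows "(\<integral>\<^sup>+x. f x \<partial>lborel) = (\<integral>\<^sup>+p. f (fst p *R snd p) \<partial>(radial_measure TYPE('a) \<Otimes>\<^sub>M sphere_measure))"
proof -
 have m: "(\<lambda>p. f (fst p *R snd p)) \<in> borel_measurable (radial_measure TYPE('a) \<Otimes>\<^sub>M sphere_measure)"
  by (rule measurable_compose[OF measurable_polar_map f])
 have "(\<lambda>r. \<integral>\<^sup>+w. f (r *R w) \<partial>sphere_measure) \<in> borel_measurable (radial_measure TYPE('a))"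
  using m by (intro sphere.borel_measurable_nn_integral) (simp add: case_prod_unfold)
 then have m': "(\<lambda>r. \<integral>\<^sup>+w. f (r *R w) \<partial>sphere_measure) \<in> borel_measurable borel"
  by (simp add: measurable_cong_sets[OF sets_radial_measure refl])
 have "(\<integral>\<^sup>+x. f x \<partial>lborel) = (\<integral>\<^sup>+r. (\<integral>\<^sup>+w. f (r *R w) \<partial>sphere_measure) \<partial>radial_measure TYPE('a))"
  unfolding nn_integral_polar[OF f] nn_integral_radial_measure[OF m'] ..
 also have "... = (\<integral>\<^sup>+p. f (fst p *R snd p) \<partial>(radial_measure TYPE('a) \<Otimes>\<^sub>M sphere_measure))"
  using sphere.nn_integral_fst[OF m] by simp
 finally show ?thesis .
qed

text \<open>An equality of measures, so that integrability and integrals of vector-valued functions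
  pass to the product measure as well, where Fubini applies.\<close>

lemma lborel_eq_polar:
 "(lborel :: 'a::euclidean_space measure) =
   distr (radial_measure TYPE('a) \<Otimes>\<^sub>M sphere_measure) borel (\<lambda>p. fst p *R snd p)"
proof (rule measure_eqI)
 fix A :: "'a set"
 assume "A \<in> sets lborel"
 then have A: "indicator A \<in> borel_measurable borel" "A \<in> sets borel" by simp_all
 have "emeasure lborel A = (\<integral>\<^sup>+x. indicator A x \<partial>lborel)" using A by simp
 also have "... = (\<integral>\<^sup>+x. indicator A x \<partial>distr (radial_measure TYPE('a) \<Otimes>\<^sub>M sphere_measure) borel (\<lambda>p. fst p *R snd p))"
  unfolding nn_integral_polar_pair[OF A(1)]
  by (rule nn_integral_distr[OF measurable_polar_map, symmetric]) (use A in simp)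
 also have "... = emeasure (distr (radial_measure TYPE('a) \<Otimes>\<^sub>M sphere_measure) borel (\<lambda>p. fst p *R snd p)) A"
  using A by simp
 finally show "emeasure lborel A = ..." .
qed simp

theorem integral_polar:
 fixes f :: "'a::euclidean_space => 'b::{banach, second_countable_topology}"
 assumes f: "integrable lborel f"
 shows "integrable lborel (\<lambda>r. (r ^ (DIM('a) - 1) * indicator {0<..} r) *R (SPH w. f (r *R w)))"
  and "(LBINT x. f x) = (LBINT r. (r ^ (DIM('a) - 1) * indicator {0<..} r) *R (SPH w. f (r *R w)))"
proof -
 let ?D = "distr (radial_measure TYPE('a) \<Otimes>\<^sub>M sphere_measure) (borel :: 'a measure) (\<lambda>p. fst p *R snd p)"
 have m: "f \<in> borel_measurable borel" using f by simp
 have "integrable ?D f" using f lborel_eq_polar by metis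
 then have int: "integrable (radial_measure TYPE('a) \<Otimes>\<^sub>M sphere_measure) (\<lambda>p. f (fst p *R snd p))"
  by (rule integrable_distr[OF measurable_polar_map])
 have ir: "integrable (radial_measure TYPE('a)) (\<lambda>r. (SPH w. f (r *R w)))"
  using radial_sphere.integrable_fst'[OF int] by simp
 then have mr: "(\<lambda>r. (SPH w. f (r *R w))) \<in> borel_measurable borel"
  using borel_measurable_integrable measurable_cong_sets[OF sets_radial_measure refl] by blast
 have "(LBINT x. f x) = (LINT x|?D. f x)" by (rule arg_cong[OF lborel_eq_polar])
 also have "... = (LINT p|(radial_measure TYPE('a) \<Otimes>\<^sub>M sphere_measure). f (fst p *R snd p))"
  by (rule integral_distr[OF measurable_polar_map m])
 also have "... = (LINT r|radial_measure TYPE('a). (SPH w. f (r *R w)))"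
  using radial_sphere.integral_fst'[OF int] by simp
 also have "... = (LBINT r. (r ^ (DIM('a) - 1) * indicator {0<..} r) *R (SPH w. f (r *R w)))"
  unfolding radial_measure_def
  by (rule integral_density) (use mr in \<open>auto intro!: AE_I2 split: split_indicator\<close>)
 finally show "(LBINT x. f x) = ..." .
 show "integrable lborel (\<lambda>r. (r ^ (DIM('a) - 1) * indicator {0<..} r) *R (SPH w. f (r *R w)))"
  using ir unfolding radial_measure_def
  by (subst (asm) integrable_density) (use mr in \<open>auto intro!: AE_I2 split: split_indicator\<close>)
qed

lemma continuous_sphere_integrable:
 fixes f :: "'a::euclidean_space => 'b::{banach, second_countable_topology}"
 assumes "continuous_on (sphere 0 1) f"
 shows "integrable sphere_measure f"
proof -
 have m: "f \<in> borel_measurable sphere_measure"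
  unfolding measurable_cong_sets[OF sets_sphere_measure refl]
  by (rule borel_measurable_continuous_on_restrict[OF assms])
 obtain B where "\<And>w. w \<in> sphere 0 1 ==> norm (f w) \<le> B"
  using compact_imp_bounded[OF compact_continuous_image[OF assms compact_sphere]]
  unfolding bounded_iff by blast
 then show ?thesis by (intro sphere.integrable_const_bound[of _ B] m AE_I2) auto
qed

lemma measure_sphere_measure:
 "measure (sphere_measure :: 'a::euclidean_space measure) (sphere 0 1) = real DIM('a) * unit_ball_vol (real DIM('a))"
 by (simp add: measure_def emeasure_sphere_measure_space)

section \<open>Smooth functions and integration by parts\<close>

definition pdir :: "'a => ('a::euclidean_space => complex) => 'a => complex" where
 "pdir b f x = frechet_derivative f (at x) b"

lemma pdir_eq: "(f has_derivative f') (at x) ==> pdir b f x = f' b"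
 unfolding pdir_def by (metis frechet_derivative_at)

lemma laplacian_pdir: "laplacian f x = (\<Sum>b\<in>Basis. pdir b (pdir b f) x)"
 by (simp add: laplacian_def pdir_def[abs_def])

lemma C_k_SucI:
 assumes "\<And>x. (f has_derivative f' x) (at x)" and "\<And>b. b \<in> Basis ==> C_k n (\<lambda>x. f' x b)"
 shows "C_k (Suc n) f"
proof -
 have "(\<lambda>x. frechet_derivative f (at x) b) = (\<lambda>x. f' x b)" for b
  using assms(1) by (metis frechet_derivative_at)
 then show ?thesis using assms by (auto simp: differentiable_def)
qed

lemma C_k_SucD:
 assumes "C_k (Suc n) f"
 shows "f differentiable at x" "(f has_derivative (\<lambda>b. pdir b f x)) (at x)"
  and "b \<in> Basis ==> C_k n (pdir b f)"
proof -
 show "f differentiable at x" using assms by simp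
 then show "(f has_derivative (\<lambda>b. pdir b f x)) (at x)"
  unfolding pdir_def using frechet_derivative_works by metis
 show "b \<in> Basis ==> C_k n (pdir b f)" using assms by (simp add: pdir_def[abs_def])
qed

declare C_k.simps(2) [simp del]

lemma C_k_continuous: "C_k n f ==> continuous_on S f"
proof (cases n)
 case (Suc m)
 moreover assume "C_k n f"
 ultimately have "f differentiable at x" for x using C_k_SucD(1) by blast
 then show ?thesis
  by (simp add: differentiable_imp_continuous_on differentiable_at_imp_differentiable_on)
qed (auto intro: continuous_on_subset)

lemma C_k_Suc_imp: "C_k (Suc n) f ==> C_k n f"
proof (induction n arbitrary: f)
 case 0
 then show ?case using C_k_continuous[of "Suc 0" f UNIV] by simp
next
 case (Suc n)
 then show ?case unfolding C_k.simps(2)[of "Suc n"] C_k.simps(2)[of n] by blast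
qed

lemma C_k_const: "C_k n (\<lambda>x. c)"
proof (induction n arbitrary: c)
 case (Suc n)
 then show ?case by (intro C_k_SucI[where f' = "\<lambda>x h. 0"]) auto
qed simp

lemma C_k_add: "C_k n f ==> C_k n g ==> C_k n (\<lambda>x. f x + g x)"
proof (induction n arbitrary: f g)
 case 0
 then show ?case by (simp add: continuous_intros)
next
 case (Suc n)
 show ?case by (rule C_k_SucI[OF has_derivative_add[OF C_k_SucD(2) C_k_SucD(2)]])
    (use Suc in \<open>auto intro: C_k_SucD\<close>)
qed

lemma C_k_mult: "C_k n f ==> C_k n g ==> C_k n (\<lambda>x. f x * g x)"
proof (induction n arbitrary: f g)
 case 0
 then show ?case by (simp add: continuous_intros)
next
 case (Suc n)
 show ?case
 proof (rule C_k_SucI[OF has_derivative_mult[OF C_k_SucD(2) C_k_SucD(2)]])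
  show "C_k n (\<lambda>x. f x * pdir b g x + pdir b f x * g x)" if "b \<in> Basis" for b
   using Suc that by (intro C_k_add Suc.IH) (auto intro: C_k_SucD C_k_Suc_imp)
 qed (use Suc in auto)
qed

lemma C_k_cmult: "C_k n f ==> C_k n (\<lambda>x. c * f x)" by (intro C_k_mult C_k_const)

lemma C_k_sum: "(\<And>i. i \<in> I ==> C_k n (f i)) ==> C_k n (\<lambda>x. \<Sum>i\<in>I. f i x)"
proof (induction I rule: infinite_finite_induct)
 case (insert i I)
 then show ?case by (simp add: C_k_add)
qed (simp_all add: C_k_const)

lemma C_k_power: "C_k n f ==> C_k n (\<lambda>x. f x ^ m)" by (induction m) (simp_all add: C_k_const C_k_mult)

lemma C_k_bounded_linear: "bounded_linear f ==> C_k n f"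
proof (cases n)
 case 0
 assume "bounded_linear f"
 then show ?thesis using 0 by (simp add: linear_continuous_on)
next
 case (Suc m)
 assume "bounded_linear f"
 then show ?thesis
  unfolding Suc by (intro C_k_SucI[where f' = "\<lambda>x. f"] bounded_linear_imp_has_derivative C_k_const)
qed

lemma C_k_inner: "C_k n (\<lambda>x. cx (x \<bullet> a))"
 by (intro C_k_bounded_linear bounded_linear_compose[OF bounded_linear_of_real bounded_linear_inner_left])

lemma C_k_inner_self: "C_k n (\<lambda>x::'a::euclidean_space. cx (sq x))"
proof -
 have "(\<lambda>x::'a. cx (sq x)) = (\<lambda>x. \<Sum>b\<in>Basis. cx (x \<bullet> b) ^ 2)"
  by (subst euclidean_inner) (simp add: power2_eq_square)
 then show ?thesis by (simp add: C_k_sum C_k_power C_k_inner)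
qed

lemma C_k_real_polynomial: "real_polynomial_function p ==> C_k n (\<lambda>x. cx (p x))"
proof (induction rule: real_polynomial_function.induct)
 case (linear f)
 then show ?case by (intro C_k_bounded_linear bounded_linear_compose[OF bounded_linear_of_real])
qed (simp_all add: C_k_const C_k_add C_k_mult)

lemma complex_polynomial_function_parts:
 fixes p :: "'a::euclidean_space => complex"
 assumes "polynomial_function p"
 shows "real_polynomial_function (\<lambda>x. Re (p x))" "real_polynomial_function (\<lambda>x. Im (p x))"
 using assms bounded_linear_Re bounded_linear_Im unfolding polynomial_function_def o_def by auto

lemma C_k_polynomial:
 fixes p :: "'a::euclidean_space => complex"
 assumes "polynomial_function p"
 shows "C_k n p"
proof -
 have "C_k n (\<lambda>x. cx (Re (p x)) + \<i> * cx (Im (p x)))"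
  using complex_polynomial_function_parts[OF assms] by (intro C_k_add C_k_cmult C_k_real_polynomial)
 then show ?thesis by (simp add: complex_eq[symmetric])
qed

lemma has_derivative_of_real_inner_self:
 "((\<lambda>y. sq y) has_derivative (\<lambda>h. 2 * (x \<bullet> h))) (at (x::'a::euclidean_space))"
 by (auto intro!: derivative_eq_intros simp: inner_commute)

lemma has_derivative_radial:
 fixes F :: "real => complex" and x :: "'a::euclidean_space"
 assumes "(F has_vector_derivative F') (at (sq x))"
 shows "((\<lambda>y. F (sq y)) has_derivative (\<lambda>h. cx (2 * (x \<bullet> h)) * F')) (at x)"
proof -
 have "((\<lambda>y. F (sq y)) has_derivative (\<lambda>h. (2 * (x \<bullet> h)) *R F')) (at x)"
  using has_derivative_compose[OF has_derivative_of_real_inner_self assms[unfolded has_vector_derivative_def]] .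
 then show ?thesis by (simp add: scaleR_conv_of_real)
qed

text \<open>A full chain of derivatives \<open>F m\<close> makes the class of profiles closed under
  differentiation: a partial derivative multiplies by a coordinate and moves from m to m +
  1.\<close>

lemma C_k_radial:
 fixes F :: "nat => real => complex"
 assumes "\<And>m t. t \<ge> 0 ==> (F m has_vector_derivative F (Suc m) t) (at t)"
 shows "C_k n (\<lambda>x::'a::euclidean_space. F m (sq x))"
proof (induction n arbitrary: m)
 case 0
 have "(\<lambda>x::'a. F m (sq x)) differentiable at x" for x
  using has_derivative_radial[OF assms] by (auto simp: differentiable_def)
 then show ?case by (simp add: continuous_at_imp_continuous_on differentiable_imp_continuous_within)
next
 case (Suc n)
 show ?case by (rule C_k_SucI[OF has_derivative_radial[OF assms]])
    (auto intro!: C_k_mult C_k_cmult Suc C_k_inner)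
qed

text \<open>Meant for profiles singular at 0. The factor h vanishes near the origin and so do its
  derivatives; the induction therefore runs over all such h at once, which keeps the product rule
  inside the class.\<close>

lemma C_k_radial_cutoff:
 fixes F :: "nat => real => complex" and h :: "'a::euclidean_space => complex"
 assumes F: "\<And>m t. t > 0 ==> (F m has_vector_derivative F (Suc m) t) (at t)"
  and "\<And>n. C_k n h" and "\<And>x. sq x < a ==> h x = 0" and "a > 0"
 shows "C_k n (\<lambda>x. h x * F m (sq x))"
proof -
 define D where "D = (\<lambda>h m (x::'a) v. h x * (cx (2 * (x \<bullet> v)) * F (Suc m) (sq x)) + pdir v h x * F m (sq x))"
 have op: "open {x::'a. sq x < a}" by (intro open_Collect_less continuous_intros)
 have zero: "pdir v h x = 0" if "\<And>x. sq x < a ==> h x = 0" "sq x < a" for v x and h :: "'a => complex"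
 proof -
  have "(h has_derivative (\<lambda>_. 0)) (at x)"
   by (rule has_derivative_transform_within_open[OF has_derivative_const op]) (use that in auto)
  then show ?thesis by (simp add: pdir_eq)
 qed
 have deriv: "((\<lambda>x. h x * F m (sq x)) has_derivative D h m x) (at x)"
  if h: "\<And>n. C_k n h" "\<And>x. sq x < a ==> h x = 0" for h m and x :: 'a
 proof (cases "sq x < a")
  case True
  have "((\<lambda>x. h x * F m (sq x)) has_derivative (\<lambda>_. 0)) (at x)"
   by (rule has_derivative_transform_within_open[OF has_derivative_const op]) (use that True in auto)
  moreover have "D h m x = (\<lambda>_. 0)" using h True zero by (auto simp: D_def)
  ultimately show ?thesis by simp
 next
  case False
  then have "sq x > 0" using \<open>a > 0\<close> by linarith
  show ?thesis unfolding D_def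
   by (rule has_derivative_mult[OF C_k_SucD(2)[OF h(1)[of "Suc 0"]] has_derivative_radial[OF F[OF \<open>x \<bullet> x > 0\<close>]]])
 qed
 show ?thesis using assms(2,3)
 proof (induction n arbitrary: h m)
  case 0
  then show ?case
   using has_derivative_continuous[OF deriv[OF 0]] by (auto intro!: continuous_at_imp_continuous_on)
 next
  case (Suc n)
  show ?case
  proof (rule C_k_SucI[OF deriv[OF Suc.prems]])
   fix b :: 'a
   assume b: "b \<in> Basis"
   have "C_k n (\<lambda>x. (cx (2 * (x \<bullet> b)) * h x) * F (Suc m) (sq x))"
    using Suc.prems by (intro Suc.IH) (auto intro!: C_k_mult C_k_cmult C_k_inner)
   moreover have "C_k n (\<lambda>x. pdir b h x * F m (sq x))"
    using Suc.prems b zero by (intro Suc.IH) (auto intro: C_k_SucD)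
   ultimately have "C_k n (\<lambda>x. (cx (2 * (x \<bullet> b)) * h x) * F (Suc m) (sq x) + pdir b h x * F m (sq x))"
    by (rule C_k_add)
   then show "C_k n (\<lambda>x. D h m x b)" by (simp add: D_def mult_ac)
  qed
 qed
qed

section \<open>Rules for the Laplacian\<close>

lemma pdir_mult:
 assumes "f differentiable at x" "g differentiable at x"
 shows "pdir b (\<lambda>x. f x * g x) x = f x * pdir b g x + pdir b f x * g x"
proof -
 obtain f' g' where "(f has_derivative f') (at x)" "(g has_derivative g') (at x)"
  using assms by (auto simp: differentiable_def)
 from pdir_eq[OF this(1)] pdir_eq[OF this(2)] pdir_eq[OF has_derivative_mult[OF this]]
 show ?thesis by simp
qed

lemma pdir_add:
 assumes "f differentiable at x" "g differentiable at x"
 shows "pdir b (\<lambda>x. f x + g x) x = pdir b f x + pdir b g x"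
proof -
 obtain f' g' where "(f has_derivative f') (at x)" "(g has_derivative g') (at x)"
  using assms by (auto simp: differentiable_def)
 from pdir_eq[OF this(1)] pdir_eq[OF this(2)] pdir_eq[OF has_derivative_add[OF this]]
 show ?thesis by simp
qed

lemma pdir_const: "pdir b (\<lambda>x. c) x = 0" by (rule pdir_eq) simp

lemma pdir_cmult:
 "f differentiable at x ==> pdir b (\<lambda>x. c * f x) x = c * pdir b f x"
 by (simp add: pdir_mult pdir_const)

lemma pdir_cong_open:
 assumes "open S" "x \<in> S" "\<And>y. y \<in> S ==> f y = g y"
 shows "pdir b f x = pdir b g x"
proof -
 have "(f has_derivative f') (at x) = (g has_derivative f') (at x)" for f'
  using assms by (metis has_derivative_transform_within_open)
 then show ?thesis by (simp add: pdir_def frechet_derivative_def)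
qed

lemma laplacian_mult:
 assumes "C_k 2 f" "C_k 2 g"
 shows "laplacian (\<lambda>x. f x * g x) x = f x * laplacian g x + laplacian f x * g x
   + 2 * (\<Sum>b\<in>Basis. pdir b f x * pdir b g x)"
proof -
 have df: "f differentiable at x" "g differentiable at x" for x
  using assms C_k_SucD(1) unfolding numeral_2_eq_2 by blast+
 have df': "pdir b f differentiable at x" "pdir b g differentiable at x" if "b \<in> Basis" for b x
  using assms C_k_SucD that unfolding numeral_2_eq_2 by blast+
 have "pdir b (pdir b (\<lambda>x. f x * g x)) x =
   f x * pdir b (pdir b g) x + pdir b (pdir b f) x * g x + 2 * (pdir b f x * pdir b g x)"
  if b: "b \<in> Basis" for b
 proof -
  have "pdir b (\<lambda>x. f x * g x) = (\<lambda>x. f x * pdir b g x + pdir b f x * g x)"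
   using df by (auto simp: pdir_mult)
  then show ?thesis using df df'[OF b] by (simp add: pdir_add pdir_mult differentiable_mult)
 qed
 then show ?thesis by (simp add: laplacian_pdir sum.distrib sum_distrib_left sum_distrib_right)
qed

lemma laplacian_add:
 assumes "C_k 2 f" "C_k 2 g"
 shows "laplacian (\<lambda>x. f x + g x) x = laplacian f x + laplacian g x"
proof -
 have df: "f differentiable at x" "g differentiable at x" for x
  using assms C_k_SucD(1) unfolding numeral_2_eq_2 by blast+
 have df': "pdir b f differentiable at x" "pdir b g differentiable at x" if "b \<in> Basis" for b x
  using assms C_k_SucD that unfolding numeral_2_eq_2 by blast+
 have "pdir b (\<lambda>x. f x + g x) = (\<lambda>x. pdir b f x + pdir b g x)" for b
  using df by (auto simp: pdir_add)
 then show ?thesis using df' by (simp add: laplacian_pdir pdir_add sum.distrib)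
qed

lemma laplacian_const: "laplacian (\<lambda>x. c) x = 0"
 by (simp add: laplacian_pdir pdir_const[abs_def] pdir_const)

lemma laplacian_cmult: "C_k 2 f ==> laplacian (\<lambda>x. c * f x) x = c * laplacian f x"
 by (subst laplacian_mult) (simp_all add: C_k_const laplacian_const pdir_const)

lemma laplacian_sum:
 assumes "\<And>i. i \<in> I ==> C_k 2 (f i)"
 shows "laplacian (\<lambda>x. \<Sum>i\<in>I. f i x) x = (\<Sum>i\<in>I. laplacian (f i) x)" using assms
proof (induction I rule: infinite_finite_induct)
 case (insert i I)
 then show ?case by (simp add: laplacian_add C_k_sum)
qed (simp_all add: laplacian_const)

lemma euler_homogeneous:
 assumes "\<And>t x. p (t *R x) = cx (t ^ l) * p x" "p differentiable at x"
 shows "(\<Sum>b\<in>Basis. cx (x \<bullet> b) * pdir b p x) = of_nat l * p x"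
proof -
 obtain p' where p': "(p has_derivative p') (at x)" using assms(2) by (auto simp: differentiable_def)
 have lin: "linear p'" using has_derivative_linear[OF p'] .
 have "((\<lambda>t. p (t *R x)) has_derivative (\<lambda>h. p' (h *R x))) (at 1)"
  by (rule has_derivative_compose[of "\<lambda>t. t *R x" "\<lambda>h. h *R x" 1 UNIV p p'])
    (use p' in \<open>auto intro!: derivative_eq_intros\<close>)
 moreover have "((\<lambda>t. cx (t ^ l) * p x) has_derivative (\<lambda>h. cx (of_nat l * h) * p x)) (at 1)"
  by (auto intro!: derivative_eq_intros simp: mult_ac)
 ultimately have "p' (1 *R x) = cx (of_nat l * 1) * p x"
  unfolding assms(1) by (metis has_derivative_unique)
 moreover have "p' x = (\<Sum>b\<in>Basis. cx (x \<bullet> b) * p' b)"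
  by (subst euclidean_representation[of x, symmetric])
    (simp add: linear_sum[OF lin] linear_scale[OF lin] scaleR_conv_of_real)
 ultimately show ?thesis by (simp add: pdir_eq[OF p'])
qed

text \<open>Euler's identity for the homogeneous factor turns the mixed term into 4 l F' p; in
  effect the degree l raises the dimension from d to d + 2 l in the radial operator.\<close>

lemma laplacian_radial_mult:
 fixes p :: "'a::euclidean_space => complex"
 assumes S: "open S" "sq x \<in> S"
  and F: "\<And>t. t \<in> S ==> (F has_vector_derivative F' t) (at t)"
   "\<And>t. t \<in> S ==> (F' has_vector_derivative F'' t) (at t)"
  and p: "C_k 2 p" "\<And>t x. p (t *R x) = cx (t ^ l) * p x"
 shows "laplacian (\<lambda>x. F (sq x) * p x) x =
  (4 * cx (sq x) * F'' (sq x) + cx (2 * real DIM('a) + 4 * real l) * F' (sq x)) * p x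
  + F (sq x) * laplacian p x"
proof -
 let ?U = "{y::'a. sq y \<in> S}"
 have U: "open ?U" using S(1) by (intro open_vimage[of S "\<lambda>y. sq y", unfolded vimage_def] continuous_intros)
 have x: "x \<in> ?U" using S by simp
 have dp: "p differentiable at y" for y using p(1) C_k_SucD(1) unfolding numeral_2_eq_2 by blast
 have rF: "((\<lambda>y. F (sq y)) has_derivative (\<lambda>h. cx (2 * (y \<bullet> h)) * F' (sq y))) (at y)" if "y \<in> ?U" for y :: 'a
  using has_derivative_radial F(1) that by blast
 have rF': "((\<lambda>y. F' (sq y)) has_derivative (\<lambda>h. cx (2 * (y \<bullet> h)) * F'' (sq y))) (at y)" if "y \<in> ?U" for y :: 'a
  using has_derivative_radial F(2) that by blast
 have "pdir b (pdir b (\<lambda>x. F (sq x) * p x)) x =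
   (4 * cx ((x \<bullet> b)\<^sup>2) * F'' (sq x) + 2 * F' (sq x)) * p x
   + 4 * F' (sq x) * (cx (x \<bullet> b) * pdir b p x) + F (sq x) * pdir b (pdir b p) x"
  if b: "b \<in> Basis" for b
 proof -
  have D: "((\<lambda>y. F (sq y) * pdir b p y + (cx (2 * (y \<bullet> b)) * F' (sq y)) * p y) has_derivative
    (\<lambda>v. (F (sq x) * pdir v (pdir b p) x + (cx (2 * (x \<bullet> v)) * F' (sq x)) * pdir b p x)
    + ((cx (2 * (x \<bullet> b)) * F' (sq x)) * pdir v p x
      + (cx (2 * (x \<bullet> b)) * (cx (2 * (x \<bullet> v)) * F'' (sq x)) + cx (2 * (v \<bullet> b)) * F' (sq x)) * p x))) (at x)"
    by (intro has_derivative_add has_derivative_mult rF[OF x] rF'[OF x])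
      (use p(1) b in \<open>auto intro!: derivative_eq_intros intro: C_k_SucD simp: numeral_2_eq_2\<close>)
  have "pdir b (\<lambda>x. F (sq x) * p x) y =
    F (sq y) * pdir b p y + (cx (2 * (y \<bullet> b)) * F' (sq y)) * p y" if "y \<in> ?U" for y
   using rF[OF that] dp[of y] by (subst pdir_mult) (auto simp: pdir_eq differentiable_def)
  then have "pdir b (pdir b (\<lambda>x. F (sq x) * p x)) x =
    pdir b (\<lambda>y. F (sq y) * pdir b p y + (cx (2 * (y \<bullet> b)) * F' (sq y)) * p y) x"
   by (rule pdir_cong_open[OF U x])
  also have "... = (F (sq x) * pdir b (pdir b p) x + (cx (2 * (x \<bullet> b)) * F' (sq x)) * pdir b p x)
    + ((cx (2 * (x \<bullet> b)) * F' (sq x)) * pdir b p x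
      + (cx (2 * (x \<bullet> b)) * (cx (2 * (x \<bullet> b)) * F'' (sq x)) + cx (2 * (sq b)) * F' (sq x)) * p x)"
   by (rule pdir_eq[OF D])
  finally show ?thesis using b by (simp add: power2_eq_square algebra_simps)
 qed
 then have "laplacian (\<lambda>x. F (sq x) * p x) x =
   (\<Sum>b\<in>Basis. (4 * cx ((x \<bullet> b)\<^sup>2) * F'' (sq x) + 2 * F' (sq x)) * p x
   + 4 * F' (sq x) * (cx (x \<bullet> b) * pdir b p x) + F (sq x) * pdir b (pdir b p) x)"
  by (simp add: laplacian_pdir)
 also have "... = (4 * cx (\<Sum>b\<in>Basis. (x \<bullet> b)\<^sup>2) * F'' (sq x) + 2 * of_nat DIM('a) * F' (sq x)) * p x
   + 4 * F' (sq x) * (\<Sum>b\<in>Basis. cx (x \<bullet> b) * pdir b p x) + F (sq x) * laplacian p x"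
  by (simp add: sum.distrib laplacian_pdir sum_distrib_left sum_distrib_right algebra_simps)
 also have "(\<Sum>b\<in>Basis. (x \<bullet> b)\<^sup>2) = sq x"
  by (subst euclidean_inner[of x x]) (simp add: power2_eq_square)
 also have "(\<Sum>b\<in>Basis. cx (x \<bullet> b) * pdir b p x) = of_nat l * p x"
  by (rule euler_homogeneous[OF p(2) dp])
 finally show ?thesis by (simp add: algebra_simps)
qed

lemma pdir_diff:
 assumes "f differentiable at x" "g differentiable at x"
 shows "pdir b (\<lambda>x. f x - g x) x = pdir b f x - pdir b g x"
proof -
 obtain f' g' where "(f has_derivative f') (at x)" "(g has_derivative g') (at x)"
  using assms by (auto simp: differentiable_def)
 from pdir_eq[OF this(1)] pdir_eq[OF this(2)] pdir_eq[OF has_derivative_diff[OF this]]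
 show ?thesis by simp
qed

lemma C_k_diff: "C_k n f ==> C_k n g ==> C_k n (\<lambda>x. f x - g x)"
 using C_k_add[OF _ C_k_cmult[of n g "- 1"], of f] by simp

section \<open>Integration by parts against compactly supported functions\<close>

lemma integrable_compact_support:
 fixes f :: "'a::euclidean_space => complex"
 assumes "continuous_on UNIV f" "compact K" "\<And>x. x \<notin> K ==> f x = 0"
 shows "integrable lborel f"
proof -
 have "integrable lborel (\<lambda>x. indicator K x *R f x)"
  using assms by (intro borel_integrable_compact) (auto intro: continuous_on_subset)
 moreover have "(\<lambda>x. indicator K x *R f x) = f" using assms(3) by (auto simp: indicator_def)
 ultimately show ?thesis by simp
qed

lemma pdir_eq_0_outside:
 assumes "compact K" "\<And>x. x \<notin> K ==> f x = 0" "x \<notin> K"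
 shows "pdir b f x = 0"
proof -
 have "pdir b f x = pdir b (\<lambda>_. 0) x"
  using assms by (intro pdir_cong_open[of "- K"]) (auto intro: compact_imp_closed)
 then show ?thesis by (simp add: pdir_const)
qed

lemma integral_translate:
 fixes f :: "'a::euclidean_space => complex"
 assumes "integrable lborel f"
 shows "integrable lborel (\<lambda>x. f (x + c))" "(LBINT x. f (x + c)) = (LBINT x. f x)"
proof -
 have eq: "lborel = distr lborel borel (\<lambda>x::'a. x + c)"
 proof -
  have "(+) c = (\<lambda>x. x + c)" by (auto simp: add.commute)
  then show ?thesis using lborel_distr_plus[of c] by simp
 qed
 have m: "f \<in> borel_measurable borel" using assms by simp
 have "integrable (distr lborel borel (\<lambda>x::'a. x + c)) f" using assms eq by metis
 then show "integrable lborel (\<lambda>x. f (x + c))" by (rule integrable_distr[rotated]) simp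
 have "(LBINT x. f x) = (LINT x|distr lborel borel (\<lambda>x::'a. x + c). f x)" by (rule arg_cong[OF eq])
 also have "... = (LBINT x. f (x + c))" using m by (intro integral_distr) auto
 finally show "(LBINT x. f (x + c)) = (LBINT x. f x)" ..
qed

lemma vector_derivative_difference_quotient:
 assumes "(f has_vector_derivative D) (at x)"
 shows "((\<lambda>h. (f (x + h) - f x) /R h) \<longlongrightarrow> D) (at 0)"
proof -
 have "((\<lambda>h. norm (f (x + h) - f x - h *R D) / norm h) \<longlongrightarrow> 0) (at 0)"
  using assms by (simp add: has_vector_derivative_def has_derivative_at)
 moreover have "\<forall>\<^sub>F h in at 0. norm (f (x + h) - f x - h *R D) / norm h = norm ((f (x + h) - f x) /R h - D)"
 proof -
  have "norm (y - h *R D) / norm h = norm (y /R h - D)" if "h \<noteq> 0" for h :: real and y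
  proof -
   have "y /R h - D = (y - h *R D) /R h" using that by (simp add: scaleR_diff_right)
   then show ?thesis by (simp add: divide_inverse mult.commute)
  qed
  then show ?thesis by (simp add: eventually_at_filter)
 qed
 ultimately have "((\<lambda>h. norm ((f (x + h) - f x) /R h - D)) \<longlongrightarrow> 0) (at 0)"
  by (rule Lim_transform_eventually)
 then show ?thesis by (rule LIM_zero_cancel[OF tendsto_norm_zero_cancel])
qed

text \<open>Translation invariance of Lebesgue measure makes every difference quotient integrate to
  zero, and dominated convergence passes to the derivative.\<close>

lemma integral_pdir_eq_0:
 fixes f :: "'a::euclidean_space => complex"
 assumes f: "C_k 1 f" and K: "compact K" "\<And>x. x \<notin> K ==> f x = 0" and b: "b \<in> Basis"
 shows "(LBINT x. pdir b f x) = 0"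
proof -
 let ?D = "pdir b f"
 have contD: "continuous_on UNIV ?D" using C_k_SucD(3)[of 0 f b] f b by simp
 have D0: "?D x = 0" if "x \<notin> K" for x using pdir_eq_0_outside[OF K that] .
 obtain B where B: "\<And>x. norm (?D x) \<le> B"
 proof -
  have "bounded (?D ` K)"
   using compact_continuous_image[OF continuous_on_subset[OF contD] K(1)] compact_imp_bounded by blast
  then obtain B where B: "\<And>x. x \<in> K ==> norm (?D x) \<le> B" unfolding bounded_iff by blast
  have "norm (?D x) \<le> max B 0" for x using B[of x] D0[of x] by (cases "x \<in> K") auto
  then show ?thesis using that by blast
 qed
 have intf: "integrable lborel f" using integrable_compact_support[OF C_k_continuous[OF f] K] .
 define t where "t = (\<lambda>n. 1 / real (Suc n))"
 have t: "t n > 0" "t n \<le> 1" for n by (auto simp: t_def)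
 \<comment> \<open>The steps \<open>t n\<close> are at most 1, so the unit neighbourhood of K
   contains the supports of all difference quotients.\<close>
 define K' where "K' = {x + y |x y. x \<in> K \<and> y \<in> cball (0::'a) 1}"
 have K': "compact K'" unfolding K'_def by (rule compact_sums[OF K(1) compact_cball])
 define q where "q = (\<lambda>n x. (f (x + t n *R b) - f x) /R t n)"
 have der: "(f has_derivative (\<lambda>h. pdir h f x)) (at x)" for x using C_k_SucD(2)[of 0 f] f by simp
 have lin: "pdir (c *R b) f x = c *R ?D x" for c x
  using linear_scale[OF has_derivative_linear[OF der[of x]]] by simp
 have line: "((\<lambda>s. f (x + s *R b)) has_derivative (\<lambda>h. h *R ?D (x + s *R b))) (at s within S)" for x s S
 proof -
  have "((\<lambda>s. x + s *R b) has_derivative (\<lambda>h. h *R b)) (at s within S)"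
   by (auto intro!: derivative_eq_intros)
  from has_derivative_compose[OF this der] show ?thesis by (simp add: lin)
 qed
 have int_q: "(LBINT x. q n x) = 0" for n
  unfolding q_def using integral_translate[OF intf, of "t n *R b"] intf by simp
 have "(\<lambda>n. LBINT x. q n x) \<longlonglongrightarrow> (LBINT x. ?D x)"
 proof (rule integral_dominated_convergence)
  show "?D \<in> borel_measurable lborel" using borel_measurable_continuous_onI[OF contD] by simp
  show "q n \<in> borel_measurable lborel" for n
   using borel_measurable_integrable[OF integral_translate(1)[OF intf, of "t n *R b"]] borel_measurable_integrable[OF intf]
   by (simp add: q_def)
  have "integrable lborel (\<lambda>x. indicator K' x *R B)"
   using K' by (intro borel_integrable_compact continuous_intros)
  then show "integrable lborel (\<lambda>x. B * indicator K' x)" by (simp add: mult.commute)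
  show "AE x in lborel. (\<lambda>n. q n x) \<longlonglongrightarrow> ?D x"
  proof (rule AE_I2)
   fix x :: 'a
   have "((\<lambda>s. f (x + s *R b)) has_vector_derivative ?D x) (at 0)"
    using line[of x 0 UNIV] by (simp add: has_vector_derivative_def)
   then have "((\<lambda>s. (f (x + s *R b) - f x) /R s) \<longlongrightarrow> ?D x) (at 0)"
    using vector_derivative_difference_quotient by fastforce
   moreover have "filterlim t (at 0) sequentially"
    unfolding filterlim_at t_def using LIMSEQ_inverse_real_of_nat by (auto simp: inverse_eq_divide)
   ultimately show "(\<lambda>n. q n x) \<longlonglongrightarrow> ?D x" unfolding q_def by (rule filterlim_compose)
  qed
  show "AE x in lborel. norm (q n x) \<le> B * indicator K' x" for n
  proof (rule AE_I2)
   fix x :: 'a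
   show "norm (q n x) \<le> B * indicator K' x"
   proof (cases "x \<in> K'")
    case True
    have "norm (f (x + t n *R b) - f (x + 0 *R b)) \<le> B * norm (t n - 0)"
    proof (rule differentiable_bound[where S = "{0..t n}" and f = "\<lambda>s. f (x + s *R b)"])
     show "((\<lambda>s. f (x + s *R b)) has_derivative (\<lambda>h. h *R ?D (x + s *R b))) (at s within {0..t n})" for s
      by (rule line)
     show "onorm (\<lambda>h. h *R ?D (x + s *R b)) \<le> B" for s
     proof (rule onorm_le)
      show "norm (h *R ?D (x + s *R b)) \<le> B * norm h" for h
       using mult_left_mono[OF B[of "x + s *R b"], of "\<bar>h\<bar>"] by (simp add: mult.commute)
     qed
    qed (use t in \<open>auto simp: less_imp_le\<close>)
    moreover have "norm (q n x) = norm (f (x + t n *R b) - f (x + 0 *R b)) / t n"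
     using t[of n] by (simp add: q_def divide_inverse mult.commute)
    ultimately show ?thesis using t[of n] True by (simp add: divide_le_eq)
   next
    case False
    have "x \<notin> K" using False by (force simp: K'_def)
    moreover have "x + t n *R b \<notin> K"
    proof
     assume "x + t n *R b \<in> K"
     moreover have "- (t n *R b) \<in> cball 0 1" using t[of n] b by simp
     moreover have "x = (x + t n *R b) + - (t n *R b)" by simp
     ultimately have "x \<in> K'" unfolding K'_def by blast
     then show False using False by blast
    qed
    ultimately show ?thesis using False K(2) by (simp add: q_def)
   qed
  qed
 qed
 then show ?thesis using LIMSEQ_unique[OF _ tendsto_const[of 0]] by (simp add: int_q)
qed

lemma test_function_supp:
 assumes "test_function S \<phi>"
 obtains K where "compact K" "K \<subseteq> S" "\<And>x. x \<notin> K ==> \<phi> x = 0"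
 using assms closure_subset[of "{x. \<phi> x \<noteq> 0}"] unfolding test_function_def by blast

text \<open>The difference of the integrands is the sum over b of the b-derivatives of u * pdir b
  \<phi> - pdir b u * \<phi>, each of compact support.\<close>

theorem integral_laplacian_swap:
 fixes u :: "'a::euclidean_space => complex"
 assumes u: "C_k 2 u" and \<phi>: "test_function S \<phi>"
 shows "integrable lborel (\<lambda>x. u x * laplacian \<phi> x)" "integrable lborel (\<lambda>x. laplacian u x * \<phi> x)"
  and "(LBINT x. u x * laplacian \<phi> x) = (LBINT x. laplacian u x * \<phi> x)"
proof -
 obtain K where K: "compact K" "\<And>x. x \<notin> K ==> \<phi> x = 0" using test_function_supp[OF \<phi>] by metis
 have \<phi>2: "C_k n \<phi>" for n using \<phi> by (simp add: test_function_def)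
 have u1: "C_k 1 u" "C_k 1 (pdir b u)" "C_k 0 (pdir b (pdir b u))" if "b \<in> Basis" for b
  using u that C_k_Suc_imp[of 1 u] C_k_SucD(3)[of 1 u b] C_k_SucD(3)[of 0 "pdir b u" b]
  by (simp_all add: numeral_2_eq_2)
 have \<phi>1: "C_k n (pdir b \<phi>)" "C_k n (pdir b (pdir b \<phi>))" if "b \<in> Basis" for b n
  using C_k_SucD(3)[OF \<phi>2 that] C_k_SucD(3)[OF C_k_SucD(3)[OF \<phi>2 that] that] by blast+
 have z: "pdir b \<phi> x = 0" "pdir b (pdir b \<phi>) x = 0" if "x \<notin> K" for b x
  using pdir_eq_0_outside[OF K] pdir_eq_0_outside[OF K(1), of "pdir b \<phi>"] that by auto
 have i1: "integrable lborel (\<lambda>x. u x * pdir b (pdir b \<phi>) x)" if "b \<in> Basis" for b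
  using u1[OF that] \<phi>1[OF that] z
  by (intro integrable_compact_support[OF _ K(1)] continuous_on_mult) (auto intro: C_k_continuous)
 have i2: "integrable lborel (\<lambda>x. pdir b (pdir b u) x * \<phi> x)" if "b \<in> Basis" for b
  using u1[OF that] \<phi>2 K
  by (intro integrable_compact_support[OF _ K(1)] continuous_on_mult) (auto intro: C_k_continuous)
 show "integrable lborel (\<lambda>x. u x * laplacian \<phi> x)" "integrable lborel (\<lambda>x. laplacian u x * \<phi> x)"
  using i1 i2 by (simp_all add: laplacian_pdir sum_distrib_left sum_distrib_right)
 have "(LBINT x. u x * pdir b (pdir b \<phi>) x) = (LBINT x. pdir b (pdir b u) x * \<phi> x)"
  if b: "b \<in> Basis" for b
 proof -
  let ?F = "\<lambda>x. u x * pdir b \<phi> x - pdir b u x * \<phi> x"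
  have dif: "u differentiable at x" "\<phi> differentiable at x" "pdir b u differentiable at x"
   "pdir b \<phi> differentiable at x" for x
   using C_k_SucD(1)[of 0] u1[OF b] \<phi>2[of 1] \<phi>1(1)[OF b, of 1] by auto
  have "pdir b ?F x = u x * pdir b (pdir b \<phi>) x - pdir b (pdir b u) x * \<phi> x" for x
   using dif by (simp add: pdir_diff pdir_mult differentiable_mult)
  moreover have "(LBINT x. pdir b ?F x) = 0" using u1[OF b] \<phi>2 \<phi>1(1)[OF b] K z
   by (intro integral_pdir_eq_0[OF _ K(1) _ b] C_k_diff C_k_mult) auto
  ultimately show ?thesis using i1[OF b] i2[OF b] by simp
 qed
 then show "(LBINT x. u x * laplacian \<phi> x) = (LBINT x. laplacian u x * \<phi> x)"
  using i1 i2 by (simp add: laplacian_pdir sum_distrib_left sum_distrib_right integral_sum)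
qed

section \<open>Smooth cutoff functions\<close>

lemma C_k_compose:
 fixes h :: "real => complex" and q :: "'a::euclidean_space => real"
 assumes "\<And>n. C_k n h" "\<And>n. C_k n (\<lambda>x. cx (q x))"
 shows "C_k n (\<lambda>x. h (q x))" using assms(1)
proof (induction n arbitrary: h)
 case 0
 have "continuous_on UNIV q" using continuous_on_Re[OF C_k_continuous[OF assms(2), of UNIV]] by simp
 then show ?case using C_k_continuous[OF 0, of UNIV] by (auto intro: continuous_on_compose2)
next
 case (Suc n)
 have q: "(q has_derivative (\<lambda>v. Re (pdir v (\<lambda>x. cx (q x)) x))) (at x)" for x
  using has_derivative_Re[OF C_k_SucD(2)[OF assms(2)]] by simp
 have qc: "pdir v (\<lambda>x. cx (q x)) x = cx (Re (pdir v (\<lambda>x. cx (q x)) x))" for v x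
  by (rule pdir_eq[OF has_derivative_of_real[OF q]])
 have h: "(h has_derivative (\<lambda>v. pdir v h x)) (at x)" for x by (rule C_k_SucD(2)[OF Suc.prems])
 have lin: "pdir v h x = cx v * pdir 1 h x" for v x
  using linear_scale[OF has_derivative_linear[OF h[of x]], of v 1] by (simp add: scaleR_conv_of_real)
 have D: "((\<lambda>x. h (q x)) has_derivative (\<lambda>v. pdir v (\<lambda>x. cx (q x)) x * pdir 1 h (q x))) (at x)" for x
  using has_derivative_compose[OF q h, of x] lin[of "Re (pdir _ (\<lambda>x. cx (q x)) x)"]
  by (simp add: qc[symmetric])
 have "C_k n (pdir 1 h)" for n using C_k_SucD(3)[OF Suc.prems] by simp
 then show ?case by (intro C_k_SucI[OF D] C_k_mult Suc.IH C_k_SucD(3)[OF assms(2)])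
qed

text \<open>With arbitrary polynomials in 1 / t as factors the family is closed under
  differentiation: the derivative of p(1/t) exp(-1/t) belongs to the polynomial x^2 (p -
  p').\<close>

definition exp_cutoff :: "real poly => real => real" where
 "exp_cutoff p t = (if t > 0 then poly p (1 / t) * exp (- (1 / t)) else 0)"

lemma poly_exp_tendsto_0: "((\<lambda>x::real. poly p x * exp (- x)) \<longlongrightarrow> 0) at_top"
proof -
 have "((\<lambda>x::real. \<Sum>i\<le>degree p. coeff p i * (x ^ i / exp x)) \<longlongrightarrow> (\<Sum>i\<le>degree p. coeff p i * 0)) at_top"
  by (intro tendsto_intros tendsto_power_div_exp_0)
 moreover have "(\<Sum>i\<le>degree p. coeff p i * (x ^ i / exp x)) = poly p x * exp (- x)" for x
  by (simp add: poly_altdef sum_distrib_left exp_minus divide_inverse mult_ac)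
 ultimately show ?thesis by simp
qed

lemma exp_cutoff_deriv:
 "(exp_cutoff p has_real_derivative exp_cutoff (monom 1 2 * (p - pderiv p)) t) (at t)"
proof -
 consider "t > 0" | "t < 0" | "t = 0" by linarith
 then show ?thesis
 proof cases
  case 1
  have "((\<lambda>t. poly p (1 / t) * exp (- (1 / t))) has_real_derivative
    poly p (1 / t) * (exp (- (1 / t)) * (1 / t^2)) + (poly (pderiv p) (1 / t) * (- 1 / t^2)) * exp (- (1 / t))) (at t)"
   using 1 by (auto intro!: derivative_eq_intros simp: power2_eq_square)
  moreover have "poly p (1 / t) * (exp (- (1 / t)) * (1 / t^2)) + (poly (pderiv p) (1 / t) * (- 1 / t^2)) * exp (- (1 / t))
    = exp_cutoff (monom 1 2 * (p - pderiv p)) t"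
   using 1 by (simp add: exp_cutoff_def poly_monom power_divide algebra_simps)
  ultimately have "((\<lambda>t. poly p (1 / t) * exp (- (1 / t))) has_real_derivative exp_cutoff (monom 1 2 * (p - pderiv p)) t) (at t)"
   by simp
  then show ?thesis
   by (rule has_field_derivative_transform_within_open[where S = "{0<..}"]) (use 1 in \<open>auto simp: exp_cutoff_def\<close>)
 next
  case 2
  have "((\<lambda>_. 0) has_real_derivative exp_cutoff (monom 1 2 * (p - pderiv p)) t) (at t)"
   using 2 by (simp add: exp_cutoff_def)
  then show ?thesis
   by (rule has_field_derivative_transform_within_open[where S = "{..<0}"]) (use 2 in \<open>auto simp: exp_cutoff_def\<close>)
 next
  case 3
  have "((\<lambda>h. exp_cutoff p h / h) \<longlongrightarrow> 0) (at_right 0)"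
  proof -
   have "((\<lambda>x. poly (monom 1 1 * p) x * exp (- x)) \<longlongrightarrow> 0) at_top" by (rule poly_exp_tendsto_0)
   then have "((\<lambda>h. poly (monom 1 1 * p) (inverse h) * exp (- inverse h)) \<longlongrightarrow> 0) (at_right 0)"
    by (rule filterlim_compose[OF _ filterlim_inverse_at_top_right])
   then show ?thesis by (rule Lim_transform_eventually)
     (auto simp: eventually_at_filter exp_cutoff_def poly_monom divide_inverse mult_ac)
  qed
  moreover have "((\<lambda>h. exp_cutoff p h / h) \<longlongrightarrow> 0) (at_left 0)"
   by (rule Lim_transform_eventually[OF tendsto_const[of 0]])
    (auto simp: eventually_at_filter exp_cutoff_def)
  ultimately have "((\<lambda>h. exp_cutoff p h / h) \<longlongrightarrow> 0) (at 0)" by (simp add: filterlim_split_at)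
  then show ?thesis using 3 by (simp add: has_field_derivative_iff exp_cutoff_def)
 qed
qed

lemma C_k_exp_cutoff:
 fixes q :: "'a::euclidean_space => real"
 assumes "\<And>n. C_k n (\<lambda>x. cx (q x))"
 shows "C_k n (\<lambda>x. cx (exp_cutoff p (q x)))"
proof -
 have "C_k n (\<lambda>t. cx (exp_cutoff p t))" for n
 proof (induction n arbitrary: p)
  case 0
  show ?case
   using DERIV_isCont[OF exp_cutoff_deriv] by (auto intro!: continuous_at_imp_continuous_on continuous_intros)
 next
  case (Suc n)
  have "((\<lambda>t. cx (exp_cutoff p t)) has_derivative
    (\<lambda>h. cx (exp_cutoff (monom 1 2 * (p - pderiv p)) t * h))) (at t)" for t
   using exp_cutoff_deriv[of p t] by (intro has_derivative_of_real) (simp add: has_field_derivative_def)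
  then show ?case by (rule C_k_SucI) (use Suc in simp)
 qed
 from C_k_compose[OF this assms] show ?thesis .
qed

lemma C_k_of_real_ident: "C_k n cx" by (rule C_k_bounded_linear[OF bounded_linear_of_real])

text \<open>Both the step and its density are exposed: the step cuts functions off, the density is
  the weight with which the weak equation averages over a shell. The density is the bump exp(-1 /
  ((s - a) (b - s))) divided by its total mass.\<close>

theorem smooth_step:
 fixes a b :: real
 assumes "a < b"
 obtains \<theta> \<Theta> :: "real => real" where
  "\<And>n. C_k n (\<lambda>s. cx (\<theta> s))" "\<And>n. C_k n (\<lambda>s. cx (\<Theta> s))"
  "\<And>s. (\<Theta> has_real_derivative \<theta> s) (at s)" "\<And>s. \<theta> s \<ge> 0" "\<And>s. s \<notin> {a<..<b} ==> \<theta> s = 0"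
  "\<And>s. s \<le> a ==> \<Theta> s = 0" "\<And>s. s \<ge> b ==> \<Theta> s = 1"
proof -
 define \<theta>0 where "\<theta>0 = (\<lambda>s. exp_cutoff 1 ((s - a) * (b - s)))"
 have sm: "C_k n (\<lambda>s. cx (\<theta>0 s))" for n unfolding \<theta>0_def
  by (rule C_k_exp_cutoff) (auto simp: of_real_diff intro!: C_k_mult C_k_diff C_k_const C_k_of_real_ident)
 have pos: "\<theta>0 s > 0" if "a < s" "s < b" for s using that by (simp add: \<theta>0_def exp_cutoff_def)
 have nonneg: "\<theta>0 s \<ge> 0" for s by (simp add: \<theta>0_def exp_cutoff_def)
 have out: "\<theta>0 s = 0" if "s \<notin> {a<..<b}" for s
  using that assms by (auto simp: \<theta>0_def exp_cutoff_def zero_less_mult_iff)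
 have cont: "continuous_on S \<theta>0" for S using continuous_on_Re[OF C_k_continuous[OF sm]] by simp
 have int: "\<theta>0 integrable_on {c..d}" for c d by (rule integrable_continuous_interval[OF cont])
 define P where "P = (\<lambda>s. if s \<le> a then 0 else integral {a..s} \<theta>0)"
 have P1: "(P has_real_derivative \<theta>0 s) (at s)" for s
 proof -
  \<comment> \<open>A lower limit below both s and a makes P, near s, an integral with a fixed lower
    end, also across the case distinction at a.\<close>
  define L where "L = min s a - 1"
  have eq: "P t = integral {L..t} \<theta>0" if "t \<in> {L<..<s + 1}" for t
  proof (cases "t \<le> a")
   case True
   have "integral {L..t} \<theta>0 = integral {L..t} (\<lambda>_. 0)"
    by (rule integral_cong) (use True out in auto)
   then show ?thesis using True by (simp add: P_def)
  next
   case False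
   have "integral {L..a} \<theta>0 + integral {a..t} \<theta>0 = integral {L..t} \<theta>0"
    using False by (intro Henstock_Kurzweil_Integration.integral_combine int) (auto simp: L_def)
   moreover have "integral {L..a} \<theta>0 = integral {L..a} (\<lambda>_. 0)"
    by (rule integral_cong) (use out in auto)
   ultimately show ?thesis using False by (simp add: P_def)
  qed
  have "((\<lambda>t. integral {L..t} \<theta>0) has_real_derivative \<theta>0 s) (at s within {L..s + 1})"
   by (rule integral_has_real_derivative[OF cont]) (auto simp: L_def)
  then have "((\<lambda>t. integral {L..t} \<theta>0) has_real_derivative \<theta>0 s) (at s)"
   by (subst (asm) at_within_interior) (auto simp: L_def)
  then show ?thesis
   by (rule has_field_derivative_transform_within_open[where S = "{L<..<s + 1}"]) (use eq in \<open>auto simp: L_def\<close>)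
 qed
 have Pb: "P s = P b" if "s \<ge> b" for s
 proof -
  have "integral {a..b} \<theta>0 + integral {b..s} \<theta>0 = integral {a..s} \<theta>0"
   using that assms by (intro Henstock_Kurzweil_Integration.integral_combine int) auto
  moreover have "integral {b..s} \<theta>0 = integral {b..s} (\<lambda>_. 0)"
   by (rule integral_cong) (use out in auto)
  ultimately show ?thesis using that assms by (simp add: P_def)
 qed
 have Ppos: "P b > 0"
 proof -
  have "P a < P b"
  proof (rule DERIV_pos_imp_increasing_open[OF assms])
   show "\<exists>y. (P has_real_derivative y) (at x) \<and> 0 < y" if "a < x" "x < b" for x
    using P1 pos[OF that] by blast
   show "continuous_on {a..b} P" using P1 DERIV_isCont by (blast intro: continuous_at_imp_continuous_on)
  qed
  then show ?thesis by (simp add: P_def)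
 qed
 define \<theta> where "\<theta> = (\<lambda>s. \<theta>0 s / P b)"
 define \<Theta> where "\<Theta> = (\<lambda>s. P s / P b)"
 have 1: "C_k n (\<lambda>s. cx (\<theta> s))" for n
 proof -
  have "C_k n (\<lambda>s. cx (1 / P b) * cx (\<theta>0 s))" by (intro C_k_cmult sm)
  then show ?thesis by (simp add: \<theta>_def)
 qed
 have 2: "(\<Theta> has_real_derivative \<theta> s) (at s)" for s
  unfolding \<Theta>_def \<theta>_def by (rule DERIV_cdivide[OF P1])
 have 3: "C_k (Suc n) (\<lambda>s. cx (\<Theta> s))" for n
 proof (rule C_k_SucI)
  show "((\<lambda>s. cx (\<Theta> s)) has_derivative (\<lambda>h. cx (\<theta> s * h))) (at s)" for s
   using 2[of s] by (intro has_derivative_of_real) (simp add: has_field_derivative_def)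
 qed (use 1 in simp)
 show ?thesis
 proof (rule that[of \<theta> \<Theta>])
  show "C_k n (\<lambda>s. cx (\<Theta> s))" for n using 3 by (rule C_k_Suc_imp)
  show "\<Theta> s = 1" if "s \<ge> b" for s unfolding \<Theta>_def Pb[OF that] using Ppos by simp
  show "\<Theta> s = 0" if "s \<le> a" for s using that by (simp add: \<Theta>_def P_def)
  show "\<theta> s \<ge> 0" "s \<notin> {a<..<b} ==> \<theta> s = 0" for s
   using nonneg[of s] out[of s] Ppos by (simp_all add: \<theta>_def)
 qed (rule 1 2)+
qed

lemma test_functionI:
 assumes "\<And>n. C_k n \<phi>" "compact K" "K \<subseteq> S" "\<And>x. x \<notin> K ==> \<phi> x = 0"
 shows "test_function S \<phi>"
proof -
 have "closure {x. \<phi> x \<noteq> 0} \<subseteq> K"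
  using assms by (intro closure_minimal) (auto intro: compact_imp_closed)
 then show ?thesis using assms closed_Int_compact[OF closed_closure[of "{x. \<phi> x \<noteq> 0}"] assms(2)]
  by (auto simp: test_function_def inf.absorb1)
qed

section \<open>Projections of weak Helmholtz solutions\<close>

lemma continuous_on_sphere_integral:
 fixes h :: "real => 'a::euclidean_space => complex"
 assumes h: "continuous_on (I \<times> sphere 0 1) (\<lambda>p. h (fst p) (snd p))"
 shows "continuous_on I (\<lambda>r. SPH v. h r v)" unfolding continuous_on_sequentially o_def
proof safe
 fix X r
 assume r: "r \<in> I" and X: "\<forall>n. X n \<in> I" "X \<longlonglongrightarrow> r"
 have slice: "continuous_on (sphere 0 1) (h t)" if "t \<in> I" for t
  using that by (intro continuous_on_compose2[OF h, of _ "\<lambda>v. (t, v)", simplified] continuous_intros) auto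
 have line: "continuous_on I (\<lambda>t. h t v)" if "v \<in> sphere 0 1" for v
  using that by (intro continuous_on_compose2[OF h, of _ "\<lambda>t. (t, v)", simplified] continuous_intros) auto
 define K where "K = insert r (range X)"
 have "compact (K \<times> sphere (0::'a) 1)" "K \<times> sphere 0 1 \<subseteq> I \<times> sphere (0::'a) 1"
  using X r by (auto simp: K_def intro!: compact_Times compact_sequence_with_limit)
 then have "bounded ((\<lambda>p. h (fst p) (snd p)) ` (K \<times> sphere 0 1))"
  using compact_continuous_image[OF continuous_on_subset[OF h]] compact_imp_bounded by blast
 then obtain B where B: "\<And>t v. t \<in> K ==> v \<in> sphere 0 1 ==> norm (h t v) \<le> B"
  unfolding bounded_iff by force
 show "(\<lambda>n. SPH v. h (X n) v) \<longlonglongrightarrow> (SPH v. h r v)"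
 proof (rule integral_dominated_convergence[where w = "\<lambda>_. B"])
  show "h r \<in> borel_measurable sphere_measure" "h (X n) \<in> borel_measurable sphere_measure" for n
   using continuous_sphere_integrable[OF slice] X r by auto
  show "AE v in sphere_measure. (\<lambda>n. h (X n) v) \<longlonglongrightarrow> h r v"
   using line X r unfolding continuous_on_sequentially o_def by (intro AE_I2) auto
  show "AE v in sphere_measure. norm (h (X n) v) \<le> B" for n
   using B by (intro AE_I2) (auto simp: K_def)
 qed auto
qed

text \<open>Formulated within an interval because the uniqueness proof differentiates at the
  boundary radius R, where only a one-sided derivative is given.\<close>

lemma sphere_integral_has_vector_derivative:
 fixes h h' :: "real => 'a::euclidean_space => complex"
 assumes I: "is_interval I" and r: "r \<in> I"
  and h: "\<And>t. t \<in> I ==> continuous_on (sphere 0 1) (h t)"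
  and d: "\<And>t v. t \<in> I ==> v \<in> sphere 0 1 ==> ((\<lambda>t. h t v) has_vector_derivative h' t v) (at t within I)"
  and h': "continuous_on (I \<times> sphere 0 1) (\<lambda>p. h' (fst p) (snd p))"
 shows "((\<lambda>t. SPH v. h t v) has_vector_derivative (SPH v. h' r v)) (at r within I)"
 unfolding has_vector_derivative_def has_derivative_within
proof (intro conjI bounded_linear_scaleR_left)
 let ?H = "\<lambda>t. SPH v. h t v" and ?H' = "SPH v. h' r v"
 have slice: "continuous_on (sphere 0 1) (h' t)" if "t \<in> I" for t
  using that by (intro continuous_on_compose2[OF h', of _ "\<lambda>v. (t, v)", simplified] continuous_intros) auto
 have int: "integrable sphere_measure (h t)" "integrable sphere_measure (h' t)" if "t \<in> I" for t
  using continuous_sphere_integrable h slice that by auto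
 show "((\<lambda>t. (1 / norm (t - r)) *R (?H t - (?H r + (t - r) *R ?H'))) \<longlongrightarrow> 0) (at r within I)"
  unfolding tendsto_at_iff_sequentially o_def
 proof (intro allI impI)
  fix X
  assume X: "\<forall>i. X i \<in> I - {r}" "X \<longlonglongrightarrow> r"
  define K where "K = insert r (range X)"
  have K: "compact K" "K \<noteq> {}" "K \<subseteq> I"
   using X r by (auto simp: K_def intro!: compact_sequence_with_limit)
  \<comment> \<open>The mean value estimate needs a segment; the hull of the sequence and its limit
    stays in the interval I and is compact, which yields the dominating constant.\<close>
  define J where "J = {Inf K..Sup K}"
  have "Inf K \<in> K" "Sup K \<in> K" using K closed_contains_Inf closed_contains_Sup
   by (auto simp: compact_imp_closed bounded_imp_bdd_below bounded_imp_bdd_above compact_imp_bounded)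
  with K(3) have "Inf K \<in> I" "Sup K \<in> I" by blast+
  then have J: "J \<subseteq> I" using mem_is_interval_1_I[OF I, of "Inf K" "Sup K"] by (auto simp: J_def)
  have KJ: "K \<subseteq> J"
   using K by (auto simp: J_def intro!: cInf_lower cSup_upper bounded_imp_bdd_below bounded_imp_bdd_above compact_imp_bounded)
  have "compact (J \<times> sphere (0::'a) 1)" "J \<times> sphere 0 1 \<subseteq> I \<times> sphere (0::'a) 1"
   using J by (auto simp: J_def intro!: compact_Times)
  then have "bounded ((\<lambda>p. h' (fst p) (snd p)) ` (J \<times> sphere 0 1))"
   using compact_continuous_image[OF continuous_on_subset[OF h']] compact_imp_bounded by blast
  then obtain B where B: "\<And>t v. t \<in> J ==> v \<in> sphere 0 1 ==> norm (h' t v) \<le> B"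
   unfolding bounded_iff by force
  have lip: "norm (h t v - h r v) \<le> B * norm (t - r)" if "t \<in> K" "v \<in> sphere 0 1" for t v
  proof (rule differentiable_bound[where S = J and f = "\<lambda>t. h t v"])
   show "((\<lambda>t. h t v) has_derivative (\<lambda>s. s *R h' t v)) (at t within J)" if "t \<in> J" for t
    using d[of t v] that J \<open>v \<in> _\<close> by (auto simp: has_vector_derivative_def intro: has_derivative_subset)
   show "onorm (\<lambda>s. s *R h' t v) \<le> B" if "t \<in> J" for t
   proof (rule onorm_le)
    show "norm (s *R h' t v) \<le> B * norm s" for s
     using mult_left_mono[OF B[OF that \<open>v \<in> _\<close>], of "\<bar>s\<bar>"] by (simp add: mult.commute)
   qed
  qed (use KJ that in \<open>auto simp: J_def K_def\<close>)
  define q where "q = (\<lambda>n v. (1 / norm (X n - r)) *R (h (X n) v - (h r v + (X n - r) *R h' r v)))"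
  have "(\<lambda>n. SPH v. q n v) \<longlonglongrightarrow> (LINT v|(sphere_measure :: 'a measure). 0)"
  proof (rule integral_dominated_convergence[where w = "\<lambda>_. 2 * B"])
   show "q n \<in> borel_measurable sphere_measure" for n
    unfolding q_def using int[of r] int[of "X n"] X r by (intro borel_measurable_integrable) auto
   show "AE v in sphere_measure. (\<lambda>n. q n v) \<longlonglongrightarrow> 0"
   proof (rule AE_I2)
    fix v :: 'a
    assume "v \<in> space sphere_measure"
    then have "((\<lambda>t. (1 / norm (t - r)) *R (h t v - (h r v + (t - r) *R h' r v))) \<longlongrightarrow> 0) (at r within I)"
     using d[OF r, of v] by (auto simp: has_vector_derivative_def has_derivative_within)
    then show "(\<lambda>n. q n v) \<longlonglongrightarrow> 0" using X unfolding tendsto_at_iff_sequentially o_def q_def by blast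
   qed
   show "AE v in sphere_measure. norm (q n v) \<le> 2 * B" for n
   proof (rule AE_I2)
    fix v :: 'a
    assume "v \<in> space sphere_measure"
    then have v: "v \<in> sphere 0 1" by simp
    have Xn: "X n \<in> K" "X n \<noteq> r" "r \<in> J" using X KJ by (auto simp: K_def)
    have "norm (h (X n) v - (h r v + (X n - r) *R h' r v)) \<le>
      norm (h (X n) v - h r v) + norm ((X n - r) *R h' r v)"
     by (simp only: diff_add_eq_diff_diff_swap[of _ "h r v"] norm_triangle_ineq4 add.commute diff_diff_eq[symmetric])
    also have "... \<le> B * norm (X n - r) + norm (X n - r) * B"
     using lip[OF Xn(1) v] mult_left_mono[OF B[OF Xn(3) v], of "norm (X n - r)"]
     by (intro add_mono) simp_all
    finally have "norm (h (X n) v - (h r v + (X n - r) *R h' r v)) / norm (X n - r) \<le> 2 * B"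
     using Xn(2) by (simp add: divide_le_eq)
    moreover have "norm (q n v) = norm (h (X n) v - (h r v + (X n - r) *R h' r v)) / norm (X n - r)"
     by (simp add: q_def divide_inverse mult.commute)
    ultimately show "norm (q n v) \<le> 2 * B" by simp
   qed
  qed auto
  moreover have "(SPH v. q n v) =
    (1 / norm (X n - r)) *R (?H (X n) - (?H r + (X n - r) *R ?H'))" for n
   unfolding q_def using int[of r] int[of "X n"] X r by simp
  ultimately show "(\<lambda>n. (1 / norm (X n - r)) *R (?H (X n) - (?H r + (X n - r) *R ?H'))) \<longlonglongrightarrow> 0" by simp
 qed
qed

section \<open>Radial test functions and shell averages\<close>

lemma continuous_on_dilated_sphere:
 assumes "continuous_on A u" "\<And>w. w \<in> sphere 0 1 ==> r *R w \<in> A"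
 shows "continuous_on (sphere (0::'a::euclidean_space) 1) (\<lambda>w. u (r *R w))"
 using assms by (auto intro!: continuous_on_compose2[OF assms(1)] continuous_intros)

text \<open>Green's identity for the projection \<open>y\<close> of \<open>u\<close> to a solid harmonic \<open>p\<close>. Here \<open>T\<close> is the factor in
 \<open>(\<Delta> + k^2) (\<eta> G p) = T p\<close> when \<open>G p\<close> solves the Helmholtz equation and \<open>\<eta>' = \<theta>\<close>.\<close>

lemma integral_radial_test:
 fixes u p :: "'a::euclidean_space => complex"
 assumes ab: "0 < a" "a < b"
  and u: "continuous_on (cball 0 b - ball 0 a) u"
  and p: "continuous_on UNIV p" "\<And>t x. p (t *R x) = cx (t ^ l) * p x"
  and y: "\<And>r. r \<in> {a..b} ==> (SPH w. u (r *R w) * p w) = r ^ l *R y r"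
   "\<And>r. r \<in> {a..b} ==> (y has_vector_derivative y' r) (at r within {a..b})"
   "continuous_on {a..b} y'"
  and \<theta>: "\<And>s. (\<theta> has_real_derivative \<theta>' s) (at s)" "continuous_on UNIV \<theta>'" "\<And>s. s \<notin> {a^2<..<b\<^sup>2} ==> \<theta> s = 0"
  and G: "\<And>s. s > 0 ==> (G has_real_derivative G' s) (at s)" "continuous_on {0<..} G'"
  and T: "\<And>s. T s = 8 * s * \<theta> s * G' s + 4 * s * \<theta>' s * G s + (2 * real DIM('a) + 4 * real l) * \<theta> s * G s"
 shows "integrable lborel (\<lambda>x. u x * (cx (T (sq x)) * p x))"
  and "(LBINT x. u x * (cx (T (sq x)) * p x)) =
   integral {a..b} (\<lambda>r. (2 * r * \<theta> (r^2)) *R (r ^ (DIM('a) - 1 + 2 * l) *R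
    ((2 * r * G' (r^2)) *R y r - G (r^2) *R y' r)))"
proof -
 define N where "N = DIM('a) - 1 + 2 * l"
 let ?K = "cball 0 b - ball (0::'a) a"
 have K: "compact ?K" by (simp add: compact_diff)
 \<comment> \<open>On the open complement of the closed interval \<theta> is locally zero, so its
   derivative vanishes there too.\<close>
 have \<theta>'0: "\<theta>' s = 0" if "s \<notin> {a^2..b\<^sup>2}" for s
 proof -
  have "(\<theta> has_real_derivative 0) (at s)"
   by (rule has_field_derivative_transform_within_open[OF DERIV_const, of "- {a^2..b\<^sup>2}"]) (use that \<theta>(3) in auto)
  then show ?thesis using \<theta>(1) DERIV_unique by blast
 qed
 have T0: "T s = 0" if "s \<notin> {a^2..b\<^sup>2}" for s using \<theta>'0[OF that] \<theta>(3)[of s] that by (auto simp: T)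
 have inK: "x \<in> ?K \<longleftrightarrow> sq x \<in> {a^2..b\<^sup>2}" for x :: 'a
  using ab by (auto simp: dot_square_norm not_less abs_le_square_iff[symmetric] intro: power_mono)
 have cG: "continuous_on {0<..} G" "continuous_on UNIV \<theta>"
  using G(1) \<theta>(1) by (auto intro!: continuous_at_imp_continuous_on DERIV_isCont)
 have cT: "continuous_on {0<..} T"
  unfolding T by (intro continuous_intros cG G(2) continuous_on_subset[OF cG(2)] continuous_on_subset[OF \<theta>(2)]) auto
 have cTK: "continuous_on ?K (\<lambda>x. T (sq x))"
  by (rule continuous_on_compose2[OF cT]) (use ab in \<open>auto intro!: continuous_intros simp: not_less\<close>)
 have eq: "u x * (cx (T (sq x)) * p x) = indicator ?K x *R (u x * (cx (T (sq x)) * p x))" for x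
  using inK[of x] T0[of "sq x"] by (cases "x \<in> ?K") auto
 have int: "integrable lborel (\<lambda>x. indicator ?K x *R (u x * (cx (T (sq x)) * p x)))"
  using K u cTK continuous_on_subset[OF p(1)] by (intro borel_integrable_compact continuous_intros) auto
 from int show int': "integrable lborel (\<lambda>x. u x * (cx (T (sq x)) * p x))" by (subst eq)
 have ycont: "continuous_on {a..b} y"
  unfolding continuous_on_eq_continuous_within using y(2) has_vector_derivative_continuous by blast
 define Q where "Q = (\<lambda>r. (r ^ N * T (r^2)) *R y r)"
 have rN: "r ^ N = r ^ (DIM('a) - 1) * r ^ l * r ^ l" for r :: real
  by (simp only: N_def power_add mult_2 mult.assoc)
 have sph: "(r ^ (DIM('a) - 1) * indicator {0<..} r) *R
   (SPH w. u (r *R w) * (cx (T (sq (r *R w))) * p (r *R w))) = indicator {a..b} r *R Q r" for r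
 proof (cases "r > 0")
  case True
  have "(SPH w. u (r *R w) * (cx (T (sq (r *R w))) * p (r *R w))) =
    (SPH w. cx (T (r^2) * r ^ l) * (u (r *R w) * p w))"
  proof (rule lint_cong)
   fix w :: 'a
   assume "w \<in> space sphere_measure"
   then have "sq (r *R w) = r^2" by (simp add: dot_square_norm power2_eq_square)
   then show "u (r *R w) * (cx (T (sq (r *R w))) * p (r *R w)) =
     cx (T (r^2) * r ^ l) * (u (r *R w) * p w)" by (simp add: p(2) mult_ac)
  qed simp
  also have "... = cx (T (r^2) * r ^ l) * (SPH w. u (r *R w) * p w)"
   by (rule integral_mult_right_zero)
  finally have eq1: "(SPH w. u (r *R w) * (cx (T (sq (r *R w))) * p (r *R w))) = ..." .
  show ?thesis
  proof (cases "r \<in> {a..b}")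
   case True
   then show ?thesis unfolding eq1 using \<open>r > 0\<close> y(1)[OF True]
    by (simp add: Q_def rN scaleR_conv_of_real mult_ac)
  next
   case False
   then have "r^2 \<notin> {a^2..b\<^sup>2}" using ab \<open>r > 0\<close> by (auto simp: abs_le_square_iff[symmetric])
   then show ?thesis unfolding eq1 using False T0 by simp
  qed
 qed (use ab in \<open>auto simp: indicator_def\<close>)
 have cQ: "continuous_on {a..b} Q" unfolding Q_def using ab
  by (intro continuous_intros continuous_on_compose2[OF cT] ycont) auto
 have "(LBINT x. u x * (cx (T (sq x)) * p x)) = (LBINT r. indicator {a..b} r *R Q r)"
  unfolding integral_polar(2)[OF int'] sph ..
 also have "... = integral {a..b} Q"
  using set_borel_integral_eq_integral(2)[of "{a..b}" Q] borel_integrable_compact[OF compact_Icc cQ]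
  by (simp add: set_integrable_def set_lebesgue_integral_def)
 also have "... = integral {a..b} (\<lambda>r. (2 * r * \<theta> (r^2)) *R (r ^ N *R ((2 * r * G' (r^2)) *R y r - G (r^2) *R y' r)))"
  (is "_ = integral _ ?W")
 proof -
  \<comment> \<open>Integration by parts: the derivative of A carries the whole \<theta>' term, A
    vanishes at both ends because \<theta> does, and the integrand minus the derivative of A y is
    exactly the Wronskian expression weighted by \<theta>.\<close>
  define A where "A = (\<lambda>r. 2 * r ^ Suc N * (G (r^2) * \<theta> (r^2)))"
  define A' where "A' = (\<lambda>r. 2 * real (Suc N) * r ^ N * (G (r^2) * \<theta> (r^2))
    + 4 * r ^ (N + 2) * (G' (r^2) * \<theta> (r^2) + G (r^2) * \<theta>' (r^2)))"
  have A: "(A has_real_derivative A' r) (at r within {a..b})" if r: "r \<in> {a..b}" for r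
  proof -
   have "r^2 > 0" using r ab by simp
   have sq: "((\<lambda>r. r\<^sup>2) has_real_derivative 2 * r) (at r within {a..b})"
    by (auto intro!: derivative_eq_intros)
   note DG = DERIV_chain2[OF G(1)[OF \<open>r\<^sup>2 > 0\<close>] sq] and D\<theta> = DERIV_chain2[OF \<theta>(1)[of "r^2"] sq]
   have "(A has_real_derivative 2 * (real (Suc N) * r ^ N) * (G (r^2) * \<theta> (r^2)) +
     (G' (r^2) * (2 * r) * \<theta> (r^2) + \<theta>' (r^2) * (2 * r) * G (r^2)) * (2 * r ^ Suc N)) (at r within {a..b})"
    unfolding A_def by (intro DERIV_mult DG D\<theta> DERIV_cmult) (use DERIV_pow[of "Suc N"] in simp)
   then show ?thesis by (rule DERIV_cong) (simp add: A'_def algebra_simps)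
  qed
  have deriv: "((\<lambda>r. A r *R y r) has_vector_derivative (A r *R y' r + A' r *R y r)) (at r within {a..b})"
   if "r \<in> {a..b}" for r using A[OF that] y(2)[OF that] by (rule has_vector_derivative_scaleR)
  have "((\<lambda>r. A r *R y' r + A' r *R y r) has_integral (A b *R y b - A a *R y a)) {a..b}"
   using deriv ab by (intro fundamental_theorem_of_calculus) auto
  moreover have "A a = 0" "A b = 0" using \<theta>(3) by (auto simp: A_def)
  ultimately have hi: "((\<lambda>r. A r *R y' r + A' r *R y r) has_integral 0) {a..b}" by simp
  have "Q r - (A r *R y' r + A' r *R y r) = ?W r" if "r \<in> {a..b}" for r
  proof -
   have d1: "2 * real DIM('a) + 4 * real l = 2 * real (Suc N)"
    using DIM_positive[where 'a = 'a] by (simp add: N_def of_nat_diff Suc_leI)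
   have "r ^ N * T (r^2) - A' r = 4 * r ^ (N + 2) * (\<theta> (r^2) * G' (r^2))"
    unfolding T A'_def d1 by (simp add: algebra_simps power2_eq_square)
   then have "Q r - (A r *R y' r + A' r *R y r) = (4 * r ^ (N + 2) * (\<theta> (r^2) * G' (r^2))) *R y r - A r *R y' r"
    by (simp add: Q_def algebra_simps flip: scaleR_diff_left)
   also have "... = ?W r" by (simp add: A_def scaleR_diff_right algebra_simps)
   finally show ?thesis .
  qed
  moreover have "Q integrable_on {a..b}" by (rule integrable_continuous_interval[OF cQ])
  then have "((\<lambda>r. Q r - (A r *R y' r + A' r *R y r)) has_integral (integral {a..b} Q - 0)) {a..b}"
   by (intro has_integral_diff hi integrable_integral)
  ultimately have "(?W has_integral integral {a..b} Q) {a..b}"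
   using has_integral_eq[of "{a..b}" "\<lambda>r. Q r - (A r *R y' r + A' r *R y r)" ?W] by simp
  then show ?thesis by (simp add: integral_unique)
 qed
 finally show "(LBINT x. u x * (cx (T (sq x)) * p x)) =
   integral {a..b} (\<lambda>r. (2 * r * \<theta> (r^2)) *R (r ^ (DIM('a) - 1 + 2 * l) *R
    ((2 * r * G' (r^2)) *R y r - G (r^2) *R y' r)))" by (simp add: N_def)
qed

text \<open>2 r \<theta>(r^2) is the derivative of \<Theta>(r^2), hence a probability density on
  [a, b]; a weighted mean stays as close to v as the values of V do.\<close>

lemma bump_average:
 fixes V :: "real => complex"
 assumes ab: "0 < a" "a < b" and V: "continuous_on {a..b} V" "\<And>r. r \<in> {a..b} ==> norm (V r - v) \<le> e"
  and \<Theta>: "\<And>s. (\<Theta> has_real_derivative \<theta> s) (at s)" "continuous_on UNIV \<theta>" "\<And>s. \<theta> s \<ge> 0"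
   "\<Theta> (a^2) = 0" "\<Theta> (b^2) = 1"
 shows "norm (integral {a..b} (\<lambda>r. (2 * r * \<theta> (r^2)) *R V r) - v) \<le> e"
proof -
 let ?t = "\<lambda>r. 2 * r * \<theta> (r^2)"
 have c: "continuous_on {a..b} (\<lambda>r. ?t r)"
  by (intro continuous_intros continuous_on_compose2[OF \<Theta>(2)]) auto
 have "((\<lambda>r. \<Theta> (r^2)) has_vector_derivative (?t r)) (at r within {a..b})" for r
  unfolding has_real_derivative_iff_has_vector_derivative[symmetric]
  by (rule DERIV_cong[OF DERIV_chain2[OF \<Theta>(1)]]) (auto intro!: derivative_eq_intros)
 then have "((\<lambda>r. ?t r) has_integral (\<Theta> (b^2) - \<Theta> (a^2))) {a..b}"
  using ab by (intro fundamental_theorem_of_calculus) auto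
 then have one: "((\<lambda>r. ?t r) has_integral 1) {a..b}" using \<Theta>(4,5) by simp
 have v: "((\<lambda>r. ?t r *R v) has_integral v) {a..b}"
  using has_integral_scaleR_left[OF one, of v] by simp
 have int: "(\<lambda>r. ?t r *R V r) integrable_on {a..b}"
  by (intro integrable_continuous_interval continuous_on_scaleR c V)
 have "norm (integral {a..b} (\<lambda>r. ?t r *R V r - ?t r *R v)) \<le> integral {a..b} (\<lambda>r. ?t r * e)"
 proof (rule integral_norm_bound_integral)
  show "(\<lambda>r. ?t r *R V r - ?t r *R v) integrable_on {a..b}"
   using int v by (intro integrable_diff) auto
  show "(\<lambda>r. ?t r * e) integrable_on {a..b}" using has_integral_mult_left[OF one] by auto
  show "norm (?t r *R V r - ?t r *R v) \<le> ?t r * e" if "r \<in> {a..b}" for r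
  proof -
   have "0 \<le> ?t r" using that ab \<Theta>(3) by simp
   then show ?thesis using V(2)[OF that] by (simp add: mult_left_mono flip: scaleR_diff_right)
  qed
 qed
 also have "integral {a..b} (\<lambda>r. ?t r * e) = e"
  using integral_unique[OF has_integral_mult_left[OF one, of e]] by simp
 also have "integral {a..b} (\<lambda>r. ?t r *R V r - ?t r *R v) = integral {a..b} (\<lambda>r. ?t r *R V r) - v"
  using int v by (subst Henstock_Kurzweil_Integration.integral_diff) (auto simp: integral_unique)
 finally show ?thesis .
qed

section \<open>Radial Helmholtz profiles multiplied by solid harmonics\<close>

lemma solid_harmonicD:
 assumes "solid_harmonic l p"
 shows "C_k n p" "p (t *R x) = cx (t ^ l) * p x" "laplacian p x = 0" "continuous_on S p"
 using assms C_k_polynomial[of p] C_k_continuous[of 0 p] by (auto simp: solid_harmonic_def)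

text \<open>\<open>z powr (-\<mu>) * J(\<mu>, z)\<close> and \<open>z powr (-\<mu>) * Y(\<mu>, z)\<close> with \<open>z = k * sqrt s\<close>, as functions of \<open>s\<close>,
 followed by their derivatives.\<close>

definition famJ :: "real => real => nat => real => real" where
 "famJ k \<mu> m s = (- k\<^sup>2 / 2) ^ m * redJ (\<mu> + real m) (k^2 * s)"

definition famY :: "real => real => nat => real => real" where
 "famY k \<mu> m s = (- k\<^sup>2 / 2) ^ m * redY (\<mu> + real m) (k^2 * s)"

lemma famJ_deriv: "(famJ k \<mu> m has_real_derivative famJ k \<mu> (Suc m) s) (at s)" unfolding famJ_def
 by (rule DERIV_cong, rule DERIV_cmult, rule redJ_has_derivative, rule DERIV_cmult_Id) (simp add: add_ac)

lemma famY_deriv: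
 assumes "\<mu> > 0" "k > 0" "s > 0"
 shows "(famY k \<mu> m has_real_derivative famY k \<mu> (Suc m) s) (at s)"
proof -
 have "(redY (\<mu> + real m) has_real_derivative - 1 / 2 * redY (\<mu> + real m + 1) (k^2 * s)) (at (k^2 * s))"
  using assms by (intro redY_has_derivative) auto
 from DERIV_cmult[OF DERIV_chain2[OF this DERIV_cmult_Id], of "(- k\<^sup>2 / 2) ^ m"]
 show ?thesis unfolding famY_def by (rule DERIV_cong) (simp add: add_ac)
qed

text \<open>The radial Helmholtz equation in s = |x|^2 for a profile multiplied by a solid harmonic
  of degree l: for \<mu> = d/2 - 1 + l the coefficient 4 (\<mu> + 1) is the 2 d + 4 l of
  \<open>laplacian_radial_mult\<close>.\<close>

lemma famJ_ode: "4 * s * famJ k \<mu> 2 s + 4 * (\<mu> + 1) * famJ k \<mu> 1 s + k^2 * famJ k \<mu> 0 s = 0"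
proof -
 have "4 * s * famJ k \<mu> 2 s = k^2 * ((k^2 * s) * redJ (\<mu> + 2) (k^2 * s))"
  by (simp add: famJ_def power2_eq_square algebra_simps)
 then show ?thesis unfolding redJ_rec by (simp add: famJ_def algebra_simps)
qed

lemma famY_ode:
 assumes "\<mu> > 0" "k > 0" "s > 0"
 shows "4 * s * famY k \<mu> 2 s + 4 * (\<mu> + 1) * famY k \<mu> 1 s + k^2 * famY k \<mu> 0 s = 0"
proof -
 have ks: "k^2 * s > 0" using assms by simp
 have "4 * s * famY k \<mu> 2 s = k^2 * ((k^2 * s) * redY (\<mu> + 2) (k^2 * s))"
  by (simp add: famY_def power2_eq_square algebra_simps)
 then show ?thesis unfolding redY_rec[OF assms(1) ks] by (simp add: famY_def algebra_simps)
qed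

lemma famJ_famY_wronskian:
 assumes "\<mu> > 0" "k > 0" "s > 0"
 shows "famJ k \<mu> 0 s * famY k \<mu> 1 s - famJ k \<mu> 1 s * famY k \<mu> 0 s = k powr (- 2 * \<mu>) / pi * s powr (- \<mu> - 1)"
proof -
 have ks: "k^2 * s > 0" using assms by simp
 have k2: "(k^2) powr a = k powr (2 * a)" for a
  using assms powr_powr[of k 2 a] by (simp add: powr_numeral)
 have "famJ k \<mu> 0 s * famY k \<mu> 1 s - famJ k \<mu> 1 s * famY k \<mu> 0 s =
   (- k\<^sup>2 / 2) * (redJ \<mu> (k^2 * s) * redY (\<mu> + 1) (k^2 * s) - redJ (\<mu> + 1) (k^2 * s) * redY \<mu> (k^2 * s))"
  by (simp add: famJ_def famY_def algebra_simps)
 also have "... = k^2 * (k^2 * s) powr (- \<mu> - 1) / pi"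
  unfolding redJ_redY_wronskian[OF assms(1) ks] by simp
 also have "(k^2 * s) powr (- \<mu> - 1) = k powr (- 2 * \<mu> - 2) * s powr (- \<mu> - 1)"
  using assms by (simp add: powr_mult k2)
 also have "k powr (- 2 * \<mu> - 2) = k powr (- 2 * \<mu>) / k^2"
  using assms by (simp add: powr_diff powr_numeral)
 finally show ?thesis using assms by simp
qed

text \<open>The terms with undifferentiated \<eta> cancel by the differential equation, so what is
  left lives where \<eta> changes.\<close>

lemma helmholtz_radial_product:
 fixes p :: "'a::euclidean_space => complex" and x :: 'a
 assumes p: "solid_harmonic l p" and S: "open S" "sq x \<in> S"
  and \<eta>: "\<And>s. (\<eta> has_real_derivative \<theta> s) (at s)" "\<And>s. (\<theta> has_real_derivative \<theta>' s) (at s)"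
  and G: "\<And>m s. s \<in> S ==> (G m has_real_derivative G (Suc m) s) (at s)"
  and ode: "\<And>s. s \<in> S ==> 4 * s * G 2 s + (2 * real DIM('a) + 4 * real l) * G 1 s + k^2 * G 0 s = 0"
 defines "T \<equiv> \<lambda>s. 8 * s * \<theta> s * G 1 s + 4 * s * \<theta>' s * G 0 s + (2 * real DIM('a) + 4 * real l) * \<theta> s * G 0 s"
 shows "laplacian (\<lambda>x. cx (\<eta> (sq x) * G 0 (sq x)) * p x) x
   + cx (k^2) * (cx (\<eta> (sq x) * G 0 (sq x)) * p x) = cx (T (sq x)) * p x"
proof -
 let ?F' = "\<lambda>s. \<theta> s * G 0 s + \<eta> s * G 1 s" and ?F'' = "\<lambda>s. \<theta>' s * G 0 s + 2 * \<theta> s * G 1 s + \<eta> s * G 2 s"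
 note G1 = G[of _ 0, folded One_nat_def] and G2 = G[of _ 1, unfolded Suc_1]
 have cvd: "((\<lambda>s. cx (f s)) has_vector_derivative cx f') (at s)"
  if "(f has_real_derivative f') (at s)" for f f' s
  using that bounded_linear.has_vector_derivative[OF bounded_linear_of_real]
  by (simp add: has_real_derivative_iff_has_vector_derivative)
 have "laplacian (\<lambda>x. cx (\<eta> (sq x) * G 0 (sq x)) * p x) x =
  (4 * cx (sq x) * cx (?F'' (sq x)) + cx (2 * real DIM('a) + 4 * real l) * cx (?F' (sq x))) * p x
  + cx (\<eta> (sq x) * G 0 (sq x)) * laplacian p x"
 proof (rule laplacian_radial_mult[OF S])
  show "((\<lambda>s. cx (\<eta> s * G 0 s)) has_vector_derivative cx (?F' t)) (at t)" if "t \<in> S" for t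
   by (intro cvd DERIV_cong[OF DERIV_mult[OF \<eta>(1) G1[OF that]]]) simp
  show "((\<lambda>s. cx (?F' s)) has_vector_derivative cx (?F'' t)) (at t)" if "t \<in> S" for t
   by (intro cvd DERIV_cong[OF DERIV_add[OF DERIV_mult[OF \<eta>(2) G1[OF that]] DERIV_mult[OF \<eta>(1) G2[OF that]]]]) simp
 qed (use solid_harmonicD[OF p] in auto)
 also have "... = cx (4 * (sq x) * ?F'' (sq x) + (2 * real DIM('a) + 4 * real l) * ?F' (sq x)) * p x"
  by (simp add: solid_harmonicD(3)[OF p])
 also have "4 * (sq x) * ?F'' (sq x) + (2 * real DIM('a) + 4 * real l) * ?F' (sq x)
   = T (sq x) - k^2 * (\<eta> (sq x) * G 0 (sq x))
    + \<eta> (sq x) * (4 * (sq x) * G 2 (sq x) + (2 * real DIM('a) + 4 * real l) * G 1 (sq x) + k^2 * G 0 (sq x))"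
  by (simp add: T_def algebra_simps)
 also have "... = T (sq x) - k^2 * (\<eta> (sq x) * G 0 (sq x))" unfolding ode[OF S(2)] by simp
 finally show ?thesis by (simp add: algebra_simps)
qed

lemma has_vector_derivative_of_real:
 "(f has_real_derivative f') (at s) ==> ((\<lambda>s. cx (f s)) has_vector_derivative cx f') (at s)"
 using bounded_linear.has_vector_derivative[OF bounded_linear_of_real]
 by (simp add: has_real_derivative_iff_has_vector_derivative)

lemma C_k_famJ: "C_k n (\<lambda>x::'a::euclidean_space. cx (famJ k \<mu> m (sq x)))"
 by (rule C_k_radial[of "\<lambda>m s. cx (famJ k \<mu> m s)"])
   (intro has_vector_derivative_of_real famJ_deriv)

lemma C_k_of_real_radial:
 assumes "\<And>n. C_k n (\<lambda>s::real. cx (h s))"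
 shows "C_k n (\<lambda>x::'a::euclidean_space. cx (h (sq x)))" using C_k_compose[OF assms C_k_inner_self] .

lemma C_k_real_derivative:
 fixes h :: "real => real"
 assumes "C_k 2 (\<lambda>s. cx (h s))"
 obtains h' where "\<And>s. (h has_real_derivative h' s) (at s)" "continuous_on UNIV h'"
proof -
 let ?h = "\<lambda>s. cx (h s)"
 have "(h has_derivative (\<lambda>v. Re (pdir v ?h s))) (at s)" for s
  using has_derivative_Re[OF C_k_SucD(2)[of 1 ?h s]] assms by (simp add: numeral_2_eq_2)
 note D = this
 have "(\<lambda>v. Re (pdir v ?h s)) = (*) (Re (pdir 1 ?h s))" for s
 proof
  fix v
  show "Re (pdir v ?h s) = Re (pdir 1 ?h s) * v"
   using linear_scale[OF has_derivative_linear[OF D[of s]], of v 1] by (simp add: mult.commute)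
 qed
 then have "(h has_real_derivative Re (pdir 1 ?h s)) (at s)" for s
  using D[of s] by (simp add: has_field_derivative_def)
 moreover have "continuous_on UNIV (\<lambda>s. Re (pdir 1 ?h s))"
  using C_k_continuous[OF C_k_SucD(3)[of 1 ?h 1]] assms
  by (auto intro!: continuous_on_Re simp: numeral_2_eq_2)
 ultimately show ?thesis by (rule that)
qed

lemma C_k_famY_cutoff:
 fixes h :: "'a::euclidean_space => complex"
 assumes "\<mu> > 0" "k > 0" "\<And>n. C_k n h" "\<And>x. sq x < a ==> h x = 0" "a > 0"
 shows "C_k n (\<lambda>x. h x * cx (famY k \<mu> m (sq x)))"
 by (rule C_k_radial_cutoff[of "\<lambda>m s. cx (famY k \<mu> m s)" h a])
   (rule has_vector_derivative_of_real famY_deriv assms | assumption)+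

text \<open>The Wronskians of the projection with the two radial solutions are constant, also across the sphere
 through the exceptional point; the one with \<open>J\<close> vanishes, since \<open>J\<close> is smooth at the origin.\<close>

theorem weak_helmholtz_projection:
 fixes u p :: "'a::euclidean_space => complex"
 assumes d: "DIM('a) \<ge> 3" and k: "k > 0" and \<rho>: "\<rho> > 0" and p: "solid_harmonic l p"
  and u: "continuous_on (ball 0 \<rho> - {x0}) u"
  and E: "\<And>r w. r \<in> {0<..<\<rho>} - {norm x0} ==> w \<in> sphere 0 1 ==>
    ((\<lambda>t. u (t *R w)) has_vector_derivative E r w) (at r)"
   "continuous_on (({0<..<\<rho>} - {norm x0}) \<times> sphere 0 1) (\<lambda>q. E (fst q) (snd q))"
  and weak: "\<And>\<phi>. test_function (ball 0 \<rho>) \<phi> ==> (LINT x:ball 0 \<rho>|lborel. u x * helmholtz k \<phi> x) = 0"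
 defines "\<mu> \<equiv> real DIM('a) / 2 - 1 + real l"
 shows "\<exists>c. \<forall>r \<in> {0<..<\<rho>} - {norm x0}.
  (SPH w. u (r *R w) * p w) = c * cx (r ^ l * redJ \<mu> (k^2 * r^2))"
proof -
 define U where "U = {0<..<\<rho>} - {norm x0}"
 define N where "N = DIM('a) - 1 + 2 * l"
 have \<mu>: "\<mu> > 0" using d by (simp add: \<mu>_def)
 have d4: "2 * real DIM('a) + 4 * real l = 4 * (\<mu> + 1)" by (simp add: \<mu>_def)
 have U: "open U" "U \<subseteq> {0<..<\<rho>}" by (auto simp: U_def)
 define f where "f = (\<lambda>r. SPH w. u (r *R w) * p w)"
 define f' where "f' = (\<lambda>r. SPH w. E r w * p w)"
 have pS: "continuous_on S p" for S using solid_harmonicD(4)[OF p] .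
 have Ep: "continuous_on (U \<times> sphere 0 1) (\<lambda>q. E (fst q) (snd q) * p (snd q))"
  using E(2) unfolding U_def by (intro continuous_intros continuous_on_compose2[OF pS[of UNIV]]) auto
 have us: "continuous_on (sphere 0 1) (\<lambda>w. u (r *R w) * p w)" if "r \<in> U" for r
  using that by (intro continuous_intros pS continuous_on_dilated_sphere[OF u]) (auto simp: U_def)
 have f'c: "continuous_on U f'" unfolding f'_def by (rule continuous_on_sphere_integral[OF Ep])
 have fd: "(f has_vector_derivative f' r) (at r)" if r: "r \<in> U" for r
 proof -
  obtain e where e: "e > 0" "cball r e \<subseteq> U" using U(1) r open_contains_cball by blast
  have sub: "{r - e..r + e} \<subseteq> U" using e(2) by (auto simp: cball_eq_atLeastAtMost)
  have "(f has_vector_derivative f' r) (at r within {r - e..r + e})" unfolding f_def f'_def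
  proof (rule sphere_integral_has_vector_derivative)
   show "continuous_on ({r - e..r + e} \<times> sphere 0 1) (\<lambda>q. E (fst q) (snd q) * p (snd q))"
    using sub by (intro continuous_on_subset[OF Ep]) auto
   show "((\<lambda>t. u (t *R w) * p w) has_vector_derivative E t w * p w) (at t within {r - e..r + e})"
    if "t \<in> {r - e..r + e}" "w \<in> sphere 0 1" for t w
   proof -
    have "t \<in> {0<..<\<rho>} - {norm x0}" using sub that by (auto simp: U_def)
    from E(1)[OF this that(2)] show ?thesis
     by (rule has_vector_derivative_at_within[OF has_vector_derivative_mult_left])
   qed
  qed (use e sub us in auto)
  then show ?thesis using e by (subst (asm) at_within_interior) auto
 qed
 \<comment> \<open>Dividing by r^l removes the power belonging to the degree of p; y is then to be
   compared with profiles in r^2.\<close>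
 define y where "y = (\<lambda>r. (1 / r ^ l) *R f r)"
 define y' where "y' = (\<lambda>r. (1 / r ^ l) *R f' r + (- (real l * r ^ (l - 1)) / (r ^ l * r ^ l)) *R f r)"
 have fc: "continuous_on U f"
  using fd has_vector_derivative_continuous by (blast intro: continuous_at_imp_continuous_on)
 have yd: "(y has_vector_derivative y' r) (at r)" if "r \<in> U" for r
 proof -
  have r: "r > 0" using that U by auto
  have "((\<lambda>r. 1 / r ^ l) has_real_derivative - (real l * r ^ (l - 1)) / (r ^ l * r ^ l)) (at r)"
   using r by (auto intro!: derivative_eq_intros)
  then show ?thesis unfolding y_def y'_def by (rule has_vector_derivative_scaleR[OF _ fd[OF that]])
 qed
 have y'c: "continuous_on U y'" unfolding y'_def using U by (intro continuous_intros f'c fc) auto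
 have yc: "continuous_on U y"
  using yd has_vector_derivative_continuous by (blast intro: continuous_at_imp_continuous_on)
 have fy: "f r = r ^ l *R y r" if "r \<in> U" for r using that U by (auto simp: y_def)
 \<comment> \<open>\<open>V G\<close> is r^N times the Wronskian of r -> G(r^2) and y; the weight
   r^N is the one for which it is constant on solutions.\<close>
 define V where "V = (\<lambda>G r. r ^ N *R ((2 * r * G 1 (r^2)) *R y r - G (0::nat) (r^2) *R y' r))"
 have Vc: "continuous_on U (V G)"
  if "\<And>m s. s > 0 ==> (G m has_real_derivative G (Suc m) s) (at s)" for G
 proof -
  have c: "continuous_on U (\<lambda>r. G m (r^2))" for m
  proof (rule continuous_on_compose2[of "{0<..}" "G m"])
   show "continuous_on {0<..} (G m)"
    using DERIV_isCont[OF that] by (auto intro: continuous_at_imp_continuous_on)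
  qed (use U in \<open>auto intro!: continuous_intros\<close>)
  show ?thesis unfolding V_def by (intro continuous_intros c yc y'c)
 qed
 \<comment> \<open>Shells that avoid the radius of the exceptional point, so that u is continuous on
   them.\<close>
 define good where "good = (\<lambda>a b. 0 < a \<and> a < b \<and> {a..b} \<subseteq> U)"
 have goodb: "b^2 < \<rho>\<^sup>2" if "good a b" for a b
 proof -
  have "b \<in> U" using that by (auto simp: good_def)
  then show ?thesis using U by (intro power_strict_mono) auto
 qed
 have small: "\<exists>a b. good a b \<and> a < c \<and> c < b \<and> (\<forall>r\<in>{a..b}. norm (W r - W c) \<le> \<epsilon>)"
  if W: "continuous_on U W" "c \<in> U" "\<epsilon> > 0" for W :: "real => complex" and c \<epsilon>
 proof -
  obtain e1 where e1: "e1 > 0" "cball c e1 \<subseteq> U" using U(1) W(2) open_contains_cball by blast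
  obtain e2 where e2: "e2 > 0" "\<And>r. r \<in> U ==> dist r c < e2 ==> dist (W r) (W c) < \<epsilon>"
   using W unfolding continuous_on_iff by metis
  define e where "e = min e1 (e2 / 2)"
  have e: "e > 0" "e \<le> e1" "e < e2" using e1 e2 by (auto simp: e_def)
  have sub: "{c - e..c + e} \<subseteq> U" using e1(2) e by (auto simp: cball_eq_atLeastAtMost)
  then have "c - e \<in> U" using e by auto
  then have "c - e > 0" using U by auto
  moreover have "norm (W r - W c) \<le> \<epsilon>" if "r \<in> {c - e..c + e}" for r
   using e2(2)[of r] that sub e by (force simp: dist_real_def dist_norm)
  ultimately have "good (c - e) (c + e) \<and> c - e < c \<and> c < c + e \<and> (\<forall>r\<in>{c - e..c + e}. norm (W r - W c) \<le> \<epsilon>)"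
   using sub e by (auto simp: good_def)
  then show ?thesis by blast
 qed
 define T where "T = (\<lambda>G \<theta> \<theta>' s. 8 * s * \<theta> s * G 1 s + 4 * s * \<theta>' s * G (0::nat) s + (2 * real DIM('a) + 4 * real l) * \<theta> s * G 0 s)"
 let ?F = "\<lambda>G \<theta> \<theta>' (x::'a). cx (T G \<theta> \<theta>' (sq x)) * p x"
 let ?VJ = "V (famJ k \<mu>)"
 let ?VY = "V (famY k \<mu>)"
 have key: "integrable lborel (\<lambda>x. u x * (?F G \<theta> \<theta>' x))"
   "(LBINT x. u x * (?F G \<theta> \<theta>' x)) = integral {a..b} (\<lambda>r. (2 * r * \<theta> (r^2)) *R V G r)"
   "\<And>x. x \<notin> ball 0 \<rho> ==> T G \<theta> \<theta>' (sq x) = 0"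
   "T G \<theta> \<theta>' 0 = 0"
  if g: "good a b" and \<theta>: "\<And>s. (\<theta> has_real_derivative \<theta>' s) (at s)" "continuous_on UNIV \<theta>'" "\<And>s. s \<notin> {a^2<..<b\<^sup>2} ==> \<theta> s = 0"
   and G: "\<And>m s. s > 0 ==> (G m has_real_derivative G (Suc m) s) (at s)" for a b \<theta> \<theta>' G
 proof -
  have ab: "0 < a" "a < b" "{a..b} \<subseteq> U" using g by (auto simp: good_def)
  have "b \<in> U" using ab by auto
  then have b\<rho>: "b < \<rho>" using U by auto
  have cu: "continuous_on (cball 0 b - ball 0 a) u"
  proof (rule continuous_on_subset[OF u])
   have "norm x0 \<notin> {a..b}" using ab by (auto simp: U_def)
   then show "cball 0 b - ball 0 a \<subseteq> ball 0 \<rho> - {x0}" using b\<rho> by auto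
  qed
  have yw: "(y has_vector_derivative y' r) (at r within {a..b})" if "r \<in> {a..b}" for r
   using yd ab that has_vector_derivative_at_within by blast
  have fy': "(SPH w. u (r *R w) * p w) = r ^ l *R y r" if "r \<in> {a..b}" for r
   using fy ab that unfolding f_def by blast
  have cG': "continuous_on {0<..} (G 1)"
   using G DERIV_isCont by (intro continuous_at_imp_continuous_on) blast
  note rt = integral_radial_test[OF ab(1,2) cu pS[of UNIV] solid_harmonicD(2)[OF p] fy' yw
    continuous_on_subset[OF y'c ab(3)] \<theta> G[of _ 0, folded One_nat_def] cG',
    of "T G \<theta> \<theta>'", folded N_def]
  show "integrable lborel (\<lambda>x. u x * (?F G \<theta> \<theta>' x))"
   "(LBINT x. u x * (?F G \<theta> \<theta>' x)) = integral {a..b} (\<lambda>r. (2 * r * \<theta> (r^2)) *R V G r)"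
   unfolding V_def by (rule rt; simp add: T_def)+
  have \<theta>'0: "\<theta>' s = 0" if "s \<notin> {a^2..b\<^sup>2}" for s
  proof -
   have "(\<theta> has_real_derivative 0) (at s)"
    by (rule has_field_derivative_transform_within_open[OF DERIV_const, of "- {a^2..b\<^sup>2}"]) (use that \<theta>(3) in auto)
   then show ?thesis using \<theta>(1) DERIV_unique by blast
  qed
  show "T G \<theta> \<theta>' 0 = 0" using \<theta>(3)[of 0] by (simp add: T_def)
  show "T G \<theta> \<theta>' (sq x) = 0" if "x \<notin> ball 0 \<rho>" for x
  proof -
   have "\<rho>^2 \<le> sq x" using power_mono[of \<rho> "norm x" 2] that \<rho> by (simp add: dot_square_norm)
   then have "b^2 < sq x" using goodb[OF g] by linarith
   then have "\<theta> (sq x) = 0" "\<theta>' (sq x) = 0" by (intro \<theta>(3) \<theta>'0; simp)+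
   then show ?thesis by (simp only: T_def mult_zero_left mult_zero_right add_0_left)
  qed
 qed
 have VJ: "?VJ c = 0" if c: "c \<in> U" for c
 proof -
  have "norm (?VJ c) \<le> \<epsilon>" if \<epsilon>: "\<epsilon> > 0" for \<epsilon>
  proof -
   obtain a b where ab: "good a b" "\<And>r. r \<in> {a..b} ==> norm (?VJ r - ?VJ c) \<le> \<epsilon>"
    using small[OF Vc[of "famJ k \<mu>", OF famJ_deriv] c \<epsilon>] by blast
   have a2b2: "a^2 < b\<^sup>2" using ab(1) by (auto simp: good_def intro!: power_strict_mono)
   obtain \<theta> \<Theta> where st: "\<And>n. C_k n (\<lambda>s. cx (\<theta> s))" "\<And>n. C_k n (\<lambda>s. cx (\<Theta> s))"
    "\<And>s. (\<Theta> has_real_derivative \<theta> s) (at s)" "\<And>s. \<theta> s \<ge> 0" "\<And>s. s \<notin> {a^2<..<b\<^sup>2} ==> \<theta> s = 0"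
    "\<And>s. s \<le> a^2 ==> \<Theta> s = 0" "\<And>s. s \<ge> b^2 ==> \<Theta> s = 1" using smooth_step[OF a2b2] by metis
   obtain \<theta>' where \<theta>': "\<And>s. (\<theta> has_real_derivative \<theta>' s) (at s)" "continuous_on UNIV \<theta>'"
    using C_k_real_derivative[OF st(1)] by blast
   note K = key[of a b \<theta> \<theta>' "famJ k \<mu>", OF ab(1) \<theta>' st(5) famJ_deriv]
   \<comment> \<open>\<Theta> - 1 is - 1 near the origin and 0 beyond b, so the support is compact,
     and the regular profile keeps \<phi> smooth at the origin. Only the shell between a and b
     contributes.\<close>
   define \<phi> where "\<phi> = (\<lambda>x. cx ((\<Theta> (sq x) - 1) * famJ k \<mu> 0 (sq x)) * p x)"
   have tf: "test_function (ball 0 \<rho>) \<phi>"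
   proof (rule test_functionI[where K = "cball 0 b"])
    show "C_k n \<phi>" for n unfolding \<phi>_def of_real_mult of_real_diff
     by (rule C_k_mult[OF C_k_mult[OF C_k_diff[OF C_k_of_real_radial[OF st(2)] C_k_const] C_k_famJ]
        solid_harmonicD(1)[OF p]])
    have "b \<in> U" using ab by (auto simp: good_def)
    then show "cball 0 b \<subseteq> ball (0::'a) \<rho>" using U by auto
    show "\<phi> x = 0" if "x \<notin> cball 0 b" for x
    proof -
     have "b^2 \<le> sq x" using power_mono[of b "norm x" 2] that ab by (auto simp: good_def dot_square_norm)
     then show ?thesis by (simp add: \<phi>_def st(7))
    qed
   qed auto
   have eq: "helmholtz k \<phi> x = (?F (famJ k \<mu>) \<theta> \<theta>' x)" for x unfolding \<phi>_def T_def
    by (rule helmholtz_radial_product[OF p open_UNIV])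
      (use famJ_ode[of _ k \<mu>] in \<open>auto simp: d4 intro!: \<theta>' famJ_deriv DERIV_cong[OF DERIV_diff[OF st(3) DERIV_const]]\<close>)
   have "0 = (LINT x:ball 0 \<rho>|lborel. u x * (?F (famJ k \<mu>) \<theta> \<theta>' x))"
    using weak[OF tf] unfolding eq by simp
   also have "... = (LBINT x. u x * (?F (famJ k \<mu>) \<theta> \<theta>' x))" unfolding set_lebesgue_integral_def
    by (rule lint_cong) (use K(3) in \<open>auto simp: indicator_def\<close>)
   also have "... = integral {a..b} (\<lambda>r. (2 * r * \<theta> (r^2)) *R ?VJ r)" by (rule K(2))
   finally have z: "integral {a..b} (\<lambda>r. (2 * r * \<theta> (r^2)) *R ?VJ r) = 0" ..
   have "norm (integral {a..b} (\<lambda>r. (2 * r * \<theta> (r^2)) *R ?VJ r) - ?VJ c) \<le> \<epsilon>"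
    using ab st \<theta>' continuous_on_subset[OF Vc[of "famJ k \<mu>", OF famJ_deriv]]
    by (intro bump_average[of a b _ _ _ \<Theta>])
      (auto simp: good_def intro!: continuous_at_imp_continuous_on DERIV_isCont)
   then show ?thesis unfolding z by simp
  qed
  then show ?thesis by (meson dense_ge dual_order.antisym norm_ge_zero norm_eq_zero not_le field_le_epsilon le_add_same_cancel2)
 qed
 have VY: "?VY c1 = ?VY c2" if c: "c1 \<in> U" "c2 \<in> U" for c1 c2
 proof -
  note Yd = famY_deriv[OF \<mu> k]
  have "norm (?VY c1 - ?VY c2) \<le> 0 + 2 * \<epsilon>" if \<epsilon>: "\<epsilon> > 0" for \<epsilon>
  proof -
   obtain a1 b1 where ab1: "good a1 b1" "\<And>r. r \<in> {a1..b1} ==> norm (?VY r - ?VY c1) \<le> \<epsilon>"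
    using small[OF Vc[of "famY k \<mu>", OF Yd] c(1) \<epsilon>] by blast
   obtain a2 b2 where ab2: "good a2 b2" "\<And>r. r \<in> {a2..b2} ==> norm (?VY r - ?VY c2) \<le> \<epsilon>"
    using small[OF Vc[of "famY k \<mu>", OF Yd] c(2) \<epsilon>] by blast
   have lt: "a1^2 < b1\<^sup>2" "a2^2 < b2\<^sup>2" using ab1(1) ab2(1) by (auto simp: good_def intro!: power_strict_mono)
   obtain \<theta>1 \<Theta>1 where st1: "\<And>n. C_k n (\<lambda>s. cx (\<theta>1 s))" "\<And>n. C_k n (\<lambda>s. cx (\<Theta>1 s))"
    "\<And>s. (\<Theta>1 has_real_derivative \<theta>1 s) (at s)" "\<And>s. \<theta>1 s \<ge> 0" "\<And>s. s \<notin> {a1^2<..<b1\<^sup>2} ==> \<theta>1 s = 0"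
    "\<And>s. s \<le> a1^2 ==> \<Theta>1 s = 0" "\<And>s. s \<ge> b1^2 ==> \<Theta>1 s = 1" using smooth_step[OF lt(1)] by metis
   obtain \<theta>2 \<Theta>2 where st2: "\<And>n. C_k n (\<lambda>s. cx (\<theta>2 s))" "\<And>n. C_k n (\<lambda>s. cx (\<Theta>2 s))"
    "\<And>s. (\<Theta>2 has_real_derivative \<theta>2 s) (at s)" "\<And>s. \<theta>2 s \<ge> 0" "\<And>s. s \<notin> {a2^2<..<b2\<^sup>2} ==> \<theta>2 s = 0"
    "\<And>s. s \<le> a2^2 ==> \<Theta>2 s = 0" "\<And>s. s \<ge> b2^2 ==> \<Theta>2 s = 1" using smooth_step[OF lt(2)] by metis
   obtain \<theta>1' where \<theta>1': "\<And>s. (\<theta>1 has_real_derivative \<theta>1' s) (at s)" "continuous_on UNIV \<theta>1'"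
    using C_k_real_derivative[OF st1(1)] by blast
   obtain \<theta>2' where \<theta>2': "\<And>s. (\<theta>2 has_real_derivative \<theta>2' s) (at s)" "continuous_on UNIV \<theta>2'"
    using C_k_real_derivative[OF st2(1)] by blast
   note K1 = key[of a1 b1 \<theta>1 \<theta>1' "famY k \<mu>", OF ab1(1) \<theta>1' st1(5) Yd] and K2 = key[of a2 b2 \<theta>2 \<theta>2' "famY k \<mu>", OF ab2(1) \<theta>2' st2(5) Yd]
   \<comment> \<open>For arguments below this value both steps vanish, so the product with the
     singular profile is smooth at the origin.\<close>
   define a where "a = min (a1^2) (a2^2)"
   define b where "b = max b1 b2"
   have a: "a > 0" using ab1(1) ab2(1) by (auto simp: a_def good_def)
   have z0: "\<Theta>1 s - \<Theta>2 s = 0" if "s < a" for s using that by (simp add: a_def st1(6) st2(6))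
   define h where "h = (\<lambda>x::'a. cx (\<Theta>1 (sq x) - \<Theta>2 (sq x)) * p x)"
   \<comment> \<open>The difference of two steps vanishes near the origin and beyond both shells.
     The exceptional point may lie between the shells, which is how constancy passes from one side
     of its sphere to the other.\<close>
   define \<phi> where "\<phi> = (\<lambda>x. cx ((\<Theta>1 (sq x) - \<Theta>2 (sq x)) * famY k \<mu> 0 (sq x)) * p x)"
   have tf: "test_function (ball 0 \<rho>) \<phi>"
   proof (rule test_functionI[where K = "cball 0 b"])
    show "C_k n \<phi>" for n
    proof -
     have "C_k n h" for n unfolding h_def of_real_diff
      by (rule C_k_mult[OF C_k_diff[OF C_k_of_real_radial[OF st1(2)] C_k_of_real_radial[OF st2(2)]]
         solid_harmonicD(1)[OF p]])
     then have "C_k n (\<lambda>x. h x * cx (famY k \<mu> 0 (sq x)))"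
      by (rule C_k_famY_cutoff[OF \<mu> k _ _ a]) (use z0 in \<open>simp add: h_def\<close>)
     then show ?thesis by (simp add: h_def \<phi>_def mult_ac)
    qed
    have "b1 \<in> U" "b2 \<in> U" using ab1(1) ab2(1) by (auto simp: good_def)
    then have "b1 < \<rho>" "b2 < \<rho>" using U by auto
    then show "cball 0 b \<subseteq> ball (0::'a) \<rho>" by (auto simp: b_def le_max_iff_disj)
    show "\<phi> x = 0" if "x \<notin> cball 0 b" for x
    proof -
     have "b1^2 \<le> sq x" "b2^2 \<le> sq x"
      using power_mono[of b1 "norm x" 2] power_mono[of b2 "norm x" 2] that ab1(1) ab2(1)
      by (auto simp: b_def good_def dot_square_norm)
     then show ?thesis by (simp add: \<phi>_def st1(7) st2(7))
    qed
   qed auto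
   define TT where "TT = (\<lambda>s. T (famY k \<mu>) \<theta>1 \<theta>1' s - T (famY k \<mu>) \<theta>2 \<theta>2' s)"
   have eq: "helmholtz k \<phi> x = cx (TT (sq x)) * p x" for x
   proof (cases "x = 0")
    case True
    \<comment> \<open>The derivative rules for \<open>famY\<close> hold for s > 0 only, but \<phi>
      is identically zero near the origin.\<close>
    have op: "open {x::'a. sq x < a}" by (intro open_Collect_less continuous_intros)
    moreover have "\<phi> x = 0" if "sq x < a" for x using z0[OF that] by (simp add: \<phi>_def)
    ultimately have "pdir v \<phi> x = 0" if "sq x < a" for v x
     using pdir_cong_open[of "{x::'a. sq x < a}" x \<phi> "\<lambda>_. 0" v] that by (simp add: pdir_const)
    then have "pdir v (pdir v \<phi>) 0 = 0" for v
     using pdir_cong_open[of "{x::'a. sq x < a}" 0 "pdir v \<phi>" "\<lambda>_. 0" v] op a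
     by (simp add: pdir_const)
    then have "laplacian \<phi> 0 = 0" by (simp add: laplacian_pdir)
    moreover have "\<phi> 0 = 0" using z0[OF a] by (simp add: \<phi>_def)
    ultimately show ?thesis using True K1(4) K2(4) by (simp add: TT_def)
   next
    case False
    have "helmholtz k \<phi> x = (?F (famY k \<mu>) (\<lambda>s. \<theta>1 s - \<theta>2 s) (\<lambda>s. \<theta>1' s - \<theta>2' s) x)"
     unfolding \<phi>_def T_def by (rule helmholtz_radial_product[OF p, of "{0<..}"])
       (use False famY_ode[OF \<mu> k] in \<open>auto simp: d4 intro!: DERIV_diff \<theta>1' \<theta>2' Yd st1(3) st2(3)\<close>)
    also have "T (famY k \<mu>) (\<lambda>s. \<theta>1 s - \<theta>2 s) (\<lambda>s. \<theta>1' s - \<theta>2' s) (sq x) = TT (sq x)"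
     by (simp add: T_def TT_def algebra_simps)
    finally show ?thesis .
   qed
   have "0 = (LINT x:ball 0 \<rho>|lborel. u x * (cx (TT (sq x)) * p x))"
    using weak[OF tf] unfolding eq by simp
   also have "... = (LBINT x. u x * (?F (famY k \<mu>) \<theta>1 \<theta>1' x)
     - u x * (?F (famY k \<mu>) \<theta>2 \<theta>2' x))" unfolding set_lebesgue_integral_def
   proof (rule lint_cong)
    show "indicat_real (ball 0 \<rho>) x *R (u x * (cx (TT (sq x)) * p x)) =
     u x * (?F (famY k \<mu>) \<theta>1 \<theta>1' x) - u x * (?F (famY k \<mu>) \<theta>2 \<theta>2' x)" for x
     using K1(3)[of x] K2(3)[of x] by (cases "x \<in> ball 0 \<rho>") (simp_all add: TT_def algebra_simps)
   qed simp
   also have "... = integral {a1..b1} (\<lambda>r. (2 * r * \<theta>1 (r^2)) *R ?VY r)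
     - integral {a2..b2} (\<lambda>r. (2 * r * \<theta>2 (r^2)) *R ?VY r)" (is "_ = ?I1 - ?I2")
    using K1(1,2) K2(1,2) by simp
   finally have z: "?I1 = ?I2" by simp
   have 1: "norm (?I1 - ?VY c1) \<le> \<epsilon>"
    using ab1 st1 \<theta>1' continuous_on_subset[OF Vc[of "famY k \<mu>", OF Yd]]
    by (intro bump_average[of a1 b1 _ _ _ \<Theta>1])
      (auto simp: good_def intro!: continuous_at_imp_continuous_on DERIV_isCont)
   have 2: "norm (?I2 - ?VY c2) \<le> \<epsilon>"
    using ab2 st2 \<theta>2' continuous_on_subset[OF Vc[of "famY k \<mu>", OF Yd]]
    by (intro bump_average[of a2 b2 _ _ _ \<Theta>2])
      (auto simp: good_def intro!: continuous_at_imp_continuous_on DERIV_isCont)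
   have "?VY c1 - ?VY c2 = (?I2 - ?VY c2) - (?I1 - ?VY c1)" using z by simp
   then show ?thesis using norm_triangle_ineq4[of "?I2 - ?VY c2" "?I1 - ?VY c1"] 1 2 by simp
  qed
  note le = this
  have "norm (?VY c1 - ?VY c2) \<le> 0"
  proof (rule field_le_epsilon)
   show "norm (?VY c1 - ?VY c2) \<le> 0 + e" if "e > 0" for e using le[of "e / 2"] that by simp
  qed
  then show ?thesis by simp
 qed
 \<comment> \<open>The constant value of r^N times the Wronskian, in r, of the two profiles; the 2
   is the chain rule through r^2.\<close>
 define B where "B = 2 * k powr (- 2 * \<mu>) / pi"
 have B: "B > 0" using k by (simp add: B_def)
 obtain A where A: "\<And>c. c \<in> U ==> ?VY c = A" using VY by metis
 have "f r = (A / cx B) * cx (r ^ l * redJ \<mu> (k^2 * r^2))" if r: "r \<in> U" for r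
 proof -
  have r0: "r > 0" using r U by auto
  let ?J = "\<lambda>m. famJ k \<mu> m (r^2)" and ?Y = "\<lambda>m. famY k \<mu> m (r^2)"
  have "r ^ N * (2 * r) * (?J 0 * ?Y 1 - ?J 1 * ?Y 0) = B"
  proof -
   have "r ^ N * r = (r^2) powr (\<mu> + 1)"
   proof -
    have "(r^2) powr (\<mu> + 1) = r powr (2 * (\<mu> + 1))"
     using r0 powr_powr[of r 2 "\<mu> + 1"] by (simp add: powr_numeral)
    also have "2 * (\<mu> + 1) = real (Suc N)" using d by (simp add: \<mu>_def N_def of_nat_diff)
    also have "r powr real (Suc N) = r ^ Suc N" using r0 by (rule powr_realpow)
    finally show ?thesis by simp
   qed
   then have "r ^ N * (2 * r) * (?J 0 * ?Y 1 - ?J 1 * ?Y 0) =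
     2 * (k powr (- 2 * \<mu>) / pi) * ((r^2) powr (\<mu> + 1) * (r^2) powr (- \<mu> - 1))"
    using famJ_famY_wronskian[OF \<mu> k, of "r^2"] r0 by (simp add: mult_ac)
   also have "(r^2) powr (\<mu> + 1) * (r^2) powr (- \<mu> - 1) = 1" using r0 by (simp flip: powr_add)
   finally show ?thesis by (simp add: B_def)
  qed
  \<comment> \<open>Cramer's rule for the two Wronskian relations eliminates the derivative of
    y.\<close>
  then have "cx B * y r = (r ^ N * (2 * r) * (?J 0 * ?Y 1 - ?J 1 * ?Y 0)) *R y r"
   by (simp add: scaleR_conv_of_real)
  also have "... = ?J 0 *R ?VY r - ?Y 0 *R ?VJ r" by (simp add: V_def algebra_simps)
  also have "... = cx (?J 0) * A" using VJ[OF r] A[OF r] by (simp add: scaleR_conv_of_real)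
  finally have "y r = cx (?J 0) * A / cx B" using B by (simp add: field_simps)
  then show ?thesis unfolding fy[OF r] by (simp add: famJ_def scaleR_conv_of_real mult_ac)
 qed
 then show ?thesis unfolding f_def U_def by blast
qed

section \<open>Solid harmonics\<close>

lemma complex_polynomial_iff:
 fixes p :: "'a::euclidean_space => complex"
 shows "polynomial_function p \<longleftrightarrow>
  real_polynomial_function (\<lambda>x. Re (p x)) \<and> real_polynomial_function (\<lambda>x. Im (p x))"
 unfolding polynomial_function_iff_Basis_inner Basis_complex_def by (simp add: inner_complex_def)

lemma complex_polynomial_mult:
 fixes p q :: "'a::euclidean_space => complex"
 assumes "polynomial_function p" "polynomial_function q"
 shows "polynomial_function (\<lambda>x. p x * q x)" using assms unfolding complex_polynomial_iff
 by (auto intro!: real_polynomial_function_diff real_polynomial_function.intros(3,4))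

lemma complex_polynomial_induct [consumes 1, case_names linear const add mult]:
 fixes p :: "'a::euclidean_space => complex"
 assumes "polynomial_function p"
  and lin: "\<And>f. bounded_linear f ==> P (\<lambda>x::'a. cx (f x))"
  and const: "\<And>c. P (\<lambda>x. c)"
  and add: "\<And>f g. polynomial_function f ==> polynomial_function g ==> P f ==> P g ==> P (\<lambda>x. f x + g x)"
  and mult: "\<And>f g. polynomial_function f ==> polynomial_function g ==> P f ==> P g ==> P (\<lambda>x. f x * g x)"
 shows "P p"
proof -
 have pr: "polynomial_function (\<lambda>x. cx (f x))" if "real_polynomial_function f" for f :: "'a => real"
  using that real_polynomial_function_eq[of f]
   polynomial_function_compose[of f cx] polynomial_function_bounded_linear[OF bounded_linear_of_real]
  by (simp add: o_def)
 have real: "P (\<lambda>x. cx (f x))" if "real_polynomial_function f" for f :: "'a => real" using that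
 proof (induction rule: real_polynomial_function.induct)
  case (linear f)
  then show ?case by (rule lin)
 next
  case (const c)
  then show ?case using assms(3)[of "cx c"] by simp
 next
  case (add f g)
  then show ?case using assms(4)[OF pr pr, of f g] by simp
 next
  case (mult f g)
  then show ?case using assms(5)[OF pr pr, of f g] by simp
 qed
 note parts = complex_polynomial_function_parts[OF assms(1)]
 have "P (\<lambda>x. cx (Re (p x)) + \<i> * cx (Im (p x)))"
  using parts by (intro add mult const real pr complex_polynomial_mult polynomial_function_const) auto
 then show ?thesis by (simp add: complex_eq[symmetric])
qed

lemma polynomial_differentiable:
 "polynomial_function p ==> p differentiable at x" for p :: "'a::euclidean_space => complex"
 using C_k_SucD(1)[OF C_k_polynomial] by blast

lemma polynomial_cmult:
 "polynomial_function p ==> polynomial_function (\<lambda>x. c * p x)" for p :: "'a::euclidean_space => complex"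
 by (intro complex_polynomial_mult polynomial_function_const)

lemma polynomial_pdir:
 fixes p :: "'a::euclidean_space => complex"
 assumes "polynomial_function p"
 shows "polynomial_function (pdir a p)" using assms
proof (induction rule: complex_polynomial_induct)
 case (linear f)
 have "pdir a (\<lambda>x. cx (f x)) = (\<lambda>x. cx (f a))"
  by (rule ext, rule pdir_eq[OF bounded_linear_imp_has_derivative])
    (rule bounded_linear_compose[OF bounded_linear_of_real linear])
 then show ?case by simp
next
 case (const c)
 have "pdir a (\<lambda>x::'a. c) = (\<lambda>x. 0)" by (auto simp: pdir_const)
 then show ?case by simp
next
 case (add f g)
 then have "pdir a (\<lambda>x. f x + g x) = (\<lambda>x. pdir a f x + pdir a g x)"
  by (auto simp: pdir_add polynomial_differentiable)
 then show ?case using add by (simp add: polynomial_function_add)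
next
 case (mult f g)
 then have "pdir a (\<lambda>x. f x * g x) = (\<lambda>x. f x * pdir a g x + pdir a f x * g x)"
  by (auto simp: pdir_mult polynomial_differentiable)
 then show ?case using mult by (simp add: polynomial_function_add complex_polynomial_mult)
qed

lemma pdir_commute:
 fixes p :: "'a::euclidean_space => complex"
 assumes "polynomial_function p"
 shows "pdir a (pdir b p) = pdir b (pdir a p)" using assms
proof (induction rule: complex_polynomial_induct)
 case (linear f)
 have "pdir a (\<lambda>x. cx (f x)) = (\<lambda>x. cx (f a))" for a
  by (rule ext, rule pdir_eq[OF bounded_linear_imp_has_derivative])
    (rule bounded_linear_compose[OF bounded_linear_of_real linear])
 then show ?case by (auto simp: pdir_const)
next
 case (const c)
 have "pdir a (\<lambda>x::'a. c) = (\<lambda>x. 0)" for a c by (auto simp: pdir_const)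
 then show ?case by simp
next
 case (add f g)
 have "pdir a (\<lambda>x. f x + g x) = (\<lambda>x. pdir a f x + pdir a g x)" for a
  using add by (auto simp: pdir_add polynomial_differentiable)
 moreover have "pdir a (\<lambda>x. pdir b f x + pdir b g x) = (\<lambda>x. pdir a (pdir b f) x + pdir a (pdir b g) x)" for a b
  using add by (auto simp: pdir_add polynomial_differentiable polynomial_pdir)
 ultimately show ?case using add by simp
next
 case (mult f g)
 have 1: "pdir a (\<lambda>x. f x * g x) = (\<lambda>x. f x * pdir a g x + pdir a f x * g x)" for a
  using mult by (auto simp: pdir_mult polynomial_differentiable)
 have 2: "pdir a (\<lambda>x. f x * pdir b g x + pdir b f x * g x) x =
   f x * pdir a (pdir b g) x + pdir a f x * pdir b g x
   + (pdir b f x * pdir a g x + pdir a (pdir b f) x * g x)" for a b x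
  using mult by (simp add: pdir_add pdir_mult polynomial_differentiable polynomial_pdir
    complex_polynomial_mult differentiable_mult)
 show ?case unfolding 1
 proof
  show "pdir a (\<lambda>x. f x * pdir b g x + pdir b f x * g x) x =
    pdir b (\<lambda>x. f x * pdir a g x + pdir a f x * g x) x" for x
   unfolding 2 mult.IH by (simp only: mult_ac add_ac)
 qed
qed

lemma laplacian_pdir_commute:
 fixes p :: "'a::euclidean_space => complex"
 assumes "polynomial_function p"
 shows "laplacian (pdir a p) x = pdir a (laplacian p) x"
proof -
 have eq: "laplacian p = (\<lambda>x. \<Sum>b\<in>Basis. pdir b (pdir b p) x)" by (auto simp: laplacian_pdir)
 have "((\<lambda>x. \<Sum>b\<in>Basis. pdir b (pdir b p) x) has_derivative
   (\<lambda>h. \<Sum>b\<in>Basis. pdir h (pdir b (pdir b p)) x)) (at x)"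
  by (intro has_derivative_sum C_k_SucD(2)[OF C_k_polynomial] polynomial_pdir assms)
 then have "pdir a (laplacian p) x = (\<Sum>b\<in>Basis. pdir a (pdir b (pdir b p)) x)"
  unfolding eq by (rule pdir_eq)
 also have "... = (\<Sum>b\<in>Basis. pdir b (pdir b (pdir a p)) x)"
  using pdir_commute[OF assms] pdir_commute[OF polynomial_pdir[OF assms]] by simp
 finally show ?thesis by (simp add: laplacian_pdir)
qed

lemma pdir_homogeneous:
 fixes p :: "'a::euclidean_space => complex"
 assumes "\<And>x. p (t *R x) = cx (t ^ l) * p x" and "\<And>x. p differentiable at x" and "t \<noteq> 0"
 shows "pdir a p (t *R x) = cx (t ^ l / t) * pdir a p x"
proof -
 obtain D where D: "(p has_derivative D) (at (t *R x))" using assms(2) by (auto simp: differentiable_def)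
 obtain D' where D': "(p has_derivative D') (at x)" using assms(2) by (auto simp: differentiable_def)
 have "((\<lambda>x. p (t *R x)) has_derivative (\<lambda>h. D (t *R h))) (at x)"
  by (rule has_derivative_compose[of "\<lambda>x. t *R x" "\<lambda>h. t *R h", OF _ D]) (auto intro!: derivative_eq_intros)
 moreover have "((\<lambda>x. cx (t ^ l) * p x) has_derivative (\<lambda>h. cx (t ^ l) * D' h)) (at x)"
  by (intro has_derivative_mult_right D')
 ultimately have "D (t *R a) = cx (t ^ l) * D' a"
  unfolding assms(1) by (metis has_derivative_unique)
 then have "cx t * D a = cx (t ^ l) * D' a"
  using linear_scale[OF has_derivative_linear[OF D], of t a] by (simp add: scaleR_conv_of_real)
 then show ?thesis using assms(3) by (simp add: pdir_eq[OF D] pdir_eq[OF D'] field_simps)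
qed

lemma laplacian_homogeneous:
 fixes p :: "'a::euclidean_space => complex"
 assumes "\<And>x. p (t *R x) = cx (t ^ l) * p x" and "C_k 2 p" and "t > 0"
 shows "cx (t^2) * laplacian p (t *R x) = cx (t ^ l) * laplacian p x"
proof -
 have dif: "p differentiable at x" "b \<in> Basis ==> pdir b p differentiable at x" for x b
  using assms(2) C_k_SucD(1) C_k_SucD(3) unfolding numeral_2_eq_2 by blast+
 have "cx (t^2) * pdir b (pdir b p) (t *R x) = cx (t ^ l) * pdir b (pdir b p) x"
  if b: "b \<in> Basis" for b
 proof -
  obtain D where D: "(pdir b p has_derivative D) (at (t *R x))" using dif(2)[OF b] by (auto simp: differentiable_def)
  obtain D' where D': "(pdir b p has_derivative D') (at x)" using dif(2)[OF b] by (auto simp: differentiable_def)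
  have h: "pdir b p (t *R x) = cx (t ^ l / t) * pdir b p x" for x
   by (rule pdir_homogeneous) (use assms dif in auto)
  have "((\<lambda>x. pdir b p (t *R x)) has_derivative (\<lambda>h. D (t *R h))) (at x)"
   by (rule has_derivative_compose[of "\<lambda>x. t *R x" "\<lambda>h. t *R h", OF _ D]) (auto intro!: derivative_eq_intros)
  moreover have "((\<lambda>x. cx (t ^ l / t) * pdir b p x) has_derivative (\<lambda>h. cx (t ^ l / t) * D' h)) (at x)"
   by (intro has_derivative_mult_right D')
  ultimately have "D (t *R b) = cx (t ^ l / t) * D' b" unfolding h by (metis has_derivative_unique)
  then have "cx t * D b = cx (t ^ l / t) * D' b"
   using linear_scale[OF has_derivative_linear[OF D], of t b] by (simp add: scaleR_conv_of_real)
  then show ?thesis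
   using assms(3) by (simp add: pdir_eq[OF D] pdir_eq[OF D'] power2_eq_square field_simps)
 qed
 then show ?thesis by (simp add: laplacian_pdir sum_distrib_left)
qed

lemma solid_harmonic_0:
 assumes "solid_harmonic 0 p"
 shows "p x = p y"
 using solid_harmonicD(2)[OF assms, of 0] by (metis mult_1 of_real_1 power_0 scaleR_zero_left)

text \<open>The chain rule gives homogeneity only after division by t; the case t = 0 follows by
  continuity. Harmonicity is inherited because the Laplacian commutes with directional derivatives
  of polynomials.\<close>

lemma solid_harmonic_pdir:
 fixes p :: "'a::euclidean_space => complex"
 assumes p: "solid_harmonic (Suc l) p"
 shows "solid_harmonic l (pdir a p)"
proof -
 have poly: "polynomial_function p" using p by (simp add: solid_harmonic_def)
 have eq: "pdir a p (t *R x) = cx (t ^ l) * pdir a p x" if "t \<noteq> 0" for t x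
  using pdir_homogeneous[of p t "Suc l" a x] solid_harmonicD(2)[OF p] polynomial_differentiable[OF poly] that
  by simp
 have c: "continuous_on UNIV (pdir a p)"
  by (rule C_k_continuous[OF C_k_polynomial[OF polynomial_pdir[OF poly]]])
 have "pdir a p (0 *R x) = cx (0 ^ l) * pdir a p x" for x
 proof -
  have "((\<lambda>t. t *R x) \<longlongrightarrow> 0 *R x) (at (0::real))" by (intro tendsto_intros)
  then have 1: "((\<lambda>t. pdir a p (t *R x)) \<longlongrightarrow> pdir a p (0 *R x)) (at 0)"
   by (rule continuous_on_tendsto_compose[OF c]) auto
  have 2: "((\<lambda>t. cx (t ^ l) * pdir a p x) \<longlongrightarrow> cx (0 ^ l) * pdir a p x) (at 0)"
   by (intro tendsto_intros)
  have 3: "\<forall>\<^sub>F t in at 0. cx (t ^ l) * pdir a p x = pdir a p (t *R x)"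
   using eq by (simp add: eventually_at_filter)
  show ?thesis by (rule LIM_unique[OF 1 Lim_transform_eventually[OF 2 3]])
 qed
 then have "pdir a p (t *R x) = cx (t ^ l) * pdir a p x" for t x using eq by (cases "t = 0") auto
 moreover have "laplacian (pdir a p) x = 0" for x
 proof -
  have "laplacian p = (\<lambda>x. 0)" using solid_harmonicD(3)[OF p] by auto
  then show ?thesis unfolding laplacian_pdir_commute[OF poly] by (simp add: pdir_const)
 qed
 ultimately show ?thesis using polynomial_pdir[OF poly] by (simp add: solid_harmonic_def)
qed

text \<open>The divergence theorem in disguise: F is paired with a radial cutoff \<phi>, the
  Laplacian is moved across, and both sides are evaluated in polar coordinates. Homogeneity
  separates off the radial integrals, which one integration by parts relates to each other.\<close>

theorem sphere_integral_laplacian: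
 fixes F :: "'a::euclidean_space => complex"
 assumes d: "DIM('a) \<ge> 3" and F: "\<And>n. C_k n F" "\<And>t x. F (t *R x) = cx (t ^ m) * F x"
 shows "(SPH w. laplacian F w) = of_nat (m * (m + DIM('a) - 2)) * (SPH w. F w)"
proof -
 define A where "A = (SPH w. F w)"
 define B where "B = (SPH w. laplacian F w)"
 \<comment> \<open>The exponent of r when the Laplacian of F, homogeneous of degree m - 2, meets the
   Jacobian r^(d-1).\<close>
 define M where "M = m + DIM('a) - 3"
 have M: "m + DIM('a) - 2 = Suc M" "DIM('a) - 1 + m = Suc (Suc M)" using d by (auto simp: M_def)
 obtain \<theta> \<Theta> where st: "\<And>n. C_k n (\<lambda>s. cx (\<theta> s))" "\<And>n. C_k n (\<lambda>s. cx (\<Theta> s))"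
  "\<And>s. (\<Theta> has_real_derivative \<theta> s) (at s)" "\<And>s. \<theta> s \<ge> 0" "\<And>s. s \<notin> {1<..<4} ==> \<theta> s = 0"
  "\<And>s. s \<le> 1 ==> \<Theta> s = 0" "\<And>s. s \<ge> 4 ==> \<Theta> s = 1" by (rule smooth_step[of 1 4]) auto
 obtain \<theta>' where \<theta>': "\<And>s. (\<theta> has_real_derivative \<theta>' s) (at s)" "continuous_on UNIV \<theta>'"
  using C_k_real_derivative[OF st(1)] by blast
 have c\<theta>: "continuous_on S \<theta>" "continuous_on S \<Theta>" for S
  using DERIV_isCont[OF \<theta>'(1)] DERIV_isCont[OF st(3)] by (auto intro: continuous_at_imp_continuous_on)
 have \<Theta>1: "\<Theta> s \<le> 1" for s
 proof (cases "s \<le> 4")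
  case True
  have "\<Theta> s \<le> \<Theta> 4" by (rule DERIV_nonneg_imp_nondecreasing[OF True]) (use st(3,4) in blast)
  then show ?thesis using st(7)[of 4] by simp
 qed (use st(7)[of s] in simp)
 define \<phi> where "\<phi> = (\<lambda>x::'a. cx (1 - \<Theta> (sq x)))"
 have tf: "test_function UNIV \<phi>"
 proof (rule test_functionI[where K = "cball 0 2"])
  show "C_k n \<phi>" for n
   unfolding \<phi>_def of_real_diff by (rule C_k_diff[OF C_k_const C_k_of_real_radial[OF st(2)]])
  show "\<phi> x = 0" if "x \<notin> cball 0 2" for x
   using power_mono[of 2 "norm x" 2] that st(7)[of "sq x"] by (auto simp: \<phi>_def dot_square_norm)
 qed auto
 have lap: "laplacian \<phi> x = - cx (4 * (sq x) * \<theta>' (sq x) + 2 * real DIM('a) * \<theta> (sq x))" for x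
 proof -
  have "laplacian (\<lambda>x. cx (1 - \<Theta> (sq x)) * 1) x =
   (4 * cx (sq x) * cx (- \<theta>' (sq x)) + cx (2 * real DIM('a) + 4 * real 0) * cx (- \<theta> (sq x))) * 1
   + cx (1 - \<Theta> (sq x)) * laplacian (\<lambda>x::'a. 1) x"
  proof (rule laplacian_radial_mult[OF open_UNIV])
   show "((\<lambda>s. cx (1 - \<Theta> s)) has_vector_derivative cx (- \<theta> t)) (at t)" for t
    by (rule has_vector_derivative_of_real) (auto intro!: derivative_eq_intros st(3))
   show "((\<lambda>s. cx (- \<theta> s)) has_vector_derivative cx (- \<theta>' t)) (at t)" for t
    by (rule has_vector_derivative_of_real) (auto intro!: derivative_eq_intros \<theta>'(1))
  qed (auto simp: C_k_const)
  then show ?thesis by (simp add: \<phi>_def laplacian_const algebra_simps)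
 qed
 define y where "y = (\<lambda>r::real. r ^ m *R A)"
 define y' where "y' = (\<lambda>r::real. (real m * r ^ (m - 1)) *R A)"
 have Fc: "continuous_on S F" for S by (rule C_k_continuous[OF F(1)])
 have polarF: "(SPH w. F (r *R w)) = y r" for r by (simp add: F(2) y_def A_def scaleR_conv_of_real)
 have yd: "(y has_vector_derivative y' r) (at r within S)" for r S unfolding y_def y'_def
  by (rule has_vector_derivative_scaleR[where g' = 0, simplified])
    (auto intro!: derivative_eq_intros)
 have "(LBINT x. F x * (cx (4 * (sq x) * \<theta>' (sq x) + 2 * real DIM('a) * \<theta> (sq x)) * 1)) =
   integral {1..2} (\<lambda>r. (2 * r * \<theta> (r^2)) *R (r ^ (DIM('a) - 1 + 2 * 0) *R ((2 * r * 0) *R y r - 1 *R y' r)))"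
 proof (rule integral_radial_test(2)[where \<theta>' = \<theta>'])
  show "(SPH w. F (r *R w) * 1) = r ^ 0 *R y r" for r using polarF by simp
  show "continuous_on {1..2} y'" unfolding y'_def by (intro continuous_intros)
  show "\<theta> s = 0" if "s \<notin> {1\<^sup>2<..<2\<^sup>2}" for s using st(5)[of s] that by simp
 qed (use \<theta>' yd Fc in auto)
 then have 1: "(LBINT x. F x * laplacian \<phi> x) = integral {1..2} (\<lambda>r. (real m * (2 * r * \<theta> (r^2) * r ^ Suc M)) *R A)"
 proof -
  assume "(LBINT x. F x * (cx (4 * (sq x) * \<theta>' (sq x) + 2 * real DIM('a) * \<theta> (sq x)) * 1)) =
   integral {1..2} (\<lambda>r. (2 * r * \<theta> (r^2)) *R (r ^ (DIM('a) - 1 + 2 * 0) *R ((2 * r * 0) *R y r - 1 *R y' r)))" (is "?L = ?R")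
  have "(LBINT x. F x * laplacian \<phi> x) = - ?L"
   by (simp only: lap mult_minus_right lint_minus mult_1_right)
  also have "... = - ?R" using \<open>?L = ?R\<close> by simp
  also have "... = integral {1..2} (\<lambda>r. (real m * (2 * r * \<theta> (r^2) * r ^ Suc M)) *R A)"
  proof -
   have "(2 * r * \<theta> (r^2)) *R (r ^ (DIM('a) - 1 + 2 * 0) *R ((2 * r * 0) *R y r - 1 *R y' r))
     = - ((real m * (2 * r * \<theta> (r^2) * r ^ Suc M)) *R A)" for r
   proof (cases m)
    case (Suc m')
    then have "Suc M = DIM('a) - 1 + (m - 1)" using d by (simp add: M_def)
    then have "r ^ Suc M = r ^ (DIM('a) - 1) * r ^ (m - 1)" by (simp only: power_add)
    then show ?thesis by (simp add: y'_def del: power_Suc)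
   qed (simp add: y'_def)
   then show ?thesis by simp
  qed
  finally show ?thesis .
 qed
 define g where "g = (\<lambda>r. r ^ M * (1 - \<Theta> (r^2)))"
 have cg: "continuous_on S g" for S
  unfolding g_def by (intro continuous_intros continuous_on_compose2[OF c\<theta>(2)[of UNIV]]) auto
 have int: "integrable lborel (\<lambda>x. laplacian F x * \<phi> x)"
  using integral_laplacian_swap(2)[OF F(1) tf] .
 have 2: "(LBINT x. laplacian F x * \<phi> x) = integral {0..2} (\<lambda>r. g r *R B)"
 proof -
  have sph: "(r ^ (DIM('a) - 1) * indicator {0<..} r) *R (SPH w. laplacian F (r *R w) * \<phi> (r *R w))
    = indicator {0<..2} r *R (g r *R B)" for r
  proof (cases "r > 0")
   case True
   have "(SPH w. laplacian F (r *R w) * \<phi> (r *R w)) =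
     (SPH w. cx (r ^ m / r^2 * (1 - \<Theta> (r^2))) * laplacian F w)"
   proof (rule lint_cong)
    fix w :: 'a
    assume "w \<in> space sphere_measure"
    then have "sq (r *R w) = r^2" by (simp add: dot_square_norm power2_eq_square)
    moreover have "cx (r^2) * laplacian F (r *R w) = cx (r ^ m) * laplacian F w"
     using laplacian_homogeneous[of F r m] F True by auto
    then have "laplacian F (r *R w) = cx (r ^ m / r^2) * laplacian F w"
     using True by (simp add: field_simps)
    ultimately show "laplacian F (r *R w) * \<phi> (r *R w) = cx (r ^ m / r^2 * (1 - \<Theta> (r^2))) * laplacian F w"
     by (simp add: \<phi>_def mult_ac)
   qed simp
   also have "... = cx (r ^ m / r^2 * (1 - \<Theta> (r^2))) * B"
    unfolding B_def by (rule integral_mult_right_zero)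
   finally have e: "(SPH w. laplacian F (r *R w) * \<phi> (r *R w)) = ..." .
   have rM: "r ^ (DIM('a) - 1) * (r ^ m / r^2) = r ^ M"
    using True M(2) by (simp add: power2_eq_square flip: power_add)
   show ?thesis
   proof (cases "r \<le> 2")
    case True
    then show ?thesis unfolding e using \<open>r > 0\<close>
     by (simp add: g_def scaleR_conv_of_real rM[symmetric])
   next
    case False
    then have "\<Theta> (r^2) = 1" using st(7)[of "r^2"] power_mono[of 2 r 2] by simp
    then show ?thesis unfolding e using False by simp
   qed
  qed simp
  have "(LBINT x. laplacian F x * \<phi> x) = (LBINT r. indicator {0<..2} r *R (g r *R B))"
   unfolding integral_polar(2)[OF int] sph ..
  also have "... = (LBINT r. indicator {0..2} r *R (g r *R B))"
  proof (rule integral_cong_AE)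
   have m: "g \<in> borel_measurable borel" by (rule borel_measurable_continuous_onI[OF cg])
   show "(\<lambda>r. indicator {0<..2} r *R (g r *R B)) \<in> borel_measurable lborel"
    "(\<lambda>r. indicator {0..2} r *R (g r *R B)) \<in> borel_measurable lborel" using m by simp_all
   show "AE r in lborel. indicator {0<..2} r *R (g r *R B) = indicator {0..2} r *R (g r *R B)"
    using AE_lborel_singleton[of "0::real"] by (rule eventually_mono) (auto simp: indicator_def)
  qed
  also have "... = integral {0..2} (\<lambda>r. g r *R B)"
   using set_borel_integral_eq_integral(2)[of "{0..2}" "\<lambda>r. g r *R B"]
    borel_integrable_compact[of "{0..2}" "\<lambda>r. g r *R B"] cg
   by (simp add: set_integrable_def set_lebesgue_integral_def continuous_intros)
  finally show ?thesis .
 qed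
 define I where "I = integral {0..2} g"
 have "I \<noteq> 0"
 proof
  assume "I = 0"
  moreover have "g r \<ge> 0" if "r \<in> {0..2}" for r using that \<Theta>1 by (simp add: g_def)
  ultimately have "g 1 = 0" using integral_eq_0_iff[of 0 2 g] cg by (auto simp: I_def)
  then show False using st(6)[of 1] by (simp add: g_def)
 qed
 \<comment> \<open>Moving the derivative from the cutoff to r^(M+1) produces the factor M + 1 = m +
   d - 2; the density vanishes on [0, 1], so integrating over [0, 2] changes nothing.\<close>
 have J: "((\<lambda>r. 2 * r * \<theta> (r^2) * r ^ Suc M) has_integral (real (Suc M) * I)) {1..2}"
 proof -
  have "((\<lambda>r. r ^ Suc M * (1 - \<Theta> (r^2))) has_real_derivative
    (real (Suc M) * r ^ M) * (1 - \<Theta> (r^2)) + (- (\<theta> (r^2) * (2 * r))) * r ^ Suc M) (at r within {0..2})" for r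
  proof (rule DERIV_mult)
   show "((\<lambda>r. r ^ Suc M) has_real_derivative real (Suc M) * r ^ M) (at r within {0..2})"
    using DERIV_pow[of "Suc M" r] by simp
   have "((\<lambda>r. r\<^sup>2) has_real_derivative 2 * r) (at r within {0..2})"
    by (auto intro!: derivative_eq_intros)
   from DERIV_chain2[OF st(3) this] show "((\<lambda>r. 1 - \<Theta> (r^2)) has_real_derivative - (\<theta> (r^2) * (2 * r))) (at r within {0..2})"
    by (auto intro!: derivative_eq_intros)
  qed
  then have "((\<lambda>r. (real (Suc M) * r ^ M) * (1 - \<Theta> (r^2)) + (- (\<theta> (r^2) * (2 * r))) * r ^ Suc M) has_integral
    (2 ^ Suc M * (1 - \<Theta> (2\<^sup>2)) - 0 ^ Suc M * (1 - \<Theta> (0\<^sup>2)))) {0..2}"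
   by (intro fundamental_theorem_of_calculus) (auto simp: has_real_derivative_iff_has_vector_derivative)
  then have z: "((\<lambda>r. real (Suc M) * g r - 2 * r * \<theta> (r^2) * r ^ Suc M) has_integral 0) {0..2}"
   using st(7)[of 4] by (simp add: g_def algebra_simps)
  have "(g has_integral I) {0..2}"
   unfolding I_def by (intro integrable_integral integrable_continuous_interval cg)
  from has_integral_diff[OF has_integral_mult_right[OF this, of "real (Suc M)"] z]
  have full: "((\<lambda>r. 2 * r * \<theta> (r^2) * r ^ Suc M) has_integral (real (Suc M) * I)) {0..2}" by simp
  have "((\<lambda>r. 2 * r * \<theta> (r^2) * r ^ Suc M) has_integral 0) {0..1}"
  proof (rule has_integral_is_0)
   show "2 * r * \<theta> (r^2) * r ^ Suc M = 0" if "r \<in> {0..1}" for r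
    using st(5)[of "r^2"] power_mono[of r 1 2] that by simp
  qed
  moreover have "(\<lambda>r. 2 * r * \<theta> (r^2) * r ^ Suc M) integrable_on {1..2}"
   by (intro integrable_continuous_interval continuous_intros continuous_on_compose2[OF c\<theta>(1)[of UNIV]]) auto
  ultimately have "((\<lambda>r. 2 * r * \<theta> (r^2) * r ^ Suc M) has_integral (0 + integral {1..2} (\<lambda>r. 2 * r * \<theta> (r^2) * r ^ Suc M))) {0..2}"
   by (intro has_integral_combine[of 0 1 2]) auto
  then have "integral {1..2} (\<lambda>r. 2 * r * \<theta> (r^2) * r ^ Suc M) = real (Suc M) * I"
   using has_integral_unique[OF _ full] by fastforce
  then show ?thesis using \<open>_ integrable_on {1..2}\<close> integrable_integral by fastforce
 qed
 have "integral {1..2} (\<lambda>r. (real m * (2 * r * \<theta> (r^2) * r ^ Suc M)) *R A) = (real m * (real (Suc M) * I)) *R A"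
  by (rule integral_unique[OF has_integral_scaleR_left[OF has_integral_mult_right[OF J]]])
 moreover have "integral {0..2} (\<lambda>r. g r *R B) = I *R B" unfolding I_def
  by (rule integral_unique[OF has_integral_scaleR_left[OF integrable_integral[OF integrable_continuous_interval[OF cg]]]])
 ultimately have "(real m * (real (Suc M) * I)) *R A = I *R B"
  using integral_laplacian_swap(3)[OF F(1) tf] unfolding 1 2 by simp
 then have "I *R (of_nat (m * Suc M) * A) = I *R B"
  by (simp only: scaleR_conv_of_real of_real_mult of_real_of_nat_eq of_nat_mult mult_ac)
 then have "of_nat (m * Suc M) * A = B" using \<open>I \<noteq> 0\<close> by simp
 then show ?thesis unfolding A_def B_def M(1) ..
qed

section \<open>Powers of linear forms and their moments against harmonics\<close>

lemma pdir_inner: "pdir a (\<lambda>y. cx (x \<bullet> y)) z = cx (x \<bullet> a)"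
 by (rule pdir_eq) (auto intro!: derivative_eq_intros)

lemma polynomial_inner: "polynomial_function (\<lambda>y::'a::euclidean_space. cx (x \<bullet> y))"
 by (rule polynomial_function_bounded_linear)
   (intro bounded_linear_compose[OF bounded_linear_of_real bounded_linear_inner_right])

lemma polynomial_power:
 fixes p :: "'a::euclidean_space => complex"
 shows "polynomial_function p ==> polynomial_function (\<lambda>x. p x ^ n)"
 by (induction n) (simp_all add: complex_polynomial_mult)

lemma pdir_power:
 fixes p :: "'a::euclidean_space => complex"
 assumes "p differentiable at x"
 shows "pdir a (\<lambda>x. p x ^ n) x = of_nat n * p x ^ (n - 1) * pdir a p x"
proof -
 obtain D where D: "(p has_derivative D) (at x)" using assms by (auto simp: differentiable_def)
 have "((\<lambda>x. p x ^ n) has_derivative (\<lambda>h. of_nat n * D h * p x ^ (n - 1))) (at x)"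
  by (rule has_derivative_power[OF D])
 from pdir_eq[OF this] pdir_eq[OF D] show ?thesis by simp
qed

lemma pdir_inner_power:
 "pdir a (\<lambda>y. cx (x \<bullet> y) ^ n) z = of_nat n * cx (x \<bullet> z) ^ (n - 1) * cx (x \<bullet> a)"
 by (simp add: pdir_power[OF polynomial_differentiable[OF polynomial_inner]] pdir_inner)

lemma sum_Basis_inner_sq: "(\<Sum>b\<in>Basis. cx (x \<bullet> b) * cx (y \<bullet> b)) = cx (x \<bullet> y)"
 by (subst euclidean_inner) simp

lemma laplacian_inner_power:
 "laplacian (\<lambda>y. cx (x \<bullet> y) ^ n) z = of_nat (n * (n - 1)) * cx (x \<bullet> z) ^ (n - 2) * cx (sq x)"
proof -
 have 1: "pdir b (\<lambda>y. cx (x \<bullet> y) ^ n) = (\<lambda>z. of_nat n * cx (x \<bullet> b) * cx (x \<bullet> z) ^ (n - 1))" for b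
  by (auto simp: pdir_inner_power)
 have "pdir b (pdir b (\<lambda>y. cx (x \<bullet> y) ^ n)) z =
   of_nat n * cx (x \<bullet> b) * (of_nat (n - 1) * cx (x \<bullet> z) ^ (n - 1 - 1) * cx (x \<bullet> b))" for b
  unfolding 1
  by (subst pdir_cmult) (simp_all add: pdir_inner_power polynomial_differentiable polynomial_power polynomial_inner)
 then have "laplacian (\<lambda>y. cx (x \<bullet> y) ^ n) z =
   (of_nat (n * (n - 1)) * cx (x \<bullet> z) ^ (n - 2)) * (\<Sum>b\<in>Basis. cx (x \<bullet> b) * cx (x \<bullet> b))"
  by (simp add: laplacian_pdir sum_distrib_left mult_ac numeral_2_eq_2)
 then show ?thesis by (simp only: sum_Basis_inner_sq)
qed

lemma sum_Basis_pdir: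
 assumes "p differentiable at z"
 shows "(\<Sum>b\<in>Basis. cx (x \<bullet> b) * pdir b p z) = pdir x p z"
proof -
 obtain D where D: "(p has_derivative D) (at z)" using assms by (auto simp: differentiable_def)
 have "D x = (\<Sum>b\<in>Basis. cx (x \<bullet> b) * D b)" by (subst euclidean_representation[of x, symmetric])
    (simp add: linear_sum[OF has_derivative_linear[OF D]] linear_scale[OF has_derivative_linear[OF D]] scaleR_conv_of_real)
 then show ?thesis by (simp add: pdir_eq[OF D])
qed

lemma pdir_self_homogeneous:
 assumes "\<And>t x. p (t *R x) = cx (t ^ l) * p x" "p differentiable at x"
 shows "pdir x p x = of_nat l * p x"
 using euler_homogeneous[OF assms] sum_Basis_pdir[OF assms(2), of x] by simp

lemma laplacian_inner_power_mult:
 assumes p: "solid_harmonic l p"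
 shows "laplacian (\<lambda>y. cx (x \<bullet> y) ^ j * p y) z =
  of_nat (j * (j - 1)) * cx (sq x) * (cx (x \<bullet> z) ^ (j - 2) * p z)
  + 2 * of_nat j * (cx (x \<bullet> z) ^ (j - 1) * pdir x p z)"
proof -
 have dif: "p differentiable at z" using C_k_SucD(1)[OF solid_harmonicD(1)[OF p]] .
 have "(\<Sum>b\<in>Basis. pdir b (\<lambda>y. cx (x \<bullet> y) ^ j) z * pdir b p z) =
   of_nat j * cx (x \<bullet> z) ^ (j - 1) * (\<Sum>b\<in>Basis. cx (x \<bullet> b) * pdir b p z)"
  by (simp add: pdir_inner_power sum_distrib_left mult_ac)
 also have "... = of_nat j * cx (x \<bullet> z) ^ (j - 1) * pdir x p z"
  by (simp only: sum_Basis_pdir[OF dif])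
 finally show ?thesis
  using laplacian_mult[OF C_k_polynomial[OF polynomial_power[OF polynomial_inner]] solid_harmonicD(1)[OF p], of x j z]
  by (simp add: solid_harmonicD(3)[OF p] laplacian_inner_power mult_ac)
qed

definition sphere_area :: "nat => real" where
 "sphere_area d = real d * unit_ball_vol (real d)"

text \<open>The constants c_l for which the sphere integral of (x . w)^l p(w) is c_l p(x). The
  quotient (l + 1) / (2 l + d) comes from combining \<open>sphere_integral_laplacian\<close> with
  Euler's identity in degree l + 1.\<close>

fun harmonic_moment :: "nat => nat => real" where
 "harmonic_moment d 0 = sphere_area d"
| "harmonic_moment d (Suc l) = real (Suc l) * harmonic_moment d l / real (2 * l + d)"

lemma sphere_area_pos: "sphere_area DIM('a::euclidean_space) > 0" by (simp add: sphere_area_def)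

lemma harmonic_moment_pos: "harmonic_moment DIM('a::euclidean_space) l > 0"
proof (induction l)
 case (Suc l)
 have "0 < real (2 * l + DIM('a))" using DIM_positive[where 'a='a] by linarith
 then show ?case using Suc by (simp only: harmonic_moment.simps) (intro divide_pos_pos mult_pos_pos; simp)
qed (simp add: sphere_area_pos)

lemma pos_notin_nonpos_Ints: "x > 0 ==> x \<notin> \<int>\<^sub>\<le>\<^sub>0" for x :: real by (auto elim!: nonpos_Ints_cases)

lemma harmonic_moment_closed:
 "harmonic_moment DIM('a::euclidean_space) l =
   fact l * (2 * pi powr (real DIM('a) / 2)) / (2 ^ l * Gamma (real DIM('a) / 2 + real l))"
proof (induction l)
 case 0
 have g: "Gamma (real DIM('a) / 2 + 1) = real DIM('a) / 2 * Gamma (real DIM('a) / 2)"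
 proof (rule Gamma_plus1)
  have "real DIM('a) / 2 > 0" using DIM_positive[where 'a='a] by simp
  then show "real DIM('a) / 2 \<notin> \<int>\<^sub>\<le>\<^sub>0" by (rule pos_notin_nonpos_Ints)
 qed
 show ?case
  unfolding harmonic_moment.simps sphere_area_def unit_ball_vol_def g using DIM_positive[where 'a='a] by simp
next
 case (Suc l)
 have "Gamma (real DIM('a) / 2 + real l + 1) = (real DIM('a) / 2 + real l) * Gamma (real DIM('a) / 2 + real l)"
 proof (rule Gamma_plus1)
  have "real DIM('a) / 2 + real l > 0" by (intro add_pos_nonneg) simp_all
  then show "real DIM('a) / 2 + real l \<notin> \<int>\<^sub>\<le>\<^sub>0" by (rule pos_notin_nonpos_Ints)
 qed
 moreover have "real DIM('a) / 2 + real (Suc l) = real DIM('a) / 2 + real l + 1" by simp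
 moreover have "real (2 * l + DIM('a)) = 2 * (real DIM('a) / 2 + real l)" by simp
 moreover have "real DIM('a) / 2 + real l > 0" by (intro add_pos_nonneg) simp_all
 ultimately show ?case
  by (simp only: harmonic_moment.simps Suc.IH fact_Suc) (simp add: field_simps del: of_nat_Suc)
qed

text \<open>The integrand is homogeneous of degree j + l, so its integral is a multiple of that of
  its Laplacian. The Laplacian lowers j by two, or lowers j by one while replacing p by its
  derivative along x, of degree l - 1. For j < l both contributions vanish inductively; at j = l the
  second survives and Euler's identity evaluates it.\<close>

theorem harmonic_moments:
 fixes p :: "'a::euclidean_space => complex"
 assumes d: "DIM('a) \<ge> 3" and "solid_harmonic l p"
 shows "j < l ==> (SPH w. cx (x \<bullet> w) ^ j * p w) = 0"
  and "(SPH w. cx (x \<bullet> w) ^ l * p w) = cx (harmonic_moment DIM('a) l) * p x"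
proof -
 define M where "M = (\<lambda>(p::'a=>complex) j. SPH w. cx (x \<bullet> w) ^ j * p w)"
 have rec: "of_nat ((j + l) * (j + l + DIM('a) - 2)) * M p j =
   of_nat (j * (j - 1)) * cx (sq x) * M p (j - 2) + 2 * of_nat j * M (pdir x p) (j - 1)"
  if p: "solid_harmonic l p" and q: "\<And>w. continuous_on (sphere 0 1) (pdir x p)" for p l j
 proof -
  have hom: "cx (x \<bullet> (t *R y)) ^ j * p (t *R y) = cx (t ^ (j + l)) * (cx (x \<bullet> y) ^ j * p y)" for t y
   by (simp add: solid_harmonicD(2)[OF p] power_add power_mult_distrib)
  have Ck: "C_k n (\<lambda>y. cx (x \<bullet> y) ^ j * p y)" for n
   by (intro C_k_mult C_k_polynomial[OF polynomial_power[OF polynomial_inner]] solid_harmonicD(1)[OF p])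
  have "of_nat ((j + l) * (j + l + DIM('a) - 2)) * M p j = (SPH w. laplacian (\<lambda>y. cx (x \<bullet> y) ^ j * p y) w)"
   unfolding M_def by (rule sphere_integral_laplacian[OF d Ck hom, symmetric])
  also have "... = of_nat (j * (j - 1)) * cx (sq x) * M p (j - 2) + 2 * of_nat j * M (pdir x p) (j - 1)"
   unfolding laplacian_inner_power_mult[OF p] M_def by (subst lint_add)
     (auto intro!: continuous_sphere_integrable continuous_intros solid_harmonicD(4)[OF p] q)
  finally show ?thesis .
 qed
 have "(j < l \<longrightarrow> M p j = 0) \<and> M p l = cx (harmonic_moment DIM('a) l) * p x" using assms(2)
 proof (induction l arbitrary: p j)
  case 0
  have "M p 0 = (LINT w|(sphere_measure :: 'a measure). p x)" unfolding M_def
   by (rule lint_cong[OF refl]) (simp, rule solid_harmonic_0[OF 0])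
  also have "... = cx (sphere_area DIM('a)) * p x"
   by (simp add: measure_sphere_measure sphere_area_def scaleR_conv_of_real)
  finally show ?case by simp
 next
  case (Suc l)
  have hp: "solid_harmonic l (pdir x p)" by (rule solid_harmonic_pdir[OF Suc.prems])
  have q: "continuous_on (sphere 0 1) (pdir x p)" by (rule solid_harmonicD(4)[OF hp])
  have z: "M p j = 0" if "j < Suc l" for j using that
  proof (induction j rule: less_induct)
   case (less j)
   \<comment> \<open>For j \<le> 1 the index j - 2 is truncated, but then the factor j (j - 1) is
     zero.\<close>
   have "of_nat (j * (j - 1)) * cx (sq x) * M p (j - 2) = 0"
    using less.IH[of "j - 2"] less.prems by (cases "j \<le> 1") auto
   moreover have "2 * of_nat j * M (pdir x p) (j - 1) = 0"
    using Suc.IH[OF hp, of "j - 1"] less.prems by (cases j) auto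
   ultimately have "of_nat ((j + Suc l) * (j + Suc l + DIM('a) - 2)) * M p j = 0"
    unfolding rec[OF Suc.prems q] by (simp only: add_0)
   moreover have "(j + Suc l) * (j + Suc l + DIM('a) - 2) \<noteq> 0" using d by auto
   ultimately show ?case by (metis mult_eq_0_iff of_nat_eq_0_iff)
  qed
  have "of_nat ((Suc l + Suc l) * (Suc l + Suc l + DIM('a) - 2)) * M p (Suc l) =
    of_nat (Suc l * (Suc l - 1)) * cx (sq x) * M p (Suc l - 2) + 2 * of_nat (Suc l) * M (pdir x p) (Suc l - 1)"
   by (rule rec[OF Suc.prems q])
  also have "of_nat (Suc l * (Suc l - 1)) * cx (sq x) * M p (Suc l - 2) = 0"
   using z[of "Suc l - 2"] by (cases l) auto
  also have "M (pdir x p) (Suc l - 1) = cx (harmonic_moment DIM('a) l) * pdir x p x"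
   using Suc.IH[OF hp] by simp
  also have "pdir x p x = of_nat (Suc l) * p x"
   by (rule pdir_self_homogeneous[OF solid_harmonicD(2)[OF Suc.prems] C_k_SucD(1)[OF solid_harmonicD(1)[OF Suc.prems]]])
  finally have e: "of_nat ((Suc l + Suc l) * (Suc l + Suc l + DIM('a) - 2)) * M p (Suc l) =
    2 * of_nat (Suc l) * (cx (harmonic_moment DIM('a) l) * (of_nat (Suc l) * p x))" by simp
  have n: "(Suc l + Suc l) * (Suc l + Suc l + DIM('a) - 2) = 2 * Suc l * (2 * l + DIM('a))"
   by (simp add: algebra_simps)
  have nz: "complex_of_nat (2 * Suc l) \<noteq> 0" "complex_of_nat (2 * l + DIM('a)) \<noteq> 0"
   using DIM_positive[where 'a='a] by (simp_all only: of_nat_eq_0_iff) auto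
  have "complex_of_nat (2 * Suc l) * (complex_of_nat (2 * l + DIM('a)) * M p (Suc l)) =
    complex_of_nat (2 * Suc l) * (cx (real (Suc l) * harmonic_moment DIM('a) l) * p x)"
   using e unfolding n by (simp only: of_nat_mult of_real_mult of_real_of_nat_eq mult_ac of_nat_numeral)
  then have "complex_of_nat (2 * l + DIM('a)) * M p (Suc l) = cx (real (Suc l) * harmonic_moment DIM('a) l) * p x"
   using nz(1) mult_left_cancel by blast
  then have "M p (Suc l) = cx (real (Suc l) * harmonic_moment DIM('a) l) * p x / complex_of_nat (2 * l + DIM('a))"
   using nz(2) by (simp add: field_simps)
  then show ?case using z by simp
 qed
 then show "j < l ==> (SPH w. cx (x \<bullet> w) ^ j * p w) = 0"
  and "(SPH w. cx (x \<bullet> w) ^ l * p w) = cx (harmonic_moment DIM('a) l) * p x"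
  unfolding M_def by blast+
qed

section \<open>Zonal harmonics\<close>

fun zonal_coeff :: "nat => nat => nat => real" where
 "zonal_coeff d l 0 = 1"
| "zonal_coeff d l (Suc i) = - zonal_coeff d l i * real ((l - 2 * i) * (l - 2 * i - 1))
   / real (2 * Suc i * (2 * l - 2 * i - 4 + d))"

text \<open>For |y| = 1 and x on the sphere this is the Gegenbauer polynomial of index d/2 - 1 and
  degree l in y . x, scaled to leading coefficient one. \<open>zonal_coeff\<close> is the recursion
  forced by harmonicity.\<close>

definition zonal :: "nat => 'a::euclidean_space => 'a => complex" where
 "zonal l y x = (\<Sum>i\<le>l div 2. cx (zonal_coeff DIM('a) l i) *
   (cx (sq x) ^ i * cx (y \<bullet> x) ^ (l - 2 * i)))"

lemma laplacian_zonal_term: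
 fixes x y :: "'a::euclidean_space"
 shows "laplacian (\<lambda>x. cx (sq x) ^ i * cx (y \<bullet> x) ^ a) x =
  of_nat (i * (2 * DIM('a) + 4 * a + 4 * (i - 1))) * (cx (sq x) ^ (i - 1) * cx (y \<bullet> x) ^ a)
  + of_nat (a * (a - 1)) * cx (sq y) * (cx (sq x) ^ i * cx (y \<bullet> x) ^ (a - 2))"
proof -
 have v: "((\<lambda>t. cx t ^ i) has_vector_derivative of_nat i * cx t ^ (i - 1)) (at t)" for t i
 proof -
  have "((\<lambda>t. cx (t ^ i)) has_vector_derivative cx (real i * t ^ (i - 1))) (at t)"
   by (rule has_vector_derivative_of_real) (auto intro!: derivative_eq_intros)
  then show ?thesis by simp
 qed
 have v2: "((\<lambda>t. of_nat i * cx t ^ (i - 1)) has_vector_derivative of_nat i * (of_nat (i - 1) * cx t ^ (i - 1 - 1))) (at t)" for t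
  by (rule has_vector_derivative_mult_right[OF v])
 have "laplacian (\<lambda>x. cx (sq x) ^ i * cx (y \<bullet> x) ^ a) x =
  (4 * cx (sq x) * (of_nat i * (of_nat (i - 1) * cx (sq x) ^ (i - 1 - 1)))
   + cx (2 * real DIM('a) + 4 * real a) * (of_nat i * cx (sq x) ^ (i - 1))) * cx (y \<bullet> x) ^ a
  + cx (sq x) ^ i * laplacian (\<lambda>x. cx (y \<bullet> x) ^ a) x"
  by (rule laplacian_radial_mult[of UNIV x "\<lambda>t. cx t ^ i", OF open_UNIV UNIV_I v v2])
    (auto intro!: C_k_polynomial polynomial_power polynomial_inner simp: power_mult_distrib)
 also have "4 * cx (sq x) * (of_nat i * (of_nat (i - 1) * cx (sq x) ^ (i - 1 - 1)))
   = of_nat (i * (4 * (i - 1))) * cx (sq x) ^ (i - 1)" by (cases "i - 1") (simp_all add: mult_ac)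
 also have "laplacian (\<lambda>x. cx (y \<bullet> x) ^ a) x =
   of_nat (a * (a - 1)) * cx (y \<bullet> x) ^ (a - 2) * cx (sq y)" by (rule laplacian_inner_power)
 finally show ?thesis
  by (simp only: of_nat_mult of_nat_add of_real_add of_real_mult of_real_of_nat_eq of_real_numeral of_nat_numeral
    distrib_left distrib_right mult_ac add_ac)
qed

lemma polynomial_inner_self: "polynomial_function (\<lambda>x::'a::euclidean_space. cx (sq x))"
proof -
 have "(\<lambda>x::'a. cx (sq x)) = (\<lambda>x. \<Sum>b\<in>Basis. cx (b \<bullet> x) ^ 2)"
  by (subst euclidean_inner) (simp add: power2_eq_square inner_commute)
 then show ?thesis by (simp add: polynomial_function_sum polynomial_power polynomial_inner)
qed

lemma polynomial_zonal: "polynomial_function (zonal l y)" unfolding zonal_def[abs_def]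
 by (intro polynomial_function_sum finite_atMost polynomial_cmult complex_polynomial_mult polynomial_power
   polynomial_inner polynomial_inner_self)

text \<open>Each term contributes two monomials to the Laplacian, \<open>B i\<close> and
  \<open>U i\<close>; the recursion for the coefficients makes \<open>B (Suc i)\<close> cancel
  \<open>U i\<close>, so the sum telescopes to its last \<open>U\<close>.\<close>

lemma solid_harmonic_zonal:
 fixes y :: "'a::euclidean_space"
 assumes "norm y = 1"
 shows "solid_harmonic l (zonal l y)"
proof -
 have hom: "zonal l y (t *R x) = cx (t ^ l) * zonal l y x" for t x
 proof -
  have "t ^ l = t ^ (2 * i) * t ^ (l - 2 * i)" if "i \<le> l div 2" for i
   using that by (simp flip: power_add)
  then show ?thesis
   by (simp add: zonal_def sum_distrib_left power_mult_distrib power_mult mult_ac power2_eq_square flip: of_real_power)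
 qed
 have yy: "sq y = 1" using assms by (simp add: dot_square_norm)
 have "laplacian (zonal l y) x = 0" for x
 proof -
  define U where "U = (\<lambda>i. cx (zonal_coeff DIM('a) l i * real ((l - 2 * i) * (l - 2 * i - 1))) *
   (cx (sq x) ^ i * cx (y \<bullet> x) ^ (l - 2 * i - 2)))"
  define B where "B = (\<lambda>i. cx (zonal_coeff DIM('a) l i * real (i * (2 * DIM('a) + 4 * (l - 2 * i) + 4 * (i - 1)))) *
   (cx (sq x) ^ (i - 1) * cx (y \<bullet> x) ^ (l - 2 * i)))"
  have "laplacian (zonal l y) x = (\<Sum>i\<le>l div 2. cx (zonal_coeff DIM('a) l i) *
    laplacian (\<lambda>x. cx (sq x) ^ i * cx (y \<bullet> x) ^ (l - 2 * i)) x)" unfolding zonal_def[abs_def]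
   by (subst laplacian_sum; (subst laplacian_cmult)?)
     (auto intro!: C_k_cmult C_k_polynomial complex_polynomial_mult polynomial_power polynomial_inner polynomial_inner_self)
  also have "... = (\<Sum>i\<le>l div 2. B i + U i)" unfolding laplacian_zonal_term yy B_def U_def
   by (rule sum.cong[OF refl]) (simp add: algebra_simps)
  also have "... = U (l div 2)"
  proof -
   have "n \<le> l div 2 ==> (\<Sum>i\<le>n. B i + U i) = U n" for n
   proof (induction n)
    case 0
    then show ?case by (simp add: B_def)
   next
    case (Suc n)
    \<comment> \<open>The bound \<open>Suc n \<le> l div 2\<close> keeps all truncated subtractions
      exact.\<close>
    have e: "2 * DIM('a) + 4 * (l - 2 * Suc n) + 4 * (Suc n - 1) = 2 * (2 * l - 2 * n - 4 + DIM('a))"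
     using Suc.prems by auto
    have nz: "real (2 * Suc n * (2 * l - 2 * n - 4 + DIM('a))) \<noteq> 0"
     using DIM_positive[where 'a='a] by (simp only: of_nat_eq_0_iff) auto
    have "zonal_coeff DIM('a) l (Suc n) * real (Suc n * (2 * DIM('a) + 4 * (l - 2 * Suc n) + 4 * (Suc n - 1)))
      = - (zonal_coeff DIM('a) l n * real ((l - 2 * n) * (l - 2 * n - 1)))"
    proof -
     have "Suc n * (2 * DIM('a) + 4 * (l - 2 * Suc n) + 4 * (Suc n - 1)) = 2 * Suc n * (2 * l - 2 * n - 4 + DIM('a))"
      unfolding e by simp
     then show ?thesis using nz by (simp only: zonal_coeff.simps times_divide_eq_left mult_minus_left nonzero_mult_div_cancel_right minus_divide_left[symmetric] not_False_eq_True)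
    qed
    then have "B (Suc n) = - U n" unfolding B_def U_def by (simp del: zonal_coeff.simps of_nat_mult)
    then show ?case using Suc by simp
   qed
   then show ?thesis by simp
  qed
  also have "... = 0"
  proof -
   \<comment> \<open>The exponent of y . x left in the last term is 0 or 1, so the second derivative
     of that power vanishes.\<close>
   have "l - 2 * (l div 2) = l mod 2" by (simp add: minus_mult_div_eq_mod)
   then have "(l - 2 * (l div 2)) * (l - 2 * (l div 2) - 1) = 0" by (cases "even l") (simp_all add: odd_iff_mod_2_eq_one)
   then show ?thesis by (simp add: U_def del: of_nat_mult)
  qed
  finally show ?thesis .
 qed
 then show ?thesis using hom polynomial_zonal by (simp add: solid_harmonic_def)
qed

lemma zonal_on_sphere:
 "norm w = 1 ==> zonal l y w = (\<Sum>i\<le>l div 2. cx (zonal_coeff DIM('a) l i) * cx (y \<bullet> w) ^ (l - 2 * i))"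
 for y w :: "'a::euclidean_space" by (simp add: zonal_def dot_square_norm)

text \<open>All terms of the zonal polynomial but the first carry powers of y . w below l, which
  integrate to zero.\<close>

lemma sphere_integral_zonal:
 fixes f :: "'a::euclidean_space => complex"
 assumes f: "continuous_on (sphere 0 1) f"
  and lower: "\<And>j. j < l ==> (SPH w. cx (y \<bullet> w) ^ j * f w) = 0"
 shows "(SPH w. zonal l y w * f w) = (SPH w. cx (y \<bullet> w) ^ l * f w)"
proof -
 have "(SPH w. zonal l y w * f w) =
   (SPH w. (\<Sum>i\<le>l div 2. cx (zonal_coeff DIM('a) l i) * (cx (y \<bullet> w) ^ (l - 2 * i) * f w)))"
  by (rule lint_cong[OF refl])
    (simp add: zonal_on_sphere sum_distrib_left mult_ac)
 also have "... = (\<Sum>i\<le>l div 2. SPH w. cx (zonal_coeff DIM('a) l i) * (cx (y \<bullet> w) ^ (l - 2 * i) * f w))"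
  by (intro lint_sum continuous_sphere_integrable continuous_intros f)
 also have "... = (\<Sum>i\<le>l div 2. if i = 0 then SPH w. cx (y \<bullet> w) ^ l * f w else 0)"
  by (rule sum.cong[OF refl]) (auto simp: lower)
 finally show ?thesis by simp
qed

lemma zonal_reproducing:
 fixes y :: "'a::euclidean_space"
 assumes "DIM('a) \<ge> 3" "solid_harmonic l p"
 shows "(SPH w. zonal l y w * p w) = cx (harmonic_moment DIM('a) l) * p y"
 by (simp add: sphere_integral_zonal solid_harmonicD(4)[OF assms(2)] harmonic_moments[OF assms])

section \<open>Completeness of spherical harmonics\<close>

lemma harmonic_orthogonal_powers:
 fixes f :: "'a::euclidean_space => complex"
 assumes f: "continuous_on (sphere 0 1) f"
  and orth: "\<And>l p. solid_harmonic l p ==> (SPH w. f w * p w) = 0"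
  and y: "norm y = 1"
 shows "(SPH w. cx (y \<bullet> w) ^ j * f w) = 0"
proof (induction j rule: less_induct)
 case (less j)
 show ?case
  using sphere_integral_zonal[OF f less] orth[OF solid_harmonic_zonal[OF y], of j] by (simp add: mult.commute)
qed

text \<open>The sphere measure charges every nonempty open set: by its construction a null set of
  directions spans a null cone in the ball, whereas positivity of F at y would make the cone over {F
  > 0} contain a nonempty open set.\<close>

lemma sphere_integral_eq_0_imp:
 fixes F :: "'a::euclidean_space => real"
 assumes F: "continuous_on (sphere 0 1) F" "\<And>w. norm w = 1 ==> F w \<ge> 0"
  and 0: "(SPH w. F w) = 0" and y: "norm y = 1"
 shows "F y = 0"
proof (rule ccontr)
 assume "F y \<noteq> 0"
 \<comment> \<open>Borel extension by zero, as F is continuous on the sphere only.\<close>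
 define F' where "F' = (\<lambda>x::'a. indicator (sphere 0 1) x * F x)"
 have [measurable]: "F' \<in> borel_measurable borel"
  unfolding F'_def using borel_measurable_continuous_on_indicator[OF _ F(1)] by simp
 have "(\<lambda>x. F' (x /R norm x)) \<in> borel_measurable borel"
  by (rule measurable_compose[of _ borel borel]) simp_all
 then have measurable_proj: "(\<lambda>x. ennreal (F' (x /R norm x)) * indicator (ball 0 1 - {0}) x) \<in> borel_measurable borel"
  by (intro borel_measurable_times_ennreal borel_measurable_indicator measurable_compose[OF _ measurable_ennreal]) simp_all
 have "AE w in sphere_measure. 0 \<le> F w" using F(2) by (intro AE_I2) simp
 then have "AE w in sphere_measure. F w = 0"
  using integral_nonneg_eq_0_iff_AE[OF continuous_sphere_integrable[OF F(1)]] F(2) 0 by auto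
 then have "AE w in sphere_measure. ennreal (F' w) = 0"
  by (auto simp: F'_def elim!: eventually_mono)
 then have "(\<integral>\<^sup>+w. ennreal (F' w) \<partial>sphere_measure) = (\<integral>\<^sup>+w. 0 \<partial>(sphere_measure :: 'a measure))"
  by (rule nn_integral_cong_AE)
 then have "(\<integral>\<^sup>+x. ennreal (F' (x /R norm x)) * indicator (ball 0 1 - {0}) x \<partial>lborel) = 0"
  by (subst (asm) nn_integral_sphere_measure) auto
 then have ae: "AE x in lborel. ennreal (F' (x /R norm x)) * indicator (ball 0 1 - {0}) x = 0"
  by (subst (asm) nn_integral_0_iff_AE) (simp_all add: measurable_proj)
 define V where "V = (ball 0 1 - {0}) \<inter> (\<lambda>x. F (x /R norm x)) -` {0<..}"
 have "open V" unfolding V_def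
 proof (rule continuous_open_preimage)
  show "continuous_on (ball 0 1 - {0}) (\<lambda>x. F (x /R norm x))"
   by (rule continuous_on_compose2[OF F(1)]) (auto intro!: continuous_intros, metis left_inverse norm_eq_zero)
 qed auto
 moreover have "y /R 2 \<in> V" using y \<open>F y \<noteq> 0\<close> F(2)[OF y] by (auto simp: V_def)
 ultimately have "\<not> negligible V" using open_not_negligible by blast
 moreover have "AE x in lborel. x \<notin> V" using ae
 proof eventually_elim
  case (elim x)
  show ?case
  proof
   assume "x \<in> V"
   then have "norm (x /R norm x) = 1" "F (x /R norm x) > 0" "x \<in> ball 0 1 - {0}" by (auto simp: V_def)
   then show False using elim by (simp add: F'_def)
  qed
 qed
 then have "V \<in> null_sets lebesgue"
  by (metis (mono_tags) AE_iff_null_sets AE_completion \<open>open V\<close> borel_open sets_completionI_sets sets_lborel)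
 then have "negligible V" by (simp add: negligible_iff_null_sets)
 ultimately show False by simp
qed

text \<open>Orthogonality to the zonal harmonics gives, degree by degree, orthogonality to all
  powers of y . w, and Weierstrass approximation on [-1, 1] extends it to every continuous function
  of y . w. A nonnegative one concentrated near y would detect a nonzero value f(y).\<close>

theorem spherical_harmonics_complete:
 fixes f :: "'a::euclidean_space => complex"
 assumes f: "continuous_on (sphere 0 1) f"
  and orth: "\<And>l p. solid_harmonic l p ==> (SPH w. f w * p w) = 0"
  and y: "norm y = 1"
 shows "f y = 0"
proof (rule ccontr)
 let ?I = "\<lambda>(g::real=>real). (SPH w. g (y \<bullet> w) *R f w)"
 assume nz: "f y \<noteq> 0"
 have cont: "continuous_on (sphere 0 1) (\<lambda>w. g (y \<bullet> w) *R f w)" if "continuous_on {-1..1} g" for g :: "real => real"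
 proof (intro continuous_intros f continuous_on_compose2[OF that])
  show "(\<bullet>) y ` sphere 0 1 \<subseteq> {-1..1}"
   using Cauchy_Schwarz_ineq2[of y] y by (auto simp: abs_le_iff) (metis abs_le_iff minus_le_iff mult_1 norm_eq_1 power2_norm_eq_inner power2_eq_square)+
 qed
 have poly: "?I g = 0" if g: "real_polynomial_function g" for g
 proof -
  obtain a n where a: "g = (\<lambda>x. \<Sum>i\<le>(n::nat). a i * x ^ i)"
   using real_polynomial_function_imp_sum[OF g] by blast
  have "?I g = (SPH w. (\<Sum>i\<le>n. cx (a i) * (cx (y \<bullet> w) ^ i * f w)))" by (rule lint_cong[OF refl])
     (simp add: a scaleR_conv_of_real sum_distrib_left mult_ac)
  also have "... = (\<Sum>i\<le>n. SPH w. cx (a i) * (cx (y \<bullet> w) ^ i * f w))"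
   by (intro lint_sum continuous_sphere_integrable continuous_intros f)
  also have "... = 0" by (simp add: harmonic_orthogonal_powers[OF f orth y])
  finally show ?thesis .
 qed
 obtain B where B: "\<And>w. w \<in> sphere 0 1 ==> norm (f w) \<le> B"
  using compact_imp_bounded[OF compact_continuous_image[OF f compact_sphere]] unfolding bounded_iff by (metis imageI)
 define S where "S = measure (sphere_measure :: 'a measure) (sphere 0 1)"
 have all: "?I g = 0" if g: "continuous_on {-1..1} g" for g
 proof -
  have "norm (?I g) \<le> e * (B * S)" if "e > 0" for e
  proof -
   obtain h where h: "real_polynomial_function h" "\<And>x. x \<in> {-1..1} ==> \<bar>g x - h x\<bar> < e"
    using Stone_Weierstrass_real_polynomial_function[OF compact_Icc g \<open>e > 0\<close>] by blast
   have hc: "continuous_on {-1..1} h"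
    using h(1) continuous_on_polymonial_function real_polynomial_function_eq by blast
   have yr: "y \<bullet> w \<in> {-1..1}" if "w \<in> sphere 0 1" for w
    using Cauchy_Schwarz_ineq2[of y w] y that by (auto simp: abs_le_iff)
   have "?I g = (SPH w. g (y \<bullet> w) *R f w - h (y \<bullet> w) *R f w)"
    by (subst lint_diff) (auto intro!: continuous_sphere_integrable cont g hc simp: poly[OF h(1)])
   also have "norm ... \<le> (LINT w|(sphere_measure :: 'a measure). e * B)"
   proof (rule lint_norm_bound_integral)
    show "integrable sphere_measure (\<lambda>w. g (y \<bullet> w) *R f w - h (y \<bullet> w) *R f w)"
     by (intro Bochner_Integration.integrable_diff continuous_sphere_integrable cont g hc)
    show "norm (g (y \<bullet> w) *R f w - h (y \<bullet> w) *R f w) \<le> e * B" if "w \<in> space sphere_measure" for w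
    proof -
     have "norm (g (y \<bullet> w) *R f w - h (y \<bullet> w) *R f w) = \<bar>g (y \<bullet> w) - h (y \<bullet> w)\<bar> * norm (f w)"
      by (simp flip: scaleR_diff_left)
     also have "... \<le> e * B"
      using h(2)[OF yr] B that \<open>e > 0\<close> by (intro mult_mono) (auto intro: less_imp_le)
     finally show ?thesis .
    qed
   qed auto
   also have "... = e * (B * S)" by (simp add: S_def)
   finally show ?thesis .
  qed
  then have "norm (?I g) \<le> 0"
  proof -
   assume b: "\<And>e. e > 0 ==> norm (?I g) \<le> e * (B * S)"
   have "((\<lambda>e. e * (B * S)) \<longlongrightarrow> 0 * (B * S)) (at_right 0)" by (intro tendsto_intros)
   moreover have "\<forall>\<^sub>F e in at_right 0. norm (?I g) \<le> e * (B * S)"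
    by (auto intro!: eventually_at_rightI[of 0 1] b)
   ultimately show ?thesis by (intro tendsto_lowerbound[of "\<lambda>e. e * (B * S)" _ "at_right 0"]) auto
  qed
  then show ?thesis by simp
 qed
 \<comment> \<open>Multiplying by the conjugate of \<open>f y\<close> makes the real part positive
   at y, hence near y.\<close>
 define h where "h = (\<lambda>w. Re (f w * cnj (f y)))"
 have h: "continuous_on (sphere 0 1) h" unfolding h_def by (intro continuous_intros f)
 have hy: "h y > 0" using nz by (auto simp: h_def complex_eq_iff add_pos_nonneg add_nonneg_pos not_sum_squares_lt_zero sum_squares_gt_zero_iff)
 obtain \<delta> where \<delta>: "\<delta> > 0" "\<And>w. w \<in> sphere 0 1 ==> dist w y < \<delta> ==> dist (h w) (h y) < h y"
  using h hy y unfolding continuous_on_iff by (metis mem_sphere_0)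
 \<comment> \<open>A hat supported on the cap of radius \<delta>, since dist(w, y)^2 = 2 - 2 (y . w)
   for unit vectors.\<close>
 define g where "g = (\<lambda>t::real. max 0 (t - (1 - \<delta>^2 / 2)))"
 have g: "continuous_on A g" for A unfolding g_def by (intro continuous_intros)
 have "g (sq y) * h y = 0"
 proof (rule sphere_integral_eq_0_imp[of "\<lambda>w. g (y \<bullet> w) * h w" y, OF _ _ _ y])
  show "continuous_on (sphere 0 1) (\<lambda>w. g (y \<bullet> w) * h w)"
   by (intro continuous_intros h continuous_on_compose2[OF g[of UNIV]]) auto
  show "g (y \<bullet> w) * h w \<ge> 0" if "norm w = 1" for w
  proof (cases "g (y \<bullet> w) = 0")
   case False
   then have "y \<bullet> w > 1 - \<delta>^2 / 2" by (auto simp: g_def max_def split: if_splits)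
   moreover have "(dist w y)\<^sup>2 = 2 - 2 * (y \<bullet> w)"
    unfolding dist_norm power2_norm_eq_inner inner_diff_left inner_diff_right inner_commute[of w y]
    using that y by (simp add: dot_square_norm)
   ultimately have "(dist w y)\<^sup>2 < \<delta>\<^sup>2" by simp
   then have "dist w y < \<delta>" using \<delta>(1) by (simp add: power_less_imp_less_base)
   then have "h w > 0" using \<delta>(2)[of w] that by (auto simp: dist_real_def)
   then show ?thesis by (simp add: g_def)
  qed simp
  have "(SPH w. g (y \<bullet> w) * h w) = (SPH w. Re ((g (y \<bullet> w) *R f w) * cnj (f y)))"
   by (simp add: h_def)
  also have "... = Re (SPH w. (g (y \<bullet> w) *R f w) * cnj (f y))"
   by (intro integral_Re integrable_mult_left continuous_sphere_integrable cont g)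
  also have "(SPH w. (g (y \<bullet> w) *R f w) * cnj (f y)) = 0"
   using all[OF g] by (subst integral_mult_left_zero) simp
  finally show "(SPH w. g (y \<bullet> w) * h w) = 0" by simp
 qed
 then show False using hy \<delta>(1) y by (auto simp: g_def dot_square_norm)
qed

section \<open>Orthogonality of different degrees\<close>

lemma pdir_cnj:
 assumes "p differentiable at x"
 shows "pdir b (\<lambda>x. cnj (p x)) x = cnj (pdir b p x)"
proof -
 obtain D where D: "(p has_derivative D) (at x)" using assms by (auto simp: differentiable_def)
 have "((\<lambda>x. cnj (p x)) has_derivative (\<lambda>h. cnj (D h))) (at x)"
  by (rule bounded_linear.has_derivative[OF bounded_linear_cnj D])
 from pdir_eq[OF this] pdir_eq[OF D] show ?thesis by simp
qed

lemma solid_harmonic_cnj: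
 fixes p :: "'a::euclidean_space => complex"
 assumes p: "solid_harmonic l p"
 shows "solid_harmonic l (\<lambda>x. cnj (p x))"
proof -
 have poly: "polynomial_function p" using p by (simp add: solid_harmonic_def)
 have "polynomial_function (cnj \<circ> p)"
  by (intro polynomial_function_compose poly polynomial_function_bounded_linear bounded_linear_cnj)
 then have 1: "polynomial_function (\<lambda>x. cnj (p x))" by (simp add: o_def)
 have "pdir b (\<lambda>x. cnj (p x)) = (\<lambda>x. cnj (pdir b p x))" for b
  by (auto simp: pdir_cnj polynomial_differentiable poly)
 then have "laplacian (\<lambda>x. cnj (p x)) x = cnj (laplacian p x)" for x
  by (simp add: laplacian_pdir pdir_cnj polynomial_differentiable polynomial_pdir poly)
 then show ?thesis using 1 solid_harmonicD[OF p] by (simp add: solid_harmonic_def)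
qed

lemma solid_harmonic_cmult:
 fixes p :: "'a::euclidean_space => complex"
 assumes p: "solid_harmonic l p"
 shows "solid_harmonic l (\<lambda>x. c * p x)"
 using p by (simp add: solid_harmonic_def polynomial_cmult laplacian_cmult[OF solid_harmonicD(1)[OF p]])

text \<open>For harmonic factors the Laplacian of the product is twice the product of the gradients;
  \<open>sphere_integral_laplacian\<close> is applied in degree l + m.\<close>

lemma sphere_integral_mult_harmonic:
 fixes p q :: "'a::euclidean_space => complex"
 assumes d: "DIM('a) \<ge> 3" and p: "solid_harmonic l p" and q: "solid_harmonic m q"
 shows "of_nat ((l + m) * (l + m + DIM('a) - 2)) * (SPH w. p w * q w) =
  2 * (\<Sum>b\<in>Basis. SPH w. pdir b p w * pdir b q w)"
proof -
 have poly: "polynomial_function p" "polynomial_function q" using p q by (simp_all add: solid_harmonic_def)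
 have "of_nat ((l + m) * (l + m + DIM('a) - 2)) * (SPH w. p w * q w) =
   (SPH w. laplacian (\<lambda>x. p x * q x) w)" by (rule sphere_integral_laplacian[OF d, symmetric])
    (auto intro: C_k_mult solid_harmonicD[OF p] solid_harmonicD[OF q]
     simp: solid_harmonicD(2)[OF p] solid_harmonicD(2)[OF q] power_add mult_ac)
 also have "... = (SPH w. (\<Sum>b\<in>Basis. 2 * (pdir b p w * pdir b q w)))" by (subst laplacian_mult)
    (simp_all add: solid_harmonicD[OF p] solid_harmonicD[OF q] sum_distrib_left)
 also have "... = (\<Sum>b\<in>Basis. SPH w. 2 * (pdir b p w * pdir b q w))"
  by (intro lint_sum continuous_sphere_integrable continuous_intros
    C_k_continuous[OF C_k_polynomial] polynomial_pdir poly)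
 finally show ?thesis by (simp add: sum_distrib_left)
qed

text \<open>Passing to partial derivatives lowers both degrees; the smaller one ends at a constant,
  whose gradient is zero.\<close>

lemma solid_harmonic_orthogonal_less:
 fixes p q :: "'a::euclidean_space => complex"
 assumes d: "DIM('a) \<ge> 3" and "solid_harmonic l p" "solid_harmonic m q" "l < m"
 shows "(SPH w. p w * q w) = 0" using assms(2-)
proof (induction l arbitrary: m p q)
 case 0
 have "p = (\<lambda>x. p 0)" using solid_harmonic_0[OF 0(1)] by blast
 then have "pdir b p x = 0" for b x by (metis pdir_const)
 then have "of_nat ((0 + m) * (0 + m + DIM('a) - 2)) * (SPH w. p w * q w) = 0"
  using sphere_integral_mult_harmonic[OF d 0(1,2)] by simp
 moreover have "(0 + m) * (0 + m + DIM('a) - 2) \<noteq> 0" using d 0(3) by auto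
 ultimately show ?case by (metis mult_eq_0_iff of_nat_eq_0_iff)
next
 case (Suc l)
 obtain m' where m: "m = Suc m'" "l < m'" using Suc.prems(3) by (cases m) auto
 have "(SPH w. pdir b p w * pdir b q w) = 0" for b
  by (rule Suc.IH[OF solid_harmonic_pdir[OF Suc.prems(1)] solid_harmonic_pdir[OF Suc.prems(2)[unfolded m(1)]] m(2)])
 then have "of_nat ((Suc l + m) * (Suc l + m + DIM('a) - 2)) * (SPH w. p w * q w) = 0"
  unfolding sphere_integral_mult_harmonic[OF d Suc.prems(1,2)] by simp
 moreover have "(Suc l + m) * (Suc l + m + DIM('a) - 2) \<noteq> 0" using d by auto
 ultimately show ?case by (metis mult_eq_0_iff of_nat_eq_0_iff)
qed

lemma solid_harmonic_orthogonal:
 fixes p q :: "'a::euclidean_space => complex"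
 assumes d: "DIM('a) \<ge> 3" and "solid_harmonic l p" "solid_harmonic m q" "l \<noteq> m"
 shows "(SPH w. p w * q w) = 0"
 using solid_harmonic_orthogonal_less[OF d assms(2,3)] solid_harmonic_orthogonal_less[OF d assms(3,2)] assms(4)
 by (cases "l < m") (simp_all add: mult.commute)

section \<open>The reproducing kernel and its growth\<close>

definition harmonic_kernel :: "nat => 'a::euclidean_space => 'a => complex" where
 "harmonic_kernel l y x = zonal l y x / cx (harmonic_moment DIM('a) l)"

lemma solid_harmonic_kernel: "norm y = 1 ==> solid_harmonic l (harmonic_kernel l y)"
 using solid_harmonic_cmult[OF solid_harmonic_zonal[of y l]]
 unfolding harmonic_kernel_def[abs_def] by (simp add: divide_inverse mult.commute[of "zonal l y _"])

lemma harmonic_kernel_reproducing: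
 fixes y :: "'a::euclidean_space"
 assumes "DIM('a) \<ge> 3" "solid_harmonic l p"
 shows "(SPH w. harmonic_kernel l y w * p w) = p y"
proof -
 have "(SPH w. harmonic_kernel l y w * p w) =
   (SPH w. inverse (cx (harmonic_moment DIM('a) l)) * (zonal l y w * p w))"
  by (rule lint_cong[OF refl]) (simp add: harmonic_kernel_def divide_inverse mult_ac)
 also have "... = p y"
  using harmonic_moment_pos[where 'a='a and l=l] by (simp add: zonal_reproducing[OF assms])
 finally show ?thesis .
qed

text \<open>The addition theorem: the kernel is expanded in the basis, and the reproducing property
  applied to the conjugate of \<open>Y m\<close> reads off the coefficients. The sum is therefore
  independent of the basis.\<close>

theorem harmonic_basis_kernel:
 fixes Y :: "nat => 'a::euclidean_space => complex"
 assumes d: "DIM('a) \<ge> 3" and Y: "orthonormal_harmonic_basis l N Y" and y: "norm y = 1" "norm w = 1"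
 shows "(\<Sum>m=1..N. Y m w * cnj (Y m y)) = harmonic_kernel l y w"
proof -
 have "\<forall>m\<in>{1..N}. \<exists>p. solid_harmonic l p \<and> (\<forall>w\<in>sphere 0 1. Y m w = p w)"
  using Y by (simp add: orthonormal_harmonic_basis_def spherical_harmonic_def)
 then obtain p where p: "\<And>m. m \<in> {1..N} ==> solid_harmonic l (p m)"
   "\<And>m w. m \<in> {1..N} ==> w \<in> sphere 0 1 ==> Y m w = p m w" by metis
 have "spherical_harmonic l (harmonic_kernel l y)"
  using solid_harmonic_kernel[OF y(1)] by (auto simp: spherical_harmonic_def)
 then obtain c where c: "\<And>w. w \<in> sphere 0 1 ==> harmonic_kernel l y w = (\<Sum>m=1..N. c m * Y m w)"
  using Y unfolding orthonormal_harmonic_basis_def by blast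
 have "c m = cnj (Y m y)" if m: "m \<in> {1..N}" for m
 proof -
  have "cnj (Y m y) = cnj (p m y)" using p(2)[OF m] y by simp
  also have "... = (SPH w. harmonic_kernel l y w * cnj (p m w))"
   by (rule harmonic_kernel_reproducing[OF d solid_harmonic_cnj[OF p(1)[OF m]], symmetric])
  also have "... = (SPH w. (\<Sum>m'=1..N. c m' * (p m' w * cnj (p m w))))"
   by (rule lint_cong[OF refl]) (simp add: c p(2) sum_distrib_right mult.assoc)
  also have "... = (\<Sum>m'=1..N. SPH w. c m' * (p m' w * cnj (p m w)))"
   by (intro lint_sum continuous_sphere_integrable continuous_intros
     solid_harmonicD(4)[OF p(1)] m)
  also have "... = (\<Sum>m'=1..N. c m' * (SPH w. Y m' w * cnj (Y m w)))"
  proof (rule sum.cong[OF refl])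
   fix m' assume m': "m' \<in> {1..N}"
   have "(SPH w. p m' w * cnj (p m w)) = (SPH w. Y m' w * cnj (Y m w))"
    by (rule lint_cong[OF refl]) (use m m' in \<open>simp add: p(2)\<close>)
   then show "(SPH w. c m' * (p m' w * cnj (p m w))) = c m' * (SPH w. Y m' w * cnj (Y m w))" by simp
  qed
  also have "... = (\<Sum>m'=1..N. if m' = m then c m else 0)"
   using Y m unfolding orthonormal_harmonic_basis_def by (intro sum.cong[OF refl]) auto
  also have "... = c m" using m by simp
  finally show ?thesis ..
 qed
 then show ?thesis using c[of w] y by (simp add: mult.commute)
qed

text \<open>On the diagonal the kernel is constant on the sphere, and integrating the sum of the |Y
  m|^2 identifies it as N divided by the area. Off the diagonal 2 |a b| \<le> |a|^2 + |b|^2 reduces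
  to the diagonal.\<close>

lemma harmonic_kernel_bound:
 fixes Y :: "nat => 'a::euclidean_space => complex" and y w :: 'a
 assumes d: "DIM('a) \<ge> 3" and Y: "orthonormal_harmonic_basis l N Y" and y: "norm y = 1" "norm w = 1"
 shows "norm (harmonic_kernel l y w) \<le> real N / sphere_area DIM('a)"
proof -
 have "\<forall>m\<in>{1..N}. \<exists>p. solid_harmonic l p \<and> (\<forall>w\<in>sphere 0 1. Y m w = p w)"
  using Y by (simp add: orthonormal_harmonic_basis_def spherical_harmonic_def)
 then obtain p where p: "\<And>m. m \<in> {1..N} ==> solid_harmonic l (p m)"
   "\<And>m w. m \<in> {1..N} ==> w \<in> sphere 0 1 ==> Y m w = p m w" by metis
 have diag: "harmonic_kernel l w w = harmonic_kernel l y y" if "norm w = 1" for w :: 'a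
  using that y by (simp add: harmonic_kernel_def zonal_on_sphere dot_square_norm)
 have "cx (sphere_area DIM('a)) * harmonic_kernel l y y = (LINT w|(sphere_measure :: 'a measure). harmonic_kernel l y y)"
  by (simp add: measure_sphere_measure sphere_area_def scaleR_conv_of_real)
 also have "... = (SPH w. (\<Sum>m=1..N. p m w * cnj (p m w)))" by (rule lint_cong[OF refl])
    (simp add: diag[symmetric] harmonic_basis_kernel[OF d Y, symmetric] p(2))
 also have "... = (\<Sum>m=1..N. SPH w. p m w * cnj (p m w))"
  by (intro lint_sum continuous_sphere_integrable continuous_intros solid_harmonicD(4)[OF p(1)])
 also have "... = (\<Sum>m=1..N. 1)"
 proof (rule sum.cong[OF refl])
  fix m assume m: "m \<in> {1..N}"
  have "(SPH w. p m w * cnj (p m w)) = (SPH w. Y m w * cnj (Y m w))"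
   by (rule lint_cong[OF refl]) (use m in \<open>simp add: p(2)\<close>)
  also have "... = 1" using Y m unfolding orthonormal_harmonic_basis_def by auto
  finally show "(SPH w. p m w * cnj (p m w)) = 1" .
 qed
 finally have e: "harmonic_kernel l y y = cx (real N / sphere_area DIM('a))"
  using sphere_area_pos[where 'a='a] by (simp add: field_simps)
 have sq: "cx (\<Sum>m=1..N. (norm (Y m w))\<^sup>2) = harmonic_kernel l w w" if "norm w = 1" for w
  using harmonic_basis_kernel[OF d Y that that] by (simp only: of_real_sum complex_norm_square)
 have s: "(\<Sum>m=1..N. (norm (Y m w))\<^sup>2) = real N / sphere_area DIM('a)" if "norm w = 1" for w
  using sq[OF that] unfolding diag[OF that] e of_real_eq_iff .
 have "norm (harmonic_kernel l y w) \<le> (\<Sum>m=1..N. norm (Y m w * cnj (Y m y)))"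
  unfolding harmonic_basis_kernel[OF d Y y, symmetric] by (rule norm_sum)
 also have "... \<le> (\<Sum>m=1..N. ((norm (Y m w))\<^sup>2 + (norm (Y m y))\<^sup>2) / 2)"
 proof (rule sum_mono)
  fix m
  show "norm (Y m w * cnj (Y m y)) \<le> ((norm (Y m w))\<^sup>2 + (norm (Y m y))\<^sup>2) / 2"
   using sum_squares_bound[of "norm (Y m w)" "norm (Y m y)"] by (simp add: norm_mult)
 qed
 also have "... = real N / sphere_area DIM('a)"
  unfolding sum_divide_distrib[symmetric] sum.distrib s[OF y(1)] s[OF y(2)] by simp
 finally show ?thesis .
qed

text \<open>Supremum from mean square: the kernel represents q(y) as an integral and is itself
  bounded through the dimension. The product is estimated by half the sum of squares, hence the
  additive form of the bound.\<close>

lemma solid_harmonic_sup_bound: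
 fixes Y :: "nat => 'a::euclidean_space => complex" and y :: 'a
 assumes d: "DIM('a) \<ge> 3" and Y: "orthonormal_harmonic_basis l N Y" and q: "solid_harmonic l q" and y: "norm y = 1"
 shows "norm (q y) \<le> ((SPH w. (norm (q w))\<^sup>2) + (real N)\<^sup>2 / sphere_area DIM('a)) / 2"
proof -
 have c: "continuous_on (sphere 0 1) q" "continuous_on (sphere 0 1) (harmonic_kernel l y)"
  using solid_harmonicD(4) q solid_harmonic_kernel[OF y] by blast+
 have "norm (q y) = norm (SPH w. harmonic_kernel l y w * q w)"
  by (simp add: harmonic_kernel_reproducing[OF d q])
 also have "... \<le> (SPH w. ((norm (q w))\<^sup>2 + (real N / sphere_area DIM('a))\<^sup>2) / 2)"
 proof (rule lint_norm_bound_integral)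
  show "norm (harmonic_kernel l y w * q w) \<le> ((norm (q w))\<^sup>2 + (real N / sphere_area DIM('a))\<^sup>2) / 2"
   if "w \<in> space sphere_measure" for w
  proof -
   have k: "norm (harmonic_kernel l y w) \<le> real N / sphere_area DIM('a)"
    using that by (intro harmonic_kernel_bound[OF d Y y]) simp
   have "norm (harmonic_kernel l y w * q w) \<le> ((norm (q w))\<^sup>2 + (norm (harmonic_kernel l y w))\<^sup>2) / 2"
    using sum_squares_bound[of "norm (q w)" "norm (harmonic_kernel l y w)"] by (simp add: norm_mult mult_ac)
   also have "... \<le> ((norm (q w))\<^sup>2 + (real N / sphere_area DIM('a))\<^sup>2) / 2"
    using power_mono[OF k norm_ge_zero, of 2] by simp
   finally show ?thesis .
  qed
 qed (auto intro!: continuous_sphere_integrable continuous_intros c)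
 also have "... = ((SPH w. (norm (q w))\<^sup>2) + sphere_area DIM('a) * (real N / sphere_area DIM('a))\<^sup>2) / 2"
 proof -
  have "(SPH w. (norm (q w))\<^sup>2 + (real N / sphere_area DIM('a))\<^sup>2) =
    (SPH w. (norm (q w))\<^sup>2) + (LINT w|(sphere_measure :: 'a measure). (real N / sphere_area DIM('a))\<^sup>2)"
   by (intro lint_add continuous_sphere_integrable continuous_intros c)
  then show ?thesis by (simp add: measure_sphere_measure sphere_area_def)
 qed
 also have "sphere_area DIM('a) * (real N / sphere_area DIM('a))\<^sup>2 = (real N)\<^sup>2 / sphere_area DIM('a)"
  using sphere_area_pos[where 'a='a] by (simp add: power2_eq_square)
 finally show ?thesis .
qed

text \<open>The product identity with the conjugate of p as second factor expresses the full
  gradient by the norm of p; one partial derivative is a single nonnegative summand.\<close>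

lemma harmonic_gradient_L2:
 fixes p :: "'a::euclidean_space => complex"
 assumes d: "DIM('a) \<ge> 3" and p: "solid_harmonic l p" and b: "b \<in> Basis"
 shows "(SPH w. (norm (pdir b p w))\<^sup>2) \<le> real (l * (2 * l + DIM('a) - 2)) * (SPH w. (norm (p w))\<^sup>2)"
proof -
 have poly: "polynomial_function p" using p by (simp add: solid_harmonic_def)
 have I: "(SPH w. f w * cnj (f w)) = cx (SPH w. (norm (f w))\<^sup>2)" for f :: "'a => complex"
  by (simp add: complex_norm_square[symmetric] integral_complex_of_real[symmetric] del: of_real_power integral_complex_of_real)
 have "cx (real ((l + l) * (l + l + DIM('a) - 2)) * (SPH w. (norm (p w))\<^sup>2)) =
   cx (2 * (\<Sum>b\<in>Basis. SPH w. (norm (pdir b p w))\<^sup>2))"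
  using sphere_integral_mult_harmonic[OF d p solid_harmonic_cnj[OF p]]
  by (simp add: pdir_cnj polynomial_differentiable poly I del: of_nat_mult)
 then have "real ((l + l) * (l + l + DIM('a) - 2)) * (SPH w. (norm (p w))\<^sup>2) =
   2 * (\<Sum>b\<in>Basis. SPH w. (norm (pdir b p w))\<^sup>2)" unfolding of_real_eq_iff .
 moreover have "(SPH w. (norm (pdir b p w))\<^sup>2) \<le> (\<Sum>b\<in>Basis. SPH w. (norm (pdir b p w))\<^sup>2)"
  by (rule member_le_sum[OF b]) simp_all
 moreover have "real ((l + l) * (l + l + DIM('a) - 2)) = 2 * real (l * (2 * l + DIM('a) - 2))"
  unfolding mult_2[symmetric] by simp
 ultimately show ?thesis by (simp del: of_nat_mult)
qed

lemma harmonic_dim_bound: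
 assumes "d \<ge> 3"
 shows "real (harmonic_dim d l) \<le> 2 * real d ^ Suc d * real (Suc l) ^ Suc d"
proof -
 obtain e where d: "d = e + 3" using assms by (metis add.commute le_Suc_ex)
 have g: "Gamma (real l + real d - 2) = fact (l + e)" "Gamma (real l + 1) = fact l" "Gamma (real d - 1) = fact (e + 1)"
  using Gamma_fact[of "l + e", where 'a = real] Gamma_fact[of l, where 'a = real] Gamma_fact[of "e + 1", where 'a = real]
  by (simp_all add: d algebra_simps)
 have "fact (l + e) div fact l \<le> (l + e) ^ e" using fact_div_fact_le_pow[of e "l + e"] by simp
 moreover have "(fact l :: nat) dvd fact (l + e)" by (rule fact_dvd) simp
 ultimately have "(fact (l + e) :: nat) \<le> (l + e) ^ e * fact l"
  by (metis div_mult_self1_is_m dvd_div_mult_self mult_le_mono1)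
 then have "real (fact (l + e)) \<le> real ((l + e) ^ e * fact l)" by (rule of_nat_mono)
 then have f: "(fact (l + e) :: real) \<le> real (l + e) ^ e * fact l" by simp
 have "real (harmonic_dim d l) = (2 * real l + real d - 2) * fact (l + e) / (fact l * fact (e + 1))"
  unfolding real_harmonic_dim[OF assms] g ..
 also have "... \<le> (2 * real l + real d - 2) * fact (l + e) / (fact l * 1)"
  using assms by (intro divide_left_mono mult_left_mono mult_pos_pos mult_nonneg_nonneg) (auto simp: fact_ge_1 simp del: fact_Suc)
 also have "... \<le> (2 * real l + real d - 2) * (real (l + e) ^ e * fact l) / (fact l * 1)"
  using assms f by (intro divide_right_mono mult_left_mono) auto
 also have "... = (2 * real l + real d - 2) * real (l + e) ^ e" by simp
 also have "... \<le> (2 * (real d * real (Suc l))) * (real d * real (Suc l)) ^ d"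
 proof (rule mult_mono)
  have ld: "real (l + d) \<le> real d * real (Suc l)"
  proof -
   have "l + d \<le> d * Suc l" using assms by (cases d) auto
   then show ?thesis by (metis of_nat_le_iff of_nat_mult)
  qed
  then show "2 * real l + real d - 2 \<le> 2 * (real d * real (Suc l))" by simp
  have "real (l + e) ^ e \<le> real (l + d) ^ e" by (rule power_mono) (simp_all add: d)
  also have "... \<le> real (l + d) ^ d" using assms by (intro power_increasing) (simp_all add: d)
  also have "... \<le> (real d * real (Suc l)) ^ d" by (rule power_mono[OF ld]) simp
  finally show "real (l + e) ^ e \<le> (real d * real (Suc l)) ^ d" .
 qed auto
 also have "... = 2 * real d ^ Suc d * real (Suc l) ^ Suc d" by (simp add: power_mult_distrib mult_ac)
 finally show ?thesis .
qed

text \<open>Induction on the exponent with q replaced by its square root: Bernoulli's inequality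
  spends one sqrt q^l on the new factor l + 1, the remaining power takes the other.\<close>

lemma polynomial_le_geometric:
 assumes "q > (1::real)"
 shows "\<exists>C>0. \<forall>l. real (Suc l) ^ n \<le> C * q ^ l" using assms
proof (induction n arbitrary: q)
 case 0
 then show ?case by (intro exI[of _ 1]) simp
next
 case (Suc n)
 have q: "sqrt q > 1" using Suc.prems by simp
 obtain C where C: "C > 0" "\<And>l. real (Suc l) ^ n \<le> C * sqrt q ^ l" using Suc.IH[OF q] by blast
 define c where "c = min 1 (sqrt q - 1)"
 have c: "c > 0" "c \<le> 1" "c \<le> sqrt q - 1" using q by (simp_all add: c_def)
 have "real (Suc l) * c \<le> sqrt q ^ l" for l
 proof -
  have "real (Suc l) * c \<le> 1 + real l * (sqrt q - 1)"
   using mult_left_mono[OF c(3), of "real l"] c(2) by (simp add: algebra_simps)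
  also have "... \<le> sqrt q ^ l" using Bernoulli_inequality[of "sqrt q - 1" l] q by simp
  finally show ?thesis .
 qed
 then have "real (Suc l) \<le> sqrt q ^ l / c" for l using c by (simp add: pos_le_divide_eq)
 then have "real (Suc l) ^ Suc n \<le> (sqrt q ^ l / c) * (C * sqrt q ^ l)" for l
  unfolding power_Suc using C(2) c q by (intro mult_mono) (auto intro!: divide_nonneg_pos)
 moreover have "(sqrt q ^ l / c) * (C * sqrt q ^ l) = C / c * q ^ l" for l
 proof -
  have "sqrt q ^ l * sqrt q ^ l = q ^ l" using Suc.prems by (simp flip: power_mult_distrib)
  then show ?thesis by (simp add: field_simps)
 qed
 ultimately have "real (Suc l) ^ Suc n \<le> C / c * q ^ l" for l by (simp only:)
 then show ?case using C(1) c(1) by (intro exI[of _ "C / c"] conjI allI) simp_all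
qed

text \<open>Any q > 1 absorbs the polynomial growth of the dimensions, so kernel and gradient cost
  an arbitrarily small exponential factor in the convergence proof. Partial derivatives of a kernel
  of degree l + 1 are harmonic of degree l, so their mean square controls them pointwise on the
  sphere; homogeneity extends the bounds to all x.\<close>

theorem harmonic_kernel_growth:
 fixes Y :: "nat => nat => 'a::euclidean_space => complex"
 assumes d: "DIM('a) \<ge> 3" and Y: "\<And>l. orthonormal_harmonic_basis l (harmonic_dim DIM('a) l) (Y l)"
  and q: "q > 1"
 obtains C where "C \<ge> 0"
  "\<And>l (y::'a) x. norm y = 1 ==> norm (harmonic_kernel l y x) \<le> C * q ^ l * norm x ^ l"
  "\<And>l (y::'a) x b. norm y = 1 ==> b \<in> Basis ==>
    norm (pdir b (harmonic_kernel l y) x) \<le> C * q ^ l * norm x ^ (l - 1)"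
proof -
 define A where "A = 2 * real DIM('a) ^ Suc DIM('a)"
 define S where "S = sphere_area DIM('a)"
 define e where "e = Suc DIM('a)"
 define N where "N = (\<lambda>l. real (harmonic_dim DIM('a) l))"
 have S: "S > 0" unfolding S_def by (rule sphere_area_pos)
 have N: "N l \<le> A * real (Suc l) ^ e" for l
  unfolding N_def A_def e_def by (rule harmonic_dim_bound[OF d])
 have N0: "N l \<ge> 0" for l by (simp add: N_def)
 have A: "A \<ge> 0" by (simp add: A_def)
 let ?m = "\<lambda>l. Suc l * (2 * Suc l + DIM('a) - 2)"
 let ?r = "\<lambda>l. real (Suc (Suc l))"
 have hom: "norm (f x) \<le> B * norm x ^ l"
  if f: "solid_harmonic l f" and B: "\<And>\<omega>. norm \<omega> = 1 ==> norm (f \<omega>) \<le> B" for f and x :: 'a and l B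
 proof (cases "x = 0")
  case True
  show ?thesis
  proof (cases l)
   case 0
   obtain b :: 'a where "b \<in> Basis" using nonempty_Basis by blast
   then have "norm (f b) \<le> B" using B by simp
   then show ?thesis using solid_harmonic_0[of f x b] f 0 by simp
  next
   case (Suc m)
   have "f (0 *R x) = cx (0 ^ l) * f x" by (rule solid_harmonicD(2)[OF f])
   then show ?thesis using True Suc by simp
  qed
 next
  case False
  have "f (norm x *R (x /R norm x)) = cx (norm x ^ l) * f (x /R norm x)" by (rule solid_harmonicD(2)[OF f])
  then have "norm (f x) = norm x ^ l * norm (f (x /R norm x))" using False by (simp add: norm_mult norm_power)
  also have "... \<le> norm x ^ l * B" using False by (intro mult_left_mono B) simp_all
  finally show ?thesis by (simp add: mult.commute)
 qed
 have k1: "norm (harmonic_kernel l y \<omega>) \<le> N l / S" if "norm y = 1" "norm \<omega> = 1" for l and y \<omega> :: 'a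
  unfolding N_def S_def by (rule harmonic_kernel_bound[OF d Y that])
 have k2: "norm (pdir b (harmonic_kernel (Suc l) y) \<omega>) \<le>
   (real (?m l) * (N (Suc l))\<^sup>2 / S + (N l)\<^sup>2 / S) / 2"
  if y: "norm y = 1" "norm \<omega> = 1" and b: "b \<in> Basis" for l and y \<omega> b :: 'a
 proof -
  have h: "solid_harmonic (Suc l) (harmonic_kernel (Suc l) y)" by (rule solid_harmonic_kernel[OF y(1)])
  have c: "continuous_on (sphere 0 1) (harmonic_kernel (Suc l) y)" by (rule solid_harmonicD(4)[OF h])
  have "norm (pdir b (harmonic_kernel (Suc l) y) \<omega>) \<le>
    ((SPH \<omega>. (norm (pdir b (harmonic_kernel (Suc l) y) \<omega>))\<^sup>2) + (N l)\<^sup>2 / S) / 2"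
   unfolding N_def S_def by (rule solid_harmonic_sup_bound[OF d Y solid_harmonic_pdir[OF h] y(2)])
  moreover have "(SPH \<omega>. (norm (pdir b (harmonic_kernel (Suc l) y) \<omega>))\<^sup>2) \<le>
    real (?m l) * (SPH \<omega>. (norm (harmonic_kernel (Suc l) y \<omega>))\<^sup>2)"
   by (rule harmonic_gradient_L2[OF d h b])
  moreover have "(SPH \<omega>. (norm (harmonic_kernel (Suc l) y \<omega>))\<^sup>2) \<le> (N (Suc l))\<^sup>2 / S"
  proof -
  have "(SPH \<omega>. (norm (harmonic_kernel (Suc l) y \<omega>))\<^sup>2) \<le> (LINT \<omega>|(sphere_measure :: 'a measure). (N (Suc l) / S)\<^sup>2)"
   by (rule integral_mono) (auto intro!: continuous_sphere_integrable continuous_intros c power_mono k1 y)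
  also have "... = (N (Suc l))\<^sup>2 / S"
   using S by (simp add: measure_sphere_measure flip: sphere_area_def S_def) (simp add: power2_eq_square)
  finally show ?thesis .
  qed
  then have "real (?m l) * (SPH \<omega>. (norm (harmonic_kernel (Suc l) y \<omega>))\<^sup>2) \<le>
    real (?m l) * ((N (Suc l))\<^sup>2 / S)" by (rule mult_left_mono) simp
  moreover have "a \<le> (v + z) / 2" if "a \<le> (g + z) / 2" "g \<le> w" "w \<le> v" for a g z w v :: real
   using that by argo
  ultimately show ?thesis unfolding times_divide_eq_right by blast
 qed
 define n where "n = 2 * e + 2"
 have big: "real (Suc l) ^ i \<le> real (Suc l) ^ n" if "i \<le> n" for i l
  using that by (intro power_increasing) auto
 have b1: "N l / S \<le> (A / S) * real (Suc l) ^ n" for l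
 proof -
  have "N l / S \<le> A * real (Suc l) ^ e / S" using S by (intro divide_right_mono N) simp
  also have "... \<le> A * real (Suc l) ^ n / S" using S A by (intro divide_right_mono mult_left_mono big) (simp_all add: n_def)
  finally show ?thesis by simp
 qed
 define B where "B = (2 * real DIM('a) * A^2 + A^2) / S"
 have b2: "(real (?m l) * (N (Suc l))\<^sup>2 / S + (N l)\<^sup>2 / S) / 2 \<le> B * ?r l ^ n" for l
 proof -
  have sq: "(N m)\<^sup>2 \<le> A^2 * ?r l ^ (2 * e)" if "m \<le> Suc l" for m
  proof -
   have "(N m)\<^sup>2 \<le> (A * real (Suc m) ^ e)\<^sup>2" by (rule power_mono[OF N N0])
   also have "... \<le> (A * ?r l ^ e)\<^sup>2" using that A by (intro power_mono mult_left_mono) auto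
   finally show ?thesis by (simp add: power_mult_distrib power_mult[symmetric] mult.commute)
  qed
  have "?m l \<le> 2 * DIM('a) * (Suc (Suc l))\<^sup>2"
  proof -
   have "2 * Suc l + DIM('a) - 2 \<le> 2 * DIM('a) * Suc (Suc l)" using d by (cases "DIM('a)") auto
   then have "?m l \<le> Suc (Suc l) * (2 * DIM('a) * Suc (Suc l))" by (intro mult_mono) auto
   then show ?thesis by (simp only: power2_eq_square mult_ac)
  qed
  then have "real (?m l) \<le> real (2 * DIM('a) * (Suc (Suc l))\<^sup>2)" by (simp only: of_nat_le_iff)
  also have "... = 2 * real DIM('a) * (?r l)\<^sup>2"
   by (simp only: of_nat_mult of_nat_power of_nat_numeral)
  finally have r: "real (?m l) \<le> 2 * real DIM('a) * (?r l)\<^sup>2" .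
  have "real (?m l) * (N (Suc l))\<^sup>2 + (N l)\<^sup>2 \<le>
    (2 * real DIM('a) * (?r l)\<^sup>2) * (A^2 * ?r l ^ (2 * e)) + A^2 * ?r l ^ (2 * e)"
   by (intro add_mono mult_mono r sq) auto
  also have "... \<le> (2 * real DIM('a) * (?r l)\<^sup>2) * (A^2 * ?r l ^ (2 * e)) + A^2 * ?r l ^ n"
   by (intro add_mono mult_left_mono big) (simp_all add: n_def)
  also have "... = (2 * real DIM('a) * A^2 + A^2) * ?r l ^ n"
   by (simp only: n_def power_add) (simp add: algebra_simps)
  finally have "(real (?m l) * (N (Suc l))\<^sup>2 + (N l)\<^sup>2) / S \<le> B * ?r l ^ n"
   using S by (simp only: B_def divide_right_mono times_divide_eq_left less_imp_le)
  moreover have "0 \<le> (real (?m l) * (N (Suc l))\<^sup>2 + (N l)\<^sup>2) / S" using S by simp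
  moreover have "t / 2 \<le> u" if "t \<le> u" "0 \<le> t" for t u :: real using that by argo
  ultimately show ?thesis unfolding add_divide_distrib[symmetric] by blast
 qed
 obtain G where G: "G > 0" "\<And>l. real (Suc l) ^ n \<le> G * q ^ l" using polynomial_le_geometric[OF q] by blast
 define C where "C = max (A / S) B * G"
 have mx: "A / S \<ge> 0" "B \<ge> 0" using A S by (simp_all add: B_def)
 have C: "A / S * real (Suc l) ^ n \<le> C * q ^ l" "B * real (Suc l) ^ n \<le> C * q ^ l" for l
 proof -
  have "max (A / S) B * real (Suc l) ^ n \<le> max (A / S) B * (G * q ^ l)" using mx by (intro mult_left_mono G(2)) simp
  then have M: "max (A / S) B * real (Suc l) ^ n \<le> C * q ^ l" unfolding C_def mult.assoc .
  have m: "A / S * real (Suc l) ^ n \<le> max (A / S) B * real (Suc l) ^ n" "B * real (Suc l) ^ n \<le> max (A / S) B * real (Suc l) ^ n"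
   by (intro mult_right_mono; simp)+
  show "A / S * real (Suc l) ^ n \<le> C * q ^ l" "B * real (Suc l) ^ n \<le> C * q ^ l"
   using order_trans[OF m(1) M] order_trans[OF m(2) M] by blast+
 qed
 have C0: "C \<ge> 0" using mx G(1) by (simp add: C_def)
 show thesis
 proof (rule that[OF C0])
  show "norm (harmonic_kernel l y x) \<le> C * q ^ l * norm x ^ l" if "norm y = 1" for l and y x :: 'a
   by (rule hom[OF solid_harmonic_kernel[OF that]]) (rule order_trans[OF k1[OF that] order_trans[OF b1 C(1)]])
  show "norm (pdir b (harmonic_kernel l y) x) \<le> C * q ^ l * norm x ^ (l - 1)"
   if y: "norm y = 1" and b: "b \<in> Basis" for l and y x b :: 'a
  proof (cases l)
   case 0
   \<comment> \<open>In degree 0 the exponent l - 1 is truncated to 0; the kernel is constant and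
     its derivative vanishes.\<close>
   have "harmonic_kernel 0 y = (\<lambda>x. harmonic_kernel 0 y 0)"
    using solid_harmonic_0[OF solid_harmonic_kernel[OF y]] by blast
   then have "pdir b (harmonic_kernel 0 y) x = 0" by (metis pdir_const)
   then show ?thesis using 0 C0 by simp
  next
   case (Suc m)
   have "norm (pdir b (harmonic_kernel (Suc m) y) x) \<le> C * q ^ Suc m * norm x ^ m"
    by (rule hom[OF solid_harmonic_pdir[OF solid_harmonic_kernel[OF y]]])
      (rule order_trans[OF k2[OF y _ b] order_trans[OF b2 C(2)]])
   then show ?thesis using Suc by simp
  qed
 qed
qed

declare measurable_id_sphere_measure [measurable del]

section \<open>Fundamental solution and its expansion\<close>

lemma has_derivative_translate:
 "((\<lambda>y. f (y + a)) has_derivative D) (at y) \<longleftrightarrow> (f has_derivative D) (at (y + a))"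
 for f :: "'a::real_normed_vector => 'b::real_normed_vector"
proof
 have id: "((\<lambda>z. z - a) has_derivative (\<lambda>h. h)) (at (y + a))" by (auto intro!: derivative_eq_intros)
 assume "((\<lambda>y. f (y + a)) has_derivative D) (at y)"
 then have "((\<lambda>y. f (y + a)) has_derivative D) (at (y + a - a))" by simp
 from has_derivative_compose[where f = "\<lambda>z. z - a" and g = "\<lambda>y. f (y + a)", OF id this]
 show "(f has_derivative D) (at (y + a))" by simp
next
 have id: "((\<lambda>z. z + a) has_derivative (\<lambda>h. h)) (at y)" by (auto intro!: derivative_eq_intros)
 assume "(f has_derivative D) (at (y + a))"
 from has_derivative_compose[where f = "\<lambda>z. z + a" and g = f, OF id this]
 show "((\<lambda>y. f (y + a)) has_derivative D) (at y)" by simp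
qed

lemma frechet_derivative_translate:
 "frechet_derivative (\<lambda>y. f (y + a)) (at y) = frechet_derivative f (at (y + a))"
 by (simp add: frechet_derivative_def has_derivative_translate)

lemma pdir_translate: "pdir b (\<lambda>y. f (y + a)) = (\<lambda>y. pdir b f (y + a))"
 by (auto simp: pdir_def frechet_derivative_translate)

lemma laplacian_translate: "laplacian (\<lambda>y. f (y + a)) y = laplacian f (y + a)"
 by (simp add: laplacian_pdir pdir_translate)

lemma C_k_translate: "C_k n f ==> C_k n (\<lambda>y. f (y + a))"
proof (induction n arbitrary: f)
 case 0
 then show ?case by (auto intro!: continuous_intros continuous_on_compose2[of UNIV f])
next
 case (Suc n)
 show ?case
 proof (rule C_k_SucI)
  show "((\<lambda>y. f (y + a)) has_derivative (\<lambda>b. pdir b f (y + a))) (at y)" for y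
   unfolding has_derivative_translate by (rule C_k_SucD(2)[OF Suc.prems])
  show "C_k n (\<lambda>y. pdir b f (y + a))" if "b \<in> Basis" for b
   by (rule Suc.IH[OF C_k_SucD(3)[OF Suc.prems that]])
 qed
qed

lemma test_function_translate:
 assumes "test_function S \<phi>"
 shows "test_function ((\<lambda>y. y - a) ` S) (\<lambda>y. \<phi> (y + a))"
proof -
 obtain K where K: "compact K" "K \<subseteq> S" "\<And>x. x \<notin> K ==> \<phi> x = 0" using test_function_supp[OF assms] by blast
 show ?thesis
 proof (rule test_functionI)
  show "C_k n (\<lambda>y. \<phi> (y + a))" for n using assms by (simp add: test_function_def C_k_translate)
  show "compact ((\<lambda>y. y - a) ` K)" using compact_translation[of K "- a"] K(1) by (simp add: add.commute[of "- a"])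
  show "(\<lambda>y. y - a) ` K \<subseteq> (\<lambda>y. y - a) ` S" using K(2) by blast
  show "\<phi> (y + a) = 0" if "y \<notin> (\<lambda>y. y - a) ` K" for y
  proof (rule K(3))
   show "y + a \<notin> K" using that by (metis add_diff_cancel_right' image_eqI)
  qed
 qed
qed

lemma laplacian_cong_open:
 assumes "open S" "x \<in> S" "\<And>y. y \<in> S ==> f y = g y"
 shows "laplacian f x = laplacian g x"
proof -
 have "pdir b f y = pdir b g y" if "y \<in> S" for b y
  by (rule pdir_cong_open[OF assms(1) that assms(3)])
 then have "pdir b (pdir b f) x = pdir b (pdir b g) x" for b by (rule pdir_cong_open[OF assms(1,2)])
 then show ?thesis by (simp add: laplacian_pdir)
qed

lemma test_function_helmholtz:
 fixes \<phi> :: "'a::euclidean_space => complex"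
 assumes \<phi>: "test_function S \<phi>"
 obtains K B where "compact K" "K \<subseteq> S" "\<And>x. x \<notin> K ==> \<phi> x = 0" "\<And>x. x \<notin> K ==> laplacian \<phi> x + c * \<phi> x = 0"
  "\<And>x. norm (\<phi> x) \<le> B" "\<And>x. norm (laplacian \<phi> x + c * \<phi> x) \<le> B" "B \<ge> 0"
  "continuous_on UNIV \<phi>" "continuous_on UNIV (\<lambda>x. laplacian \<phi> x + c * \<phi> x)"
proof -
 obtain K where K: "compact K" "K \<subseteq> S" "\<And>x. x \<notin> K ==> \<phi> x = 0" using test_function_supp[OF \<phi>] by blast
 have lap0: "laplacian \<phi> y = 0" if "y \<notin> K" for y
  using laplacian_cong_open[of "- K" y \<phi> "\<lambda>_. 0"] that K by (simp add: laplacian_const compact_imp_closed open_Compl)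
 have Ck: "C_k n \<phi>" for n using \<phi> by (simp add: test_function_def)
 have "continuous_on UNIV (pdir b (pdir b \<phi>))" if "b \<in> Basis" for b
  by (rule C_k_continuous[OF C_k_SucD(3)[OF C_k_SucD(3)[OF Ck that] that]])
 then have lapc: "continuous_on UNIV (laplacian \<phi>)"
  unfolding laplacian_pdir[abs_def] by (auto intro!: continuous_on_sum)
 have c: "continuous_on UNIV \<phi>" by (rule C_k_continuous[OF Ck])
 have c2: "continuous_on UNIV (\<lambda>x. laplacian \<phi> x + c * \<phi> x)" by (intro continuous_intros lapc c)
 have bd: "\<exists>B. \<forall>x. norm (f x) \<le> B" if f: "continuous_on UNIV f" "\<And>x. x \<notin> K ==> f x = 0" for f :: "'a => complex"
 proof -
  obtain B where B: "\<And>y. y \<in> f ` K ==> norm y \<le> B"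
   using compact_imp_bounded[OF compact_continuous_image[OF continuous_on_subset[OF f(1)] K(1)]] unfolding bounded_iff by auto
  have "norm (f x) \<le> max 0 B" for x using B[of "f x"] f(2)[of x] by (cases "x \<in> K") auto
  then show ?thesis by blast
 qed
 obtain B1 B2 where B: "\<And>x. norm (\<phi> x) \<le> B1" "\<And>x. norm (laplacian \<phi> x + c * \<phi> x) \<le> B2"
  using bd[OF c K(3)] bd[OF c2] lap0 K(3) by auto
 show thesis
 proof (rule that[of K "max 0 (max B1 B2)"])
  show "laplacian \<phi> x + c * \<phi> x = 0" if "x \<notin> K" for x using lap0[OF that] K(3)[OF that] by simp
  show "norm (\<phi> x) \<le> max 0 (max B1 B2)" "norm (laplacian \<phi> x + c * \<phi> x) \<le> max 0 (max B1 B2)" for x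
   using B(1)[of x] B(2)[of x] by auto
 qed (use K c c2 in auto)
qed

lemma integral_helmholtz_swap:
 fixes u :: "'a::euclidean_space => complex"
 assumes u: "C_k 2 u" and \<phi>: "test_function S \<phi>"
 shows "integrable lborel (\<lambda>x. u x * (laplacian \<phi> x + c * \<phi> x))"
  and "(LBINT x. u x * (laplacian \<phi> x + c * \<phi> x)) = (LBINT x. (laplacian u x + c * u x) * \<phi> x)"
proof -
 obtain K where K: "compact K" "\<And>x. x \<notin> K ==> \<phi> x = 0" "continuous_on UNIV \<phi>"
  using test_function_helmholtz[OF \<phi>, of 0] by metis
 have int: "integrable lborel (\<lambda>x. c * (u x * \<phi> x))"
  by (rule integrable_compact_support[OF _ K(1)]) (use K C_k_continuous[OF u] in \<open>auto intro!: continuous_intros\<close>)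
 have eq: "u x * (laplacian \<phi> x + c * \<phi> x) = u x * laplacian \<phi> x + c * (u x * \<phi> x)"
  "(laplacian u x + c * u x) * \<phi> x = laplacian u x * \<phi> x + c * (u x * \<phi> x)" for x
  by (simp_all add: algebra_simps)
 show "integrable lborel (\<lambda>x. u x * (laplacian \<phi> x + c * \<phi> x))"
  unfolding eq by (intro Bochner_Integration.integrable_add integral_laplacian_swap(1)[OF u \<phi>] int)
 show "(LBINT x. u x * (laplacian \<phi> x + c * \<phi> x)) = (LBINT x. (laplacian u x + c * u x) * \<phi> x)"
  unfolding eq by (simp only: lint_add[OF integral_laplacian_swap(1)[OF u \<phi>] int]
    lint_add[OF integral_laplacian_swap(2)[OF u \<phi>] int] integral_laplacian_swap(3)[OF u \<phi>])
qed

lemma set_integral_helmholtz: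
 fixes G \<phi> :: "'a::euclidean_space => complex"
 assumes \<phi>: "test_function S \<phi>"
 shows "(LINT x:S|lborel. G x * (laplacian \<phi> x + c * \<phi> x)) = (LBINT x. G x * (laplacian \<phi> x + c * \<phi> x))"
proof -
 obtain K where K: "K \<subseteq> S" "\<And>x. x \<notin> K ==> laplacian \<phi> x + c * \<phi> x = 0"
  using test_function_helmholtz[OF \<phi>, of c] by metis
 show ?thesis unfolding set_lebesgue_integral_def
 proof (rule lint_cong[OF refl])
  fix x
  show "indicator S x *R (G x * (laplacian \<phi> x + c * \<phi> x)) = G x * (laplacian \<phi> x + c * \<phi> x)"
   using K by (cases "x \<in> K") auto
 qed
qed

lemma laplacian_radial:
 fixes F :: "nat => real => real" and x :: "'a::euclidean_space"
 assumes S: "open S" "sq x \<in> S"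
  and F: "\<And>m t. t \<in> S ==> (F m has_real_derivative F (Suc m) t) (at t)"
 shows "laplacian (\<lambda>x. cx (F 0 (sq x))) x =
  cx (4 * (sq x) * F 2 (sq x) + 2 * real DIM('a) * F 1 (sq x))"
proof -
 have "laplacian (\<lambda>x. cx (F 0 (sq x)) * 1) x = (4 * cx (sq x) * cx (F 2 (sq x))
    + cx (2 * real DIM('a) + 4 * real 0) * cx (F 1 (sq x))) * 1
   + cx (F 0 (sq x)) * laplacian (\<lambda>x. 1) x"
  by (rule laplacian_radial_mult[OF S, where F="\<lambda>s. cx (F 0 s)" and F'="\<lambda>s. cx (F 1 s)" and F''="\<lambda>s. cx (F 2 s)" and p = "\<lambda>x. 1" and l = 0])
    (use F[of _ 0] F[of _ 1] in \<open>auto intro!: has_vector_derivative_of_real C_k_const simp: numeral_2_eq_2\<close>)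
 then show ?thesis by (simp add: laplacian_const)
qed

text \<open>Away from the source the profile may be replaced by a smooth function that agrees with
  it on an open set containing the support of the test function; the Laplacian can then be moved
  across.\<close>

lemma weak_helmholtz_radial_0:
 fixes F :: "nat => real => real" and \<phi> :: "'a::euclidean_space => complex"
 assumes F: "\<And>m s. s > 0 ==> (F m has_real_derivative F (Suc m) s) (at s)"
  and ode: "\<And>s. s > 0 ==> 4 * s * F 2 s + 2 * real DIM('a) * F 1 s + k^2 * F 0 s = 0"
  and \<phi>: "test_function S \<phi>" and S: "0 \<notin> S"
 shows "(LBINT y. cx (F 0 (sq y)) * helmholtz k \<phi> y) = 0"
proof -
 obtain K where K: "compact K" "K \<subseteq> S" "\<And>x. x \<notin> K ==> \<phi> x = 0"
   "\<And>x. x \<notin> K ==> helmholtz k \<phi> x = 0" using test_function_helmholtz[OF \<phi>, of "cx (k^2)"] by metis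
 have "open (- K)" "0 \<in> - K" using K S by (auto intro: compact_imp_closed)
 then obtain \<delta> where \<delta>: "\<delta> > 0" "ball 0 \<delta> \<subseteq> - K" using openE by blast
 \<comment> \<open>The step rises for |y|^2 between \<delta>^2 / 4 and \<delta>^2 / 2, inside the
   ball that misses K.\<close>
 define a where "a = \<delta>^2 / 4"
 have a: "0 < a" "a < 2 * a" using \<delta>(1) by (simp_all add: a_def)
 obtain \<theta> \<Theta> where st: "\<And>n. C_k n (\<lambda>s. cx (\<Theta> s))"
  "\<And>s. s \<le> a ==> \<Theta> s = 0" "\<And>s. s \<ge> 2 * a ==> \<Theta> s = (1::real)" by (rule smooth_step[OF a(2)]) blast
 define h where "h = (\<lambda>y::'a. cx (\<Theta> (sq y)))"
 define u where "u = (\<lambda>y. h y * cx (F 0 (sq y)))"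
 have u: "C_k n u" for n unfolding u_def
  by (rule C_k_radial_cutoff[where F = "\<lambda>m s. cx (F m s)" and a = a])
    (auto simp: h_def st(2) a(1) intro!: has_vector_derivative_of_real F C_k_of_real_radial st(1))
 define V where "V = {y::'a. sq y > 2 * a}"
 have V: "open V" unfolding V_def by (intro open_Collect_less continuous_intros)
 have KV: "y \<in> V" if "y \<in> K" for y
 proof -
  have "\<delta> \<le> norm y" using \<delta>(2) that by (force simp: subset_eq)
  then have "\<delta>^2 \<le> sq y" using \<delta>(1) by (simp flip: power2_norm_eq_inner)
  moreover have "\<delta>^2 > 0" using \<delta>(1) by simp
  ultimately show ?thesis unfolding V_def a_def mem_Collect_eq by linarith
 qed
 have uV: "u y = cx (F 0 (sq y))" if "y \<in> V" for y using that by (simp add: u_def h_def V_def st(3))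
 have ode': "helmholtz k u y = 0" if "y \<in> V" for y
 proof -
  have y: "sq y \<in> {0<..}" using that a unfolding V_def mem_Collect_eq greaterThan_iff by linarith
  have "laplacian u y = laplacian (\<lambda>y. cx (F 0 (sq y))) y"
   by (rule laplacian_cong_open[OF V that uV])
  also have "... = cx (4 * (sq y) * F 2 (sq y) + 2 * real DIM('a) * F 1 (sq y))"
   by (rule laplacian_radial[OF _ y]) (auto intro: F)
  also have "... + cx (k^2) * u y = cx (4 * (sq y) * F 2 (sq y) + 2 * real DIM('a) * F 1 (sq y) + k^2 * F 0 (sq y))"
   by (simp add: uV[OF that])
  also have "4 * (sq y) * F 2 (sq y) + 2 * real DIM('a) * F 1 (sq y) + k^2 * F 0 (sq y) = 0"
   using y by (intro ode) simp
  finally show ?thesis by simp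
 qed
 have "cx (F 0 (sq y)) * helmholtz k \<phi> y = u y * helmholtz k \<phi> y" for y
  using uV[OF KV] K(4) by (cases "y \<in> K") simp_all
 then have "(LBINT y. cx (F 0 (sq y)) * helmholtz k \<phi> y) = (LBINT y. helmholtz k u y * \<phi> y)"
  by (simp only: integral_helmholtz_swap(2)[OF u \<phi>])
 moreover have "helmholtz k u y * \<phi> y = 0" for y
  by (cases "y \<in> K") (simp_all only: K(3) ode'[OF KV] mult_zero_left mult_zero_right not_False_eq_True)
 ultimately show ?thesis by (simp only: lint_zero)
qed

text \<open>Continuity gives a Borel function on the open half line; the arbitrary value at the
  single point 0 is added back.\<close>

lemma borel_measurable_radial:
 fixes f :: "real => real" and x :: "'a::euclidean_space"
 assumes "continuous_on {0<..} f"
 shows "(\<lambda>y. f (sq (y - x))) \<in> borel_measurable borel"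
proof -
 have "(\<lambda>s. indicator {0<..} s *R f s) \<in> borel_measurable borel"
  using assms by (intro borel_measurable_continuous_on_indicator) auto
 then have "(\<lambda>s. indicator {0<..} s *R f s + indicator {0} s * f 0) \<in> borel_measurable borel"
  by (rule borel_measurable_add) simp
 then have "(\<lambda>y::'a. (\<lambda>s. indicator {0<..} s *R f s + indicator {0} s * f 0) (sq (y - x))) \<in> borel_measurable borel"
  by (rule measurable_compose[rotated]) (intro borel_measurable_inner borel_measurable_diff; simp)
 also have "(\<lambda>y::'a. (\<lambda>s. indicator {0<..} s *R f s + indicator {0} s * f 0) (sq (y - x))) = (\<lambda>y. f (sq (y - x)))"
  by (auto simp: indicator_def)
 finally show ?thesis .
qed

lemma weak_helmholtz_radial:
 fixes F :: "nat => real => real" and \<phi> :: "'a::euclidean_space => complex"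
 assumes F: "\<And>m s. s > 0 ==> (F m has_real_derivative F (Suc m) s) (at s)"
  and ode: "\<And>s. s > 0 ==> 4 * s * F 2 s + 2 * real DIM('a) * F 1 s + k^2 * F 0 s = 0"
  and \<phi>: "test_function S \<phi>" and S: "x \<notin> S"
 shows "(LBINT y. cx (F 0 (sq (y - x))) * helmholtz k \<phi> y) = 0"
proof -
 have 0: "(LBINT y. cx (F 0 (sq y)) * (laplacian (\<lambda>y. \<phi> (y + x)) y + cx (k^2) * \<phi> (y + x))) = 0"
  by (rule weak_helmholtz_radial_0[OF F ode test_function_translate[OF \<phi>, of x]]) (use S in auto)
 have "(lborel :: 'a measure) = distr lborel borel (\<lambda>y. y + x)"
 proof -
  have "(+) x = (\<lambda>y. y + x)" by (auto simp: add.commute)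
  then show ?thesis using lborel_distr_plus[of x] by simp
 qed
 then have "(LBINT y. cx (F 0 (sq (y - x))) * helmholtz k \<phi> y) =
   (LINT y|distr lborel borel (\<lambda>y. y + x). cx (F 0 (sq (y - x))) * helmholtz k \<phi> y)"
  by (rule arg_cong)
 also have "... = (LBINT y. cx (F 0 (sq (y + x - x))) * (laplacian \<phi> (y + x) + cx (k^2) * \<phi> (y + x)))"
 proof (rule integral_distr)
  have m: "(\<lambda>y. F 0 (sq (y - x))) \<in> borel_measurable borel"
   using F by (intro borel_measurable_radial) (auto intro!: continuous_at_imp_continuous_on DERIV_isCont)
  have "continuous_on UNIV (\<lambda>y. helmholtz k \<phi> y)"
   using test_function_helmholtz[OF \<phi>, of "cx (k^2)"] by metis
  then show "(\<lambda>y. cx (F 0 (sq (y - x))) * helmholtz k \<phi> y) \<in> borel_measurable borel"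
   by (intro borel_measurable_times measurable_compose[OF m borel_measurable_of_real] borel_measurable_continuous_onI)
 qed simp
 also have "... = 0" using 0 by (simp add: laplacian_translate)
 finally show ?thesis .
qed

section \<open>Expansion of a shifted radial solution about the centre\<close>

lemma harmonic_moment_redJ:
 "harmonic_moment DIM('a::euclidean_space) l =
   fact l * (2 * pi) powr (real DIM('a) / 2) * redJ (real DIM('a) / 2 - 1 + real l) 0"
proof -
 have p: "real DIM('a) / 2 + real l > 0" by (intro add_pos_nonneg) simp_all
 have "redJ (real DIM('a) / 2 - 1 + real l) 0 = 2 powr (1 - real DIM('a) / 2 - real l) * rGamma (real DIM('a) / 2 + real l)"
  by (simp add: redJ_0 algebra_simps)
 also have "2 powr (1 - real DIM('a) / 2 - real l) = 2 / (2 powr (real DIM('a) / 2) * 2 ^ l)"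
  by (simp add: powr_diff powr_realpow)
 finally show ?thesis
  by (simp add: harmonic_moment_closed powr_mult rGamma_inverse_Gamma field_simps)
qed

text \<open>Inside the ball of radius |x| the shifted solution is regular, so its projection is
  known up to a factor c. The behaviour as s tends to 0 determines c: in the Taylor series of
  \<open>F 0\<close> at |x|^2 with increment s^2 - 2 s (x . v), moments below l vanish, and order l
  contributes (- 2 s)^l with the l-th derivative \<open>F l\<close>.\<close>

theorem radial_expansion:
 fixes F :: "nat => real => real" and x :: "'a::euclidean_space"
 assumes d: "DIM('a) \<ge> 3" and k: "k > 0"
  and F: "\<And>m s. s > 0 ==> (F m has_real_derivative F (Suc m) s) (at s)"
  and ode: "\<And>s. s > 0 ==> 4 * s * F 2 s + 2 * real DIM('a) * F 1 s + k^2 * F 0 s = 0"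
  and p: "solid_harmonic l p" and s: "0 \<le> s" "s < norm x"
 shows "(SPH v. cx (F 0 (sq (s *R v - x))) * p v) =
  cx ((2 * pi) powr (real DIM('a) / 2) * (- 2) ^ l * F l (sq x) * s ^ l
   * redJ (real DIM('a) / 2 - 1 + real l) (k^2 * s^2)) * p x"
proof -
 define \<mu> where "\<mu> = real DIM('a) / 2 - 1 + real l"
 define r where "r = norm x"
 let ?q = "\<lambda>t w. sq (t *R w - x)"
 let ?T = "\<lambda>t. (t * (t + 2 * r))"
 let ?b = "\<lambda>t j i. cx (of_nat (j choose i) * (- 2 * t) ^ i * (t^2) ^ (j - i))"
 let ?m = "\<lambda>t. cx (t ^ l * (- 2) ^ l * harmonic_moment DIM('a) l)"
 have r: "r > 0" unfolding r_def using s by (rule order.strict_trans1)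
 define P where "P = (\<lambda>s. SPH v. cx (F 0 (?q s v)) * p v)"
 define u where "u = (\<lambda>y. cx (F 0 (sq (y - x))))"
 define E where "E = (\<lambda>t v. cx (F 1 (?q t v) * (2 * ((t *R v - x) \<bullet> v))))"
 have contF: "continuous_on {0<..} (F m)" for m
  using F by (auto intro!: continuous_at_imp_continuous_on DERIV_isCont)
 have pos: "sq (y - x) \<in> {0<..}" if "y \<noteq> x" for y using that by simp
 have off: "t *R v \<noteq> x" if "t \<in> {0..<r}" "v \<in> sphere 0 1" for t v using that by (auto simp: r_def)
 \<comment> \<open>The exceptional point x has norm r, the end of the interval, so no radius below r
   is lost.\<close>
 have "\<exists>c. \<forall>t\<in>{0<..<r} - {norm x}. (SPH v. u (t *R v) * p v) =
   c * cx (t ^ l * redJ (real DIM('a) / 2 - 1 + real l) (k^2 * t^2))"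
 proof (rule weak_helmholtz_projection[OF d k r p, where E = E])
  show "continuous_on (ball 0 r - {x}) u"
   unfolding u_def by (intro continuous_intros continuous_on_compose2[OF contF]) (use pos in auto)
  show "((\<lambda>t. u (t *R v)) has_vector_derivative E t v) (at t)"
   if t: "t \<in> {0<..<r} - {norm x}" and w: "v \<in> sphere 0 1" for t v
  proof -
   have q: "?q t v > 0" using pos[OF off[of t v]] t w by auto
   have "((\<lambda>t. ?q t v) has_real_derivative 2 * ((t *R v - x) \<bullet> v)) (at t)"
    unfolding has_field_derivative_def
    by (auto intro!: derivative_eq_intros simp: algebra_simps inner_commute)
   from DERIV_chain2[OF F[OF q, of 0] this] show ?thesis
    unfolding u_def E_def by (intro has_vector_derivative_of_real) simp
  qed
  show "continuous_on (({0<..<r} - {norm x}) \<times> sphere 0 1) (\<lambda>q. E (fst q) (snd q))" unfolding E_def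
   by (intro continuous_intros continuous_on_compose2[OF contF]) (use pos off in \<open>auto simp: r_def\<close>)
  show "(LINT y:ball 0 r|lborel. u y * helmholtz k \<phi> y) = 0"
   if \<phi>: "test_function (ball 0 r) \<phi>" for \<phi>
   unfolding set_integral_helmholtz[OF \<phi>] u_def by (rule weak_helmholtz_radial[OF F ode \<phi>]) (auto simp: r_def)
 qed
 then obtain c where "\<forall>t\<in>{0<..<r} - {norm x}. (SPH v. u (t *R v) * p v) =
   c * cx (t ^ l * redJ (real DIM('a) / 2 - 1 + real l) (k^2 * t^2))" by blast
 then have c: "P t = c * cx (t ^ l * redJ \<mu> (k^2 * t^2))" if "t \<in> {0<..<r}" for t
  using that by (simp add: u_def P_def \<mu>_def r_def)
 have pint: "integrable sphere_measure (\<lambda>v. f v * p v)" if "continuous_on (sphere 0 1) f" for f :: "'a => complex"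
  by (intro continuous_sphere_integrable continuous_intros that solid_harmonicD(4)[OF p])
 define B where "B = (SPH v. norm (p v))"
 define L where "L = cx (F l (r^2) / fact l * (- 2) ^ l * harmonic_moment DIM('a) l) * p x"
 \<comment> \<open>In the binomial expansion every factor t^2 displaces one factor x . v; against p
   only the full power (x . v)^l survives, and that requires j = l.\<close>
 have mom: "(SPH v. cx (t^2 - 2 * t * (x \<bullet> v)) ^ j * p v) =
   (if j = l then (?m t) * p x else 0)" if "j \<le> l" for t j
 proof -
  have "cx (t^2 - 2 * t * (x \<bullet> v)) ^ j * p v = (\<Sum>i\<le>j. (?b t j i) * (cx (x \<bullet> v) ^ i * p v))" for v
  proof -
   have "(t^2 - 2 * t * (x \<bullet> v)) ^ j = ((- 2 * t) * (x \<bullet> v) + t^2) ^ j" by simp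
   also have "... = (\<Sum>i\<le>j. of_nat (j choose i) * (- 2 * t) ^ i * (t^2) ^ (j - i) * (x \<bullet> v) ^ i)"
    unfolding binomial_ring by (rule sum.cong[OF refl]) (simp only: power_mult_distrib mult_ac)
   finally have "cx ((t^2 - 2 * t * (x \<bullet> v)) ^ j) = cx (\<Sum>i\<le>j. of_nat (j choose i) * (- 2 * t) ^ i * (t^2) ^ (j - i) * (x \<bullet> v) ^ i)"
    by (rule arg_cong)
   then have "cx (t^2 - 2 * t * (x \<bullet> v)) ^ j * p v =
     (\<Sum>i\<le>j. cx (of_nat (j choose i) * (- 2 * t) ^ i * (t^2) ^ (j - i) * (x \<bullet> v) ^ i)) * p v"
    by (simp only: of_real_power of_real_sum)
   then show ?thesis by (simp only: sum_distrib_right of_real_mult of_real_power mult.assoc)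
  qed
  then have "(SPH v. cx (t^2 - 2 * t * (x \<bullet> v)) ^ j * p v) =
    (SPH v. (\<Sum>i\<le>j. (?b t j i) * (cx (x \<bullet> v) ^ i * p v)))" by (simp only:)
  also have "... = (\<Sum>i\<le>j. SPH v. (?b t j i) * (cx (x \<bullet> v) ^ i * p v))"
   by (intro lint_sum integrable_mult_right pint continuous_intros)
  also have "... = (\<Sum>i\<le>j. (?b t j i) * (if i = l then cx (harmonic_moment DIM('a) l) * p x else 0))"
   by (rule sum.cong[OF refl]) (use that harmonic_moments[OF d p] in \<open>auto simp del: of_real_mult\<close>)
  also have "... = (\<Sum>i\<le>j. if i = l then cx (of_nat (j choose l) * (- 2 * t) ^ l * (t^2) ^ (j - l) * harmonic_moment DIM('a) l) * p x else 0)"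
   by (rule sum.cong[OF refl]) simp
  also have "... = (if l \<le> j then cx (of_nat (j choose l) * (- 2 * t) ^ l * (t^2) ^ (j - l) * harmonic_moment DIM('a) l) * p x else 0)"
   by (subst sum.delta) auto
  moreover have "(- 2 * t) ^ l = t ^ l * (- 2) ^ l" by (simp only: power_mult_distrib mult.commute)
  ultimately show ?thesis using that by (auto simp del: of_real_power)
 qed
 obtain M where M: "\<And>t. t \<in> {r^2 / 2..3 / 2 * r^2} ==> \<bar>F (Suc l) t\<bar> \<le> M"
 proof -
  have "compact (F (Suc l) ` {r^2 / 2..3 / 2 * r^2})"
   using r by (intro compact_continuous_image continuous_on_subset[OF contF]) (auto intro: less_le_trans[of 0 "r^2 / 2"])
  then show ?thesis using that by (force dest!: compact_imp_bounded simp: bounded_iff)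
 qed
 have expand: "?q t v = r^2 + (t^2 - 2 * t * (x \<bullet> v))" if "norm v = 1" for t v
 proof -
  have "v \<bullet> v = 1" using that by (simp add: dot_square_norm)
  then show ?thesis unfolding r_def power2_norm_eq_inner inner_diff_left inner_diff_right
   by (simp add: inner_commute[of v x] power2_eq_square algebra_simps)
 qed
 have taylor: "\<bar>F 0 (r^2 + h) - (\<Sum>j\<le>l. F j (r^2) / fact j * h ^ j)\<bar> \<le> M * \<bar>h\<bar> ^ Suc l" if h: "\<bar>h\<bar> \<le> r^2 / 2" for h
 proof (cases "h = 0")
  case True
  \<comment> \<open>\<open>Taylor\<close> compares two distinct points, hence the separate case h =
    0.\<close>
  have "(\<Sum>j\<le>l. F j (r^2) / fact j * 0 ^ j) = F 0 (r^2)"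
   by (simp add: power_0_left if_distrib cong: if_cong)
  then show ?thesis using True by simp
 next
  case False
  have "\<exists>t. (if r\<^sup>2 + h < r\<^sup>2 then r\<^sup>2 + h < t \<and> t < r\<^sup>2 else r\<^sup>2 < t \<and> t < r\<^sup>2 + h) \<and>
    F 0 (r^2 + h) = (\<Sum>m<Suc l. F m (r^2) / fact m * (r^2 + h - r^2) ^ m) + F (Suc l) t / fact (Suc l) * (r^2 + h - r^2) ^ Suc l"
  proof (rule Taylor[where a = "r^2 / 2" and b = "3 / 2 * r^2"])
   show "\<forall>m t. m < Suc l \<and> r\<^sup>2 / 2 \<le> t \<and> t \<le> 3 / 2 * r^2 \<longrightarrow> (F m has_real_derivative F (Suc m) t) (at t)"
    using F r by (metis half_gt_zero less_le_trans zero_less_power)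
  qed (use h False r in \<open>auto simp: abs_le_iff\<close>)
  then obtain t where t0: "if r\<^sup>2 + h < r\<^sup>2 then r\<^sup>2 + h < t \<and> t < r\<^sup>2 else r\<^sup>2 < t \<and> t < r\<^sup>2 + h"
   "F 0 (r^2 + h) = (\<Sum>m<Suc l. F m (r^2) / fact m * (r^2 + h - r^2) ^ m) + F (Suc l) t / fact (Suc l) * (r^2 + h - r^2) ^ Suc l"
   by blast
  have t: "t \<in> {r^2 / 2..3 / 2 * r^2}"
   "F 0 (r^2 + h) = (\<Sum>m<Suc l. F m (r^2) / fact m * h ^ m) + F (Suc l) t / fact (Suc l) * h ^ Suc l"
  proof -
   show "t \<in> {r^2 / 2..3 / 2 * r^2}" using t0(1) h unfolding abs_le_iff by (simp split: if_splits)
  qed (use t0(2) in \<open>simp only: add_diff_cancel_left'\<close>)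
  have "\<bar>F (Suc l) t / fact (Suc l)\<bar> \<le> \<bar>F (Suc l) t\<bar> / 1"
   unfolding abs_divide by (intro divide_left_mono) (simp_all add: fact_ge_1 del: fact_Suc)
  then have "\<bar>F (Suc l) t / fact (Suc l)\<bar> \<le> M" using M[OF t(1)] by simp
  then have "\<bar>F (Suc l) t / fact (Suc l) * h ^ Suc l\<bar> \<le> M * \<bar>h\<bar> ^ Suc l"
   unfolding abs_mult power_abs by (rule mult_right_mono) simp
  then show ?thesis unfolding t(2) lessThan_Suc_atMost by simp
 qed
 \<comment> \<open>The remainder is of order t^(l+1), one power beyond the leading term; the side
   condition keeps r^2 + h in the range of the Taylor bound.\<close>
 have bound: "norm (P t - cx (t ^ l) * L) \<le> M * ?T t ^ Suc l * B"
  if t: "0 < t" "t < r" "t * (t + 2 * r) \<le> r^2 / 2" for t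
 proof -
  define h where "h = (\<lambda>v. t\<^sup>2 - 2 * t * (x \<bullet> v))"
  let ?S = "\<lambda>w. (\<Sum>j\<le>l. cx (F j (r^2) / fact j) * (cx (h w) ^ j * p w))"
  have hc: "continuous_on A h" for A unfolding h_def by (intro continuous_intros)
  have hb: "\<bar>h v\<bar> \<le> t * (t + 2 * r)" if "norm v = 1" for v
  proof -
   have "\<bar>x \<bullet> v\<bar> \<le> r" using Cauchy_Schwarz_ineq2[of x v] that by (simp add: r_def)
   then have "t * \<bar>x \<bullet> v\<bar> \<le> t * r" using t by (intro mult_left_mono) auto
   moreover have "\<bar>h v\<bar> \<le> t^2 + 2 * (t * \<bar>x \<bullet> v\<bar>)"
    unfolding h_def using abs_triangle_ineq4[of "t^2" "2 * t * (x \<bullet> v)"] t by (simp add: abs_mult)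
   ultimately show ?thesis by (simp add: algebra_simps power2_eq_square)
  qed
  have "(\<Sum>j\<le>l. cx (F j (r^2) / fact j) * (SPH v. cx (h v) ^ j * p v)) =
    (\<Sum>j\<le>l. if j = l then cx (F l (r^2) / fact l) * (?m t * p x) else 0)"
   unfolding h_def by (rule sum.cong[OF refl]) (simp only: mom atMost_iff if_distrib mult_zero_right, simp)
  also have "... = cx (t ^ l) * L" by (simp add: L_def)
  finally have sum: "(\<Sum>j\<le>l. cx (F j (r^2) / fact j) * (SPH v. cx (h v) ^ j * p v)) = cx (t ^ l) * L" .
  have cF: "continuous_on (sphere 0 1) (\<lambda>v. cx (F 0 (?q t v)))"
   by (intro continuous_intros continuous_on_compose2[OF contF]) (use pos off t in auto)
  have "P t - cx (t ^ l) * L = P t - (SPH v. ?S v)" unfolding sum[symmetric]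
   by (subst lint_sum) (auto intro!: integrable_mult_right pint continuous_intros hc)
  also have "... = (SPH v. cx (F 0 (?q t v)) * p v - ?S v)" unfolding P_def
   by (intro lint_diff[symmetric] pint cF Bochner_Integration.integrable_sum integrable_mult_right continuous_intros hc)
  also have "norm ... \<le> (SPH v. M * ?T t ^ Suc l * norm (p v))"
  proof (rule lint_norm_bound_integral)
   show "norm (cx (F 0 (?q t v)) * p v - ?S v) \<le> M * ?T t ^ Suc l * norm (p v)"
    if "v \<in> space sphere_measure" for v
   proof -
    have w: "norm v = 1" using that by simp
    have he: "t^2 - 2 * t * (x \<bullet> v) = h v" by (simp add: h_def)
    have "cx (F 0 (?q t v)) * p v - ?S v =
      cx (F 0 (r^2 + h v) - (\<Sum>j\<le>l. F j (r^2) / fact j * h v ^ j)) * p v"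
     unfolding expand[OF w] he by (simp add: left_diff_distrib sum_distrib_right mult.assoc)
    then have "norm (cx (F 0 (?q t v)) * p v - ?S v) =
      \<bar>F 0 (r^2 + h v) - (\<Sum>j\<le>l. F j (r^2) / fact j * h v ^ j)\<bar> * norm (p v)"
     by (simp only: norm_mult norm_of_real)
    also have "... \<le> (M * \<bar>h v\<bar> ^ Suc l) * norm (p v)"
     using hb[OF w] t(3) by (intro mult_right_mono taylor) auto
    also have "... \<le> (M * ?T t ^ Suc l) * norm (p v)"
    proof (intro mult_right_mono mult_left_mono power_mono hb w)
     have "0 \<le> \<bar>F (Suc l) (r^2)\<bar>" by simp
     also have "... \<le> M" using r by (intro M) (auto simp: field_simps)
     finally show "0 \<le> M" .
    qed auto
    finally show ?thesis .
   qed
   show "integrable sphere_measure (\<lambda>v. cx (F 0 (?q t v)) * p v - ?S v)"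
    by (intro Bochner_Integration.integrable_diff pint cF Bochner_Integration.integrable_sum integrable_mult_right continuous_intros hc)
   show "integrable sphere_measure (\<lambda>v. M * ?T t ^ Suc l * norm (p v))"
    by (intro integrable_mult_right continuous_sphere_integrable continuous_intros solid_harmonicD(4)[OF p])
  qed
  also have "... = M * ?T t ^ Suc l * B" by (simp add: B_def)
  finally show ?thesis .
 qed
 \<comment> \<open>Division by t^l leaves one factor t in the error, and t tends to 0.\<close>
 have lim: "c * cx (redJ \<mu> 0) = L"
 proof -
  have "((\<lambda>t. M * (t * (t + 2 * r) ^ Suc l) * B) \<longlongrightarrow> M * (0 * (0 + 2 * r) ^ Suc l) * B) (at_right 0)"
   by (intro tendsto_intros)
  then have z: "((\<lambda>t. M * (t * (t + 2 * r) ^ Suc l) * B) \<longlongrightarrow> 0) (at_right 0)" by simp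
  have "((\<lambda>t. t * (t + 2 * r)) \<longlongrightarrow> 0 * (0 + 2 * r)) (at_right 0)" by (intro tendsto_intros)
  then have "\<forall>\<^sub>F t in at_right 0. t * (t + 2 * r) < r\<^sup>2 / 2" using r by (intro order_tendstoD) auto
  moreover have "\<forall>\<^sub>F t in at_right 0. t \<in> {0<..<r}" using eventually_at_right_real[OF r] .
  ultimately have ev: "\<forall>\<^sub>F t in at_right 0. norm (c * cx (redJ \<mu> (k^2 * t^2)) - L) \<le> M * (t * (t + 2 * r) ^ Suc l) * B"
  proof eventually_elim
   case (elim t)
   have "cx (t ^ l) * (c * cx (redJ \<mu> (k^2 * t^2)) - L) = P t - cx (t ^ l) * L"
    using c[OF elim(2)] by (simp add: algebra_simps)
   then have "t ^ l * norm (c * cx (redJ \<mu> (k^2 * t^2)) - L) = norm (P t - cx (t ^ l) * L)"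
    using elim by (metis greaterThanLessThan_iff less_imp_le norm_mult norm_of_real abs_of_nonneg zero_le_power)
   also have "... \<le> M * ?T t ^ Suc l * B" using elim by (intro bound) auto
   also have "... = t ^ l * (M * (t * (t + 2 * r) ^ Suc l) * B)" by (simp add: power_mult_distrib mult_ac)
   finally show ?case using elim by (simp add: mult_le_cancel_left_pos)
  qed
  have "((\<lambda>t. c * cx (redJ \<mu> (k^2 * t^2)) - L) \<longlongrightarrow> 0) (at_right 0)"
   by (rule Lim_null_comparison[OF ev z])
  moreover have "((\<lambda>t. c * cx (redJ \<mu> (k^2 * t^2)) - L) \<longlongrightarrow> c * cx (redJ \<mu> 0) - L) (at_right 0)"
  proof (intro tendsto_intros isCont_tendsto_compose[OF redJ_isCont])
   have "((\<lambda>t. k\<^sup>2 * t^2) \<longlongrightarrow> k\<^sup>2 * 0\<^sup>2) (at_right 0)" by (intro tendsto_intros)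
   then show "((\<lambda>t. k\<^sup>2 * t^2) \<longlongrightarrow> 0) (at_right 0)" by simp
  qed
  ultimately have "c * cx (redJ \<mu> 0) - L = 0" using tendsto_unique[OF trivial_limit_at_right_real] by blast
  then show ?thesis by simp
 qed
 have J0: "redJ \<mu> 0 \<noteq> 0" using harmonic_moment_redJ[where 'a='a, of l] harmonic_moment_pos[where 'a='a, of l] by (auto simp: \<mu>_def)
 \<comment> \<open>By \<open>harmonic_moment_redJ\<close> the moment contains l! and
   \<open>redJ \<mu> 0\<close>: the first cancels the Taylor denominator, the second divides out of
   both sides, and (2 pi)^(d/2) remains.\<close>
 have cc: "c = cx ((2 * pi) powr (real DIM('a) / 2) * (- 2) ^ l * F l (sq x)) * p x"
 proof -
  have "c * cx (redJ \<mu> 0) = (cx ((2 * pi) powr (real DIM('a) / 2) * (- 2) ^ l * F l (sq x)) * p x) * cx (redJ \<mu> 0)"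
   unfolding lim L_def harmonic_moment_redJ by (simp add: \<mu>_def r_def power2_norm_eq_inner)
  then show ?thesis using J0 by simp
 qed
 show ?thesis
 proof (cases "s = 0")
  case False
  then show ?thesis using c[of s] s by (simp add: P_def cc \<mu>_def r_def mult_ac)
 next
  case True
  \<comment> \<open>The projection formula speaks of positive radii; at s = 0 the profile is
    constant and the claim is the zeroth moment.\<close>
  have "(SPH v. cx (x \<bullet> v) ^ 0 * p v) = (if l = 0 then cx (harmonic_moment DIM('a) 0) * p x else 0)"
   using harmonic_moments(1)[OF d p, of 0 x] harmonic_moments(2)[OF d p, of x] by (cases "l = 0") (simp_all del: power_0)
  then have "(SPH v. p v) = (if l = 0 then cx (harmonic_moment DIM('a) 0) * p x else 0)" by simp
  then show ?thesis using True by (auto simp: harmonic_moment_redJ simp del: harmonic_moment.simps)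
 qed
qed

section \<open>The point source of the singular solution\<close>

lemma redY_continuous_on: "\<mu> > 0 ==> continuous_on {0<..} (redY \<mu>)"
 by (auto intro!: continuous_at_imp_continuous_on DERIV_isCont[OF redY_has_derivative])

lemma redY_bound:
 assumes "\<mu> > 0"
 obtains C where "C \<ge> 0" "\<And>s. 0 < s ==> s \<le> M ==> \<bar>s powr \<mu> * redY \<mu> s\<bar> \<le> C"
proof -
 define L where "L = - (2 powr \<mu> * Gamma \<mu> / pi)"
 have "((\<lambda>s. s powr \<mu> * redY \<mu> s) \<longlongrightarrow> L) (at_right 0)" unfolding L_def by (rule redY_at_0[OF assms])
 then have "\<forall>\<^sub>F s in at_right 0. dist (s powr \<mu> * redY \<mu> s) L < 1" by (rule tendstoD) simp
 then obtain \<delta> where \<delta>: "\<delta> > 0" "\<And>s. 0 < s ==> s < \<delta> ==> dist (s powr \<mu> * redY \<mu> s) L < 1"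
  unfolding eventually_at_right_field by blast
 have "compact ((\<lambda>s. s powr \<mu> * redY \<mu> s) ` {\<delta>..M})"
  by (intro compact_continuous_image continuous_intros continuous_on_subset[OF redY_continuous_on[OF assms]])
    (use \<delta>(1) in auto)
 then obtain B where B: "\<And>s. s \<in> {\<delta>..M} ==> \<bar>s powr \<mu> * redY \<mu> s\<bar> \<le> B"
  by (force dest!: compact_imp_bounded simp: bounded_iff)
 show thesis
 proof (rule that[of "max (\<bar>L\<bar> + 1) B"])
  show "\<bar>s powr \<mu> * redY \<mu> s\<bar> \<le> max (\<bar>L\<bar> + 1) B" if "0 < s" "s \<le> M" for s
  proof (cases "s < \<delta>")
   case True
   then show ?thesis using \<delta>(2)[OF that(1)] by (simp add: dist_real_def)
  next
   case False
   then show ?thesis using B[of s] that by simp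
  qed
 qed simp
qed

lemma borel_measurable_norm_powr_ball:
 "(\<lambda>x::'a::euclidean_space. indicator (ball 0 M) x * norm x powr (2 - real DIM('a))) \<in> borel_measurable borel"
 by (intro borel_measurable_times borel_measurable_indicator powr_real_measurable borel_measurable_norm
   borel_measurable_const measurable_ident_sets) auto

text \<open>In polar coordinates the density r^(d-1) times r^(2-d) is r, so the singularity is
  integrable.\<close>

lemma integrable_norm_powr_ball:
 "integrable lborel (\<lambda>x::'a::euclidean_space. indicator (ball 0 M) x * norm x powr (2 - real DIM('a)))"
proof (rule integrableI_nonneg)
 define f where "f = (\<lambda>x::'a. ennreal (indicator (ball 0 M) x * norm x powr (2 - real DIM('a))))"
 have [measurable]: "f \<in> borel_measurable borel" unfolding f_def
  by (rule measurable_compose[OF borel_measurable_norm_powr_ball measurable_ennreal])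
 define S where "S = ennreal (real DIM('a) * unit_ball_vol (real DIM('a)))"
 let ?n = "\<lambda>r. (\<integral>\<^sup>+w. f (r *R w) \<partial>sphere_measure)"
 let ?e = "(2 - real DIM('a))"
 have "(\<integral>\<^sup>+x. f x \<partial>lborel) =
   (\<integral>\<^sup>+r. ennreal (r ^ (DIM('a) - 1)) * indicator {0<..} r * ?n r \<partial>lborel)"
  by (rule nn_integral_polar) simp
 also have "... \<le> (\<integral>\<^sup>+r. ennreal \<bar>M\<bar> * S * indicator {0..\<bar>M\<bar>} r \<partial>lborel)"
 proof (rule nn_integral_mono)
  fix r :: real
  show "ennreal (r ^ (DIM('a) - 1)) * indicator {0<..} r * ?n r \<le> ennreal \<bar>M\<bar> * S * indicator {0..\<bar>M\<bar>} r"
  proof (cases "0 < r \<and> r < M")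
   case False
   then have "f (r *R w) = 0" if "w \<in> sphere 0 1" "r > 0" for w using that by (auto simp: f_def)
   then have "r > 0 ==> (?n r) = 0" by (subst nn_integral_cong[of _ _ "\<lambda>_. 0"]) auto
   then show ?thesis by (cases "r > 0") auto
  next
   case True
   have "?n r = (\<integral>\<^sup>+w. ennreal (r powr ?e) \<partial>(sphere_measure :: 'a measure))"
    by (rule nn_integral_cong) (use True in \<open>simp add: f_def\<close>)
   also have "... = ennreal (r powr ?e) * S" by (simp add: emeasure_sphere_measure_space S_def)
   finally have "ennreal (r ^ (DIM('a) - 1)) * indicator {0<..} r * ?n r =
     ennreal (r ^ (DIM('a) - 1) * r powr ?e) * S" using True by (simp add: ennreal_mult mult.assoc)
   also have "r ^ (DIM('a) - 1) * r powr ?e = r"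
   proof -
    have "r ^ (DIM('a) - 1) = r powr (real DIM('a) - 1)"
     using True by (simp add: powr_realpow[symmetric] of_nat_diff Suc_leI)
    then have "r ^ (DIM('a) - 1) * r powr ?e = r powr ((real DIM('a) - 1) + ?e)"
     by (simp only: powr_add)
    then show ?thesis using True by simp
   qed
   also have "ennreal r * S \<le> ennreal \<bar>M\<bar> * S" using True by (intro mult_right_mono ennreal_leI) auto
   finally show ?thesis using True by simp
  qed
 qed
 also have "... = ennreal \<bar>M\<bar> * S * ennreal \<bar>M\<bar>" by (subst nn_integral_cmult) auto
 also have "... < \<infinity>" by (simp add: S_def ennreal_mult_less_top)
 finally show "(\<integral>\<^sup>+x. ennreal (indicator (ball 0 M) x * norm x powr ?e) \<partial>(lborel :: 'a measure)) < \<infinity>"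
  unfolding f_def .
qed (simp_all add: borel_measurable_norm_powr_ball)

lemma famY_bound:
 assumes "\<nu> > 0" "k > 0"
 obtains C where "C \<ge> 0" "\<And>s. 0 < s ==> s \<le> M ==> \<bar>famY k \<nu> 0 s\<bar> \<le> C * s powr (- \<nu>)"
proof -
 obtain C where C: "C \<ge> 0" "\<And>s. 0 < s ==> s \<le> k^2 * M ==> \<bar>s powr \<nu> * redY \<nu> s\<bar> \<le> C"
  using redY_bound[OF assms(1), of "k^2 * M"] by blast
 show thesis
 proof (rule that[of "C * (k^2) powr (- \<nu>)"])
  show "0 \<le> C * (k^2) powr (- \<nu>)" using C(1) by simp
  show "\<bar>famY k \<nu> 0 s\<bar> \<le> C * (k^2) powr (- \<nu>) * s powr (- \<nu>)" if "0 < s" "s \<le> M" for s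
  proof -
   have ks: "k^2 * s > 0" "k^2 * s \<le> k^2 * M" using that assms by (simp_all add: mult_left_mono)
   have "\<bar>famY k \<nu> 0 s\<bar> = \<bar>(k^2 * s) powr \<nu> * redY \<nu> (k^2 * s)\<bar> * (k^2 * s) powr (- \<nu>)"
   proof -
    have "(k^2 * s) powr \<nu> * (k^2 * s) powr (- \<nu>) = 1" using that(1) assms(2) by (simp flip: powr_add)
    then show ?thesis by (simp add: famY_def abs_mult mult.assoc mult.left_commute[of _ "\<bar>redY \<nu> (k^2 * s)\<bar>"])
   qed
   also have "... \<le> C * (k^2 * s) powr (- \<nu>)" by (rule mult_right_mono[OF C(2)[OF ks]]) simp
   finally show ?thesis using that assms by (simp add: powr_mult)
  qed
 qed
qed

lemma continuous_on_famY: "\<nu> > 0 ==> k > 0 ==> continuous_on {0<..} (famY k \<nu> m)"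
 by (auto intro!: continuous_at_imp_continuous_on DERIV_isCont[OF famY_deriv])

lemma inner_self_powr:
 fixes x :: "'a::euclidean_space"
 assumes "x \<noteq> 0"
 shows "(sq x) powr (- (real DIM('a) / 2 - 1)) = norm x powr (2 - real DIM('a))"
 using assms powr_powr[of "norm x" 2 "- (real DIM('a) / 2 - 1)"]
 by (simp add: dot_square_norm powr_numeral algebra_simps)

lemma radial_vector_derivative:
 fixes f :: "'a::euclidean_space => complex"
 assumes "(f has_derivative D) (at (t *R w) within S)" "\<And>s. s \<in> I ==> s *R w \<in> S"
 shows "((\<lambda>s. f (s *R w)) has_vector_derivative D w) (at t within I)"
proof -
 have 1: "((\<lambda>s. s *R w) has_derivative (\<lambda>h. h *R w)) (at t within I)" by (auto intro!: derivative_eq_intros)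
 have 2: "(f has_derivative D) (at (t *R w) within (\<lambda>s. s *R w) ` I)"
  by (rule has_derivative_subset[OF assms(1)]) (use assms(2) in auto)
 have "D (h *R w) = h *R D w" for h by (rule linear_scale[OF has_derivative_linear[OF assms(1)]])
 then show ?thesis using has_derivative_in_compose[OF 1 2] by (simp add: has_vector_derivative_def)
qed

text \<open>The origin is cut out by steps on shrinking shells. After the swap only the shell
  contributes, namely an average of \<open>V\<close>, and \<open>V\<close> has at radius 0 a limit
  fixed by the leading singularity of Y. Domination by a multiple of |x|^(2-d) then removes the
  cutoff.\<close>

theorem famY_fundamental_0:
 fixes \<phi> :: "'a::euclidean_space => complex"
 assumes d: "DIM('a) \<ge> 3" and k: "k > 0" and \<phi>: "test_function S \<phi>"
 defines "\<nu> \<equiv> real DIM('a) / 2 - 1"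
 shows "integrable lborel (\<lambda>x. cx (famY k \<nu> 0 (sq x)) * helmholtz k \<phi> x)"
  and "(LBINT x. cx (famY k \<nu> 0 (sq x)) * helmholtz k \<phi> x) = cx (source_const k DIM('a) \<nu>) * \<phi> 0"
proof -
 have \<nu>: "\<nu> > 0" using d by (simp add: \<nu>_def)
 let ?Y = "famY k \<nu>"
 note Yd = famY_deriv[OF \<nu> k]
 define \<psi> where "\<psi> = (\<lambda>x. helmholtz k \<phi> x)"
 obtain K B where K: "compact K" "\<And>x. x \<notin> K ==> \<psi> x = 0"
  and B: "\<And>x. norm (\<psi> x) \<le> B" "B \<ge> 0" and cont: "continuous_on UNIV \<phi>" "continuous_on UNIV \<psi>"
  unfolding \<psi>_def using test_function_helmholtz[OF \<phi>, of "cx (k^2)"] by metis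
 have \<psi>_meas [measurable]: "\<psi> \<in> borel_measurable borel" using cont by (simp add: borel_measurable_continuous_onI)
 have Y_meas [measurable]: "(\<lambda>x::'a. ?Y 0 (sq x)) \<in> borel_measurable borel"
  using borel_measurable_radial[OF continuous_on_famY[OF \<nu> k], of 0 0] by simp
 have \<phi>C: "C_k n \<phi>" for n using \<phi> by (simp add: test_function_def)
 define f where "f = (\<lambda>r. SPH w. \<phi> (r *R w))"
 define f' where "f' = (\<lambda>r. SPH w. pdir w \<phi> (r *R w))"
 have dir: "pdir w \<phi> x = (\<Sum>b\<in>Basis. cx (w \<bullet> b) * pdir b \<phi> x)" for w x
  using sum_Basis_pdir C_k_SucD(1)[OF \<phi>C] by metis
 have pc: "continuous_on UNIV (pdir b \<phi>)" if "b \<in> Basis" for b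
  by (rule C_k_continuous[OF C_k_SucD(3)[OF \<phi>C[of "Suc 0"] that]])
 have c': "continuous_on (UNIV \<times> sphere 0 1) (\<lambda>q. pdir (snd q) \<phi> (fst q *R snd q))"
  unfolding dir[of "snd _"]
 proof (intro continuous_on_sum continuous_on_mult)
  show "continuous_on (UNIV \<times> sphere 0 1) (\<lambda>q::real \<times> 'a. pdir b \<phi> (fst q *R snd q))" if "b \<in> Basis" for b
   by (rule continuous_on_compose2[OF pc[OF that]]) (auto intro!: continuous_intros)
 qed (intro continuous_intros)
 have fc: "continuous_on UNIV f" unfolding f_def
  by (intro continuous_on_sphere_integral continuous_on_compose2[OF cont(1)] continuous_intros) auto
 have f'c: "continuous_on UNIV f'" unfolding f'_def by (rule continuous_on_sphere_integral[OF c'])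
 have fd: "(f has_vector_derivative f' r) (at r)" for r unfolding f_def f'_def
 proof (rule sphere_integral_has_vector_derivative[OF is_interval_univ UNIV_I])
  show "((\<lambda>t. \<phi> (t *R w)) has_vector_derivative pdir w \<phi> (t *R w)) (at t)" for t w
   by (rule radial_vector_derivative[where S = UNIV]) (auto intro: C_k_SucD(2)[OF \<phi>C])
 qed (auto intro!: c' continuous_on_compose2[OF cont(1)] continuous_intros)
 \<comment> \<open>The radial test is used with the test function in the role of u and p = 1, so the
   sphere integral f of \<phi> replaces the projection of a solution.\<close>
 define V where "V = (\<lambda>r. r ^ (DIM('a) - 1) *R ((2 * r * ?Y 1 (r^2)) *R f r - ?Y 0 (r^2) *R f' r))"
 have Vc: "continuous_on {0<..} V" unfolding V_def
  by (intro continuous_intros continuous_on_subset[OF fc] continuous_on_subset[OF f'c]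
    continuous_on_compose2[OF continuous_on_famY[OF \<nu> k]]) auto
 define v where "v = cx (source_const k DIM('a) \<nu>) * \<phi> 0"
 have V0: "(V \<longlongrightarrow> v) (at_right 0)"
 proof -
  have sq0: "filterlim (\<lambda>r. k^2 * r^2) (at_right 0) (at_right (0::real))"
  proof (rule tendsto_imp_filterlim_at_right)
   show "((\<lambda>r. k\<^sup>2 * r\<^sup>2) \<longlongrightarrow> 0) (at_right 0)" by (rule tendsto_eq_intros refl | simp)+
  qed (rule eventually_mono[OF eventually_at_right_less], use k in simp)
  define g where "g = (\<lambda>r. (k^2 * r^2) powr (\<nu> + 1) * redY (\<nu> + 1) (k^2 * r^2))"
  define g0 where "g0 = (\<lambda>r. (k^2 * r^2) powr \<nu> * redY \<nu> (k^2 * r^2))"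
  have g: "(g \<longlongrightarrow> - (2 powr (\<nu> + 1) * Gamma (\<nu> + 1) / pi)) (at_right 0)"
   unfolding g_def using \<nu> by (intro filterlim_compose[OF redY_at_0 sq0]) simp
  have g0: "(g0 \<longlongrightarrow> - (2 powr \<nu> * Gamma \<nu> / pi)) (at_right 0)"
   unfolding g0_def by (rule filterlim_compose[OF redY_at_0[OF \<nu>] sq0])
  have t: "(F \<longlongrightarrow> F 0) (at_right 0)" if "continuous_on UNIV F" for F :: "real => complex"
   using that continuous_on_def filterlim_at_split by blast
  define c where "c = k powr (- (2 * \<nu>))"
  \<comment> \<open>The f' term carries an additional factor r and disappears; the f term tends to a
    multiple of \<open>f 0\<close>, which is the sphere area times \<open>\<phi> 0\<close>.\<close>
  have lim: "((\<lambda>r. (- c * g r) *R f r - (c * g0 r * r) *R f' r) \<longlongrightarrow>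
    (- c * (- (2 powr (\<nu> + 1) * Gamma (\<nu> + 1) / pi))) *R f 0 - (c * (- (2 powr \<nu> * Gamma \<nu> / pi)) * 0) *R f' 0) (at_right 0)"
   by (intro tendsto_intros g g0 t fc f'c)
  define m G where "m = \<nu> + 1" and "G = Gamma m"
  have m: "m > 0" using \<nu> by (simp add: m_def)
  then have "G > 0" "Gamma (m + 1) = m * G"
   unfolding G_def by (auto intro!: Gamma_real_pos Gamma_plus1 pos_notin_nonpos_Ints)
  moreover have "real DIM('a) / 2 = m" "real DIM('a) = 2 * m" by (simp_all add: \<nu>_def m_def)
  moreover have "2 powr m = 2 * 2 powr \<nu>" "2 powr (\<nu> + 2) = 4 * 2 powr \<nu>" "pi powr m = pi * pi powr \<nu>"
   by (simp_all add: m_def powr_add)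
  \<comment> \<open>With m = d/2 the sphere area is 2 pi^m / Gamma m, and this Gamma cancels against
    the one in the singularity of Y.\<close>
  ultimately have "2 powr (\<nu> + 1) * Gamma (\<nu> + 1) / pi * measure (sphere_measure :: 'a measure) (sphere 0 1) = 2 powr (\<nu> + 2) * pi powr \<nu>"
   unfolding measure_sphere_measure unit_ball_vol_def m_def[symmetric] G_def[symmetric] using m by (simp add: field_simps)
  moreover have "f 0 = measure (sphere_measure :: 'a measure) (sphere 0 1) *R \<phi> 0" by (simp add: f_def)
  ultimately have "(- c * (- (2 powr (\<nu> + 1) * Gamma (\<nu> + 1) / pi))) *R f 0 = (c * (2 powr (\<nu> + 2) * pi powr \<nu>)) *R \<phi> 0"
   by (metis (no_types, lifting) minus_mult_minus mult.assoc scaleR_scaleR)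
  also have "... = v" by (simp add: v_def c_def \<nu>_def scaleR_conv_of_real mult.assoc)
  finally have lim': "((\<lambda>r. (- c * g r) *R f r - (c * g0 r * r) *R f' r) \<longlongrightarrow> v) (at_right 0)" using lim by simp
  have "\<forall>\<^sub>F r in at_right 0. (- c * g r) *R f r - (c * g0 r * r) *R f' r = V r"
   using eventually_at_right_less[of 0]
  proof eventually_elim
   case (elim r)
   have p: "(k^2 * r^2) powr a = k powr (2 * a) * r powr (2 * a)" for a
    using k elim by (simp add: powr_mult powr_powr flip: powr_numeral)
   have "r ^ (DIM('a) - 1) = r powr (2 * \<nu> + 1)"
    using elim d by (simp add: \<nu>_def of_nat_diff flip: powr_realpow)
   then have rN: "r ^ (DIM('a) - 1) = r powr (2 * \<nu>) * r" using elim by (simp add: powr_add)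
   have "c * k powr (2 * \<nu>) = 1" using k by (simp add: c_def flip: powr_add)
   then have c: "c * (k powr (2 * \<nu>) * x) = x" for x by simp
   have "- c * g r = r ^ (DIM('a) - 1) * (2 * r * ?Y 1 (r^2))" unfolding g_def p rN
    using k elim c[of "k^2 * (r powr (2 * \<nu>) * (r^2 * redY (\<nu> + 1) (k^2 * r^2)))"]
    by (simp add: famY_def powr_add distrib_left power2_eq_square mult_ac)
   moreover have "c * g0 r * r = r ^ (DIM('a) - 1) * ?Y 0 (r^2)" unfolding g0_def p rN
    using c[of "r powr (2 * \<nu>) * (r * redY \<nu> (k^2 * r^2))"] by (simp add: famY_def mult_ac)
   ultimately show ?case by (simp add: V_def scaleR_diff_right)
  qed
  then show ?thesis by (rule Lim_transform_eventually[OF lim'])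
 qed
 define e where "e = (\<lambda>n. 1 / real (Suc n))"
 have e: "e n > 0" for n by (simp add: e_def)
 have e0: "e \<longlonglongrightarrow> 0" unfolding e_def by (rule LIMSEQ_Suc[OF lim_inverse_n'])
 define U where "U = (\<lambda>\<Theta> (x::'a). cx (\<Theta> (sq x) * ?Y 0 (sq x)) * \<psi> x)"
 have "\<exists>\<Theta>. continuous_on UNIV \<Theta> \<and> (\<forall>s. \<bar>\<Theta> s\<bar> \<le> 1) \<and> (\<forall>s\<ge>(e n)\<^sup>2. \<Theta> s = 1) \<and> norm ((LBINT x. U \<Theta> x) - v) \<le> e n" for n
 proof -
  obtain b0 where b0: "b0 > 0" "\<And>r. 0 < r ==> r < b0 ==> dist (V r) v < e n"
   using tendstoD[OF V0 e[of n]] unfolding eventually_at_right_field by auto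
  \<comment> \<open>The shell between b / 2 and b must lie where \<open>V\<close> is close to v and
    inside radius \<open>e n\<close>, beyond which the step has to equal 1.\<close>
  define b where "b = min (b0 / 2) (e n)"
  have b: "0 < b / 2" "b / 2 < b" "b < b0" "b \<le> e n" using b0(1) e[of n] by (auto simp: b_def)
  have b2: "(b / 2)\<^sup>2 < b^2" using b by (intro power_strict_mono) auto
  obtain \<theta> \<Theta> where st: "\<And>n. C_k n (\<lambda>s. cx (\<theta> s))" "\<And>n. C_k n (\<lambda>s. cx (\<Theta> s))"
   "\<And>s. (\<Theta> has_real_derivative \<theta> s) (at s)" "\<And>s. \<theta> s \<ge> 0" "\<And>s. s \<notin> {(b / 2)\<^sup>2<..<b^2} ==> \<theta> s = 0"
   "\<And>s. s \<le> (b / 2)\<^sup>2 ==> \<Theta> s = 0" "\<And>s. s \<ge> b^2 ==> \<Theta> s = 1" using smooth_step[OF b2] by metis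
  obtain \<theta>' where \<theta>': "\<And>s. (\<theta> has_real_derivative \<theta>' s) (at s)" "continuous_on UNIV \<theta>'"
   using C_k_real_derivative[OF st(1)] by blast
  have mono: "\<Theta> s \<le> \<Theta> t" if "s \<le> t" for s t
   using DERIV_nonneg_imp_nondecreasing[OF that] st(3,4) by blast
  have \<Theta>1: "\<bar>\<Theta> s\<bar> \<le> 1" for s
   using mono[of "min s ((b / 2)\<^sup>2)" s] mono[of s "max s (b^2)"] st(6)[of "min s ((b / 2)\<^sup>2)"] st(7)[of "max s (b^2)"] by simp
  define h where "h = (\<lambda>x::'a. cx (\<Theta> (sq x) * ?Y 0 (sq x)) * 1)"
  have h: "C_k n h" for n unfolding h_def of_real_mult mult_1_right
   by (rule C_k_famY_cutoff[OF \<nu> k C_k_of_real_radial[OF st(2)] _ zero_less_power[OF b(1), of 2]]) (use st(6) in simp)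
  define T where "T = (\<lambda>s. 8 * s * \<theta> s * ?Y 1 s + 4 * s * \<theta>' s * ?Y 0 s + (2 * real DIM('a) + 4 * real 0) * \<theta> s * ?Y 0 s)"
  have cu: "continuous_on (cball 0 b - ball 0 (b / 2)) \<phi>" by (rule continuous_on_subset[OF cont(1)]) simp
  have yr: "(SPH w. \<phi> (r *R w) * 1) = r ^ 0 *R f r" for r by (simp add: f_def)
  note rt0 = integral_radial_test[OF b(1,2) cu continuous_on_const _ yr has_vector_derivative_at_within[OF fd]
    continuous_on_subset[OF f'c subset_UNIV] \<theta>' st(5) Yd[of _ 0, folded One_nat_def] continuous_on_famY[OF \<nu> k],
    of T, unfolded mult_0_right add_0_right]
  have rt: "integrable lborel (\<lambda>x. \<phi> x * (cx (T (sq x)) * 1))"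
   "(LBINT x. \<phi> x * (cx (T (sq x)) * 1)) = integral {b / 2..b} (\<lambda>r. (2 * r * \<theta> (r^2)) *R V r)"
   unfolding V_def by (rule rt0; simp add: T_def)+
  have sol: "solid_harmonic 0 (\<lambda>x::'a. 1)" by (simp add: solid_harmonic_def laplacian_const)
  have "continuous_on UNIV (\<lambda>x. cx (k^2) * h x * \<phi> x)"
   by (intro continuous_intros cont C_k_continuous[OF h[of 0]])
  then have m: "(\<lambda>x. helmholtz k h x * \<phi> x) \<in> borel_measurable lborel" unfolding distrib_right
   by (intro borel_measurable_add borel_measurable_integrable[OF integral_laplacian_swap(2)[OF h \<phi>]])
     (simp add: borel_measurable_continuous_onI)
  have "helmholtz k h x = cx (T (sq x))" if "x \<noteq> 0" for x
   unfolding h_def T_def using helmholtz_radial_product[OF sol, of "{0<..}" x \<Theta> \<theta> \<theta>' ?Y k] that st(3) \<theta>'(1) Yd famY_ode[OF \<nu> k]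
   by (simp add: \<nu>_def)
  then have "AE x in lborel. helmholtz k h x * \<phi> x = \<phi> x * (cx (T (sq x)) * 1)"
   using AE_lborel_singleton[of "0::'a"] by (auto elim!: eventually_mono)
  then have "(LBINT x. helmholtz k h x * \<phi> x) = (LBINT x. \<phi> x * (cx (T (sq x)) * 1))"
   using rt(1) m by (intro integral_cong_AE) auto
  moreover have "(LBINT x. U \<Theta> x) = (LBINT x. helmholtz k h x * \<phi> x)"
   using integral_helmholtz_swap(2)[OF h \<phi>] by (simp add: U_def h_def \<psi>_def)
  moreover have "norm (integral {b / 2..b} (\<lambda>r. (2 * r * \<theta> (r^2)) *R V r) - v) \<le> e n"
  proof (rule bump_average[of _ _ _ _ _ \<Theta>])
   show "continuous_on {b / 2..b} V" by (rule continuous_on_subset[OF Vc]) (use b in auto)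
   show "norm (V r - v) \<le> e n" if "r \<in> {b / 2..b}" for r using b0(2)[of r] that b by (simp add: dist_norm)
   show "continuous_on UNIV \<theta>" using \<theta>'(1) by (auto intro!: continuous_at_imp_continuous_on DERIV_isCont)
  qed (use b st in auto)
  moreover have "\<Theta> s = 1" if "s \<ge> (e n)\<^sup>2" for s
   by (rule st(7)[OF order_trans[OF power_mono that]]) (use b in auto)
  moreover have "continuous_on UNIV \<Theta>" using st(3) by (auto intro!: continuous_at_imp_continuous_on DERIV_isCont)
  ultimately show ?thesis using \<Theta>1 rt(2) by (intro exI[of _ \<Theta>]) simp
 qed
 then obtain \<Theta> where \<Theta>: "\<And>n. continuous_on UNIV (\<Theta> n)" "\<And>n s. \<bar>\<Theta> n s\<bar> \<le> 1" "\<And>n s. s \<ge> (e n)\<^sup>2 ==> \<Theta> n s = 1"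
  "\<And>n. norm ((LBINT x. U (\<Theta> n) x) - v) \<le> e n" by metis
 define U0 where "U0 = (\<lambda>x::'a. cx (?Y 0 (sq x)) * \<psi> x)"
 obtain \<rho> where \<rho>: "\<rho> > 0" "K \<subseteq> ball 0 \<rho>" using compact_imp_bounded[OF K(1)] bounded_subset_ballD[of K 0] by blast
 obtain C where C: "C \<ge> 0" "\<And>s. 0 < s ==> s \<le> \<rho>^2 ==> \<bar>?Y 0 s\<bar> \<le> C * s powr (- \<nu>)"
  using famY_bound[OF \<nu> k] by metis
 define w where "w = (\<lambda>x::'a. C * B * (indicator (ball 0 \<rho>) x * norm x powr (2 - real DIM('a))))"
 have w: "integrable lborel w" unfolding w_def by (intro integrable_mult_right integrable_norm_powr_ball)
 have U_meas: "U (\<Theta> n) \<in> borel_measurable lborel" for n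
 proof -
  have [measurable]: "\<Theta> n \<in> borel_measurable borel" using \<Theta>(1) by (rule borel_measurable_continuous_onI)
  show ?thesis unfolding U_def by measurable
 qed
 have U0_meas: "U0 \<in> borel_measurable lborel" unfolding U0_def by measurable
 have U_lim: "AE x in lborel. (\<lambda>n. U (\<Theta> n) x) \<longlonglongrightarrow> U0 x" using AE_lborel_singleton[of "0 :: 'a"]
 proof eventually_elim
  case (elim x)
  have "(\<lambda>n. (e n)\<^sup>2) \<longlonglongrightarrow> 0\<^sup>2" by (intro tendsto_intros e0)
  then have "\<forall>\<^sub>F n in sequentially. (e n)\<^sup>2 < sq x" by (rule order_tendstoD) (use elim in simp)
  then have "\<forall>\<^sub>F n in sequentially. U (\<Theta> n) x = U0 x"
   by (rule eventually_mono) (simp add: U_def U0_def \<Theta>(3))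
  then show ?case by (rule tendsto_eventually)
 qed
 have U_bound: "AE x in lborel. norm (U (\<Theta> n) x) \<le> w x" for n using AE_lborel_singleton[of "0 :: 'a"]
 proof eventually_elim
  case (elim x)
  show ?case
  proof (cases "x \<in> K")
   case False
   then show ?thesis using C(1) B(2) by (simp add: U_def w_def K(2))
  next
   case True
   then have x: "norm x < \<rho>" using \<rho>(2) by auto
   then have "sq x \<le> \<rho>^2" by (simp add: dot_square_norm power_mono)
   then have "\<bar>?Y 0 (sq x)\<bar> \<le> C * norm x powr (2 - real DIM('a))"
    using C(2)[of "sq x"] inner_self_powr[OF elim] elim by (simp add: \<nu>_def)
   then have "\<bar>\<Theta> n (sq x)\<bar> * \<bar>?Y 0 (sq x)\<bar> * norm (\<psi> x) \<le> 1 * (C * norm x powr (2 - real DIM('a))) * B"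
    using C(1) by (intro mult_mono B(1) \<Theta>(2)) auto
   then show ?thesis using x by (simp add: U_def w_def norm_mult abs_mult mult_ac)
  qed
 qed
 note dom = U0_meas U_meas w U_lim U_bound
 show "integrable lborel (\<lambda>x. cx (?Y 0 (sq x)) * helmholtz k \<phi> x)"
  using integrable_dominated_convergence[OF dom] unfolding U0_def \<psi>_def .
 have "(\<lambda>n. (LBINT x. U (\<Theta> n) x) - v) \<longlonglongrightarrow> 0" by (rule Lim_null_comparison[OF _ e0]) (simp add: \<Theta>(4))
 from LIMSEQ_unique[OF integral_dominated_convergence[OF dom] LIM_zero_cancel[OF this]]
 show "(LBINT x. cx (?Y 0 (sq x)) * helmholtz k \<phi> x) = cx (source_const k DIM('a) \<nu>) * \<phi> 0"
  unfolding U0_def \<psi>_def v_def .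
qed

theorem famY_fundamental:
 fixes \<phi> :: "'a::euclidean_space => complex"
 assumes d: "DIM('a) \<ge> 3" and k: "k > 0" and \<phi>: "test_function S \<phi>"
 defines "\<nu> \<equiv> real DIM('a) / 2 - 1"
 shows "integrable lborel (\<lambda>x. cx (famY k \<nu> 0 (sq (x - a))) * helmholtz k \<phi> x)"
  and "(LBINT x. cx (famY k \<nu> 0 (sq (x - a))) * helmholtz k \<phi> x) =
   cx (source_const k DIM('a) \<nu>) * \<phi> a"
proof -
 define f where "f = (\<lambda>x. cx (famY k \<nu> 0 (sq x)) * (laplacian (\<lambda>y. \<phi> (y + a)) x + cx (k^2) * \<phi> (x + a)))"
 note f = famY_fundamental_0[OF d k test_function_translate[OF \<phi>, of a], folded \<nu>_def, folded f_def]
 have eq: "f (x + (- a)) = cx (famY k \<nu> 0 (sq (x - a))) * helmholtz k \<phi> x" for x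
  by (simp add: f_def laplacian_translate)
 show "integrable lborel (\<lambda>x. cx (famY k \<nu> 0 (sq (x - a))) * helmholtz k \<phi> x)"
  using integral_translate(1)[OF f(1), of "- a"] unfolding eq .
 show "(LBINT x. cx (famY k \<nu> 0 (sq (x - a))) * helmholtz k \<phi> x) =
   cx (source_const k DIM('a) \<nu>) * \<phi> a"
  using integral_translate(2)[OF f(1), of "- a"] f(2) unfolding eq by simp
qed

lemma famY_locally_integrable:
 fixes a :: "'a::euclidean_space"
 assumes d: "DIM('a) \<ge> 3" and k: "k > 0"
 shows "set_integrable lborel (ball 0 R) (\<lambda>x. cx (famY k (real DIM('a) / 2 - 1) 0 (sq (x - a))))"
proof -
 define \<nu> where "\<nu> = real DIM('a) / 2 - 1"
 have \<nu>: "\<nu> > 0" using d by (simp add: \<nu>_def)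
 define M where "M = \<bar>R\<bar> + norm a + 1"
 obtain C where C: "C \<ge> 0" "\<And>s. 0 < s ==> s \<le> M^2 ==> \<bar>famY k \<nu> 0 s\<bar> \<le> C * s powr (- \<nu>)"
  using famY_bound[OF \<nu> k] by metis
 define w where "w = (\<lambda>x::'a. cx (C * (indicator (ball 0 M) x * norm x powr (2 - real DIM('a)))))"
 have w: "integrable lborel w" unfolding w_def
  by (intro integrable_of_real integrable_mult_right integrable_norm_powr_ball)
 have w': "integrable lborel (\<lambda>x. w (x + (- a)))" by (rule integral_translate(1)[OF w])
 have [measurable]: "(\<lambda>x::'a. famY k \<nu> 0 (sq (x - a))) \<in> borel_measurable borel"
  by (rule borel_measurable_radial[OF continuous_on_famY[OF \<nu> k]])
 have ball [measurable]: "ball 0 R \<in> sets (borel :: 'a measure)" by simp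
 show ?thesis unfolding set_integrable_def \<nu>_def[symmetric]
 proof (rule Bochner_Integration.integrable_bound[OF w'])
  show "(\<lambda>x. indicator (ball 0 R) x *R cx (famY k \<nu> 0 (sq (x - a)))) \<in> borel_measurable lborel"
   by (intro borel_measurable_scaleR borel_measurable_indicator measurable_compose[OF _ borel_measurable_of_real]) simp_all
  show "AE x in lborel. norm (indicator (ball 0 R) x *R cx (famY k \<nu> 0 (sq (x - a)))) \<le> norm (w (x + - a))"
   using AE_lborel_singleton[of a]
  proof eventually_elim
   case (elim x)
   show ?case
   proof (cases "x \<in> ball 0 R")
    case True
    then have "norm (x - a) < M" using norm_triangle_ineq4[of x a] by (simp add: M_def)
    then have "sq (x - a) \<le> M^2" "x - a \<in> ball 0 M" by (simp_all add: dot_square_norm power_mono)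
    moreover have "\<bar>famY k \<nu> 0 (sq (x - a))\<bar> \<le> C * (sq (x - a)) powr (- \<nu>)"
     using elim calculation(1) by (intro C(2)) auto
    moreover have "(sq (x - a)) powr (- \<nu>) = norm (x - a) powr (2 - real DIM('a))"
     unfolding \<nu>_def by (rule inner_self_powr) (use elim in auto)
    ultimately show ?thesis using True C(1) by (simp add: w_def norm_mult)
   qed simp
  qed
 qed
qed

section \<open>Growth of the coefficients\<close>

lemma rGamma_real_pos: "x > 0 ==> rGamma (x::real) > 0"
 by (simp add: rGamma_inverse_Gamma Gamma_real_pos)

lemma rGamma_antimono_nat:
 fixes \<mu> :: real
 assumes "\<mu> \<ge> 0"
 shows "rGamma (\<mu> + real n + 1) \<le> rGamma (\<mu> + 1)"
proof (induction n)
 case (Suc n)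
 have p: "\<mu> + real n + 1 \<ge> 1" using assms by simp
 have "rGamma (\<mu> + real n + 1 + 1) = rGamma (\<mu> + real n + 1) / (\<mu> + real n + 1)"
  using rGamma_plus1[of "\<mu> + real n + 1"] p by (simp add: field_simps)
 also have "... \<le> rGamma (\<mu> + real n + 1) / 1"
  using p rGamma_real_pos[of "\<mu> + real n + 1"] by (intro divide_left_mono) auto
 finally show ?case using Suc by (simp add: add_ac)
qed simp

lemma redJ_0_pos: "\<mu> \<ge> 0 ==> redJ \<mu> 0 > 0" by (simp add: redJ_0 rGamma_real_pos)

lemma redJ_0_plus1: "\<mu> \<ge> 0 ==> redJ (\<mu> + 1) 0 = redJ \<mu> 0 / (2 * (\<mu> + 1))"
 using redJ_rec[of 0 \<mu>] by (simp add: field_simps)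

text \<open>The values of \<open>rGamma\<close> at \<mu> + 1, \<mu> + 2, ... do not increase, so the
  series is dominated termwise by its value at 0 times an exponential series.\<close>

lemma redJ_bound:
 assumes "\<mu> \<ge> 0" "s \<ge> 0"
 shows "\<bar>redJ \<mu> s\<bar> \<le> redJ \<mu> 0 * exp (s / 4)"
proof -
 have b: "norm (redJ_coeff \<mu> n * s ^ n) \<le> redJ \<mu> 0 * ((s / 4) ^ n /R fact n)" for n
 proof -
  have "norm (redJ_coeff \<mu> n * s ^ n) = 2 powr (- \<mu>) * rGamma (\<mu> + real n + 1) * ((s / 4) ^ n /R fact n)"
   using assms rGamma_real_pos[of "\<mu> + real n + 1"]
   by (simp add: redJ_coeff_def abs_mult power_divide field_simps)
  also have "... \<le> 2 powr (- \<mu>) * rGamma (\<mu> + 1) * ((s / 4) ^ n /R fact n)"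
   using assms by (intro mult_right_mono mult_left_mono rGamma_antimono_nat) auto
  finally show ?thesis by (simp add: redJ_0)
 qed
 have "(\<lambda>n. (s / 4) ^ n /R fact n) sums exp (s / 4)" by (rule exp_converges)
 then have s: "(\<lambda>n. redJ \<mu> 0 * ((s / 4) ^ n /R fact n)) sums (redJ \<mu> 0 * exp (s / 4))" by (rule sums_mult)
 have "norm (redJ \<mu> s) \<le> redJ \<mu> 0 * exp (s / 4)" unfolding redJ_def[of \<mu> s] sums_unique[OF s]
  by (rule norm_suminf_le[OF b sums_summable[OF s]])
 then show ?thesis by simp
qed

text \<open>The derivative has order \<mu> + 1, and its value at 0 is smaller by the factor 2 (\<mu>
  + 1); by the mean value theorem the relative variation decays as the order grows.\<close>

lemma redJ_near_0:
 assumes "\<mu> \<ge> 0" "s \<ge> 0"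
 shows "\<bar>redJ \<mu> s - redJ \<mu> 0\<bar> \<le> redJ \<mu> 0 * (s * exp (s / 4) / (4 * (\<mu> + 1)))"
proof (cases "s = 0")
 case False
 then have "s > 0" using assms by simp
 moreover have "(redJ \<mu> has_real_derivative - 1 / 2 * redJ (\<mu> + 1) x) (at x)" for x
  by (rule DERIV_cong, rule redJ_has_derivative, rule DERIV_ident) simp
 ultimately obtain z where z: "0 < z" "z < s"
  "redJ \<mu> s - redJ \<mu> 0 = (s - 0) * (- 1 / 2 * redJ (\<mu> + 1) z)"
  using MVT2[of 0 s "redJ \<mu>" "\<lambda>x. - 1 / 2 * redJ (\<mu> + 1) x"] by blast
 have "\<bar>redJ (\<mu> + 1) z\<bar> \<le> redJ (\<mu> + 1) 0 * exp (z / 4)" using assms z by (intro redJ_bound) auto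
 also have "... \<le> redJ (\<mu> + 1) 0 * exp (s / 4)" using assms z redJ_0_pos[of "\<mu> + 1"] by (intro mult_left_mono) auto
 also have "redJ (\<mu> + 1) 0 = redJ \<mu> 0 / (2 * (\<mu> + 1))" by (rule redJ_0_plus1[OF assms(1)])
 finally have "s / 2 * \<bar>redJ (\<mu> + 1) z\<bar> \<le> s / 2 * (redJ \<mu> 0 / (2 * (\<mu> + 1)) * exp (s / 4))"
  using assms by (intro mult_left_mono) auto
 then show ?thesis unfolding z(3) using assms by (simp add: abs_mult field_simps)
qed (use assms redJ_0_pos[of \<mu>] in simp)

text \<open>Weighting Y by s^l and by the value of J at 0, which decays factorially in l,
  compensates its factorial growth: the weighted sequence satisfies D(l+2) \<le> D(l+1) + (q^2 - q)
  D(l) for large l. The equation x^2 = x + q^2 - q has the root q, so a bound C q^l reproduces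
  itself.\<close>

lemma redY_growth:
 assumes \<nu>: "\<nu> > 0" and s: "s > 0" and q: "q > 1"
 obtains C where "C \<ge> 0" "\<And>l. \<bar>redY (\<nu> + real l) s\<bar> * s ^ l * redJ (\<nu> + real l) 0 \<le> C * q ^ l"
proof -
 define D where "D = (\<lambda>l. \<bar>redY (\<nu> + real l) s\<bar> * s ^ l * redJ (\<nu> + real l) 0)"
 \<comment> \<open>From this index on the coefficient s / (4 (\<mu> + 1) (\<mu> + 2)) is at most q^2
   - q.\<close>
 define L where "L = nat \<lceil>s / (q^2 - q)\<rceil>"
 have qq: "q^2 - q > 0" using q by (simp add: power2_eq_square)
 have D0: "D l \<ge> 0" for l unfolding D_def using \<nu> s redJ_0_pos[of "\<nu> + real l"] by (intro mult_nonneg_nonneg) auto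
 have rec: "D (Suc (Suc l)) \<le> D (Suc l) + (q^2 - q) * D l" if "l \<ge> L" for l
 proof -
  define \<mu> where "\<mu> = \<nu> + real l"
  have \<mu>: "\<mu> > 0" using \<nu> by (simp add: \<mu>_def)
  let ?m = "(\<mu> + 1)"
  let ?n = "(\<mu> + 2)"
  define g where "g = redJ \<mu> 0"
  have g: "g > 0" unfolding g_def using \<mu> by (intro redJ_0_pos) simp
  have g1: "redJ ?m 0 = g / (2 * ?m)" unfolding g_def using \<mu> by (intro redJ_0_plus1) simp
  have g2: "redJ ?n 0 = g / (2 * ?m) / (2 * ?n)"
   using redJ_0_plus1[of "\<mu> + 1"] \<mu> by (simp add: g1 add.assoc)
  have i: "\<nu> + real (Suc l) = \<mu> + 1" "\<nu> + real (Suc (Suc l)) = \<mu> + 2" by (simp_all add: \<mu>_def)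
  have "D (Suc (Suc l)) = \<bar>s * redY ?n s\<bar> * s ^ Suc l * (g / (2 * ?m) / (2 * ?n))"
   unfolding D_def i g2 using s by (simp add: abs_mult mult_ac)
  also have "s * redY ?n s = 2 * ?m * redY ?m s - redY \<mu> s" by (rule redY_rec[OF \<mu> s])
  also have "\<bar>2 * ?m * redY ?m s - redY \<mu> s\<bar> * s ^ Suc l * (g / (2 * ?m) / (2 * ?n)) \<le>
    (2 * ?m * \<bar>redY ?m s\<bar> + \<bar>redY \<mu> s\<bar>) * s ^ Suc l * (g / (2 * ?m) / (2 * ?n))"
   using \<mu> g s abs_triangle_ineq4[of "2 * ?m * redY ?m s" "redY \<mu> s"]
   by (intro mult_right_mono) (auto simp: abs_mult)
  also have "... = (2 * ?m / (2 * ?n)) * D (Suc l) + (s / (4 * ?m * ?n)) * D l"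
  proof -
   have e: "D (Suc l) = \<bar>redY ?m s\<bar> * s ^ Suc l * (g / (2 * ?m))" "D l = \<bar>redY \<mu> s\<bar> * s ^ l * g"
    unfolding D_def i g1 by (simp_all add: \<mu>_def g_def)
   have "(2 * m * x + y) * (s * S) * (g / (2 * m) / (2 * n)) = (2 * m / (2 * n)) * (x * (s * S) * (g / (2 * m))) + (s / (4 * m * n)) * (y * S * g)"
    if "m > 0" "n > 0" for x y S m n :: real using that by (simp add: field_simps)
   from this[of "\<mu> + 1" "\<mu> + 2"] show ?thesis unfolding e power_Suc using \<mu> by auto
  qed
  also have "... \<le> 1 * D (Suc l) + (q^2 - q) * D l"
  proof (intro add_mono mult_right_mono D0)
   show "2 * ?m / (2 * ?n) \<le> 1" using \<mu> by simp
   have "s / (q^2 - q) \<le> real l" using that unfolding L_def by linarith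
   then have "s \<le> (q^2 - q) * real l" using qq by (simp add: pos_divide_le_eq mult.commute)
   also have "... \<le> (q^2 - q) * (4 * ?m * ?n)"
   proof (intro mult_left_mono)
    have "real l \<le> ?m * 1" using \<nu> by (simp add: \<mu>_def)
    also have "... \<le> ?m * (4 * ?n)" using \<mu> by (intro mult_left_mono) auto
    finally show "real l \<le> 4 * ?m * ?n" by (simp only: mult_ac)
   qed (use qq in simp)
   finally show "s / (4 * ?m * ?n) \<le> q^2 - q" using \<mu> by (simp add: pos_divide_le_eq)
  qed
  finally show ?thesis by simp
 qed
 \<comment> \<open>The recursion starts from the values at \<open>L\<close> and
   \<open>Suc L\<close>, hence the maximum up to \<open>Suc L\<close>.\<close>
 define C where "C = Max ((\<lambda>l. D l / q ^ l) ` {..Suc L})"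
 have C1: "D l \<le> C * q ^ l" if "l \<le> Suc L" for l
 proof -
  have "D l / q ^ l \<le> C" unfolding C_def using that by (intro Max_ge) auto
  then show ?thesis using q by (simp add: pos_divide_le_eq)
 qed
 have "0 \<le> D 0" by (rule D0)
 then have C0: "C \<ge> 0" using C1[of 0] by simp
 have "D l \<le> C * q ^ l" for l
 proof (induction l rule: less_induct)
  case (less l)
  show ?case
  proof (cases "l \<le> Suc L")
   case False
   define m where "m = l - 2"
   have m: "l = Suc (Suc m)" "m \<ge> L" using False by (auto simp: m_def)
   have "D l \<le> D (Suc m) + (q^2 - q) * D m" unfolding m(1) by (rule rec[OF m(2)])
   also have "... \<le> C * q ^ Suc m + (q^2 - q) * (C * q ^ m)"
    using qq by (intro add_mono mult_left_mono less.IH) (auto simp: m(1))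
   also have "... = C * q ^ l" unfolding m(1) by (simp add: algebra_simps power2_eq_square)
   finally show ?thesis .
  qed (rule C1)
 qed
 then show thesis using that[OF C0] unfolding D_def by blast
qed

section \<open>Robin traces of the radial solutions\<close>

definition robin_red :: "real => real => real => real => nat => (real => real => real) => real" where
 "robin_red R \<alpha> k \<nu> l g = (\<alpha> + real l / R) * g (\<nu> + real l) (k^2 * R^2) - k^2 * R * g (\<nu> + real l + 1) (k^2 * R^2)"

text \<open>The powers (k R)^(-\<nu>) and (k R)^(\<nu> + l) collapse to (k R)^l, a factor common to
  J and Y that cancels in the quotient of the traces.\<close>

lemma robin_trace_red:
 assumes "k > 0" "R > 0" "\<And>\<mu>. h \<mu> (k * R) = (k * R) powr \<mu> * g \<mu> (k^2 * R^2)"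
 shows "(k * R) powr (- \<nu>) * ((\<alpha> + real l / R) * h (real l + \<nu>) (k * R) - k * h (real l + \<nu> + 1) (k * R)) =
  (k * R) ^ l * robin_red R \<alpha> k \<nu> l g"
proof -
 have z: "k * R > 0" using assms by simp
 have e: "(k * R) powr (- \<nu>) * (k * R) powr (real l + \<nu>) = (k * R) ^ l"
  using z by (simp add: powr_realpow flip: powr_add)
 have e1: "(k * R) powr (real l + \<nu> + 1) = (k * R) powr (real l + \<nu>) * (k * R)"
  using z powr_add[of "k * R" "real l + \<nu>" 1] by simp
 have "(k * R) powr (- \<nu>) * ((\<alpha> + real l / R) * h (real l + \<nu>) (k * R) - k * h (real l + \<nu> + 1) (k * R)) =
   ((k * R) powr (- \<nu>) * (k * R) powr (real l + \<nu>)) *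
    ((\<alpha> + real l / R) * g (real l + \<nu>) (k^2 * R^2) - k * (k * R) * g (real l + \<nu> + 1) (k^2 * R^2))"
  unfolding assms(3) e1 by (simp add: algebra_simps)
 also have "... = (k * R) ^ l * robin_red R \<alpha> k \<nu> l g"
  unfolding e robin_red_def by (simp add: add.commute[of "real l"] power2_eq_square mult.assoc)
 finally show ?thesis .
qed

lemma robin_trace_J_red:
 assumes "k > 0" "R > 0"
 shows "robin_trace_J R \<alpha> k \<nu> l = (k * R) ^ l * robin_red R \<alpha> k \<nu> l redJ"
 unfolding robin_trace_J_def
 by (rule robin_trace_red) (use assms in \<open>simp_all add: bessel_J_redJ power_mult_distrib\<close>)

lemma robin_trace_H_red:
 assumes "k > 0" "R > 0"
 shows "robin_trace_H R \<alpha> k \<nu> l = cx ((k * R) ^ l) *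
   (cx (robin_red R \<alpha> k \<nu> l redJ) + \<i> * cx (robin_red R \<alpha> k \<nu> l redY))"
proof -
 have "robin_trace_H R \<alpha> k \<nu> l =
   cx ((k * R) powr (- \<nu>) * ((\<alpha> + real l / R) * bessel_J (real l + \<nu>) (k * R) - k * bessel_J (real l + \<nu> + 1) (k * R)))
   + \<i> * cx ((k * R) powr (- \<nu>) * ((\<alpha> + real l / R) * bessel_Y (real l + \<nu>) (k * R) - k * bessel_Y (real l + \<nu> + 1) (k * R)))"
  unfolding robin_trace_H_def hankel_H1_def by (simp add: algebra_simps)
 also have "(k * R) powr (- \<nu>) * ((\<alpha> + real l / R) * bessel_J (real l + \<nu>) (k * R) - k * bessel_J (real l + \<nu> + 1) (k * R)) = (k * R) ^ l * robin_red R \<alpha> k \<nu> l redJ"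
  by (rule robin_trace_red) (use assms in \<open>simp_all add: bessel_J_redJ power_mult_distrib\<close>)
 also have "(k * R) powr (- \<nu>) * ((\<alpha> + real l / R) * bessel_Y (real l + \<nu>) (k * R) - k * bessel_Y (real l + \<nu> + 1) (k * R)) = (k * R) ^ l * robin_red R \<alpha> k \<nu> l redY"
  by (rule robin_trace_red) (use assms in \<open>simp_all add: bessel_Y_redY power_mult_distrib\<close>)
 finally show ?thesis by (simp add: algebra_simps)
qed

text \<open>For large l the value of J at the boundary is at least half of its value at 0, while the
  term of order \<nu> + l + 1 is relatively O(1 / l); the positive \<alpha> then leaves \<alpha> /
  4. The finitely many smaller l are covered by nonresonance.\<close>

lemma robin_red_J_lower:
 assumes \<nu>: "\<nu> > 0" and pos: "R > 0" "\<alpha> > 0" "k > 0" and nz: "\<And>l. robin_red R \<alpha> k \<nu> l redJ \<noteq> 0"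
 obtains c where "c > 0" "\<And>l. c * redJ (\<nu> + real l) 0 \<le> \<bar>robin_red R \<alpha> k \<nu> l redJ\<bar>"
proof -
 define s where "s = k^2 * R^2"
 have s: "s > 0" using pos by (simp add: s_def)
 define g where "g = (\<lambda>l. redJ (\<nu> + real l) 0)"
 have g: "g l > 0" for l unfolding g_def using \<nu> by (intro redJ_0_pos) simp
 define D where "D = s * exp (s / 4) / 4"
 define E where "E = k^2 * R * exp (s / 4) / 2"
 \<comment> \<open>The thresholds make D / (\<mu> + 1) at most 1/2 and E / (\<mu> + 1) at most
   \<alpha> / 4: half of the main term is kept, and half of that half may be lost.\<close>
 define L where "L = nat \<lceil>max (2 * D) (4 * E / \<alpha>)\<rceil>"
 have big: "\<alpha> / 4 * g l \<le> \<bar>robin_red R \<alpha> k \<nu> l redJ\<bar>" if "l \<ge> L" for l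
 proof -
  define \<mu> where "\<mu> = \<nu> + real l"
  have \<mu>: "\<mu> > 0" using \<nu> by (simp add: \<mu>_def)
  have "max (2 * D) (4 * E / \<alpha>) \<le> real l" using that unfolding L_def by linarith
  then have "2 * D \<le> \<mu> + 1" "4 * E / \<alpha> \<le> \<mu> + 1" using \<nu> by (auto simp: \<mu>_def)
  then have DE: "D / (\<mu> + 1) \<le> 1 / 2" "E / (\<mu> + 1) \<le> \<alpha> / 4" using \<mu> pos by (simp_all add: field_simps)
  have "\<bar>redJ \<mu> s - redJ \<mu> 0\<bar> \<le> redJ \<mu> 0 * (s * exp (s / 4) / (4 * (\<mu> + 1)))" using \<mu> s by (intro redJ_near_0) auto
  also have "... = g l * (D / (\<mu> + 1))" by (simp add: g_def \<mu>_def D_def)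
  also have "... \<le> g l * (1 / 2)" using g[of l] by (intro mult_left_mono DE) simp
  finally have "redJ \<mu> s \<ge> g l / 2" unfolding g_def \<mu>_def by linarith
  then have 1: "(\<alpha> + real l / R) * redJ \<mu> s \<ge> \<alpha> * (g l / 2)"
   using pos g[of l] by (intro mult_mono) auto
  have "k^2 * R * redJ (\<mu> + 1) s \<le> k^2 * R * (redJ (\<mu> + 1) 0 * exp (s / 4))"
   using \<mu> s pos redJ_bound[of "\<mu> + 1" s] by (intro mult_left_mono) auto
  also have "... = g l * (E / (\<mu> + 1))"
   using \<mu> redJ_0_plus1[of \<mu>] by (simp add: E_def g_def \<mu>_def[symmetric])
  also have "... \<le> g l * (\<alpha> / 4)" using g[of l] by (intro mult_left_mono DE) simp
  finally have "\<alpha> / 4 * g l \<le> (\<alpha> + real l / R) * redJ \<mu> s - k^2 * R * redJ (\<mu> + 1) s"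
  proof -
   assume 2: "k^2 * R * redJ (\<mu> + 1) s \<le> g l * (\<alpha> / 4)"
   have "a / 4 * b \<le> x - y" if "y \<le> b * (a / 4)" "a * (b / 2) \<le> x" for a b x y :: real
    using that by (simp add: mult.commute)
   from this[OF 2 1] show ?thesis .
  qed
  then show ?thesis unfolding robin_red_def s_def[symmetric] \<mu>_def[symmetric] by (rule order_trans[OF _ abs_ge_self])
 qed
 define c where "c = Min (insert (\<alpha> / 4) ((\<lambda>l. \<bar>robin_red R \<alpha> k \<nu> l redJ\<bar> / g l) ` {..<L}))"
 have "c > 0" unfolding c_def using pos g nz by (subst Min_gr_iff) auto
 moreover have "c * g l \<le> \<bar>robin_red R \<alpha> k \<nu> l redJ\<bar>" for l
 proof (cases "l < L")
  case True
  then have "c \<le> \<bar>robin_red R \<alpha> k \<nu> l redJ\<bar> / g l" unfolding c_def by (intro Min_le) auto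
  then show ?thesis using g[of l] by (simp add: pos_le_divide_eq)
 next
  case False
  have "c \<le> \<alpha> / 4" unfolding c_def by (intro Min_le) auto
  then have "c * g l \<le> \<alpha> / 4 * g l" using g[of l] by (intro mult_right_mono) auto
  then show ?thesis using big[of l] False by simp
 qed
 ultimately show thesis using that unfolding g_def by blast
qed

text \<open>One factor is bounded by its value at l = 0, the other decays like 1 / (2^l l!), so
  together with s^l they are dominated by one term of the series of exp (s / 2).\<close>

lemma redJ_0_sq_bound:
 assumes "\<nu> > 0" "s \<ge> 0"
 shows "(redJ (\<nu> + real l) 0)\<^sup>2 * s ^ l \<le> (redJ \<nu> 0)\<^sup>2 * exp (s / 2)"
proof -
 have 1: "redJ (\<nu> + real l) 0 \<le> redJ \<nu> 0 / (2 ^ l * fact l)" for l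
 proof (induction l)
  case (Suc l)
  have "redJ (\<nu> + real (Suc l)) 0 = redJ (\<nu> + real l) 0 / (2 * (\<nu> + real l + 1))"
   using redJ_0_plus1[of "\<nu> + real l"] assms by (simp add: add_ac)
  also have "... \<le> (redJ \<nu> 0 / (2 ^ l * fact l)) / (2 * real (Suc l))"
   using assms redJ_0_pos[of \<nu>] Suc by (intro frac_le) auto
  finally show ?case by (simp only: fact_Suc power_Suc divide_divide_eq_left mult_ac)
 qed simp
 have p: "redJ (\<nu> + real l) 0 \<ge> 0" "redJ \<nu> 0 > 0" using assms redJ_0_pos[of "\<nu> + real l"] redJ_0_pos[of \<nu>] by auto
 have "redJ \<nu> 0 / (2 ^ l * fact l) \<le> redJ \<nu> 0 / 1"
  using p by (intro divide_left_mono mult_ge1_I) (auto simp: fact_ge_1 one_le_power)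
 then have 2: "redJ (\<nu> + real l) 0 \<le> redJ \<nu> 0" using 1[of l] by simp
 have "(redJ (\<nu> + real l) 0)\<^sup>2 * s ^ l \<le> (redJ \<nu> 0 * (redJ \<nu> 0 / (2 ^ l * fact l))) * s ^ l"
  unfolding power2_eq_square using 1 2 p assms by (intro mult_right_mono mult_mono) auto
 also have "... = (redJ \<nu> 0)\<^sup>2 * ((s / 2) ^ l /R fact l)" by (simp add: power2_eq_square power_divide field_simps)
 also have "(s / 2) ^ l /R fact l \<le> exp (s / 2)"
 proof -
  have e: "(\<lambda>n. (s / 2) ^ n /R fact n) sums exp (s / 2)" by (rule exp_converges)
  have "(\<Sum>n\<in>{l}. (s / 2) ^ n /R fact n) \<le> (\<Sum>n. (s / 2) ^ n /R fact n)"
   using assms by (intro sum_le_suminf sums_summable[OF e]) auto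
  then show ?thesis using sums_unique[OF e] by simp
 qed
 finally show ?thesis using p by (simp add: mult_left_mono)
qed

text \<open>The quotient is 1 + i Y / J. One factor \<open>redJ (\<nu> + real l) 0\<close> pays for
  the lower bound of J in the denominator, the other tames the growth of Y, and
  \<open>redJ_0_sq_bound\<close> handles the summand 1. The square is what the two J factors of a
  series term, at x0 and at x, supply.\<close>

theorem robin_ratio_bound:
 assumes \<nu>: "\<nu> > 0" and pos: "R > 0" "\<alpha> > 0" "k > 0" and nz: "\<And>l. robin_trace_J R \<alpha> k \<nu> l \<noteq> 0" and q: "q > 1"
 obtains C where "C \<ge> 0"
  "\<And>l. norm (robin_trace_H R \<alpha> k \<nu> l / cx (robin_trace_J R \<alpha> k \<nu> l)) * (redJ (\<nu> + real l) 0)\<^sup>2 * (k^2 * R^2) ^ l \<le> C * q ^ l"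
proof -
 let ?H = "\<lambda>l. (robin_trace_H R \<alpha> k \<nu> l / cx (robin_trace_J R \<alpha> k \<nu> l))"
 let ?m = "\<lambda>l. (\<nu> + real l + 1)"
 define s where "s = k^2 * R^2"
 have s: "s > 0" using pos by (simp add: s_def)
 define g where "g = (\<lambda>l. redJ (\<nu> + real l) 0)"
 have g: "g l > 0" for l unfolding g_def using \<nu> by (intro redJ_0_pos) simp
 define J where "J = (\<lambda>l. robin_red R \<alpha> k \<nu> l redJ)"
 define Y where "Y = (\<lambda>l. robin_red R \<alpha> k \<nu> l redY)"
 have J: "J l \<noteq> 0" for l using nz[of l] pos by (auto simp: J_def robin_trace_J_red)
 obtain c where c: "c > 0" "\<And>l. c * g l \<le> \<bar>J l\<bar>"
  using robin_red_J_lower[OF \<nu> pos] J unfolding J_def g_def by metis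
 have ratio: "norm (?H l) \<le> 1 + \<bar>Y l\<bar> / (c * g l)" for l
 proof -
  have "robin_trace_H R \<alpha> k \<nu> l / cx (robin_trace_J R \<alpha> k \<nu> l) = 1 + \<i> * cx (Y l / J l)"
   using pos J[of l] by (simp add: robin_trace_H_red robin_trace_J_red J_def Y_def add_divide_distrib)
  then have "norm (?H l) \<le> 1 + \<bar>Y l\<bar> / \<bar>J l\<bar>"
   using norm_triangle_ineq[of 1 "\<i> * cx (Y l / J l)"] by (simp add: norm_mult norm_divide)
  also have "\<bar>Y l\<bar> / \<bar>J l\<bar> \<le> \<bar>Y l\<bar> / (c * g l)"
   using c(1) c(2)[of l] g[of l] J[of l] by (intro divide_left_mono) auto
  finally show ?thesis by simp
 qed
 \<comment> \<open>q is split in two: one square root for the growth of Y, the other for the linear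
   factor l + 1.\<close>
 define q' where "q' = sqrt q"
 have q': "q' > 1" "q' * q' = q" using q by (simp_all add: q'_def)
 obtain B where B: "B \<ge> 0" "\<And>l. \<bar>redY (\<nu> + real l) s\<bar> * s ^ l * g l \<le> B * q' ^ l"
  using redY_growth[OF \<nu> s q'(1)] unfolding g_def by metis
 obtain P where P: "P > 0" "\<And>l. real (Suc l) \<le> P * q' ^ l" using polynomial_le_geometric[OF q'(1), of 1] by auto
 define A where "A = (\<alpha> + 1 / R) * B + k^2 * R * (B * q' / s) * (2 * (\<nu> + 1))"
 have A: "A \<ge> 0" using pos B(1) s \<nu> q' by (auto simp: A_def intro!: add_nonneg_nonneg mult_nonneg_nonneg divide_nonneg_nonneg)
 have Y: "\<bar>Y l\<bar> * (g l * s ^ l) \<le> A * (real (Suc l) * q' ^ l)" for l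
 proof -
  have i: "\<nu> + real l + 1 = \<nu> + real (Suc l)" by simp
  have g1: "g (Suc l) = g l / (2 * ?m l)"
   using redJ_0_plus1[of "\<nu> + real l"] \<nu> by (simp add: g_def add_ac)
  have "\<bar>redY (?m l) s\<bar> * (g l * s ^ l) = (\<bar>redY (\<nu> + real (Suc l)) s\<bar> * s ^ Suc l * g (Suc l)) * (2 * ?m l) / s"
  proof -
   have e: "x * (y * t) = (x * (s * t) * (y / (2 * m))) * (2 * m) / s" if "m > 0" for x y t m :: real
    using that s by simp
   have m: "\<nu> + real l + 1 > 0" using \<nu> by simp
   show ?thesis unfolding i[symmetric] g1 power_Suc by (rule e[OF m])
  qed
  also have "... \<le> (B * q' ^ Suc l) * (2 * ?m l) / s"
   using s \<nu> by (intro divide_right_mono mult_right_mono B) auto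
  also have "... \<le> (B * q' ^ Suc l) * (2 * (\<nu> + 1) * real (Suc l)) / s"
   using s \<nu> B(1) q' by (intro divide_right_mono mult_left_mono) (auto simp: algebra_simps)
  finally have y1: "\<bar>redY (?m l) s\<bar> * (g l * s ^ l) \<le> (B * q' ^ Suc l) * (2 * (\<nu> + 1) * real (Suc l)) / s" .
  have y0: "\<bar>redY (\<nu> + real l) s\<bar> * (g l * s ^ l) \<le> B * q' ^ l" using B(2)[of l] by (simp add: mult_ac)
  have "\<bar>Y l\<bar> \<le> (\<alpha> + real l / R) * \<bar>redY (\<nu> + real l) s\<bar> + k^2 * R * \<bar>redY (?m l) s\<bar>"
   unfolding Y_def robin_red_def s_def[symmetric]
   using abs_triangle_ineq4[of "(\<alpha> + real l / R) * redY (\<nu> + real l) s" "k^2 * R * redY (?m l) s"] pos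
   by (simp add: abs_mult)
  then have "\<bar>Y l\<bar> * (g l * s ^ l) \<le> ((\<alpha> + real l / R) * \<bar>redY (\<nu> + real l) s\<bar> + k^2 * R * \<bar>redY (?m l) s\<bar>) * (g l * s ^ l)"
   using g[of l] s by (intro mult_right_mono) auto
  also have "... = (\<alpha> + real l / R) * (\<bar>redY (\<nu> + real l) s\<bar> * (g l * s ^ l)) + k^2 * R * (\<bar>redY (?m l) s\<bar> * (g l * s ^ l))"
   by (simp add: algebra_simps)
  also have "... \<le> ((\<alpha> + 1 / R) * real (Suc l)) * (B * q' ^ l) + k^2 * R * ((B * q' ^ Suc l) * (2 * (\<nu> + 1) * real (Suc l)) / s)"
  proof (intro add_mono mult_mono[OF _ y0] mult_left_mono[OF y1])
   show "\<alpha> + real l / R \<le> (\<alpha> + 1 / R) * real (Suc l)" using pos by (simp add: field_simps)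
  qed (use pos g[of l] s in auto)
  also have "... = A * (real (Suc l) * q' ^ l)" using s by (simp add: A_def field_simps)
  finally show ?thesis .
 qed
 define C where "C = (redJ \<nu> 0)\<^sup>2 * exp (s / 2) + A * P / c"
 have C0: "C \<ge> 0" using A P(1) c(1) by (simp add: C_def)
 have "norm (?H l) * (g l)\<^sup>2 * s ^ l \<le> C * q ^ l" for l
 proof -
  have "norm (?H l) * ((g l)\<^sup>2 * s ^ l) \<le> (1 + \<bar>Y l\<bar> / (c * g l)) * ((g l)\<^sup>2 * s ^ l)"
   using s by (intro mult_right_mono ratio) auto
  also have "... = (g l)\<^sup>2 * s ^ l + (\<bar>Y l\<bar> * (g l * s ^ l)) / c"
   using g[of l] c(1) by (simp add: field_simps power2_eq_square)
  also have "... \<le> (redJ \<nu> 0)\<^sup>2 * exp (s / 2) + A * (real (Suc l) * q' ^ l) / c"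
   using c(1) s redJ_0_sq_bound[OF \<nu>, of s l] by (intro add_mono divide_right_mono Y) (auto simp: g_def)
  also have "... \<le> (redJ \<nu> 0)\<^sup>2 * exp (s / 2) * q ^ l + A * ((P * q' ^ l) * q' ^ l) / c"
  proof (intro add_mono divide_right_mono mult_left_mono mult_right_mono P)
   show "(redJ \<nu> 0)\<^sup>2 * exp (s / 2) \<le> (redJ \<nu> 0)\<^sup>2 * exp (s / 2) * q ^ l"
    using mult_left_mono[OF one_le_power[of q l], of "(redJ \<nu> 0)\<^sup>2 * exp (s / 2)"] q by simp
  qed (use A c(1) q' in auto)
  also have "(P * q' ^ l) * q' ^ l = P * q ^ l" by (simp add: mult.assoc q'(2) flip: power_mult_distrib)
  also have "(redJ \<nu> 0)\<^sup>2 * exp (s / 2) * q ^ l + A * (P * q ^ l) / c = C * q ^ l" by (simp add: C_def algebra_simps)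
  finally show ?thesis by (simp add: mult.assoc)
 qed
 then show thesis using that[OF C0] unfolding g_def s_def by blast
qed

section \<open>The Green function\<close>

abbreviation trace_ratio :: "real => real => real => real => nat => complex" where
 "trace_ratio R \<alpha> k \<nu> l \<equiv> robin_trace_H R \<alpha> k \<nu> l / cx (robin_trace_J R \<alpha> k \<nu> l)"

abbreviation radJ :: "real => real => nat => real => real" where
 "radJ k \<nu> l t \<equiv> t ^ l * redJ (\<nu> + real l) (k^2 * t^2)"

abbreviation radY :: "real => real => nat => real => real" where
 "radY k \<nu> l t \<equiv> t ^ l * redY (\<nu> + real l) (k^2 * t^2)"

text \<open>The direction \<open>w0\<close> of the source is a parameter: for x0 = 0 every unit
  vector qualifies, so a source at the centre is treated like any other.\<close>

locale robin_setup =
 fixes R \<alpha> k :: real and x0 w0 :: "'a::euclidean_space" and Y :: "nat => nat => 'a => complex"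
 assumes dim: "DIM('a) \<ge> 3" and R: "R > 0" and \<alpha>: "\<alpha> > 0" and k: "k > 0"
  and basis: "\<And>l. orthonormal_harmonic_basis l (harmonic_dim DIM('a) l) (Y l)"
  and nonres: "\<And>l. robin_trace_J R \<alpha> k (real DIM('a) / 2 - 1) l \<noteq> 0"
  and x0: "norm x0 < R" and w0: "norm w0 = 1" "x0 = norm x0 *R w0"
begin

definition \<nu> :: real where "\<nu> = real DIM('a) / 2 - 1"

lemma \<nu>: "\<nu> > 0" using dim by (simp add: \<nu>_def)

text \<open>Coefficient of the radial function J + i Y in the degree-l projection of the singular
  part on spheres outside |x0|. In the power of k^2 |x0|, each of the two reduced functions involved
  accounts for one k^l.\<close>

definition source_coeff :: "nat => complex" where
 "source_coeff l = \<i> * cx (pi * k ^ (DIM('a) - 2) / 2) * cx ((k^2 * norm x0) ^ l * redJ (\<nu> + real l) (k^2 * (norm x0)\<^sup>2))"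

text \<open>The power r^l sits in the homogeneous kernel, so the profile is the reduced J alone and
  the product is an entire Helmholtz solution.\<close>

definition mode :: "nat => 'a => complex" where
 "mode l x = cx (famJ k (\<nu> + real l) 0 (sq x)) * harmonic_kernel l w0 x"

text \<open>This is \<open>source_coeff l\<close> times the quotient of the Robin traces, the choice
  for which the boundary expression cancels degree by degree.\<close>

definition mode_coeff :: "nat => complex" where
 "mode_coeff l = \<i> * cx (pi * k ^ (DIM('a) - 2) / 2) * trace_ratio R \<alpha> k \<nu> l
   * cx ((k^2 * norm x0) ^ l * redJ (\<nu> + real l) (k^2 * (norm x0)\<^sup>2))"

definition reg_term :: "nat => 'a => complex" where
 "reg_term l x = mode_coeff l * mode l x"

definition regular_part :: "'a => complex" where
 "regular_part x = (\<Sum>l. reg_term l x)"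

lemma mode_C_k: "C_k n (mode l)" unfolding mode_def[abs_def]
 by (intro C_k_mult C_k_famJ solid_harmonicD(1)[OF solid_harmonic_kernel[OF w0(1)]])

lemma reg_term_C_k: "C_k n (reg_term l)"
 unfolding reg_term_def[abs_def] by (intro C_k_cmult mode_C_k)

lemma mode_helmholtz: "laplacian (mode l) x + cx (k^2) * mode l x = 0"
proof -
 define \<mu> where "\<mu> = \<nu> + real l"
 define P where "P = harmonic_kernel l w0"
 have P: "solid_harmonic l P" unfolding P_def by (rule solid_harmonic_kernel[OF w0(1)])
 have "laplacian (mode l) x = (4 * cx (sq x) * cx (famJ k \<mu> (Suc (Suc 0)) (sq x))
   + cx (2 * real DIM('a) + 4 * real l) * cx (famJ k \<mu> (Suc 0) (sq x))) * P x
   + cx (famJ k \<mu> 0 (sq x)) * laplacian P x"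
  unfolding mode_def[abs_def] P_def[symmetric] \<mu>_def[symmetric]
  by (rule laplacian_radial_mult[where S = UNIV and F = "\<lambda>s. cx (famJ k \<mu> 0 s)" and F' = "\<lambda>s. cx (famJ k \<mu> (Suc 0) s)"
     and F'' = "\<lambda>s. cx (famJ k \<mu> (Suc (Suc 0)) s)"])
    (auto intro!: has_vector_derivative_of_real famJ_deriv solid_harmonicD(1)[OF P] simp: solid_harmonicD(2)[OF P])
 moreover have "mode l x = cx (famJ k \<mu> 0 (sq x)) * P x" by (simp add: mode_def P_def \<mu>_def)
 ultimately have "laplacian (mode l) x + cx (k^2) * mode l x =
   cx (4 * (sq x) * famJ k \<mu> 2 (sq x) + (2 * real DIM('a) + 4 * real l) * famJ k \<mu> 1 (sq x) + k^2 * famJ k \<mu> 0 (sq x)) * P x"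
  by (simp add: solid_harmonicD(3)[OF P] algebra_simps numeral_2_eq_2)
 also have "2 * real DIM('a) + 4 * real l = 4 * (\<mu> + 1)" by (simp add: \<mu>_def \<nu>_def)
 finally show ?thesis unfolding famJ_ode by simp
qed

lemma pdir_mode:
 "pdir b (mode l) x = cx (famJ k (\<nu> + real l) 0 (sq x)) * pdir b (harmonic_kernel l w0) x
   + cx (2 * (x \<bullet> b) * famJ k (\<nu> + real l) 1 (sq x)) * harmonic_kernel l w0 x"
proof -
 have "((\<lambda>y. cx (famJ k (\<nu> + real l) 0 (sq y))) has_derivative
   (\<lambda>h. cx (2 * (x \<bullet> h)) * cx (famJ k (\<nu> + real l) (Suc 0) (sq x)))) (at x)"
  by (rule has_derivative_radial[OF has_vector_derivative_of_real[OF famJ_deriv]])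
 from pdir_eq[OF this, of b] show ?thesis unfolding mode_def[abs_def] by (subst pdir_mult)
    (auto intro: C_k_SucD(1)[OF C_k_famJ] C_k_SucD(1)[OF solid_harmonicD(1)[OF solid_harmonic_kernel[OF w0(1)]]])
qed

text \<open>The ratio is \<theta> = q^3 |x0| / R: one q is lost to the quotient of the traces, one
  to the growth of the kernel, one to enlarging the ball to R' = q R. The larger ball makes the
  series differentiable on the boundary sphere itself.\<close>

theorem reg_term_bounds:
 obtains R' B \<theta> where "R' > R" "B \<ge> 0" "0 \<le> \<theta>" "\<theta> < 1"
  "\<And>l x. norm x \<le> R' ==> norm (reg_term l x) \<le> B * \<theta> ^ l"
  "\<And>l x b. norm x \<le> R' ==> b \<in> Basis ==> norm (pdir b (reg_term l) x) \<le> B * \<theta> ^ l"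
proof -
 define r0 where "r0 = norm x0"
 have r0: "0 \<le> r0" "r0 < R" using x0 by (simp_all add: r0_def)
 \<comment> \<open>q is taken close enough to 1 for the three losses to leave a ratio below
   1.\<close>
 obtain q where q: "q > 1" "q ^ 3 * r0 < R"
 proof -
  have "((\<lambda>q. q ^ 3 * r0) \<longlongrightarrow> 1 ^ 3 * r0) (at_right 1)" by (intro tendsto_intros)
  then have "\<forall>\<^sub>F q in at_right 1. q ^ 3 * r0 < R" using r0 by (intro order_tendstoD(2)) auto
  moreover have "\<forall>\<^sub>F q :: real in at_right 1. q > 1" by (simp add: eventually_at_filter)
  ultimately have "\<forall>\<^sub>F q in at_right 1. q > 1 \<and> q ^ 3 * r0 < R" by eventually_elim simp
  then show ?thesis using that eventually_happens' trivial_limit_at_right_real by blast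
 qed
 define R' where "R' = q * R"
 have R': "R' > R" "R' > 0" using q R by (simp_all add: R'_def)
 obtain C1 where C1: "C1 \<ge> 0"
  "\<And>l. norm (trace_ratio R \<alpha> k \<nu> l) * (redJ (\<nu> + real l) 0)\<^sup>2 * (k^2 * R^2) ^ l \<le> C1 * q ^ l"
  using robin_ratio_bound[OF \<nu> R \<alpha> k nonres[folded \<nu>_def] q(1)] by blast
 obtain C2 where C2: "C2 \<ge> 0"
  "\<And>l (y::'a) x. norm y = 1 ==> norm (harmonic_kernel l y x) \<le> C2 * q ^ l * norm x ^ l"
  "\<And>l (y::'a) x b. norm y = 1 ==> b \<in> Basis ==>
    norm (pdir b (harmonic_kernel l y) x) \<le> C2 * q ^ l * norm x ^ (l - 1)"
  using harmonic_kernel_growth[OF dim basis q(1)] by blast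
 define g where "g = (\<lambda>l. redJ (\<nu> + real l) 0)"
 have g: "g l > 0" for l unfolding g_def using \<nu> by (intro redJ_0_pos) simp
 define E where "E = exp (k^2 * R'^2 / 4)"
 have E: "E > 0" by (simp add: E_def)
 let ?D = "\<lambda>l. g l * E * (C2 * q ^ l * R' ^ l)"
 define A where "A = pi * k ^ (DIM('a) - 2) / 2"
 have A: "A \<ge> 0" using k by (simp add: A_def)
 define T where "T = (\<lambda>l. norm (trace_ratio R \<alpha> k \<nu> l))"
 have T: "norm (trace_ratio R \<alpha> k \<nu> l) = T l" for l by (simp only: T_def)
 have T0: "T l \<ge> 0" for l by (simp add: T_def)
 have redJ_le: "\<bar>redJ (\<nu> + real l) (k^2 * t)\<bar> \<le> g l * E" if "0 \<le> t" "t \<le> R'^2" for l t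
 proof -
  have "\<bar>redJ (\<nu> + real l) (k^2 * t)\<bar> \<le> g l * exp (k^2 * t / 4)"
   unfolding g_def using \<nu> that by (intro redJ_bound) auto
  also have "... \<le> g l * E" unfolding E_def using g[of l] that k by (intro mult_left_mono) (auto intro!: mult_left_mono)
  finally show ?thesis .
 qed
 have gSuc: "g (Suc l) \<le> g l" for l
 proof -
  have "g (Suc l) = g l / (2 * (\<nu> + real l + 1))" using redJ_0_plus1[of "\<nu> + real l"] \<nu> by (simp add: g_def add_ac)
  also have "... \<le> g l / 1" using \<nu> g[of l] by (intro divide_left_mono) auto
  finally show ?thesis by simp
 qed
 have coeff: "norm (mode_coeff l) \<le> A * T l * ((k^2 * r0) ^ l * (g l * E))" for l
 proof -
  have "norm (mode_coeff l) = A * T l * ((k^2 * r0) ^ l * \<bar>redJ (\<nu> + real l) (k^2 * r0^2)\<bar>)"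
   unfolding mode_coeff_def norm_mult T r0_def[symmetric] norm_of_real A_def[symmetric]
   using A r0 by (simp add: abs_mult)
  also have "... \<le> A * T l * ((k^2 * r0) ^ l * (g l * E))"
   using A T0 r0 R' by (intro mult_left_mono redJ_le) (auto intro!: power_mono)
  finally show ?thesis .
 qed
 have kern: "norm (harmonic_kernel l w0 x) \<le> C2 * q ^ l * R' ^ l" if "norm x \<le> R'" for l x
  by (rule order_trans[OF C2(2)[OF w0(1)]]) (use C2(1) q that in \<open>auto intro!: mult_left_mono power_mono\<close>)
 have xx: "sq x \<le> R'^2" if "norm x \<le> R'" for x :: 'a
  using power_mono[OF that norm_ge_zero, of 2] by (simp add: dot_square_norm)
 have fam0: "\<bar>famJ k (\<nu> + real l) 0 (sq x)\<bar> \<le> g l * E" if "norm x \<le> R'" for l and x :: 'a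
  using redJ_le[OF _ xx[OF that]] by (simp add: famJ_def)
 have fam1: "\<bar>famJ k (\<nu> + real l) 1 (sq x)\<bar> \<le> k^2 / 2 * (g l * E)" if "norm x \<le> R'" for l and x :: 'a
 proof -
  have "\<bar>famJ k (\<nu> + real l) 1 (sq x)\<bar> = k^2 / 2 * \<bar>redJ (\<nu> + real (Suc l)) (k^2 * (sq x))\<bar>"
   by (simp add: famJ_def abs_mult add_ac)
  also have "... \<le> k^2 / 2 * (g (Suc l) * E)" by (intro mult_left_mono redJ_le xx that) auto
  also have "... \<le> k^2 / 2 * (g l * E)" using gSuc[of l] E by (intro mult_left_mono mult_right_mono) auto
  finally show ?thesis .
 qed
 define \<theta> where "\<theta> = q ^ 3 * r0 / R"
 have \<theta>: "0 \<le> \<theta>" "\<theta> < 1" using q r0 R by (simp_all add: \<theta>_def)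
 \<comment> \<open>Allowance for first derivatives: 1 / R' for the degree lost by the kernel, R' k^2
   for the derivative of the profile, 1 for the function itself and for degree 0.\<close>
 define K where "K = 1 + 1 / R' + R' * k^2"
 have K: "K \<ge> 1" using R' by (simp add: K_def)
 define B where "B = A * E * E * C1 * C2 * K"
 have B: "B \<ge> 0" using A E C1(1) C2(1) K by (simp add: B_def)
 have main: "norm (mode_coeff l) * (?D l * K) \<le> B * \<theta> ^ l" for l
 proof -
  have k2R: "(k^2 * R^2) ^ l > 0" using k R by simp
  have "norm (mode_coeff l) * (?D l * K) \<le> (A * T l * ((k^2 * r0) ^ l * (g l * E))) * (?D l * K)"
   using g[of l] E C2(1) q R' K by (intro mult_right_mono coeff) auto
  \<comment> \<open>One factor g from the coefficient and one from the mode form the square to which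
    \<open>robin_ratio_bound\<close> applies.\<close>
  also have "... = (A * E * E * C2 * K) * (T l * (g l)\<^sup>2 * (k^2 * R^2) ^ l) * ((k^2 * r0 * q * R') ^ l / (k^2 * R^2) ^ l)"
  proof -
   have pw: "(k^2 * r0 * q * R') ^ l = (k^2 * r0) ^ l * q ^ l * R' ^ l" by (simp only: power_mult_distrib)
   have "(A * t * (a * (y * E))) * (y * E * (C2 * b * c) * K) = (A * E * E * C2 * K) * (t * y^2 * X) * ((a * b * c) / X)"
    if "X > 0" for X a b c t y :: real using that by (simp add: power2_eq_square)
   from this[OF k2R] show ?thesis unfolding pw .
  qed
  also have "... \<le> (A * E * E * C2 * K) * (C1 * q ^ l) * ((k^2 * r0 * q * R') ^ l / (k^2 * R^2) ^ l)"
   using C1(2)[of l] A E C2(1) K r0 q R' k2R unfolding T_def g_def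
   by (intro mult_right_mono mult_left_mono) auto
  also have "... = B * (q * (k^2 * r0 * q * R') / (k^2 * R^2)) ^ l"
   by (simp add: B_def power_mult_distrib power_divide mult_ac)
  also have "q * (k^2 * r0 * q * R') / (k^2 * R^2) = \<theta>"
   using k R by (simp add: \<theta>_def R'_def field_simps power2_eq_square power3_eq_cube)
  finally show ?thesis .
 qed
 have b1: "norm (reg_term l x) \<le> B * \<theta> ^ l" if x: "norm x \<le> R'" for l x
 proof -
  have "norm (mode l x) \<le> ?D l"
   unfolding mode_def norm_mult norm_of_real using g[of l] E by (intro mult_mono fam0 kern x) auto
  also have "... \<le> ?D l * K" using mult_left_mono[OF K, of "?D l"] g[of l] E C2(1) q R' by simp
  finally have "norm (mode_coeff l) * norm (mode l x) \<le> norm (mode_coeff l) * (?D l * K)"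
   by (rule mult_left_mono) simp
  then show ?thesis using main[of l] by (simp add: reg_term_def norm_mult)
 qed
 have b2: "norm (pdir b (reg_term l) x) \<le> B * \<theta> ^ l" if x: "norm x \<le> R'" and b: "b \<in> Basis" for l x b
 proof -
  have "norm (pdir b (harmonic_kernel l w0) x) \<le> C2 * q ^ l * R' ^ l * (1 + 1 / R')"
  proof -
   have "norm (pdir b (harmonic_kernel l w0) x) \<le> C2 * q ^ l * norm x ^ (l - 1)" by (rule C2(3)[OF w0(1) b])
   also have "... \<le> C2 * q ^ l * (R' ^ l * (1 + 1 / R'))"
   proof (intro mult_left_mono)
    have "norm x ^ (l - 1) \<le> R' ^ (l - 1)" using x by (intro power_mono) auto
    also have "... \<le> R' ^ l * (1 + 1 / R')" using R' by (cases l) (simp_all add: field_simps)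
    finally show "norm x ^ (l - 1) \<le> R' ^ l * (1 + 1 / R')" .
   qed (use C2(1) q in auto)
   finally show ?thesis by (simp add: mult.assoc)
  qed
  then have 1: "\<bar>famJ k (\<nu> + real l) 0 (sq x)\<bar> * norm (pdir b (harmonic_kernel l w0) x) \<le> (g l * E) * (C2 * q ^ l * R' ^ l * (1 + 1 / R'))"
   using g[of l] E by (intro mult_mono fam0 x) auto
  have xb: "\<bar>2 * (x \<bullet> b)\<bar> \<le> 2 * R'" using Basis_le_norm[OF b, of x] x by simp
  have "\<bar>2 * (x \<bullet> b) * famJ k (\<nu> + real l) 1 (sq x)\<bar> \<le> 2 * R' * (k^2 / 2 * (g l * E))"
   unfolding abs_mult[of "2 * (x \<bullet> b)"] using R' by (intro mult_mono xb fam1 x) auto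
  then have 2: "\<bar>2 * (x \<bullet> b) * famJ k (\<nu> + real l) 1 (sq x)\<bar> * norm (harmonic_kernel l w0 x) \<le>
    (2 * R' * (k^2 / 2 * (g l * E))) * (C2 * q ^ l * R' ^ l)"
   using g[of l] E R' by (intro mult_mono kern x) auto
  have "norm (pdir b (mode l) x) \<le> (g l * E) * (C2 * q ^ l * R' ^ l * (1 + 1 / R')) + (2 * R' * (k^2 / 2 * (g l * E))) * (C2 * q ^ l * R' ^ l)"
   unfolding pdir_mode
   by (rule order_trans[OF norm_triangle_ineq add_mono]) (use 1 2 in \<open>simp_all only: norm_mult norm_of_real\<close>)
  also have "... = ?D l * K" by (simp add: K_def algebra_simps)
  finally have "norm (mode_coeff l) * norm (pdir b (mode l) x) \<le> norm (mode_coeff l) * (?D l * K)"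
   by (rule mult_left_mono) simp
  moreover have "pdir b (reg_term l) x = mode_coeff l * pdir b (mode l) x"
   unfolding reg_term_def[abs_def] by (rule pdir_cmult[OF C_k_SucD(1)[OF mode_C_k]])
  ultimately show ?thesis using main[of l] by (simp add: norm_mult)
 qed
 show thesis by (rule that[OF R'(1) B \<theta> b1 b2])
qed

end

lemma norm_pdir_le:
 fixes f :: "'a::euclidean_space => complex"
 assumes "f differentiable at x" "\<And>b. b \<in> Basis ==> norm (pdir b f x) \<le> M"
 shows "norm (pdir h f x) \<le> real DIM('a) * norm h * M"
proof -
 have "norm (pdir h f x) \<le> (\<Sum>b\<in>Basis. norm (cx (h \<bullet> b) * pdir b f x))"
  unfolding sum_Basis_pdir[OF assms(1), of h, symmetric] by (rule norm_sum)
 also have "... \<le> (\<Sum>b\<in>(Basis::'a set). norm h * M)"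
 proof (rule sum_mono)
  fix b :: 'a assume b: "b \<in> Basis"
  show "norm (cx (h \<bullet> b) * pdir b f x) \<le> norm h * M"
   unfolding norm_mult norm_of_real using Basis_le_norm[OF b, of h] by (intro mult_mono assms(2)[OF b]) auto
 qed
 finally show ?thesis by simp
qed

text \<open>Uniform bounds for the partial derivatives along the basis control all directions
  linearly in the norm of h, which is the uniformity that termwise differentiation asks for.\<close>

theorem smooth_series:
 fixes f :: "nat => 'a::euclidean_space => complex"
 assumes f: "\<And>n. C_k 1 (f n)" and M: "summable M"
  and b0: "\<And>n x. x \<in> ball 0 r ==> norm (f n x) \<le> M n"
  and b1: "\<And>n x b. x \<in> ball 0 r ==> b \<in> Basis ==> norm (pdir b (f n) x) \<le> M n"
 shows "x \<in> ball 0 r ==> ((\<lambda>x. \<Sum>n. f n x) has_derivative (\<lambda>h. \<Sum>n. pdir h (f n) x)) (at x)"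
  and "continuous_on (ball 0 r) (\<lambda>x. \<Sum>n. pdir h (f n) x)"
proof -
 have dif: "f n differentiable at x" for n x using C_k_SucD(1)[of 0 "f n" x] f[of n] by simp
 have bh: "norm (pdir h (f n) x) \<le> real DIM('a) * norm h * M n" if "x \<in> ball 0 r" for n x h
  by (rule norm_pdir_le[OF dif b1[OF that]])
 have sum_h: "summable (\<lambda>n. real DIM('a) * norm h * M n)" for h :: 'a by (rule summable_mult[OF M])
 have sh: "summable (\<lambda>n. pdir h (f n) x)" if "x \<in> ball 0 r" for h x
  by (rule summable_norm_cancel[OF summable_comparison_test'[OF sum_h[of h]]]) (use bh[OF that] in simp)
 show "((\<lambda>x. \<Sum>n. f n x) has_derivative (\<lambda>h. \<Sum>n. pdir h (f n) x)) (at x)" if x: "x \<in> ball 0 r"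
 proof -
  have "\<exists>g. \<forall>x\<in>ball 0 r. (\<lambda>n. f n x) sums (g x) \<and> (g has_derivative (\<lambda>h. \<Sum>n. pdir h (f n) x)) (at x within ball 0 r)"
  proof (rule has_derivative_series[where f' = "\<lambda>n x h. pdir h (f n) x"])
   show "((f n) has_derivative (\<lambda>h. pdir h (f n) x)) (at x within ball 0 r)" for n x
    using C_k_SucD(2)[of 0 "f n" x] f[of n] by (simp add: has_derivative_at_withinI)
   show "(\<lambda>n. f n x) sums (\<Sum>n. f n x)"
    by (rule summable_sums[OF summable_norm_cancel[OF summable_comparison_test'[OF M]]]) (use b0[OF x] in simp)
   show "\<forall>\<^sub>F n in sequentially. \<forall>x\<in>ball 0 r. \<forall>h. norm ((\<Sum>i<n. pdir h (f i) x) - (\<Sum>n. pdir h (f n) x)) \<le> e * norm h" if e: "e > 0" for e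
   proof -
    have "e / real DIM('a) > 0" using e by simp
    then obtain N where N: "\<And>n. n \<ge> N ==> norm (\<Sum>i. M (i + n)) < e / real DIM('a)"
     using suminf_exist_split[OF _ M] by blast
    have "norm ((\<Sum>i<n. pdir h (f i) x) - (\<Sum>n. pdir h (f n) x)) \<le> e * norm h" if n: "n \<ge> N" and x: "x \<in> ball 0 r" for n x h
    proof -
     have "(\<Sum>i<n. pdir h (f i) x) - (\<Sum>n. pdir h (f n) x) = - (\<Sum>i. pdir h (f (i + n)) x)"
      using suminf_minus_initial_segment[OF sh[OF x], of h n] by simp
     then have "norm ((\<Sum>i<n. pdir h (f i) x) - (\<Sum>n. pdir h (f n) x)) = norm (\<Sum>i. pdir h (f (i + n)) x)"
      by (simp only: norm_minus_cancel)
     also have "... \<le> (\<Sum>i. real DIM('a) * norm h * M (i + n))"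
      by (rule norm_suminf_le[OF bh[OF x]]) (use summable_ignore_initial_segment[OF sum_h[of h], of n] in simp)
     also have "... = real DIM('a) * norm h * (\<Sum>i. M (i + n))"
      by (rule suminf_mult[OF summable_ignore_initial_segment[OF M]])
     also have "... \<le> real DIM('a) * norm h * (e / real DIM('a))"
      using N[OF n] by (intro mult_left_mono) auto
     finally show ?thesis by (simp add: mult.commute)
    qed
    then show ?thesis unfolding eventually_sequentially by blast
   qed
  qed (use x in auto)
  then obtain g where g: "\<And>x. x \<in> ball 0 r ==> (\<lambda>n. f n x) sums (g x)"
   "\<And>x. x \<in> ball 0 r ==> (g has_derivative (\<lambda>h. \<Sum>n. pdir h (f n) x)) (at x within ball 0 r)" by blast
  have "((\<lambda>x. \<Sum>n. f n x) has_derivative (\<lambda>h. \<Sum>n. pdir h (f n) x)) (at x within ball 0 r)"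
   by (rule has_derivative_transform[OF x _ g(2)[OF x]]) (simp add: sums_unique[OF g(1)])
  then show ?thesis using x by (simp add: at_within_open[OF _ open_ball])
 qed
 show "continuous_on (ball 0 r) (\<lambda>x. \<Sum>n. pdir h (f n) x)"
 proof (rule uniform_limit_theorem[OF _ Weierstrass_m_test[OF bh sum_h]])
  have c: "continuous_on UNIV (pdir h (f i))" for i
  proof -
   have "pdir h (f i) = (\<lambda>x. \<Sum>b\<in>Basis. cx (h \<bullet> b) * pdir b (f i) x)"
    by (rule ext) (rule sum_Basis_pdir[OF dif, symmetric])
   moreover have "continuous_on UNIV (pdir b (f i))" if "b \<in> Basis" for b
    using C_k_SucD(3)[of 0 "f i" b] f[of i] that by simp
   ultimately show ?thesis by (auto intro!: continuous_on_sum continuous_on_mult continuous_on_const)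
  qed
  show "\<forall>\<^sub>F n in sequentially. continuous_on (ball 0 r) (\<lambda>x. \<Sum>i<n. pdir h (f i) x)"
   by (intro always_eventually allI continuous_on_sum continuous_on_subset[OF c]) auto
 qed auto
qed

lemma integral_series:
 fixes f :: "nat => 'a => complex"
 assumes f: "\<And>n. integrable N (f n)" and w: "integrable N w" and M: "summable M" "\<And>n. M n \<ge> 0"
  and b: "\<And>n x. x \<in> space N ==> norm (f n x) \<le> M n * w x"
 shows "integrable N (\<lambda>x. \<Sum>n. f n x)" "(LINT x|N. (\<Sum>n. f n x)) = (\<Sum>n. LINT x|N. f n x)"
proof -
 have 1: "AE x in N. summable (\<lambda>i. norm (f i x))"
 proof (rule AE_I2)
  fix x assume "x \<in> space N"
  then show "summable (\<lambda>i. norm (f i x))"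
   by (intro summable_comparison_test'[OF summable_mult2[OF M(1)]]) (use b in simp)
 qed
 have 2: "summable (\<lambda>i. LINT x|N. norm (f i x))"
 proof (rule summable_comparison_test'[OF summable_mult2[OF M(1), of "LINT x|N. w x"]])
  fix n
  have "norm (LINT x|N. norm (f n x)) = (LINT x|N. norm (f n x))" by (simp add: integral_nonneg_AE)
  also have "... \<le> (LINT x|N. M n * w x)" by (rule integral_mono) (use f w b in auto)
  finally show "norm (LINT x|N. norm (f n x)) \<le> M n * (LINT x|N. w x)" by simp
 qed
 show "integrable N (\<lambda>x. \<Sum>n. f n x)" by (rule integrable_suminf[OF f 1 2])
 show "(LINT x|N. (\<Sum>n. f n x)) = (\<Sum>n. LINT x|N. f n x)" by (rule integral_suminf[OF f 1 2])
qed

context robin_setup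
begin

definition reg_deriv :: "'a => 'a => complex" where
 "reg_deriv x h = (\<Sum>l. pdir h (reg_term l) x)"

lemma regular_part_smooth:
 obtains R' where "R' > R" "\<And>x. x \<in> ball 0 R' ==> (regular_part has_derivative reg_deriv x) (at x)"
  "\<And>h. continuous_on (ball 0 R') (\<lambda>x. reg_deriv x h)"
proof -
 obtain R' B \<theta> where b: "R' > R" "B \<ge> 0" "0 \<le> \<theta>" "\<theta> < 1"
  "\<And>l x. norm x \<le> R' ==> norm (reg_term l x) \<le> B * \<theta> ^ l"
  "\<And>l x b. norm x \<le> R' ==> b \<in> Basis ==> norm (pdir b (reg_term l) x) \<le> B * \<theta> ^ l"
  using reg_term_bounds by metis
 have M: "summable (\<lambda>l. B * \<theta> ^ l)" using b by (intro summable_mult summable_geometric) auto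
 show thesis
 proof (rule that[OF b(1)])
  show "(regular_part has_derivative reg_deriv x) (at x)" if "x \<in> ball 0 R'" for x
   unfolding regular_part_def[abs_def] reg_deriv_def[abs_def]
   by (rule smooth_series(1)[OF reg_term_C_k M _ _ that]) (auto intro!: b)
  show "continuous_on (ball 0 R') (\<lambda>x. reg_deriv x h)" for h
   unfolding reg_deriv_def by (rule smooth_series(2)[OF reg_term_C_k M]) (auto intro!: b)
 qed
qed

lemma reg_term_summable:
 assumes "norm x \<le> R"
 shows "summable (\<lambda>l. reg_term l x)"
proof -
 obtain R' B \<theta> where b: "R' > R" "B \<ge> 0" "0 \<le> \<theta>" "\<theta> < 1"
  "\<And>l x. norm x \<le> R' ==> norm (reg_term l x) \<le> B * \<theta> ^ l" using reg_term_bounds by metis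
 have M: "summable (\<lambda>l. B * \<theta> ^ l)" using b by (intro summable_mult summable_geometric) auto
 show ?thesis
  by (rule summable_norm_cancel[OF summable_comparison_test'[OF M]]) (use b(1,5) assms in auto)
qed

text \<open>Each term is an entire Helmholtz solution; the geometric bound times the integrable
  |\<psi>| permits integration term by term.\<close>

lemma regular_part_weak:
 assumes \<phi>: "test_function (ball 0 R) \<phi>"
 shows "(LBINT x. regular_part x * helmholtz k \<phi> x) = 0"
proof -
 obtain R' B \<theta> where b: "R' > R" "B \<ge> 0" "0 \<le> \<theta>" "\<theta> < 1"
  "\<And>l x. norm x \<le> R' ==> norm (reg_term l x) \<le> B * \<theta> ^ l" using reg_term_bounds by metis
 have M: "summable (\<lambda>l. B * \<theta> ^ l)" using b by (intro summable_mult summable_geometric) auto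
 define \<psi> where "\<psi> = (\<lambda>x. helmholtz k \<phi> x)"
 obtain K where K: "compact K" "K \<subseteq> ball 0 R" "\<And>x. x \<notin> K ==> \<phi> x = 0" "\<And>x. x \<notin> K ==> \<psi> x = 0"
  "continuous_on UNIV \<phi>" "continuous_on UNIV \<psi>"
  unfolding \<psi>_def using test_function_helmholtz[OF \<phi>, of "cx (k^2)"] by metis
 have int: "integrable lborel (\<lambda>x. reg_term l x * \<psi> x)" for l
  by (rule integrable_compact_support[OF _ K(1)])
    (use C_k_continuous[OF reg_term_C_k[of 0]] K in \<open>auto intro!: continuous_intros\<close>)
 have "integrable lborel \<psi>" by (rule integrable_compact_support[OF K(6) K(1) K(4)])
 then have w: "integrable lborel (\<lambda>x. norm (\<psi> x))" by simp
 have "regular_part x * \<psi> x = (\<Sum>l. reg_term l x * \<psi> x)" for x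
 proof (cases "x \<in> K")
  case True
  then have "norm x \<le> R" using K(2) by force
  then show ?thesis unfolding regular_part_def by (rule suminf_mult2[OF reg_term_summable])
 qed (simp add: K(4))
 then have "(LBINT x. regular_part x * \<psi> x) = (LBINT x. (\<Sum>l. reg_term l x * \<psi> x))" by simp
 also have "... = (\<Sum>l. LBINT x. reg_term l x * \<psi> x)"
 proof (rule integral_series(2)[OF int w M])
  show "norm (reg_term l x * \<psi> x) \<le> B * \<theta> ^ l * norm (\<psi> x)" for l x
  proof (cases "x \<in> K")
   case True
   then have "norm x \<le> R" using K(2) by force
   then show ?thesis unfolding norm_mult using b(1) by (intro mult_right_mono b) auto
  qed (simp add: K(4))
 qed (use b in auto)
 also have "... = (\<Sum>l. 0)"
 proof (rule arg_cong[where f = suminf], rule ext)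
  fix l
  have lap: "laplacian (reg_term l) x + cx (k^2) * reg_term l x = 0" for x
  proof -
   have "laplacian (reg_term l) x = mode_coeff l * laplacian (mode l) x"
    unfolding reg_term_def[abs_def] by (rule laplacian_cmult[OF mode_C_k])
   then have "laplacian (reg_term l) x + cx (k^2) * reg_term l x =
     mode_coeff l * (laplacian (mode l) x + cx (k^2) * mode l x)"
    by (simp add: reg_term_def algebra_simps)
   then show ?thesis unfolding mode_helmholtz by simp
  qed
  show "(LBINT x. reg_term l x * \<psi> x) = 0"
   unfolding \<psi>_def integral_helmholtz_swap(2)[OF reg_term_C_k \<phi>] lap by simp
 qed
 finally show ?thesis unfolding \<psi>_def by simp
qed

text \<open>Orthogonality removes all degrees but l, and the reproducing kernel evaluates p at
  \<open>w0\<close>; the geometric bound justifies termwise integration.\<close>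

lemma regular_part_projection:
 assumes p: "solid_harmonic l p" and t: "0 \<le> t" "t \<le> R'" and R': "R' > R"
  and bnd: "\<And>l x. norm x \<le> R' ==> norm (reg_term l x) \<le> B * \<theta> ^ l" and B: "B \<ge> 0" "0 \<le> \<theta>" "\<theta> < 1"
 shows "(SPH v. regular_part (t *R v) * p v) = mode_coeff l * cx (radJ k \<nu> l t) * p w0"
proof -
 have M: "summable (\<lambda>l. B * \<theta> ^ l)" using B by (intro summable_mult summable_geometric) auto
 have pc: "continuous_on (sphere 0 1) p" by (rule solid_harmonicD(4)[OF p])
 have c: "continuous_on (sphere 0 1) (\<lambda>v. reg_term m (t *R v))" for m
  by (rule continuous_on_compose2[OF C_k_continuous[OF reg_term_C_k[of 0], of UNIV]]) (auto intro!: continuous_intros)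
 have int: "integrable sphere_measure (\<lambda>v. reg_term m (t *R v) * p v)" for m
  by (intro continuous_sphere_integrable continuous_intros c pc)
 have w: "integrable sphere_measure (\<lambda>v. norm (p v))"
  by (intro continuous_sphere_integrable continuous_intros pc)
 have bt: "norm (reg_term m (t *R v)) \<le> B * \<theta> ^ m" if "norm v = 1" for m v
  using t that by (intro bnd) simp
 have "(SPH v. regular_part (t *R v) * p v) = (SPH v. (\<Sum>m. reg_term m (t *R v) * p v))"
 proof (rule lint_cong[OF refl])
  fix v :: 'a assume "v \<in> space sphere_measure"
  then have "norm v = 1" by simp
  from bt[OF this] have "summable (\<lambda>m. reg_term m (t *R v))"
   by (intro summable_norm_cancel[OF summable_comparison_test'[OF M]]) simp
  then show "regular_part (t *R v) * p v = (\<Sum>m. reg_term m (t *R v) * p v)"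
   unfolding regular_part_def by (rule suminf_mult2)
 qed
 also have "... = (\<Sum>m. SPH v. reg_term m (t *R v) * p v)"
  by (rule integral_series(2)[OF int w M]) (use B bt in \<open>auto simp: norm_mult intro!: mult_right_mono\<close>)
 also have "... = (\<Sum>m. if m = l then mode_coeff l * cx (radJ k \<nu> l t) * p w0 else 0)"
 proof (rule arg_cong[where f = suminf], rule ext)
  fix m
  have "(SPH v. reg_term m (t *R v) * p v) =
    (SPH v. (mode_coeff m * cx (radJ k \<nu> m t)) * (harmonic_kernel m w0 v * p v))"
  proof (rule lint_cong[OF refl])
   fix v :: 'a assume "v \<in> space sphere_measure"
   then have w: "norm v = 1" by simp
   have "sq (t *R v) = t^2" using w by (simp add: dot_square_norm power2_eq_square)
   then show "reg_term m (t *R v) * p v = (mode_coeff m * cx (radJ k \<nu> m t)) * (harmonic_kernel m w0 v * p v)"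
    unfolding reg_term_def mode_def solid_harmonicD(2)[OF solid_harmonic_kernel[OF w0(1)]] by (simp add: famJ_def)
  qed
  also have "... = (mode_coeff m * cx (radJ k \<nu> m t)) * (SPH v. harmonic_kernel m w0 v * p v)"
   by (rule integral_mult_right_zero)
  also have "... = (if m = l then mode_coeff l * cx (radJ k \<nu> l t) * p w0 else 0)"
   using harmonic_kernel_reproducing[OF dim p, of w0] solid_harmonic_orthogonal[OF dim solid_harmonic_kernel[OF w0(1)] p, of m] by auto
  finally show "(SPH v. reg_term m (t *R v) * p v) = (if m = l then mode_coeff l * cx (radJ k \<nu> l t) * p w0 else 0)" .
 qed
 also have "... = mode_coeff l * cx (radJ k \<nu> l t) * p w0"
  by (rule sums_unique[OF sums_If_finite_set[of "{l}" "\<lambda>_. _", simplified], symmetric])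
 finally show ?thesis .
qed

end

section \<open>The singular part and its projections\<close>

lemma famJ_weak:
 fixes \<phi> :: "'a::euclidean_space => complex"
 assumes \<phi>: "test_function S \<phi>"
 defines "\<nu> \<equiv> real DIM('a) / 2 - 1"
 shows "integrable lborel (\<lambda>x. cx (famJ k \<nu> 0 (sq (x - a))) * helmholtz k \<phi> x)"
  and "(LBINT x. cx (famJ k \<nu> 0 (sq (x - a))) * helmholtz k \<phi> x) = 0"
proof -
 define u where "u = (\<lambda>x::'a. cx (famJ k \<nu> 0 (sq (x - a))))"
 have u: "C_k n u" for n using C_k_translate[OF C_k_famJ[of n k \<nu> 0], of "- a"] by (simp add: u_def)
 have lap: "helmholtz k u x = 0" for x
 proof -
  define s where "s = sq (x + - a)"
  have "laplacian u x = laplacian (\<lambda>y. cx (famJ k \<nu> 0 (sq y))) (x + - a)"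
   unfolding laplacian_translate[symmetric] by (simp add: u_def)
  also have "... = cx (4 * s * famJ k \<nu> 2 s + 2 * real DIM('a) * famJ k \<nu> 1 s)"
   unfolding s_def by (rule laplacian_radial[where F = "famJ k \<nu>" and S = UNIV]) (auto intro: famJ_deriv)
  finally have "helmholtz k u x = cx (4 * s * famJ k \<nu> 2 s + 2 * real DIM('a) * famJ k \<nu> 1 s + k^2 * famJ k \<nu> 0 s)"
   by (simp add: u_def s_def)
  also have "2 * real DIM('a) = 4 * (\<nu> + 1)" by (simp add: \<nu>_def)
  finally show ?thesis unfolding famJ_ode by simp
 qed
 show "integrable lborel (\<lambda>x. cx (famJ k \<nu> 0 (sq (x - a))) * helmholtz k \<phi> x)"
  using integral_helmholtz_swap(1)[OF u \<phi>] unfolding u_def .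
 have "(LBINT x. u x * helmholtz k \<phi> x) = 0"
  unfolding integral_helmholtz_swap(2)[OF u \<phi>] lap by simp
 then show "(LBINT x. cx (famJ k \<nu> 0 (sq (x - a))) * helmholtz k \<phi> x) = 0" unfolding u_def .
qed

lemma continuous_set_integrable_ball:
 fixes f :: "'a::euclidean_space => complex"
 assumes "continuous_on (cball 0 R) f"
 shows "set_integrable lborel (ball 0 R) f"
 by (rule set_integrable_subset[OF borel_integrable_compact[OF compact_cball assms, folded set_integrable_def]]) auto

text \<open>One statement for both kinds, applied with g = \<open>redJ\<close> and g =
  \<open>redY\<close>: only the derivative rule that raises the order enters. Differentiating r^l
  supplies the l / R of the Robin trace.\<close>

lemma famJ_deriv_radial_robin:
 fixes g :: "real => real => real"
 assumes "R > 0" "(g \<mu> has_real_derivative - 1 / 2 * g (\<mu> + 1) (k^2 * R^2)) (at (k^2 * R^2))"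
 obtains D where "((\<lambda>t. t ^ l * g \<mu> (k^2 * t^2)) has_real_derivative D) (at R)"
  "D + \<alpha> * (R ^ l * g \<mu> (k^2 * R^2)) = R ^ l * ((\<alpha> + real l / R) * g \<mu> (k^2 * R^2) - k^2 * R * g (\<mu> + 1) (k^2 * R^2))"
proof -
 have "((\<lambda>t. k\<^sup>2 * t^2) has_real_derivative k\<^sup>2 * (2 * R)) (at R)" by (auto intro!: derivative_eq_intros)
 from DERIV_mult[OF DERIV_pow[of l R] DERIV_chain2[OF assms(2) this]]
 have "((\<lambda>t. t ^ l * g \<mu> (k^2 * t^2)) has_real_derivative real l * R ^ (l - 1) * g \<mu> (k^2 * R^2) + - 1 / 2 * g (\<mu> + 1) (k^2 * R^2) * (k^2 * (2 * R)) * R ^ l) (at R)"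
  by simp
 moreover have E: "real l * R ^ (l - 1) = R ^ l * (real l / R)" using assms(1) by (cases l) simp_all
 have "real l * R ^ (l - 1) * g \<mu> (k^2 * R^2) + - 1 / 2 * g (\<mu> + 1) (k^2 * R^2) * (k^2 * (2 * R)) * R ^ l + \<alpha> * (R ^ l * g \<mu> (k^2 * R^2)) =
   R ^ l * ((\<alpha> + real l / R) * g \<mu> (k^2 * R^2) - k^2 * R * g (\<mu> + 1) (k^2 * R^2))"
  unfolding E by (simp add: algebra_simps)
 ultimately show thesis by (rule that)
qed

lemma continuous_on_famJ_dist: "continuous_on A (\<lambda>x::'a::euclidean_space. famJ k \<mu> m (sq (x - a)))"
proof -
 have "continuous_on UNIV (famJ k \<mu> m)"
  by (auto intro!: continuous_at_imp_continuous_on DERIV_isCont[OF famJ_deriv])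
 then show ?thesis by (rule continuous_on_compose2) (auto intro!: continuous_intros)
qed

lemma continuous_on_famY_dist:
 "\<mu> > 0 ==> k > 0 ==> a \<notin> A ==> continuous_on A (\<lambda>x::'a::euclidean_space. famY k \<mu> m (sq (x - a)))"
 by (rule continuous_on_compose2[OF continuous_on_famY]) (auto intro!: continuous_intros)

context robin_setup
begin

text \<open>The distance in (k / (2 pi \<rho>))^\<nu> cancels against the (k \<rho>)^\<nu> split off
  from the Hankel function, leaving this constant.\<close>

definition sing_const :: complex where
 "sing_const = \<i> / 4 * cx ((k^2 / (2 * pi)) powr \<nu>)"

definition singular_part :: "'a => complex" where
 "singular_part x = sing_const * (cx (famJ k \<nu> 0 (sq (x - x0))) + \<i> * cx (famY k \<nu> 0 (sq (x - x0))))"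

definition sing_deriv :: "'a => 'a => complex" where
 "sing_deriv x h = sing_const * (cx (2 * ((x - x0) \<bullet> h)) *
   (cx (famJ k \<nu> 1 (sq (x - x0))) + \<i> * cx (famY k \<nu> 1 (sq (x - x0)))))"

lemma singular_part_eq:
 assumes "x \<noteq> x0"
 shows "singular_part x = \<i> / 4 * cx ((k / (2 * pi * norm (x - x0))) powr \<nu>) * hankel_H1 \<nu> (k * norm (x - x0))"
proof -
 define \<rho> where "\<rho> = norm (x - x0)"
 have \<rho>: "\<rho> > 0" using assms by (simp add: \<rho>_def)
 have q: "sq (x - x0) = \<rho>^2" by (simp add: \<rho>_def dot_square_norm)
 have "(k / (2 * pi * \<rho>)) powr \<nu> * (k * \<rho>) powr \<nu> = ((k / (2 * pi * \<rho>)) * (k * \<rho>)) powr \<nu>"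
  using k \<rho> by (simp only: powr_mult)
 also have "(k / (2 * pi * \<rho>)) * (k * \<rho>) = k^2 / (2 * pi)" using \<rho> by (simp add: power2_eq_square)
 finally have e: "(k^2 / (2 * pi)) powr \<nu> = (k / (2 * pi * \<rho>)) powr \<nu> * (k * \<rho>) powr \<nu>" ..
 have z: "k * \<rho> > 0" using k \<rho> by simp
 show ?thesis
  unfolding singular_part_def sing_const_def q \<rho>_def[symmetric] e hankel_H1_def bessel_J_redJ[OF z] bessel_Y_redY[OF z]
  by (simp add: famJ_def famY_def power_mult_distrib algebra_simps)
qed

lemma singular_part_deriv:
 assumes "x \<noteq> x0"
 shows "(singular_part has_derivative sing_deriv x) (at x)"
proof -
 have q: "sq (x - x0) > 0" using assms by simp
 have D: "((\<lambda>y. cx (f (sq (y - x0)))) has_derivative (\<lambda>h. cx (2 * ((x - x0) \<bullet> h)) * cx f')) (at x)"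
  if "(f has_real_derivative f') (at (sq (x - x0)))" for f f'
 proof -
  have "((\<lambda>y. cx (f (sq y))) has_derivative (\<lambda>h. cx (2 * ((x - x0) \<bullet> h)) * cx f')) (at (x + - x0))"
   using has_derivative_radial[OF has_vector_derivative_of_real, of f f' "x - x0"] that by simp
  then show ?thesis unfolding has_derivative_translate[symmetric] by simp
 qed
 have "((\<lambda>x. sing_const * (cx (famJ k \<nu> 0 (sq (x - x0))) + \<i> * cx (famY k \<nu> 0 (sq (x - x0)))))
   has_derivative (\<lambda>h. sing_const * (cx (2 * ((x - x0) \<bullet> h)) * cx (famJ k \<nu> (Suc 0) (sq (x - x0)))
    + \<i> * (cx (2 * ((x - x0) \<bullet> h)) * cx (famY k \<nu> (Suc 0) (sq (x - x0))))))) (at x)"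
  by (intro has_derivative_mult_right has_derivative_add D famJ_deriv famY_deriv \<nu> k q)
 then show ?thesis
  unfolding singular_part_def[abs_def] sing_deriv_def[abs_def] by (simp add: algebra_simps)
qed

lemma sing_deriv_continuous: "continuous_on (- {x0}) (\<lambda>x. sing_deriv x h)" unfolding sing_deriv_def
 by (intro continuous_intros continuous_on_famJ_dist continuous_on_famY_dist \<nu> k) auto

lemma singular_part_integrable: "set_integrable lborel (ball 0 R) singular_part"
proof -
 have "continuous_on (cball 0 R) (\<lambda>x. cx (famJ k \<nu> 0 (sq (x - x0))))"
  by (intro continuous_intros continuous_on_famJ_dist)
 then show ?thesis unfolding singular_part_def[abs_def]
  by (intro set_integrable_mult_right set_integral_add continuous_set_integrable_ball
    famY_locally_integrable[OF dim k, of _ x0, folded \<nu>_def]) auto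
qed

text \<open>Origin of the prefactor of the series: the constant of the fundamental solution times
  the (2 pi)^(d/2) of the addition theorem.\<close>

lemma sing_const_value: "sing_const * cx ((2 * pi) powr (real DIM('a) / 2)) = \<i> * cx (pi * k ^ (DIM('a) - 2) / 2)"
proof -
 have "real (DIM('a) - 2) = 2 * \<nu>" using dim by (simp add: \<nu>_def of_nat_diff)
 then have kp: "k ^ (DIM('a) - 2) = k powr (2 * \<nu>)" using powr_realpow[OF k, of "DIM('a) - 2"] by simp
 have "(2 * pi) powr (real DIM('a) / 2) = (2 * pi) powr \<nu> * (2 * pi)"
  using powr_add[of "2 * pi" \<nu> 1] by (simp add: \<nu>_def)
 moreover have "(k^2 / (2 * pi)) powr \<nu> * (2 * pi) powr \<nu> = k powr (2 * \<nu>)"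
  using k powr_powr[of k 2 \<nu>] by (simp add: powr_divide powr_numeral)
 ultimately have "(k^2 / (2 * pi)) powr \<nu> * (2 * pi) powr (real DIM('a) / 2) = k ^ (DIM('a) - 2) * (2 * pi)"
  unfolding kp by (simp only: mult.assoc[symmetric])
 then have "cx ((k^2 / (2 * pi)) powr \<nu>) * cx ((2 * pi) powr (real DIM('a) / 2)) = cx (k ^ (DIM('a) - 2) * (2 * pi))"
  by (simp only: of_real_mult[symmetric])
 then show ?thesis unfolding sing_const_def mult.assoc by simp
qed

text \<open>The J part is an entire solution and contributes nothing; the Y part contributes i times
  the source strength, and this i times the one in \<open>sing_const\<close> produces the sign. The
  real constants multiply to 1.\<close>

lemma singular_part_weak:
 assumes \<phi>: "test_function S \<phi>"
 shows "integrable lborel (\<lambda>x. singular_part x * helmholtz k \<phi> x)"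
  and "(LBINT x. singular_part x * helmholtz k \<phi> x) = - \<phi> x0"
proof -
 define \<psi> where "\<psi> = (\<lambda>x. helmholtz k \<phi> x)"
 define FJ where "FJ = (\<lambda>x. cx (famJ k \<nu> 0 (sq (x - x0))))"
 define FY where "FY = (\<lambda>x. cx (famY k \<nu> 0 (sq (x - x0))))"
 note J = famJ_weak[OF \<phi>, where k = k and a = x0, folded \<nu>_def, folded FJ_def \<psi>_def]
 note Y = famY_fundamental[OF dim k \<phi>, where a = x0, folded \<nu>_def, folded FY_def \<psi>_def]
 have "singular_part x = sing_const * (FJ x + \<i> * FY x)" for x
  by (simp add: singular_part_def FJ_def FY_def)
 then have eq: "singular_part x * \<psi> x = sing_const * (FJ x * \<psi> x) + sing_const * \<i> * (FY x * \<psi> x)" for x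
  by (simp add: algebra_simps)
 have Ji: "integrable lborel (\<lambda>x. FJ x * \<psi> x)" and J0: "(LBINT x. FJ x * \<psi> x) = 0"
  using J unfolding FJ_def \<psi>_def by auto
 have Yi: "integrable lborel (\<lambda>x. FY x * \<psi> x)"
  and Y0: "(LBINT x. FY x * \<psi> x) = cx (source_const k DIM('a) \<nu>) * \<phi> x0"
  using Y unfolding FY_def \<psi>_def by auto
 have "integrable lborel (\<lambda>x. singular_part x * \<psi> x)"
  unfolding eq using Ji Yi by (intro Bochner_Integration.integrable_add integrable_mult_right)
 then show "integrable lborel (\<lambda>x. singular_part x * helmholtz k \<phi> x)" unfolding \<psi>_def .
 have "(LBINT x. singular_part x * \<psi> x) = sing_const * (LBINT x. FJ x * \<psi> x) + sing_const * \<i> * (LBINT x. FY x * \<psi> x)"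
  unfolding eq using Ji Yi by (subst lint_add) auto
 also have "... = - (cx ((k^2 / (2 * pi)) powr \<nu> * (source_const k DIM('a) \<nu>) / 4)) * \<phi> x0"
  unfolding J0 Y0 sing_const_def by (simp add: mult_ac)
 also have "(k^2 / (2 * pi)) powr \<nu> * (source_const k DIM('a) \<nu>) / 4 = 1"
 proof -
  have "(k^2 / (2 * pi)) powr \<nu> = k powr (2 * \<nu>) / (2 powr \<nu> * pi powr \<nu>)"
   using k powr_powr[of k 2 \<nu>] by (simp add: powr_divide powr_mult powr_numeral)
  moreover have "k powr (2 * \<nu>) * k powr (2 - real DIM('a)) = 1"
   using k by (simp add: \<nu>_def flip: powr_add)
  moreover have "2 powr (\<nu> + 2) = 2 powr \<nu> * 4" by (simp add: powr_add powr_numeral)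
  moreover have "a * (y * b * d) / 4 = 1" if "a = K / (c * d)" "K * y = 1" "b = c * 4" "c > 0" "d > 0" for a b c d y K :: real
  proof -
   have "a * (y * b * d) / 4 = K * y" using that(1,3,4,5) by simp
   then show ?thesis using that(2) by simp
  qed
  ultimately show ?thesis by simp
 qed
 finally show "(LBINT x. singular_part x * helmholtz k \<phi> x) = - \<phi> x0" unfolding \<psi>_def by simp
qed

text \<open>For unit vectors the points t v and |x0| w0 are as far apart as |x0| v and t w0. The
  expansion about the centre is therefore applied with the source moved out to t w0 and the sphere
  shrunk to radius |x0|; this yields J at |x0| and both kinds at t.\<close>

lemma singular_part_projection:
 assumes p: "solid_harmonic l p" and t: "norm x0 < t"
 shows "(SPH v. singular_part (t *R v) * p v) = (source_coeff l)
   * (cx (radJ k \<nu> l t) + \<i> * cx (radY k \<nu> l t)) * p w0"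
proof -
 have t0: "t > 0" by (rule order.strict_trans1[OF norm_ge_zero t])
 define r0 where "r0 = norm x0"
 define x where "x = t *R w0"
 have nx: "norm x = t" using t0 w0 by (simp add: x_def)
 have xx: "sq x = t^2" using nx by (simp add: dot_square_norm)
 have px: "p x = cx (t ^ l) * p w0" unfolding x_def by (rule solid_harmonicD(2)[OF p])
 have swap: "sq (t *R v - x0) = sq (r0 *R v - x)" if w: "norm v = 1" for v
 proof -
  have "v \<bullet> v = 1" "w0 \<bullet> w0 = 1" using w w0 by (simp_all add: dot_square_norm)
  moreover have "x0 = r0 *R w0" using w0 by (simp add: r0_def)
  ultimately show ?thesis by (simp add: x_def inner_diff_left inner_diff_right inner_commute algebra_simps)
 qed
 have ode: "2 * real DIM('a) = 4 * (\<nu> + 1)" by (simp add: \<nu>_def)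
 have exJ: "(SPH v. cx (famJ k \<nu> 0 (sq (r0 *R v - x))) * p v) =
  cx ((2 * pi) powr (real DIM('a) / 2) * (- 2) ^ l * famJ k \<nu> l (sq x) * r0 ^ l * redJ (real DIM('a) / 2 - 1 + real l) (k^2 * r0^2)) * p x"
  by (rule radial_expansion[where F = "famJ k \<nu>", OF dim k famJ_deriv _ p]) (use t nx famJ_ode[of _ k \<nu>] in \<open>auto simp: r0_def ode\<close>)
 have exY: "(SPH v. cx (famY k \<nu> 0 (sq (r0 *R v - x))) * p v) =
  cx ((2 * pi) powr (real DIM('a) / 2) * (- 2) ^ l * famY k \<nu> l (sq x) * r0 ^ l * redJ (real DIM('a) / 2 - 1 + real l) (k^2 * r0^2)) * p x"
  by (rule radial_expansion[where F = "famY k \<nu>", OF dim k famY_deriv[OF \<nu> k] _ p]) (use t nx famY_ode[OF \<nu> k] in \<open>auto simp: r0_def ode\<close>)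
 \<comment> \<open>The (- 2)^l of the expansion and the (- k^2 / 2)^l in the l-th derivative of the
   profile combine to k^(2 l).\<close>
 have pw: "(- 2) ^ l * (- k\<^sup>2 / 2) ^ l = (k^2) ^ l" by (simp flip: power_mult_distrib)
 have eJ: "(- 2) ^ l * famJ k \<nu> l (sq x) = (k^2) ^ l * redJ (\<nu> + real l) (k^2 * t^2)"
  unfolding famJ_def xx mult.assoc[symmetric] pw ..
 have eY: "(- 2) ^ l * famY k \<nu> l (sq x) = (k^2) ^ l * redY (\<nu> + real l) (k^2 * t^2)"
  unfolding famY_def xx mult.assoc[symmetric] pw ..
 have off: "r0 *R v \<noteq> x" if "norm v = 1" for v using that t nx by (auto simp: r0_def)
 have cJ: "continuous_on (sphere 0 1) (\<lambda>v. cx (famJ k \<nu> 0 (sq (r0 *R v - x))))"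
 proof -
  have "continuous_on UNIV (famJ k \<nu> 0)"
   by (auto intro!: continuous_at_imp_continuous_on DERIV_isCont[OF famJ_deriv])
  then show ?thesis by (intro continuous_on_of_real) (erule continuous_on_compose2, auto intro!: continuous_intros)
 qed
 have cY: "continuous_on (sphere 0 1) (\<lambda>v. cx (famY k \<nu> 0 (sq (r0 *R v - x))))"
  by (intro continuous_intros continuous_on_compose2[OF continuous_on_famY[OF \<nu> k]]) (use off in auto)
 have int: "integrable sphere_measure (\<lambda>v. c * (f v * p v))" if "continuous_on (sphere 0 1) f" for f :: "'a => complex" and c
  by (intro integrable_mult_right continuous_sphere_integrable continuous_intros that solid_harmonicD(4)[OF p])
 have "(SPH v. singular_part (t *R v) * p v) =
   (SPH v. sing_const * (cx (famJ k \<nu> 0 (sq (r0 *R v - x))) * p v)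
    + sing_const * \<i> * (cx (famY k \<nu> 0 (sq (r0 *R v - x))) * p v))"
  by (rule lint_cong[OF refl]) (simp add: singular_part_def swap distrib_left distrib_right mult.assoc)
 also have "... = sing_const * (SPH v. cx (famJ k \<nu> 0 (sq (r0 *R v - x))) * p v)
    + sing_const * \<i> * (SPH v. cx (famY k \<nu> 0 (sq (r0 *R v - x))) * p v)"
  by (subst lint_add[OF int[OF cJ] int[OF cY]]) simp
 also have "... = (sing_const * cx ((2 * pi) powr (real DIM('a) / 2))) * cx ((k^2 * r0) ^ l * redJ (\<nu> + real l) (k^2 * r0^2))
   * (cx (radJ k \<nu> l t) + \<i> * cx (radY k \<nu> l t)) * p w0"
  unfolding exJ exY px \<nu>_def[symmetric] mult.assoc[of "(2 * pi) powr (real DIM('a) / 2)" "(- 2) ^ l"] eJ eY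
  by (simp add: power_mult_distrib algebra_simps)
 finally show ?thesis unfolding sing_const_value r0_def source_coeff_def .
qed

end

lemma integrable_on_compact_support:
 fixes f :: "'a::euclidean_space => complex"
 assumes "compact K" "continuous_on K f" "\<And>x. x \<notin> K ==> f x = 0"
 shows "integrable lborel f"
proof -
 have "(\<lambda>x. indicator K x *R f x) = f" using assms(3) by (auto simp: indicator_def)
 then show ?thesis using borel_integrable_compact[OF assms(1,2)] by simp
qed

context robin_setup
begin

section \<open>Assembly of the Green function and its boundary condition\<close>

definition green :: "'a => complex" where
 "green x = singular_part x - regular_part x"

definition green_deriv :: "'a => 'a => complex" where
 "green_deriv x h = sing_deriv x h - reg_deriv x h"

lemma green_smooth:
 obtains R' where "R' > R"
  "\<And>x. x \<in> ball 0 R' - {x0} ==> (green has_derivative green_deriv x) (at x)"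
  "\<And>h. continuous_on (ball 0 R' - {x0}) (\<lambda>x. green_deriv x h)"
  "\<And>l p t. solid_harmonic l p ==> norm x0 < t ==> t < R' ==> (SPH w. green (t *R w) * p w) =
   (source_coeff l * (cx (radJ k \<nu> l t) + \<i> * cx (radY k \<nu> l t))
    - mode_coeff l * cx (radJ k \<nu> l t)) * p w0"
proof -
 obtain R1 where R1: "R1 > R" "\<And>x. x \<in> ball 0 R1 ==> (regular_part has_derivative reg_deriv x) (at x)"
  "\<And>h. continuous_on (ball 0 R1) (\<lambda>x. reg_deriv x h)" using regular_part_smooth by blast
 obtain R2 B \<theta> where b: "R2 > R" "B \<ge> 0" "0 \<le> \<theta>" "\<theta> < 1"
  "\<And>l x. norm x \<le> R2 ==> norm (reg_term l x) \<le> B * \<theta> ^ l" using reg_term_bounds by metis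
 show thesis
 proof (rule that[of "min R1 R2"])
  show "min R1 R2 > R" using R1 b by simp
  show "(green has_derivative green_deriv x) (at x)" if "x \<in> ball 0 (min R1 R2) - {x0}" for x
   unfolding green_def[abs_def] green_deriv_def[abs_def]
   using that by (intro has_derivative_diff singular_part_deriv R1) auto
  show "continuous_on (ball 0 (min R1 R2) - {x0}) (\<lambda>x. green_deriv x h)" for h
   unfolding green_deriv_def
   by (intro continuous_intros continuous_on_subset[OF sing_deriv_continuous] continuous_on_subset[OF R1(3)]) auto
  show "(SPH w. green (t *R w) * p w) = (source_coeff l
    * (cx (radJ k \<nu> l t) + \<i> * cx (radY k \<nu> l t)) - mode_coeff l * cx (radJ k \<nu> l t)) * p w0"
   if p: "solid_harmonic l p" and t: "norm x0 < t" "t < min R1 R2" for l p t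
  proof -
   have t0: "t > 0" by (rule order.strict_trans1[OF norm_ge_zero t(1)])
   have tw: "t *R w \<in> ball 0 R1 - {x0}" if "w \<in> sphere 0 1" for w using that t t0 by auto
   have ray: "continuous_on (sphere 0 1) (\<lambda>w::'a. t *R w)" by (intro continuous_intros)
   have c1: "continuous_on (ball 0 R1 - {x0}) singular_part"
    by (auto intro!: continuous_at_imp_continuous_on has_derivative_continuous[OF singular_part_deriv])
   have c2: "continuous_on (ball 0 R1) regular_part"
    by (auto intro!: continuous_at_imp_continuous_on has_derivative_continuous[OF R1(2)])
   have c1': "continuous_on (sphere 0 1) (\<lambda>w. singular_part (t *R w))"
    by (rule continuous_on_compose2[OF c1 ray]) (use tw in blast)
   have c2': "continuous_on (sphere 0 1) (\<lambda>w. regular_part (t *R w))"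
    by (rule continuous_on_compose2[OF c2 ray]) (use tw in blast)
   have int: "integrable sphere_measure (\<lambda>w. f w * p w)" if "continuous_on (sphere 0 1) f" for f :: "'a => complex"
    by (intro continuous_sphere_integrable continuous_intros that solid_harmonicD(4)[OF p])
   have "(SPH w. green (t *R w) * p w) =
     (SPH w. singular_part (t *R w) * p w) - (SPH w. regular_part (t *R w) * p w)"
    unfolding green_def left_diff_distrib by (rule lint_diff[OF int[OF c1'] int[OF c2']])
   also have "(SPH w. regular_part (t *R w) * p w) = mode_coeff l * cx (radJ k \<nu> l t) * p w0"
    by (rule regular_part_projection[OF p _ _ b(1) b(5) b(2-4)]) (use t t0 in auto)
   finally show ?thesis unfolding singular_part_projection[OF p t(1)] left_diff_distrib .
  qed
 qed
qed

lemma robin_red_nonzero: "robin_red R \<alpha> k \<nu> l redJ \<noteq> 0"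
 using nonres[of l] R k by (auto simp: robin_trace_J_red \<nu>_def)

text \<open>Clearing the denominator in the quotient of the Robin traces; this is the cancellation
  of the boundary expression in degree l.\<close>

lemma mode_coeff_eq:
 "mode_coeff l * cx (robin_red R \<alpha> k \<nu> l redJ) = (source_coeff l)
   * (cx (robin_red R \<alpha> k \<nu> l redJ) + \<i> * cx (robin_red R \<alpha> k \<nu> l redY))"
proof -
 have e: "trace_ratio R \<alpha> k \<nu> l * cx (robin_red R \<alpha> k \<nu> l redJ) =
   cx (robin_red R \<alpha> k \<nu> l redJ) + \<i> * cx (robin_red R \<alpha> k \<nu> l redY)"
  using R k robin_red_nonzero[of l] by (simp add: robin_trace_H_red robin_trace_J_red)
 show ?thesis unfolding mode_coeff_def source_coeff_def e[symmetric] by (simp only: mult_ac)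
qed

text \<open>The radial derivative of each projection is computed twice, under the integral sign and
  from its closed form near R. Their agreement turns the projected boundary expression into the
  combination of Robin traces that \<open>mode_coeff_eq\<close> annihilates.\<close>

lemma green_boundary:
 assumes w: "norm v = 1"
 shows "green_deriv (R *R v) v + cx \<alpha> * green (R *R v) = 0"
proof -
 obtain R' where R': "R' > R"
  "\<And>x. x \<in> ball 0 R' - {x0} ==> (green has_derivative green_deriv x) (at x)"
  "\<And>h. continuous_on (ball 0 R' - {x0}) (\<lambda>x. green_deriv x h)"
  and proj: "\<And>l p t. solid_harmonic l p ==> norm x0 < t ==> t < R' ==> (SPH v. green (t *R v) * p v) =
   (source_coeff l * (cx (radJ k \<nu> l t) + \<i> * cx (radY k \<nu> l t))
    - mode_coeff l * cx (radJ k \<nu> l t)) * p w0" by (rule green_smooth) (rule that; assumption)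
 \<comment> \<open>An open interval around R that stays outside |x0|; the room beyond R makes R an
   interior point.\<close>
 define I where "I = {norm x0<..<R'}"
 have I: "is_interval I" "open I" "R \<in> I" using R'(1) x0 by (auto simp: I_def is_interval_oo)
 have tw: "t *R v \<in> ball 0 R' - {x0}" if "t \<in> I" "v \<in> sphere 0 1" for t v
 proof -
  have "t > 0" using that(1) order.strict_trans1[OF norm_ge_zero[of x0]] by (auto simp: I_def)
  then have "norm (t *R v) = t" using that(2) by simp
  then show ?thesis using that(1) by (auto simp: I_def)
 qed
 define E where "E = (\<lambda>t v. green_deriv (t *R v) v)"
 have gc: "continuous_on (ball 0 R' - {x0}) green"
  by (auto intro!: continuous_at_imp_continuous_on has_derivative_continuous[OF R'(2)])
 have greenc: "continuous_on (sphere 0 1) (\<lambda>v. green (t *R v))" if "t \<in> I" for t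
  by (intro continuous_on_compose2[OF gc] continuous_intros) (use tw[OF that] in blast)
 have Ec: "continuous_on (I \<times> sphere 0 1) (\<lambda>q. E (fst q) (snd q))"
 proof -
  \<comment> \<open>Continuity of \<open>green_deriv\<close> is known for each fixed direction, so
    the varying direction is expanded in the basis.\<close>
  have "E (fst q) (snd q) = (\<Sum>b\<in>Basis. (snd q \<bullet> b) *R green_deriv (fst q *R snd q) b)" if "q \<in> I \<times> sphere 0 1" for q
  proof -
   have "fst q *R snd q \<in> ball 0 R' - {x0}" by (rule tw) (use that in auto)
   note lin = has_derivative_linear[OF R'(2)[OF this]]
   show ?thesis unfolding E_def by (subst euclidean_representation[of "snd q", symmetric])
      (simp add: linear_sum[OF lin] linear_scale[OF lin])
  qed
  moreover have "continuous_on (I \<times> sphere 0 1) (\<lambda>q. \<Sum>b\<in>Basis. (snd q \<bullet> b) *R green_deriv (fst q *R snd q) b)"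
  proof -
   have "(\<lambda>q. fst q *R snd q) ` (I \<times> sphere 0 1) \<subseteq> ball 0 R' - {x0}"
    by (rule image_subsetI, rule tw) auto
   then show ?thesis by (intro continuous_intros continuous_on_compose2[OF R'(3)])
  qed
  ultimately show ?thesis by (simp cong: continuous_on_cong)
 qed
 have E1: "continuous_on (sphere 0 1) (E R)"
 proof -
  have "continuous_on (sphere 0 1) (\<lambda>v::'a. (R, v))" by (intro continuous_intros)
  from continuous_on_compose2[OF Ec this] show ?thesis using I(3) by auto
 qed
 define \<beta> where "\<beta> = (\<lambda>v. E R v + cx \<alpha> * green (R *R v))"
 have "\<beta> v = 0"
 proof (rule spherical_harmonics_complete[OF _ _ w])
  show "continuous_on (sphere 0 1) \<beta>" unfolding \<beta>_def by (intro continuous_intros E1 greenc I)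
  show "(SPH v. \<beta> v * p v) = 0" if p: "solid_harmonic l p" for l p
  proof -
   have pc: "continuous_on A p" for A by (rule solid_harmonicD(4)[OF p])
   define g where "g = (\<lambda>t. SPH v. green (t *R v) * p v)"
   define \<kappa> where "\<kappa> = source_coeff l"
   define J where "J = (\<lambda>t. t ^ l * redJ (\<nu> + real l) (k^2 * t^2))"
   define Y where "Y = (\<lambda>t. t ^ l * redY (\<nu> + real l) (k^2 * t^2))"
   define F where "F = (\<lambda>t. (\<kappa> * (cx (J t) + \<i> * cx (Y t)) - mode_coeff l * cx (J t)) * p w0)"
   have gF: "g t = F t" if "t \<in> I" for t
    using proj[OF p, of t] that by (simp add: g_def F_def J_def Y_def \<kappa>_def I_def)
   have g1: "(g has_vector_derivative (SPH v. E R v * p v)) (at R)"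
   proof -
    have "((\<lambda>t. SPH v. green (t *R v) * p v) has_vector_derivative (SPH v. E R v * p v)) (at R within I)"
    proof (rule sphere_integral_has_vector_derivative[where h = "\<lambda>t v. green (t *R v) * p v" and h' = "\<lambda>t v. E t v * p v", OF I(1,3)])
     show "continuous_on (sphere 0 1) (\<lambda>v. green (t *R v) * p v)" if "t \<in> I" for t
      by (intro continuous_intros greenc that pc)
     show "((\<lambda>t. green (t *R v) * p v) has_vector_derivative E t v * p v) (at t within I)"
      if "t \<in> I" "v \<in> sphere 0 1" for t v unfolding E_def
      by (intro has_vector_derivative_mult_left radial_vector_derivative[where S = UNIV] R'(2) tw that) auto
     show "continuous_on (I \<times> sphere 0 1) (\<lambda>q. E (fst q) (snd q) * p (snd q))"
      by (intro continuous_intros Ec continuous_on_compose2[OF pc[of UNIV]]) auto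
    qed
    then show ?thesis unfolding g_def at_within_open[OF I(3,2)] .
   qed
   have kR: "k^2 * R^2 > 0" using k R by simp
   have dJ: "(redJ (\<nu> + real l) has_real_derivative - 1 / 2 * redJ (\<nu> + real l + 1) (k^2 * R^2)) (at (k^2 * R^2))"
    by (rule DERIV_cong, rule redJ_has_derivative, rule DERIV_ident) simp
   have dY: "(redY (\<nu> + real l) has_real_derivative - 1 / 2 * redY (\<nu> + real l + 1) (k^2 * R^2)) (at (k^2 * R^2))"
    using \<nu> by (intro redY_has_derivative kR) auto
   obtain DJ where DJ: "(J has_real_derivative DJ) (at R)" "DJ + \<alpha> * J R = R ^ l * robin_red R \<alpha> k \<nu> l redJ"
    unfolding J_def robin_red_def by (rule famJ_deriv_radial_robin[where g = redJ, OF R dJ, of l \<alpha>]) auto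
   obtain DY where DY: "(Y has_real_derivative DY) (at R)" "DY + \<alpha> * Y R = R ^ l * robin_red R \<alpha> k \<nu> l redY"
    unfolding Y_def robin_red_def by (rule famJ_deriv_radial_robin[where g = redY, OF R dY, of l \<alpha>]) auto
   have F1: "(F has_vector_derivative (\<kappa> * (cx DJ + \<i> * cx DY) - mode_coeff l * cx DJ) * p w0) (at R)"
    unfolding F_def
    by (intro has_vector_derivative_mult_left has_vector_derivative_diff has_vector_derivative_mult_right
      has_vector_derivative_add has_vector_derivative_of_real DJ DY)
   have "(g has_vector_derivative (\<kappa> * (cx DJ + \<i> * cx DY) - mode_coeff l * cx DJ) * p w0) (at R)"
    by (rule has_vector_derivative_transform_within_open[OF F1 I(2,3)]) (simp add: gF)
   then have d: "(SPH v. E R v * p v) = (\<kappa> * (cx DJ + \<i> * cx DY) - mode_coeff l * cx DJ) * p w0"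
    using vector_derivative_unique_at[OF g1] by blast
   have int: "integrable sphere_measure (\<lambda>v. f v * p v)" if "continuous_on (sphere 0 1) f" for f :: "'a => complex"
    by (intro continuous_sphere_integrable continuous_intros that pc)
   have "(SPH v. \<beta> v * p v) = (SPH v. E R v * p v + cx \<alpha> * (green (R *R v) * p v))"
    by (simp add: \<beta>_def algebra_simps)
   also have "... = (SPH v. E R v * p v) + cx \<alpha> * g R"
    unfolding g_def by (subst lint_add) (auto intro!: int E1 integrable_mult_right greenc I)
   also have "... = (\<kappa> * (cx (DJ + \<alpha> * J R) + \<i> * cx (DY + \<alpha> * Y R)) - mode_coeff l * cx (DJ + \<alpha> * J R)) * p w0"
    unfolding d gF[OF I(3)] F_def by (simp add: algebra_simps)
   also have "... = cx (R ^ l) * (\<kappa> * (cx (robin_red R \<alpha> k \<nu> l redJ) + \<i> * cx (robin_red R \<alpha> k \<nu> l redY))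
     - mode_coeff l * cx (robin_red R \<alpha> k \<nu> l redJ)) * p w0"
    unfolding DJ(2) DY(2) by (simp add: algebra_simps)
   also have "... = 0" unfolding mode_coeff_eq \<kappa>_def by simp
   finally show ?thesis .
  qed
 qed
 then show ?thesis by (simp add: \<beta>_def E_def)
qed

theorem green_is_green_function: "robin_green_function R \<alpha> k x0 green"
proof -
 obtain R' where R': "R' > R"
  "\<And>x. x \<in> ball 0 R' - {x0} ==> (green has_derivative green_deriv x) (at x)"
  "\<And>h. continuous_on (ball 0 R' - {x0}) (\<lambda>x. green_deriv x h)"
  by (rule green_smooth) (rule that; assumption)
 obtain R1 where R1: "R1 > R" "\<And>x. x \<in> ball 0 R1 ==> (regular_part has_derivative reg_deriv x) (at x)"
  using regular_part_smooth by blast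
 have rc: "continuous_on (cball 0 R) regular_part"
  using R1 by (auto intro!: continuous_at_imp_continuous_on has_derivative_continuous[OF R1(2)])
 have 1: "set_integrable lborel (ball 0 R) green" unfolding green_def[abs_def]
  by (intro set_integral_diff singular_part_integrable continuous_set_integrable_ball rc)
 have 2: "(LINT x:ball 0 R|lborel. green x * helmholtz k \<phi> x) = - \<phi> x0"
  if \<phi>: "test_function (ball 0 R) \<phi>" for \<phi>
 proof -
  obtain K where K: "compact K" "K \<subseteq> ball 0 R" "\<And>x. x \<notin> K ==> helmholtz k \<phi> x = 0"
    "continuous_on UNIV (\<lambda>x. helmholtz k \<phi> x)"
   using test_function_helmholtz[OF \<phi>, of "cx (k^2)"] by metis
  have i: "integrable lborel (\<lambda>x. regular_part x * helmholtz k \<phi> x)"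
  proof (rule integrable_on_compact_support[OF K(1)])
   show "continuous_on K (\<lambda>x. regular_part x * helmholtz k \<phi> x)"
    by (intro continuous_on_mult continuous_on_subset[OF rc] continuous_on_subset[OF K(4)])
      (use K(2) in auto)
   show "regular_part x * helmholtz k \<phi> x = 0" if "x \<notin> K" for x
    by (simp only: K(3)[OF that] mult_zero_right)
  qed
  have "(LINT x:ball 0 R|lborel. green x * helmholtz k \<phi> x) =
    (LBINT x. singular_part x * helmholtz k \<phi> x - regular_part x * helmholtz k \<phi> x)"
   unfolding set_integral_helmholtz[OF \<phi>, of green] by (simp only: green_def left_diff_distrib)
  also have "... = - \<phi> x0" by (subst lint_diff[OF singular_part_weak(1)[OF \<phi>] i])
     (simp only: singular_part_weak(2)[OF \<phi>] regular_part_weak[OF \<phi>], simp)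
  finally show ?thesis .
 qed
 \<comment> \<open>The definition of a Green function asks for a continuous map into bounded linear
   operators; in finite dimension this follows from continuity in each basis direction.\<close>
 define D where "D = (\<lambda>x. Blinfun (green_deriv x))"
 have in_ball: "x \<in> ball 0 R' - {x0}" if "x \<in> cball 0 R - {x0}" for x using that R'(1) by auto
 have D: "blinfun_apply (D x) = green_deriv x" if "x \<in> ball 0 R' - {x0}" for x
  unfolding D_def by (rule bounded_linear_Blinfun_apply[OF has_derivative_bounded_linear[OF R'(2)[OF that]]])
 have Dc: "continuous_on (cball 0 R - {x0}) D"
 proof (rule continuous_on_blinfun_componentwise)
  fix i :: 'a
  have "continuous_on (cball 0 R - {x0}) (\<lambda>x. green_deriv x i)"
   by (rule continuous_on_subset[OF R'(3)]) (use in_ball in auto)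
  then show "continuous_on (cball 0 R - {x0}) (\<lambda>x. blinfun_apply (D x) i)"
   by (rule continuous_on_eq) (simp add: D[OF in_ball])
 qed
 have Dd: "(green has_derivative blinfun_apply (D x)) (at x within cball 0 R)" if "x \<in> cball 0 R - {x0}" for x
  unfolding D[OF in_ball[OF that]] by (rule has_derivative_at_withinI[OF R'(2)[OF in_ball[OF that]]])
 have Db: "blinfun_apply (D x) (x /R R) + cx \<alpha> * green x = 0" if "x \<in> sphere 0 R" for x
 proof -
  have "x \<noteq> x0" using that x0 by auto
  then have "x \<in> cball 0 R - {x0}" using that by auto
  moreover have "norm (x /R R) = 1" using that R by simp
  moreover have "R *R (x /R R) = x" using R by simp
  ultimately show ?thesis using green_boundary[of "x /R R"] by (simp add: D[OF in_ball])
 qed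
 show ?thesis unfolding robin_green_function_def using 1 2 Dc Dd Db by blast
qed

end

section \<open>Uniqueness\<close>

lemma set_integrable_mult_bounded:
 fixes G \<psi> :: "'a::euclidean_space => complex"
 assumes G: "set_integrable lborel S G" and \<psi>: "continuous_on UNIV \<psi>" "\<And>x. norm (\<psi> x) \<le> B"
 shows "set_integrable lborel S (\<lambda>x. G x * \<psi> x)" unfolding set_integrable_def
proof (rule Bochner_Integration.integrable_bound[OF integrable_mult_right[OF G[unfolded set_integrable_def], of "cx B"]])
 have "(\<lambda>x. (indicator S x *R G x) * \<psi> x) \<in> borel_measurable lborel"
  using G \<psi>(1) unfolding set_integrable_def by (intro borel_measurable_times) (auto simp: borel_measurable_continuous_onI)
 then show "(\<lambda>x. indicator S x *R (G x * \<psi> x)) \<in> borel_measurable lborel" by simp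
 have "norm (indicator S x *R (G x * \<psi> x)) \<le> norm (cx B * (indicator S x *R G x))" for x
 proof -
  have "norm (indicator S x *R (G x * \<psi> x)) = norm (\<psi> x) * norm (indicator S x *R G x)" by (simp add: norm_mult)
  also have "... \<le> B * norm (indicator S x *R G x)" by (intro mult_right_mono \<psi>) simp
  also have "... \<le> norm (cx B * (indicator S x *R G x))"
   unfolding norm_mult norm_of_real by (intro mult_right_mono) auto
  finally show ?thesis .
 qed
 then show "AE x in lborel. norm (indicator S x *R (G x * \<psi> x)) \<le> norm (cx B * (indicator S x *R G x))"
  by simp
qed

text \<open>The sources cancel, so the difference solves the homogeneous equation weakly across x0
  although it is known to be differentiable only elsewhere; this is exactly the projection theorem
  with exceptional point x0. Its constant c is the same on both sides of |x0|, so the condition at R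
  also reaches the inner ball.\<close>

theorem robin_green_function_unique:
 fixes x0 x :: "'a::euclidean_space"
 assumes dim: "DIM('a) \<ge> 3" and R: "R > 0" and k: "k > 0"
  and nonres: "\<And>l. robin_trace_J R \<alpha> k (real DIM('a) / 2 - 1) l \<noteq> 0"
  and x0: "norm x0 < R" and G: "robin_green_function R \<alpha> k x0 G" "robin_green_function R \<alpha> k x0 H"
  and x: "x \<in> cball 0 R - {x0}"
 shows "G x = H x"
proof -
 obtain DG where DG: "set_integrable lborel (ball 0 R) G"
  "\<And>\<phi>. test_function (ball 0 R) \<phi> ==> (LINT x:ball 0 R|lborel. G x * helmholtz k \<phi> x) = - \<phi> x0"
  "continuous_on (cball 0 R - {x0}) DG"
  "\<And>x. x \<in> cball 0 R - {x0} ==> (G has_derivative blinfun_apply (DG x)) (at x within cball 0 R)"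
  "\<And>x. x \<in> sphere 0 R ==> blinfun_apply (DG x) (x /R R) + cx \<alpha> * G x = 0"
  using G(1) unfolding robin_green_function_def by blast
 obtain DH where DH: "set_integrable lborel (ball 0 R) H"
  "\<And>\<phi>. test_function (ball 0 R) \<phi> ==> (LINT x:ball 0 R|lborel. H x * helmholtz k \<phi> x) = - \<phi> x0"
  "continuous_on (cball 0 R - {x0}) DH"
  "\<And>x. x \<in> cball 0 R - {x0} ==> (H has_derivative blinfun_apply (DH x)) (at x within cball 0 R)"
  "\<And>x. x \<in> sphere 0 R ==> blinfun_apply (DH x) (x /R R) + cx \<alpha> * H x = 0"
  using G(2) unfolding robin_green_function_def by blast
 define u where "u = (\<lambda>x. G x - H x)"
 define D where "D = (\<lambda>x. DG x - DH x)"
 have Dc: "continuous_on (cball 0 R - {x0}) D" unfolding D_def by (intro continuous_intros DG DH)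
 have Du: "(u has_derivative blinfun_apply (D x)) (at x within cball 0 R)" if "x \<in> cball 0 R - {x0}" for x
  unfolding u_def D_def minus_blinfun.rep_eq using that by (intro has_derivative_diff DG DH)
 have uc: "continuous_on (cball 0 R - {x0}) u"
 proof (rule continuous_on_eq_continuous_within[THEN iffD2, rule_format])
  fix x assume "x \<in> cball 0 R - {x0}"
  from has_derivative_continuous[OF Du[OF this]] show "continuous (at x within cball 0 R - {x0}) u"
   by (rule continuous_within_subset) auto
 qed
 have bc: "blinfun_apply (D (R *R z)) z = - (cx \<alpha> * u (R *R z))" if "norm z = 1" for z
 proof -
  have s: "R *R z \<in> sphere 0 R" and r: "(R *R z) /R R = z" using that R by simp_all
  show ?thesis using DG(5)[OF s] DH(5)[OF s] unfolding r u_def D_def minus_blinfun.rep_eq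
   by (simp add: algebra_simps add_eq_0_iff)
 qed
 have weak: "(LINT x:ball 0 R|lborel. u x * helmholtz k \<phi> x) = 0"
  if \<phi>: "test_function (ball 0 R) \<phi>" for \<phi>
 proof -
  obtain B where B: "\<And>x. norm (helmholtz k \<phi> x) \<le> B"
   "continuous_on UNIV (\<lambda>x. helmholtz k \<phi> x)"
   using test_function_helmholtz[OF \<phi>, of "cx (k^2)"] by metis
  show ?thesis unfolding u_def left_diff_distrib
   by (subst set_integral_diff(2)[OF set_integrable_mult_bounded[OF DG(1) B(2,1)] set_integrable_mult_bounded[OF DH(1) B(2,1)]])
     (simp only: DG(2)[OF \<phi>] DH(2)[OF \<phi>] diff_self)
 qed
 define r0 where "r0 = norm x0"
 have r0: "0 \<le> r0" "r0 < R" using x0 by (simp_all add: r0_def)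
 have tw: "t *R z \<in> cball 0 R - {x0}" if "t \<in> {0<..R} - {r0}" "z \<in> sphere 0 1" for t z
 proof -
  have "norm (t *R z) = t" using that by simp
  then show ?thesis using that(1) by (auto simp: r0_def)
 qed
 have ray: "continuous_on (sphere 0 1) (\<lambda>z. u (t *R z))" if "t \<in> {0<..R} - {r0}" for t
  by (intro continuous_on_compose2[OF uc] continuous_intros) (use tw[OF that] in blast)
 define E where "E = (\<lambda>t z. blinfun_apply (D (t *R z)) z)"
 have Ec: "continuous_on (({0<..R} - {r0}) \<times> sphere 0 1) (\<lambda>q. E (fst q) (snd q))"
 proof -
  have "(\<lambda>q. fst q *R snd q) ` (({0<..R} - {r0}) \<times> sphere 0 1) \<subseteq> cball 0 R - {x0}"
   by (rule image_subsetI, rule tw) auto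
  then show ?thesis unfolding E_def by (intro continuous_intros continuous_on_compose2[OF Dc])
 qed
 have proj: "(SPH z. u (t *R z) * p z) = 0" if p: "solid_harmonic l p" and t: "t \<in> {0<..<R} - {r0}" for l p t
 proof -
  define \<mu> where "\<mu> = real DIM('a) / 2 - 1 + real l"
  have pc: "continuous_on A p" for A by (rule solid_harmonicD(4)[OF p])
  define g where "g = (\<lambda>t. SPH z. u (t *R z) * p z)"
  have "\<exists>c. \<forall>t\<in>{0<..<R} - {norm x0}. (SPH z. u (t *R z) * p z) =
    c * cx (t ^ l * redJ (real DIM('a) / 2 - 1 + real l) (k^2 * t^2))"
  proof (rule weak_helmholtz_projection[OF dim k R p, where E = E])
   show "continuous_on (ball 0 R - {x0}) u" by (rule continuous_on_subset[OF uc]) auto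
   show "((\<lambda>t. u (t *R z)) has_vector_derivative E t z) (at t)"
    if t: "t \<in> {0<..<R} - {norm x0}" and w: "z \<in> sphere 0 1" for t z
   proof -
    have x: "t *R z \<in> cball 0 R - {x0}" using t w by (intro tw) (auto simp: r0_def)
    have "t *R z \<in> interior (cball 0 R)" using t w by simp
    then have "(u has_derivative blinfun_apply (D (t *R z))) (at (t *R z))"
     using Du[OF x] by (simp only: at_within_interior)
    then show ?thesis unfolding E_def by (rule radial_vector_derivative) simp
   qed
   show "continuous_on (({0<..<R} - {norm x0}) \<times> sphere 0 1) (\<lambda>q. E (fst q) (snd q))"
    by (rule continuous_on_subset[OF Ec]) (auto simp: r0_def)
  qed (rule weak)
  then obtain c where "\<forall>t\<in>{0<..<R} - {norm x0}. (SPH z. u (t *R z) * p z) =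
    c * cx (t ^ l * redJ (real DIM('a) / 2 - 1 + real l) (k^2 * t^2))" by blast
  then have c: "g t = c * cx (t ^ l * redJ \<mu> (k^2 * t^2))" if "t \<in> {0<..<R} - {r0}" for t
   using that by (simp add: g_def \<mu>_def r0_def)
  \<comment> \<open>The interval from here to R avoids |x0| and has R as an end point, where the
    derivative is one-sided.\<close>
  define r1 where "r1 = (r0 + R) / 2"
  have r1: "r0 < r1" "r1 < R" "0 < r1" using r0 by (simp_all add: r1_def)
  define I where "I = {r1..R}"
  have I: "is_interval I" "R \<in> I" using r1 by (simp_all add: I_def is_interval_cc)
  have Isub: "I \<subseteq> {0<..R} - {r0}" using r1 by (auto simp: I_def)
  have dg: "(g has_vector_derivative (SPH z. E R z * p z)) (at R within I)" unfolding g_def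
  proof (rule sphere_integral_has_vector_derivative[where h = "\<lambda>t z. u (t *R z) * p z" and h' = "\<lambda>t z. E t z * p z", OF I])
   show "continuous_on (sphere 0 1) (\<lambda>z. u (t *R z) * p z)" if "t \<in> I" for t
    using that Isub by (intro continuous_intros ray pc) auto
   show "((\<lambda>t. u (t *R z) * p z) has_vector_derivative E t z * p z) (at t within I)"
    if t: "t \<in> I" and w: "z \<in> sphere 0 1" for t z
   proof -
    have x: "t *R z \<in> cball 0 R - {x0}" using t w Isub by (intro tw) auto
    have "s *R z \<in> cball 0 R" if "s \<in> I" for s using tw[of s z] that w Isub by auto
    then have "((\<lambda>t. u (t *R z)) has_vector_derivative E t z) (at t within I)"
     unfolding E_def by (rule radial_vector_derivative[OF Du[OF x]])
    then show ?thesis by (rule has_vector_derivative_mult_left)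
   qed
   show "continuous_on (I \<times> sphere 0 1) (\<lambda>q. E (fst q) (snd q) * p (snd q))"
    using Isub by (intro continuous_intros continuous_on_subset[OF Ec] continuous_on_compose2[OF pc[of UNIV]]) auto
  qed
  have "(SPH z. E R z * p z) = (SPH z. - cx \<alpha> * (u (R *R z) * p z))"
   by (rule lint_cong[OF refl]) (simp add: E_def bc)
  then have dg2: "(SPH z. E R z * p z) = - cx \<alpha> * g R"
   unfolding g_def by (simp only: integral_mult_right_zero)
  have kR: "(redJ \<mu> has_real_derivative - 1 / 2 * redJ (\<mu> + 1) (k^2 * R^2)) (at (k^2 * R^2))"
   by (rule DERIV_cong, rule redJ_has_derivative, rule DERIV_ident) simp
  obtain d where d: "((\<lambda>t. t ^ l * redJ \<mu> (k^2 * t^2)) has_real_derivative d) (at R)"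
   "d + \<alpha> * (R ^ l * redJ \<mu> (k^2 * R^2)) = R ^ l * ((\<alpha> + real l / R) * redJ \<mu> (k^2 * R^2) - k^2 * R * redJ (\<mu> + 1) (k^2 * R^2))"
   by (rule famJ_deriv_radial_robin[where g = redJ, OF R kR, of l \<alpha>])
  define v where "v = (\<lambda>t. c * cx (t ^ l * redJ \<mu> (k^2 * t^2)))"
  have dv: "(v has_vector_derivative c * cx d) (at R within I)"
   unfolding v_def by (intro has_vector_derivative_mult_right has_vector_derivative_at_within[OF has_vector_derivative_of_real[OF d(1)]])
  have nontriv: "at R within I \<noteq> bot" using r1 by (simp add: I_def trivial_limit_within islimpt_Icc)
  have gv: "g t = v t" if "t \<in> I" "t \<noteq> R" for t
   unfolding v_def by (rule c) (use that r1 in \<open>auto simp: I_def\<close>)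
  \<comment> \<open>The closed form of the projection is known for t < R and reaches R by
    continuity.\<close>
  have gvR: "g R = v R"
  proof -
   have "(g \<longlongrightarrow> g R) (at R within I)" "(v \<longlongrightarrow> v R) (at R within I)"
    using has_vector_derivative_continuous[OF dg] has_vector_derivative_continuous[OF dv] by (simp_all add: continuous_within)
   moreover have "\<forall>\<^sub>F t in at R within I. g t = v t"
    unfolding eventually_at_filter by (rule always_eventually) (use gv in auto)
   ultimately show ?thesis using tendsto_unique[OF nontriv] tendsto_cong by metis
  qed
  have "(v has_vector_derivative - cx \<alpha> * g R) (at R within I)"
   by (rule has_vector_derivative_transform[OF I(2) _ dg[unfolded dg2]]) (use gv gvR in metis)
  then have "c * cx d = - cx \<alpha> * g R" using vector_derivative_unique_within[OF nontriv dv] by blast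
  then have "c * cx (d + \<alpha> * (R ^ l * redJ \<mu> (k^2 * R^2))) = 0"
   unfolding gvR v_def by (simp add: algebra_simps)
  then have "c * cx (R ^ l * robin_red R \<alpha> k (real DIM('a) / 2 - 1) l redJ) = 0"
   unfolding d(2) robin_red_def[of R \<alpha> k "real DIM('a) / 2 - 1" l redJ, folded \<mu>_def] .
  moreover have "robin_red R \<alpha> k (real DIM('a) / 2 - 1) l redJ \<noteq> 0"
   using nonres[of l] R k by (auto simp: robin_trace_J_red)
  ultimately have "c = 0" using R by simp
  then show ?thesis using c[OF t] by (simp add: g_def)
 qed
 have zero: "u (t *R z) = 0" if t: "t \<in> {0<..<R} - {r0}" and w: "norm z = 1" for t z
  by (rule spherical_harmonics_complete[OF _ proj[OF _ t] w]) (rule ray, use t in auto)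
 have zero': "u y = 0" if "norm y \<in> {0<..<R} - {r0}" for y
 proof -
  have "y \<noteq> 0" using that by auto
  then show ?thesis using zero[OF that, of "y /R norm y"] by simp
 qed
 \<comment> \<open>The radii 0, |x0| and R are still excluded; their points other than x0 are
   reached as limits of admissible ones.\<close>
 have limit: "u x = 0" if y: "(y \<longlongrightarrow> x) sequentially" and "\<forall>\<^sub>F n in sequentially. norm (y n) \<in> {0<..<R} - {r0}" for y
 proof -
  have "\<forall>\<^sub>F n in sequentially. y n \<in> cball 0 R - {x0}"
   using that(2) by eventually_elim (auto simp: r0_def)
  then have "(\<lambda>n. u (y n)) \<longlonglongrightarrow> u x" using continuous_on_tendsto_compose[OF uc y x] by blast
  moreover have "\<forall>\<^sub>F n in sequentially. u (y n) = 0" using that(2) by eventually_elim (rule zero')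
  then have "(\<lambda>n. u (y n)) \<longlonglongrightarrow> 0" by (rule tendsto_eventually)
  ultimately show ?thesis by (rule LIMSEQ_unique)
 qed
 have e0: "(\<lambda>n. 1 / real (Suc n)) \<longlonglongrightarrow> 0" by (rule LIMSEQ_Suc[OF lim_inverse_n'])
 have "u x = 0"
 proof (cases "x = 0")
  case True
  \<comment> \<open>The origin differs from x0, so all sufficiently small positive radii lie below
    |x0| and are admissible.\<close>
  then have r0p: "r0 > 0" using x by (simp add: r0_def)
  obtain b :: 'a where b: "b \<in> Basis" using nonempty_Basis by blast
  have "(\<lambda>n. (1 / real (Suc n)) *R b) \<longlonglongrightarrow> 0 *R b" by (intro tendsto_intros e0)
  then have lim: "(\<lambda>n. (1 / real (Suc n)) *R b) \<longlonglongrightarrow> x" using True by simp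
  have "\<forall>\<^sub>F n in sequentially. 1 / real (Suc n) < r0" using e0 r0p by (rule order_tendstoD(2))
  then have "\<forall>\<^sub>F n in sequentially. norm ((1 / real (Suc n)) *R b) \<in> {0<..<R} - {r0}"
   by eventually_elim (use b r0 in auto)
  then show ?thesis by (rule limit[OF lim])
 next
  case False
  define s where "s = (\<lambda>n. 1 - 1 / real (Suc (Suc n)))"
  have s: "s n > 0" "s n < 1" for n by (simp_all add: s_def field_simps)
  have s1: "s \<longlonglongrightarrow> 1 - 0" unfolding s_def by (intro tendsto_diff tendsto_const LIMSEQ_Suc[OF e0])
  then have "(\<lambda>n. s n *R x) \<longlonglongrightarrow> (1 - 0) *R x" by (intro tendsto_intros)
  then have lim: "(\<lambda>n. s n *R x) \<longlonglongrightarrow> x" by simp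
  have "\<forall>\<^sub>F n in sequentially. norm (s n *R x) \<in> {0<..<R} - {r0}"
  proof -
   have nx: "norm x > 0" "norm x \<le> R" using False x by auto
   \<comment> \<open>Shrinking x towards the origin keeps the norm strictly below |x0| if |x| \<le>
     |x0|, and eventually above it otherwise.\<close>
   have "\<forall>\<^sub>F n in sequentially. s n * norm x \<noteq> r0"
   proof (cases "norm x \<le> r0")
    case True
    have "s n * norm x < norm x" for n using s[of n] nx by simp
    then show ?thesis using True by (intro always_eventually allI) (metis less_le_not_le order.strict_trans2)
   next
    case False
    have "(\<lambda>n. s n * norm x) \<longlonglongrightarrow> (1 - 0) * norm x" by (intro tendsto_intros s1)
    then have "\<forall>\<^sub>F n in sequentially. s n * norm x > r0" using False by (intro order_tendstoD(1)) auto
    then show ?thesis by eventually_elim auto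
   qed
   then show ?thesis
   proof eventually_elim
    case (elim n)
    have "s n * norm x < 1 * norm x" using s[of n] nx by (intro mult_strict_right_mono) auto
    then have "s n * norm x < R" using nx by linarith
    then show ?case using elim s[of n] nx by auto
   qed
  qed
  then show ?thesis by (rule limit[OF lim])
 qed
 then show ?thesis by (simp add: u_def)
qed

section \<open>Identification with the stated series\<close>

lemma bessel_quot_redJ:
 assumes "\<nu> > 0" "z \<ge> 0"
 shows "bessel_quot \<nu> l z = z ^ l * redJ (\<nu> + real l) (z^2)"
proof -
 have q: "bessel_J (real l + \<nu>) t / t powr \<nu> = t ^ l * redJ (\<nu> + real l) (t^2)" if "t > 0" for t
  using that by (simp add: bessel_J_redJ powr_add powr_realpow add.commute)
 show ?thesis
 proof (cases "z = 0")
  case True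
  have "((\<lambda>t. t ^ l * redJ (\<nu> + real l) (t^2)) \<longlongrightarrow> 0 ^ l * redJ (\<nu> + real l) (0\<^sup>2)) (at_right 0)"
   by (intro tendsto_intros isCont_tendsto_compose[OF redJ_isCont])
  then have "((\<lambda>t. bessel_J (real l + \<nu>) t / t powr \<nu>) \<longlongrightarrow> 0 ^ l * redJ (\<nu> + real l) (0\<^sup>2)) (at_right 0)"
   by (rule Lim_transform_eventually) (auto simp: eventually_at_filter q)
  from tendsto_Lim[OF trivial_limit_at_right_real this] show ?thesis
   using True by (simp add: bessel_quot_def)
 next
  case False
  then show ?thesis using q[of z] assms by (simp add: bessel_quot_def)
 qed
qed

context robin_setup
begin

text \<open>The addition theorem for the given basis replaces the zonal kernel by the sum over m; a
  term of the regular part is then K times a term of the stated series, and K being nonzero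
  transfers summability.\<close>

lemma green_expansion:
 assumes w: "norm v = 1" and x: "x = norm x *R v" "norm x \<le> R" "x \<noteq> x0"
 defines "T \<equiv> \<lambda>l. \<Sum>m = 1..harmonic_dim DIM('a) l. (trace_ratio R \<alpha> k \<nu> l)
      * cx (bessel_quot \<nu> l (k * norm x0)) * cx (bessel_quot \<nu> l (k * norm x))
      * Y l m v * cnj (Y l m w0)"
 shows "summable T" and "green x = \<i> / 4 * cx ((k / (2 * pi * norm (x - x0))) powr \<nu>) * hankel_H1 \<nu> (k * norm (x - x0))
   - \<i> * cx pi * cx (k ^ (DIM('a) - 2)) / 2 * (\<Sum>l. T l)"
proof -
 define K where "K = \<i> * cx pi * cx (k ^ (DIM('a) - 2)) / 2"
 have K: "K \<noteq> 0" using k by (simp add: K_def)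
 have T: "reg_term l x = K * T l" for l
 proof -
  define t where "t = trace_ratio R \<alpha> k \<nu> l"
  define Z where "Z = harmonic_kernel l w0 v"
  define r0 r where "r0 = norm x0" and "r = norm x"
  have r: "r0 \<ge> 0" "r \<ge> 0" by (simp_all add: r0_def r_def)
  have "T l = (\<Sum>m = 1..harmonic_dim DIM('a) l. t * cx (bessel_quot \<nu> l (k * r0)) * cx (bessel_quot \<nu> l (k * r)) * (Y l m v * cnj (Y l m w0)))"
   by (simp add: T_def t_def r0_def r_def mult.assoc)
  also have "... = t * cx (bessel_quot \<nu> l (k * r0)) * cx (bessel_quot \<nu> l (k * r)) * Z"
   unfolding sum_distrib_left[symmetric] harmonic_basis_kernel[OF dim basis w0(1) w] Z_def ..
  finally have "T l = t * cx ((k * r0) ^ l * redJ (\<nu> + real l) (k^2 * r0^2)) * cx ((k * r) ^ l * redJ (\<nu> + real l) (k^2 * r^2)) * Z"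
   using k r by (simp add: bessel_quot_redJ[OF \<nu>] power_mult_distrib)
  moreover have "harmonic_kernel l w0 x = cx (r ^ l) * Z"
   unfolding Z_def r_def by (subst x(1)) (rule solid_harmonicD(2)[OF solid_harmonic_kernel[OF w0(1)]])
  moreover have "sq x = r^2" by (simp add: r_def dot_square_norm)
  moreover have "mode_coeff l = K * t * cx ((k^2 * r0) ^ l * redJ (\<nu> + real l) (k^2 * r0^2))"
   by (simp add: mode_coeff_def K_def t_def r0_def)
  ultimately show ?thesis
   by (simp add: reg_term_def mode_def famJ_def power_mult_distrib power2_eq_square mult_ac)
 qed
 have "summable (\<lambda>l. K * T l)" using reg_term_summable[OF x(2)] unfolding T .
 then show s: "summable T" using K by (simp add: summable_cmult_iff)
 have "regular_part x = K * (\<Sum>l. T l)" unfolding regular_part_def T by (rule suminf_mult[OF s])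
 then show "green x = \<i> / 4 * cx ((k / (2 * pi * norm (x - x0))) powr \<nu>) * hankel_H1 \<nu> (k * norm (x - x0))
   - \<i> * cx pi * cx (k ^ (DIM('a) - 2)) / 2 * (\<Sum>l. T l)"
  unfolding green_def singular_part_eq[OF x(3)] K_def by simp
qed

end

text \<open>Existence stands beside the formula so that the latter is not vacuous. The directions
  range over all unit vectors compatible with x and x0, which permits any choice at the origin, and
  summability is claimed so that the infinite sum has its usual meaning.\<close>

theorem theorem2:
  fixes d :: nat and \<nu> R \<alpha> k :: real and x0 :: "real ^ 'n"
    and Y :: "nat \<Rightarrow> nat \<Rightarrow> real ^ 'n \<Rightarrow> complex"
  assumes "d = CARD('n)" and "d \<ge> 3" and "\<nu> = real d / 2 - 1"
    and "R > 0" and "\<alpha> > 0" and "k > 0"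
    and "\<forall>l. orthonormal_harmonic_basis l (harmonic_dim d l) (Y l)"
    and "\<forall>l. robin_trace_J R \<alpha> k \<nu> l \<noteq> 0"
    and "x0 \<in> ball 0 R"
  shows "(\<exists>G. robin_green_function R \<alpha> k x0 G) \<and>
    (\<forall>G. robin_green_function R \<alpha> k x0 G \<longrightarrow>
      (\<forall>x\<in>cball 0 R - {x0}. \<forall>\<omega>\<in>sphere 0 1. \<forall>\<omega>0\<in>sphere 0 1.
         x = norm x *\<^sub>R \<omega> \<longrightarrow> x0 = norm x0 *\<^sub>R \<omega>0 \<longrightarrow>
         summable (\<lambda>l. \<Sum>m = 1..harmonic_dim d l.
            robin_trace_H R \<alpha> k \<nu> l / complex_of_real (robin_trace_J R \<alpha> k \<nu> l)
            * complex_of_real (bessel_quot \<nu> l (k * norm x0))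
            * complex_of_real (bessel_quot \<nu> l (k * norm x))
            * Y l m \<omega> * cnj (Y l m \<omega>0)) \<and>
         G x =
           \<i> / 4 * complex_of_real ((k / (2 * pi * norm (x - x0))) powr \<nu>)
             * hankel_H1 \<nu> (k * norm (x - x0))
           - \<i> * complex_of_real pi * complex_of_real (k ^ (d - 2)) / 2
             * (\<Sum>l. \<Sum>m = 1..harmonic_dim d l.
                  robin_trace_H R \<alpha> k \<nu> l / complex_of_real (robin_trace_J R \<alpha> k \<nu> l)
                  * complex_of_real (bessel_quot \<nu> l (k * norm x0))
                  * complex_of_real (bessel_quot \<nu> l (k * norm x))
                  * Y l m \<omega> * cnj (Y l m \<omega>0))))"
proof -
 have dim: "DIM(real ^ 'n) = d" using assms(1) by simp
 have \<nu>: "real DIM(real ^ 'n) / 2 - 1 = \<nu>" using assms(3) dim by simp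
 have inst: "robin_setup R \<alpha> k x0 \<omega>0 Y" if "norm \<omega>0 = 1" "x0 = norm x0 *R \<omega>0" for \<omega>0
 proof
  show "3 \<le> DIM(real ^ 'n)" using assms(2) dim by simp
  show "orthonormal_harmonic_basis l (harmonic_dim DIM(real ^ 'n) l) (Y l)" for l using assms(7) dim by simp
  show "robin_trace_J R \<alpha> k (real DIM(real ^ 'n) / 2 - 1) l \<noteq> 0" for l using assms(8) unfolding \<nu> by blast
  show "norm x0 < R" using assms(9) by simp
 qed (use assms that in auto)
 \<comment> \<open>Existence requires some direction of x0; at x0 = 0 a basis vector serves.\<close>
 obtain e :: "real ^ 'n" where e: "norm e = 1" "x0 = norm x0 *R e"
 proof (cases "x0 = 0")
  case True
  obtain b :: "real ^ 'n" where "b \<in> Basis" using nonempty_Basis by blast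
  then show ?thesis using that[of b] True by simp
 next
  case False
  then show ?thesis using that[of "x0 /R norm x0"] by simp
 qed
 show ?thesis
 proof (rule conjI, goal_cases)
  case 1
  interpret P: robin_setup R \<alpha> k x0 e Y by (rule inst[OF e])
  show ?case using P.green_is_green_function by blast
 next
  case 2
  show ?case
  proof (intro allI impI ballI, goal_cases)
   case (1 G x \<omega> \<omega>0)
   then have w0: "norm \<omega>0 = 1" "x0 = norm x0 *R \<omega>0" and w: "norm \<omega> = 1"
    and x: "x = norm x *R \<omega>" "norm x \<le> R" "x \<noteq> x0" by simp_all
   interpret P: robin_setup R \<alpha> k x0 \<omega>0 Y by (rule inst[OF w0])
   have P\<nu>: "P.\<nu> = \<nu>" unfolding P.\<nu>_def by (rule \<nu>)
   have "G x = P.green x"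
    by (rule robin_green_function_unique[OF P.dim P.R P.k P.nonres P.x0 1(1) P.green_is_green_function 1(2)])
   then show ?case using P.green_expansion[OF w x] unfolding P\<nu> dim by simp
  qed
 qed
qed

end
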